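(* Let $\mu\in\{0.99,\,0.75\}$ and consider the Kuramoto--Sivashinsky equation $u_t=-\mu u_{xxxx}-u_{xx}+(u^2)_x$, $x\in\mathbb R$, with $u(t,x)=-u(t,-x)$ and $u(t,x)=u(t,x+2\pi)$. There exists a heteroclinic connection between two fixed points: from the unstable zero solution to an attracting fixed point.
   Context: A heteroclinic connection from a fixed point $u_0$ to a fixed point $u_+$ is a solution $u(t)$ defined for all $t\in\mathbb R$ with $\lim_{t\to-\infty}u(t)=u_0$ and $\lim_{t\to+\infty}u(t)=u_+$. The equation is treated in Fourier coordinates, $u(t,x)=\sum_{k\ge1}-2a_k(t)\sin(kx)$, as the system $\dot a_k=k^2(1-\mu k^2)a_k-k\sum_{i=1}^{k-1}a_ia_{k-i}+2k\sum_{i=1}^\infty a_ia_{k+i}$, $k\ge1$, in $\ell^2$. *)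

theory Defs
  imports "HOL-Analysis.Analysis"
begin

section \<open>The phase space\<close>

text \<open>
  A state is the sequence of sine coefficients \<open>a\<^sub>1, a\<^sub>2, \<dots>\<close> of an odd \<open>2\<pi>\<close>-periodic function.
  The unused entry at index \<open>0\<close> is normalised to \<open>0\<close>, so that equality of states is
  equality of functions.
\<close>

definition ell2 :: "(nat \<Rightarrow> real) set" where
  "ell2 = {a. a 0 = 0 \<and> summable (\<lambda>k. (a k)\<^sup>2)}"

definition ell2_dist :: "(nat \<Rightarrow> real) \<Rightarrow> (nat \<Rightarrow> real) \<Rightarrow> real" where
  "ell2_dist a b = sqrt (\<Sum>k. (a k - b k)\<^sup>2)"

definition sine_series :: "(nat \<Rightarrow> real) \<Rightarrow> (real \<Rightarrow> real) \<Rightarrow> bool" where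
  "sine_series a f \<longleftrightarrow> (\<forall>x. (\<lambda>k. - 2 * a k * sin (real k * x)) sums f x)"


section \<open>The Kuramoto--Sivashinsky equation\<close>

definition ks_field :: "real \<Rightarrow> (nat \<Rightarrow> real) \<Rightarrow> nat \<Rightarrow> real" where
  "ks_field \<mu> a k =
     (real k)\<^sup>2 * (1 - \<mu> * (real k)\<^sup>2) * a k
     - real k * (\<Sum>i = 1..k - 1. a i * a (k - i))
     + 2 * real k * (\<Sum>i. a (Suc i) * a (k + Suc i))"

text \<open>
  Solutions are \<open>\<ell>\<^sup>2\<close>-continuous curves all of whose components satisfy the system. The field is
  unbounded on \<open>\<ell>\<^sup>2\<close>, but each of its components is defined and continuous there, so no
  smallness or decay of the initial state is needed for the derivative at the left end point of
  \<open>{0..}\<close>.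
\<close>

definition ks_solution_on :: "real \<Rightarrow> real set \<Rightarrow> (real \<Rightarrow> nat \<Rightarrow> real) \<Rightarrow> bool" where
  "ks_solution_on \<mu> I a \<longleftrightarrow>
     (\<forall>t\<in>I. a t \<in> ell2) \<and>
     (\<forall>t\<in>I. ((\<lambda>s. ell2_dist (a s) (a t)) \<longlongrightarrow> 0) (at t within I)) \<and>
     (\<forall>t\<in>I. \<forall>k\<ge>1. ((\<lambda>s. a s k) has_real_derivative ks_field \<mu> (a t) k) (at t within I))"

text \<open>
  Classical solutions, for all times, of \<open>u\<^sub>t = - \<mu> u\<^sub>x\<^sub>x\<^sub>x\<^sub>x - u\<^sub>x\<^sub>x + (u\<^sup>2)\<^sub>x\<close> with odd periodic
  boundary conditions; \<open>u t\<close> is the state at time \<open>t\<close>.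
\<close>

definition ks_classical_solution :: "real \<Rightarrow> (real \<Rightarrow> real \<Rightarrow> real) \<Rightarrow> bool" where
  "ks_classical_solution \<mu> u \<longleftrightarrow>
     (\<forall>t x. u t x = - u t (- x)) \<and>
     (\<forall>t x. u t x = u t (x + 2 * pi)) \<and>
     (\<forall>t x. \<forall>j<4. (deriv ^^ j) (u t) field_differentiable at x) \<and>
     (\<forall>t x. ((\<lambda>s. u s x) has_real_derivative
        (- \<mu> * (deriv ^^ 4) (u t) x - (deriv ^^ 2) (u t) x + deriv (\<lambda>y. (u t y)\<^sup>2) x)) (at t))"


section \<open>Fixed points and connections\<close>

definition ks_fixed_point :: "real \<Rightarrow> (nat \<Rightarrow> real) \<Rightarrow> bool" where
  "ks_fixed_point \<mu> p \<longleftrightarrow> p \<in> ell2 \<and> (\<forall>k\<ge>1. ks_field \<mu> p k = 0)"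

definition ks_stable :: "real \<Rightarrow> (nat \<Rightarrow> real) \<Rightarrow> bool" where
  "ks_stable \<mu> p \<longleftrightarrow>
     (\<forall>\<epsilon>>0. \<exists>\<delta>>0. \<forall>a. ks_solution_on \<mu> {0..} a \<and> ell2_dist (a 0) p < \<delta> \<longrightarrow>
        (\<forall>t\<ge>0. ell2_dist (a t) p < \<epsilon>))"

definition ks_unstable_fixed_point :: "real \<Rightarrow> (nat \<Rightarrow> real) \<Rightarrow> bool" where
  "ks_unstable_fixed_point \<mu> p \<longleftrightarrow> ks_fixed_point \<mu> p \<and> \<not> ks_stable \<mu> p"

text \<open>
  Asymptotic stability in \<open>\<ell>\<^sup>2\<close>. Existence of the forward orbits is part of the definition, so
  that attraction of a neighbourhood cannot hold vacuously.
\<close>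

definition ks_attracting_fixed_point :: "real \<Rightarrow> (nat \<Rightarrow> real) \<Rightarrow> bool" where
  "ks_attracting_fixed_point \<mu> p \<longleftrightarrow>
     ks_fixed_point \<mu> p \<and> ks_stable \<mu> p \<and>
     (\<exists>\<delta>>0. \<forall>b\<in>ell2. ell2_dist b p < \<delta> \<longrightarrow>
        (\<exists>a. ks_solution_on \<mu> {0..} a \<and> a 0 = b) \<and>
        (\<forall>a. ks_solution_on \<mu> {0..} a \<and> a 0 = b \<longrightarrow>
           ((\<lambda>t. ell2_dist (a t) p) \<longlongrightarrow> 0) at_top))"

definition ks_heteroclinic ::
  "real \<Rightarrow> (nat \<Rightarrow> real) \<Rightarrow> (nat \<Rightarrow> real) \<Rightarrow> (real \<Rightarrow> nat \<Rightarrow> real) \<Rightarrow> bool" where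
  "ks_heteroclinic \<mu> p q a \<longleftrightarrow>
     ks_fixed_point \<mu> p \<and> ks_fixed_point \<mu> q \<and>
     ks_solution_on \<mu> UNIV a \<and>
     ((\<lambda>t. ell2_dist (a t) p) \<longlongrightarrow> 0) at_bot \<and>
     ((\<lambda>t. ell2_dist (a t) q) \<longlongrightarrow> 0) at_top"

end

theory Submission
  imports Defs "HOL-Real_Asymp.Real_Asymp"
begin

text \<open>
  The linearisation at \<open>0\<close> has one unstable direction, the first mode. The orbit leaving \<open>0\<close>
  tangentially to it, with \<open>a\<^sub>1 > 0\<close>, is constructed by a Lyapunov--Perron iteration. The modes
  \<open>a\<^sub>2, a\<^sub>3, \<dots>\<close> are strongly damped, so along an orbit defined since \<open>t = -\<infinity>\<close> they are slaved to
  \<open>a\<^sub>1\<close>: \<open>a\<^sub>2\<close> is a negative multiple of \<open>a\<^sub>1\<^sup>2\<close> up to explicit constants and the others are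
  \<open>O(a\<^sub>1\<^sup>3)\<close>. Then \<open>a\<^sub>1' = (1 - \<mu>) a\<^sub>1 + 2 a\<^sub>1 a\<^sub>2 + O(a\<^sub>1\<^sup>5)\<close> keeps \<open>a\<^sub>1\<close> bounded and pushes it above a
  positive threshold, so the orbit ends up in a small explicit box. Because the nonlinearity is
  quadratic, the difference of two solutions satisfies a linear equation depending only on their
  sum; on this box it is a contraction in a suitable quadratic form. Applied to the orbit and its
  time shifts, this gives convergence to a fixed point; applied to the fixed point and nearby
  orbits, it gives attraction. Full bounded orbits have rapidly decaying coefficients, hence are
  classical solutions.
\<close>

section \<open>Square-summable sequences\<close>

text \<open>Two circularities shape the proof. Slaving a mode to a power of a_1 needs a bound on the
  decay rate of a_1, and that rate depends on the slaved modes; a crude cone condition breaks the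
  circle, and the estimates are then improved in rounds. The cone is justified by continuous
  induction in time: if it holds up to T, it holds strictly at T. Moreover, the clamped equation
  that supplies global curves agrees with the true one only under bounds on the state, so
  solvability enters the continuity arguments conditionally on such a bound. The numbers come from
  the reduced balance a_2 = -2 a_1^2 / (16 \<mu> - 4), (1 - \<mu>) + 2 a_2 = 0, hence a_1^2 = (1 -
  \<mu>) (4 \<mu> - 1): a_1 is about 0.172 for \<mu> = 0.99 and 0.707 for \<mu> = 0.75. The final
  bounds on a_1 bracket these values. Decimals are rounded outward, so that each check is rational
  arithmetic; the cone estimates hold for all 3/4 \<le> \<mu> < 1. Initial states are merely
  square-summable, so the norm is differentiated only at positive times, after parabolic
  smoothing.\<close>

definition sqs :: "(nat \<Rightarrow> real) \<Rightarrow> bool" where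
  "sqs a \<longleftrightarrow> summable (\<lambda>k. (a k)\<^sup>2)"

definition l2norm :: "(nat \<Rightarrow> real) \<Rightarrow> real" where
  "l2norm a = sqrt (\<Sum>k. (a k)\<^sup>2)"

definition tail :: "nat \<Rightarrow> (nat \<Rightarrow> real) \<Rightarrow> nat \<Rightarrow> real" where
  "tail n a = (\<lambda>k. if n \<le> k then a k else 0)"

lemma tail_apply: "tail n a k = (if n \<le> k then a k else 0)"
  by (simp add: tail_def)

lemma tail_0 [simp]: "tail 0 a = a"
  by (simp add: tail_def)

lemma l2norm_nonneg: "sqs a \<Longrightarrow> 0 \<le> l2norm a"
  unfolding l2norm_def sqs_def by (simp add: suminf_nonneg)

lemma l2norm_sq: "sqs a \<Longrightarrow> (l2norm a)\<^sup>2 = (\<Sum>k. (a k)\<^sup>2)"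
  unfolding l2norm_def sqs_def by (simp add: suminf_nonneg)

lemma l2norm_sums: "sqs a \<Longrightarrow> (\<lambda>k. (a k)\<^sup>2) sums (l2norm a)\<^sup>2"
  by (simp add: l2norm_sq sqs_def summable_sums)

lemma ell2_sqs: "a \<in> ell2 \<Longrightarrow> sqs a"
  by (simp add: ell2_def sqs_def)

lemma ell2_dist_l2norm: "ell2_dist a b = l2norm (\<lambda>k. a k - b k)"
  by (simp add: ell2_dist_def l2norm_def)

lemma sqs_mono: "sqs b \<Longrightarrow> (\<And>k. \<bar>a k\<bar> \<le> \<bar>b k\<bar>) \<Longrightarrow> sqs a"
  unfolding sqs_def by (rule summable_comparison_test'[where N=0 and g="\<lambda>k. (b k)\<^sup>2"]) (auto simp: abs_le_square_iff)

lemma l2norm_mono: "sqs b \<Longrightarrow> (\<And>k. \<bar>a k\<bar> \<le> \<bar>b k\<bar>) \<Longrightarrow> l2norm a \<le> l2norm b"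
  using sqs_mono[of b a] unfolding l2norm_def sqs_def
  by (auto intro!: suminf_le simp: abs_le_square_iff)

lemma sum_le_l2norm_sq: "sqs a \<Longrightarrow> finite I \<Longrightarrow> (\<Sum>k\<in>I. (a k)\<^sup>2) \<le> (l2norm a)\<^sup>2"
  unfolding l2norm_sq by (rule sum_le_suminf) (auto simp: sqs_def)

lemma L2_set_le_l2norm: "sqs a \<Longrightarrow> finite I \<Longrightarrow> L2_set a I \<le> l2norm a"
  unfolding L2_set_def using sum_le_l2norm_sq[of a I] l2norm_nonneg[of a]
  by (simp add: real_le_lsqrt)

lemma abs_le_l2norm: "sqs a \<Longrightarrow> \<bar>a k\<bar> \<le> l2norm a"
  using L2_set_le_l2norm[of a "{k}"] by (simp add: L2_set_def)

lemma sqs_cmult: "sqs a \<Longrightarrow> sqs (\<lambda>k. c * a k)"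
  unfolding sqs_def by (simp add: power_mult_distrib summable_mult)

lemma l2norm_cmult: "sqs a \<Longrightarrow> l2norm (\<lambda>k. c * a k) = \<bar>c\<bar> * l2norm a"
  unfolding sqs_def l2norm_def
  by (simp add: power_mult_distrib suminf_mult real_sqrt_mult)

lemma sqsI_bounded:
  assumes "\<And>n. (\<Sum>k<n. (a k)\<^sup>2) \<le> B"
  shows "sqs a"
  unfolding sqs_def by (rule bounded_imp_summable[where B=B]) (use assms in \<open>auto simp del: sum.lessThan_Suc simp: lessThan_Suc_atMost[symmetric]\<close>)

text \<open>Partial sums pass through limits taken mode by mode, so this form yields membership and
  norm bound of a limit at once.\<close>

lemma l2norm_leI:
  assumes "\<And>n. (\<Sum>k<n. (a k)\<^sup>2) \<le> B\<^sup>2" "0 \<le> B"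
  shows "sqs a" "l2norm a \<le> B"
proof -
  show s: "sqs a" by (rule sqsI_bounded[OF assms(1)])
  then have "(\<Sum>k. (a k)\<^sup>2) \<le> B\<^sup>2"
    unfolding sqs_def by (intro suminf_le_const assms)
  then show "l2norm a \<le> B" using assms(2) by (simp add: l2norm_def real_le_lsqrt)
qed

lemma
  assumes "sqs a" "sqs b"
  shows sqs_add: "sqs (\<lambda>k. a k + b k)"
    and l2norm_triangle: "l2norm (\<lambda>k. a k + b k) \<le> l2norm a + l2norm b"
proof -
  have *: "(\<Sum>k<n. (a k + b k)\<^sup>2) \<le> (l2norm a + l2norm b)\<^sup>2" for n
  proof -
    have "L2_set (\<lambda>k. a k + b k) {..<n} \<le> l2norm a + l2norm b"
      using L2_set_triangle_ineq[of a b "{..<n}"] L2_set_le_l2norm[OF assms(1), of "{..<n}"]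
        L2_set_le_l2norm[OF assms(2), of "{..<n}"] by simp
    then have "(L2_set (\<lambda>k. a k + b k) {..<n})\<^sup>2 \<le> (l2norm a + l2norm b)\<^sup>2"
      by (intro power_mono) auto
    then show ?thesis by (simp add: L2_set_def sum_nonneg)
  qed
  show "sqs (\<lambda>k. a k + b k)" "l2norm (\<lambda>k. a k + b k) \<le> l2norm a + l2norm b"
    by (rule l2norm_leI[OF *]; use assms l2norm_nonneg in simp)+
qed

lemma sqs_diff: "sqs a \<Longrightarrow> sqs b \<Longrightarrow> sqs (\<lambda>k. a k - b k)"
  using sqs_add[of a "\<lambda>k. -1 * b k"] sqs_cmult[of b "-1"] by simp

lemma l2norm_diff_triangle:
  "sqs a \<Longrightarrow> sqs b \<Longrightarrow> l2norm (\<lambda>k. a k - b k) \<le> l2norm a + l2norm b"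
  using l2norm_triangle[of a "\<lambda>k. -1 * b k"] sqs_cmult[of b "-1"] l2norm_cmult[of b "-1"] by simp

lemma l2norm_commute: "l2norm (\<lambda>k. a k - b k) = l2norm (\<lambda>k. b k - a k)"
  by (simp add: l2norm_def power2_commute)

lemma l2norm_le_add_diff:
  assumes "sqs a" "sqs b"
  shows "l2norm a \<le> l2norm b + l2norm (\<lambda>k. a k - b k)"
  using l2norm_triangle[OF assms(2) sqs_diff[OF assms]] by simp

lemma l2norm_reverse_triangle:
  assumes "sqs a" "sqs b"
  shows "\<bar>l2norm a - l2norm b\<bar> \<le> l2norm (\<lambda>k. a k - b k)"
  using l2norm_le_add_diff[OF assms] l2norm_le_add_diff[OF assms(2,1)] l2norm_commute[of a b] by simp

text \<open>Cauchy-Schwarz for series from its finite form \<open>L2_set_mult_ineq\<close>; the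
  absolute version provides the summability that the signed version needs.\<close>

lemma
  assumes "sqs a" "sqs b"
  shows summable_abs_mult: "summable (\<lambda>k. \<bar>a k\<bar> * \<bar>b k\<bar>)"
    and suminf_abs_mult_le: "(\<Sum>k. \<bar>a k\<bar> * \<bar>b k\<bar>) \<le> l2norm a * l2norm b"
    and summable_mult_sqs: "summable (\<lambda>k. a k * b k)"
    and abs_suminf_mult_le: "\<bar>\<Sum>k. a k * b k\<bar> \<le> l2norm a * l2norm b"
proof -
  have *: "(\<Sum>k<n. \<bar>a k\<bar> * \<bar>b k\<bar>) \<le> l2norm a * l2norm b" for n
  proof -
    have "(\<Sum>k<n. \<bar>a k\<bar> * \<bar>b k\<bar>) \<le> L2_set a {..<n} * L2_set b {..<n}"
      by (rule L2_set_mult_ineq)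
    also have "\<dots> \<le> l2norm a * l2norm b"
      by (intro mult_mono L2_set_le_l2norm assms l2norm_nonneg) auto
    finally show ?thesis .
  qed
  show s: "summable (\<lambda>k. \<bar>a k\<bar> * \<bar>b k\<bar>)"
    by (rule bounded_imp_summable[where B="l2norm a * l2norm b"])
      (use * in \<open>auto simp del: sum.lessThan_Suc simp: lessThan_Suc_atMost[symmetric]\<close>)
  show i: "(\<Sum>k. \<bar>a k\<bar> * \<bar>b k\<bar>) \<le> l2norm a * l2norm b"
    by (rule suminf_le_const[OF s *])
  have s': "summable (\<lambda>k. \<bar>a k * b k\<bar>)" using s by (simp add: abs_mult)
  show "summable (\<lambda>k. a k * b k)" by (rule summable_rabs_cancel[OF s'])
  have "\<bar>\<Sum>k. a k * b k\<bar> \<le> (\<Sum>k. \<bar>a k * b k\<bar>)" by (rule summable_rabs[OF s'])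
  then show "\<bar>\<Sum>k. a k * b k\<bar> \<le> l2norm a * l2norm b" using i by (simp add: abs_mult)
qed

lemma sqs_tail: "sqs a \<Longrightarrow> sqs (tail n a)"
  by (rule sqs_mono) (auto simp: tail_def)

lemma l2norm_tail_mono: "sqs a \<Longrightarrow> m \<le> n \<Longrightarrow> l2norm (tail n a) \<le> l2norm (tail m a)"
  by (rule l2norm_mono[OF sqs_tail]) (auto simp: tail_def)

lemma l2norm_tail_le: "sqs a \<Longrightarrow> l2norm (tail n a) \<le> l2norm a"
  by (rule l2norm_mono) (auto simp: tail_def)

lemma abs_le_l2norm_tail: "sqs a \<Longrightarrow> n \<le> k \<Longrightarrow> \<bar>a k\<bar> \<le> l2norm (tail n a)"
  using abs_le_l2norm[OF sqs_tail, of a n k] by (simp add: tail_apply)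

text \<open>Turns shifts into tails, so that Cauchy-Schwarz for a shifted series yields a bound by
  norms of tails; this is where smallness of the high modes enters the estimates.\<close>

lemma tail_sums_shift: "sqs a \<Longrightarrow> (\<lambda>k. (a (k + n))\<^sup>2) sums (l2norm (tail n a))\<^sup>2"
proof -
  assume "sqs a"
  then have "(\<lambda>k. (tail n a k)\<^sup>2) sums (l2norm (tail n a))\<^sup>2"
    by (intro l2norm_sums sqs_tail)
  then have "(\<lambda>k. (tail n a (k + n))\<^sup>2) sums ((l2norm (tail n a))\<^sup>2 - (\<Sum>i<n. (tail n a i)\<^sup>2))"
    by (rule sums_split_initial_segment)
  then show ?thesis by (simp add: tail_apply)
qed

lemma sqs_shift: "sqs a \<Longrightarrow> sqs (\<lambda>k. a (k + n))"
  using tail_sums_shift[of a n] by (auto simp: sqs_def sums_iff)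

lemma l2norm_shift: "sqs a \<Longrightarrow> l2norm (\<lambda>k. a (k + n)) = l2norm (tail n a)"
  using tail_sums_shift[of a n] l2norm_nonneg[OF sqs_tail, of a n]
  by (simp add: l2norm_def sums_iff)

lemma l2norm_tail_Suc: "sqs a \<Longrightarrow> (l2norm (tail n a))\<^sup>2 = (a n)\<^sup>2 + (l2norm (tail (Suc n) a))\<^sup>2"
proof -
  assume a: "sqs a"
  have "(\<lambda>k. (a (Suc k + n))\<^sup>2) sums (l2norm (tail (Suc n) a))\<^sup>2"
    using tail_sums_shift[OF a, of "Suc n"] by simp
  then have "(\<lambda>k. (a (k + n))\<^sup>2) sums ((l2norm (tail (Suc n) a))\<^sup>2 + (a (0 + n))\<^sup>2)"
    by (subst (asm) sums_Suc_iff) simp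
  from sums_unique2[OF this tail_sums_shift[OF a]] show ?thesis by simp
qed

lemma sqs_mult_shift: "sqs a \<Longrightarrow> sqs b \<Longrightarrow> summable (\<lambda>i. a (i + m) * b (i + n))"
  by (intro summable_mult_sqs sqs_shift)

lemma abs_suminf_mult_shift:
  "sqs a \<Longrightarrow> sqs b \<Longrightarrow> \<bar>\<Sum>i. a (i + m) * b (i + n)\<bar> \<le> l2norm (tail m a) * l2norm (tail n b)"
  using abs_suminf_mult_le[of "\<lambda>i. a (i + m)" "\<lambda>i. b (i + n)"] by (simp add: sqs_shift l2norm_shift)


section \<open>The quadratic term\<close>

definition ks_eig :: "real \<Rightarrow> nat \<Rightarrow> real" where
  "ks_eig \<mu> k = (real k)\<^sup>2 * (1 - \<mu> * (real k)\<^sup>2)"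

text \<open>The symmetric bilinear form whose diagonal is the quadratic term of the system: the
  factor 2 of the infinite sum is distributed over the two orders of \<open>a\<close> and
  \<open>b\<close>. Indices are shifted so that both series start at 0.\<close>

definition ks_bil :: "(nat \<Rightarrow> real) \<Rightarrow> (nat \<Rightarrow> real) \<Rightarrow> nat \<Rightarrow> real" where
  "ks_bil a b k =
     real k * ((\<Sum>i. a (i + 1) * b (i + (k + 1))) + (\<Sum>i. b (i + 1) * a (i + (k + 1)))
       - (\<Sum>i = 1..k - 1. a i * b (k - i)))"

lemma ks_field_eq: "sqs a \<Longrightarrow> ks_field \<mu> a k = ks_eig \<mu> k * a k + ks_bil a a k"
  unfolding ks_field_def ks_eig_def ks_bil_def by (simp add: algebra_simps)

lemma conv_reflect: "(\<Sum>i = 1..k - 1. f i (k - i)) = (\<Sum>i = 1..k - 1. f (k - i) i)"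
  for f :: "nat \<Rightarrow> nat \<Rightarrow> real"
  by (rule sum.reindex_bij_witness[where i="\<lambda>i. k - i" and j="\<lambda>i. k - i"]) auto

lemma conv_commute: "(\<Sum>i = 1..k - 1. a i * b (k - i)) = (\<Sum>i = 1..k - 1. b i * a (k - i))"
  for a b :: "nat \<Rightarrow> real"
  using conv_reflect[of "\<lambda>i j. a i * b j" k] by (simp add: mult.commute)

lemma conv_abs_le:
  assumes "sqs a" "sqs b"
  shows "(\<Sum>i = 1..k - 1. \<bar>a i\<bar> * \<bar>b (k - i)\<bar>) \<le> l2norm a * l2norm b"
proof -
  have "(\<Sum>i = 1..k - 1. (b (k - i))\<^sup>2) = (\<Sum>i = 1..k - 1. (b i)\<^sup>2)"
    using conv_reflect[of "\<lambda>i j. (b j)\<^sup>2" k] by simp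
  then have "L2_set (\<lambda>i. b (k - i)) {1..k-1} = L2_set b {1..k-1}"
    by (simp add: L2_set_def)
  then have "(\<Sum>i = 1..k - 1. \<bar>a i\<bar> * \<bar>b (k - i)\<bar>) \<le> L2_set a {1..k-1} * L2_set b {1..k-1}"
    using L2_set_mult_ineq[of a "\<lambda>i. b (k - i)" "{1..k-1}"] by simp
  also have "\<dots> \<le> l2norm a * l2norm b"
    by (intro mult_mono L2_set_le_l2norm assms l2norm_nonneg) auto
  finally show ?thesis .
qed

lemma conv_le:
  assumes "sqs a" "sqs b"
  shows "\<bar>\<Sum>i = 1..k - 1. a i * b (k - i)\<bar> \<le> l2norm a * l2norm b"
  using sum_abs[of "\<lambda>i. a i * b (k - i)" "{1..k-1}"] conv_abs_le[OF assms, of k]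
  by (simp add: abs_mult)

text \<open>Three sums, each at most \<open>l2norm a * l2norm b\<close> by Cauchy-Schwarz. Only one
  factor k is lost, against a dissipation of order k^4; hence square-summability of the state is
  enough to control the quadratic term.\<close>

lemma ks_bil_bound:
  assumes "sqs a" "sqs b"
  shows "\<bar>ks_bil a b k\<bar> \<le> 3 * real k * (l2norm a * l2norm b)"
proof -
  have "\<bar>\<Sum>i. a (i + 1) * b (i + (k + 1))\<bar> \<le> l2norm a * l2norm b"
    by (rule order_trans[OF abs_suminf_mult_shift[OF assms]])
      (intro mult_mono l2norm_tail_le assms l2norm_nonneg sqs_tail)
  moreover have "\<bar>\<Sum>i. b (i + 1) * a (i + (k + 1))\<bar> \<le> l2norm b * l2norm a"
    by (rule order_trans[OF abs_suminf_mult_shift[OF assms(2,1)]])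
      (intro mult_mono l2norm_tail_le assms l2norm_nonneg sqs_tail)
  ultimately have "\<bar>(\<Sum>i. a (i + 1) * b (i + (k + 1))) + (\<Sum>i. b (i + 1) * a (i + (k + 1)))
       - (\<Sum>i = 1..k - 1. a i * b (k - i))\<bar> \<le> 3 * (l2norm a * l2norm b)"
    using conv_le[OF assms, of k] by (simp add: mult.commute)
  from mult_left_mono[OF this, of "real k"] show ?thesis
    unfolding ks_bil_def by (simp add: abs_mult)
qed

lemma ks_bil_add_left:
  assumes "sqs a" "sqs b" "sqs c"
  shows "ks_bil (\<lambda>k. a k + b k) c k = ks_bil a c k + ks_bil b c k"
proof -
  note s = sqs_mult_shift[where m=1 and n="k + 1"]
  have "(\<Sum>i. (a (i+1) + b (i+1)) * c (i + (k + 1))) =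
      (\<Sum>i. a (i + 1) * c (i + (k + 1))) + (\<Sum>i. b (i + 1) * c (i + (k + 1)))"
    unfolding distrib_right by (rule suminf_add[OF s s, symmetric]) (use assms in auto)
  moreover have "(\<Sum>i. c (i+1) * (a (i + (k + 1)) + b (i + (k + 1)))) =
      (\<Sum>i. c (i + 1) * a (i + (k + 1))) + (\<Sum>i. c (i + 1) * b (i + (k + 1)))"
    unfolding distrib_left by (rule suminf_add[OF s s, symmetric]) (use assms in auto)
  ultimately show ?thesis
    unfolding ks_bil_def by (simp add: sum.distrib algebra_simps)
qed

lemma ks_bil_commute: "ks_bil a b k = ks_bil b a k"
  unfolding ks_bil_def using conv_commute[of a b k] by simp

lemma ks_bil_cmult_left:
  assumes "sqs a" "sqs c"
  shows "ks_bil (\<lambda>k. x * a k) c k = x * ks_bil a c k"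
proof -
  have "(\<Sum>i. x * a (i+1) * c (i + (k + 1))) = x * (\<Sum>i. a (i + 1) * c (i + (k + 1)))"
    by (subst suminf_mult[symmetric]) (use assms sqs_mult_shift[of a c 1 "k+1"] in \<open>auto simp: mult_ac\<close>)
  moreover have "(\<Sum>i. c (i+1) * (x * a (i + (k + 1)))) = x * (\<Sum>i. c (i + 1) * a (i + (k + 1)))"
    by (subst suminf_mult[symmetric]) (use assms sqs_mult_shift[of c a 1 "k+1"] in \<open>auto simp: mult_ac\<close>)
  moreover have "(\<Sum>i = 1..k - 1. x * a i * c (k - i)) = x * (\<Sum>i = 1..k - 1. a i * c (k - i))"
    by (simp add: sum_distrib_left mult_ac)
  ultimately show ?thesis
    unfolding ks_bil_def by (simp add: algebra_simps)
qed

lemma ks_bil_diff_left: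
  assumes "sqs a" "sqs b" "sqs c"
  shows "ks_bil (\<lambda>k. a k - b k) c k = ks_bil a c k - ks_bil b c k"
  using ks_bil_add_left[OF sqs_diff[OF assms(1,2)] assms(2,3), of k] by simp

text \<open>The identity x^2 - y^2 = (x + y) (x - y) for a symmetric bilinear form. The difference
  of two solutions therefore obeys a linear equation with their sum as coefficient.\<close>

lemma ks_bil_diff:
  assumes "sqs a" "sqs b"
  shows "ks_bil a a k - ks_bil b b k = ks_bil (\<lambda>k. a k + b k) (\<lambda>k. a k - b k) k"
proof -
  have d: "sqs (\<lambda>k. a k - b k)" using assms by (rule sqs_diff)
  show ?thesis
    using ks_bil_add_left[OF assms d, of k] ks_bil_commute[of a "\<lambda>k. a k - b k" k]
      ks_bil_commute[of b "\<lambda>k. a k - b k" k] ks_bil_diff_left[OF assms assms(1), of k]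
      ks_bil_diff_left[OF assms assms(2), of k] ks_bil_commute[of a b k] by simp
qed

lemma ks_bil_diff_bound:
  assumes "sqs a" "sqs b"
  shows "\<bar>ks_bil a a k - ks_bil b b k\<bar> \<le> 3 * real k * ((l2norm a + l2norm b) * l2norm (\<lambda>k. a k - b k))"
proof -
  have "\<bar>ks_bil a a k - ks_bil b b k\<bar> \<le> 3 * real k * (l2norm (\<lambda>k. a k + b k) * l2norm (\<lambda>k. a k - b k))"
    unfolding ks_bil_diff[OF assms] by (intro ks_bil_bound sqs_add sqs_diff assms)
  also have "\<dots> \<le> 3 * real k * ((l2norm a + l2norm b) * l2norm (\<lambda>k. a k - b k))"
    by (intro mult_left_mono mult_right_mono l2norm_triangle l2norm_nonneg sqs_diff assms) auto
  finally show ?thesis .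
qed

section \<open>Scalar differential inequalities\<close>

text \<open>Gronwall's inequality by the integrating factor exp (- c t); \<open>c\<close> and
  \<open>h\<close> may have either sign. Derivatives are required only in the open interval, since a
  solution on a closed interval has one-sided derivatives at the ends.\<close>

lemma exp_decay:
  fixes h :: "real \<Rightarrow> real"
  assumes "s \<le> t" "continuous_on {s..t} h"
    and "\<And>r. s < r \<Longrightarrow> r < t \<Longrightarrow> (h has_real_derivative h' r) (at r) \<and> h' r \<le> c * h r"
  shows "h t \<le> exp (c * (t - s)) * h s"
proof -
  have "exp (- c * t) * h t \<le> exp (- c * s) * h s"
  proof (rule DERIV_nonpos_imp_decreasing_open[OF assms(1)])
    fix r assume r: "s < r" "r < t"
    have e: "((\<lambda>r. exp (- c * r)) has_real_derivative exp (- c * r) * - c) (at r)"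
      by (auto intro!: derivative_eq_intros)
    have "((\<lambda>r. exp (- c * r) * h r) has_real_derivative
        exp (- c * r) * h' r + exp (- c * r) * (- c) * h r) (at r)"
      using DERIV_mult[OF e conjunct1[OF assms(3)[OF r]]] by (simp add: mult_ac add.commute)
    moreover have "exp (- c * r) * h' r + exp (- c * r) * (- c) * h r = exp (- c * r) * (h' r - c * h r)"
      by (simp add: algebra_simps)
    moreover have "exp (- c * r) * (h' r - c * h r) \<le> 0"
      using assms(3)[OF r] by (simp add: mult_nonneg_nonpos)
    ultimately show "\<exists>y. ((\<lambda>r. exp (- c * r) * h r) has_real_derivative y) (at r) \<and> y \<le> 0"
      by auto
  qed (intro continuous_intros assms)
  then have "exp (c * t) * (exp (- c * t) * h t) \<le> exp (c * t) * (exp (- c * s) * h s)"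
    by (rule mult_left_mono) simp
  moreover have "exp (c * t) * exp (- c * t) = 1" "exp (c * t) * exp (- c * s) = exp (c * (t - s))"
    by (simp_all add: exp_add[symmetric] right_diff_distrib)
  ultimately show ?thesis by (simp only: mult.assoc[symmetric] mult_1_left)
qed

lemma exp_growth:
  fixes h :: "real \<Rightarrow> real"
  assumes "s \<le> t" "continuous_on {s..t} h"
    and "\<And>r. s < r \<Longrightarrow> r < t \<Longrightarrow> (h has_real_derivative h' r) (at r) \<and> c * h r \<le> h' r"
  shows "exp (c * (t - s)) * h s \<le> h t"
proof -
  have "- h t \<le> exp (c * (t - s)) * - h s"
  proof (rule exp_decay[OF assms(1), where h'="\<lambda>r. - h' r"])
    show "((\<lambda>t. - h t) has_real_derivative - h' r) (at r) \<and> - h' r \<le> c * - h r"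
      if "s < r" "r < t" for r
      using assms(3)[OF that] DERIV_minus[of h "h' r" r UNIV] by simp
  qed (intro continuous_intros assms)
  then show ?thesis by simp
qed

text \<open>The excess of f over the equilibrium G / L of the worst-case equation decays at rate L;
  the same one-sided argument serves f and - f.\<close>

lemma forced_decay_abs:
  fixes f :: "real \<Rightarrow> real"
  assumes "s \<le> t" "continuous_on {s..t} f" "0 < L" "0 \<le> G"
    and "\<And>r. s < r \<Longrightarrow> r < t \<Longrightarrow> (f has_real_derivative - L * f r + g r) (at r) \<and> \<bar>g r\<bar> \<le> G"
  shows "\<bar>f t\<bar> \<le> exp (- L * (t - s)) * \<bar>f s\<bar> + G / L"
proof -
  have *: "h t - G / L \<le> exp (- L * (t - s)) * (h s - G / L)"
    if "continuous_on {s..t} h"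
      "\<And>r. s < r \<Longrightarrow> r < t \<Longrightarrow> (h has_real_derivative - L * h r + e r) (at r) \<and> \<bar>e r\<bar> \<le> G" for h e
  proof (rule exp_decay[OF assms(1), where h'="\<lambda>r. - L * h r + e r"])
    fix r assume r: "s < r" "r < t"
    have "((\<lambda>t. h t - G / L) has_real_derivative - L * h r + e r) (at r)"
      using DERIV_diff[OF _ DERIV_const, of h "- L * h r + e r" r UNIV "G / L"] that(2)[OF r] by simp
    moreover have "- L * (h r - G / L) = - L * h r + G" using assms(3) by (simp add: algebra_simps)
    ultimately show "((\<lambda>t. h t - G / L) has_real_derivative - L * h r + e r) (at r) \<and>
        - L * h r + e r \<le> - L * (h r - G / L)"
      using that(2)[OF r] by (simp add: abs_le_iff)
  qed (intro continuous_intros that)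
  define E where "E = exp (- L * (t - s))"
  have E: "0 \<le> E * (G / L)" "E * f s \<le> E * \<bar>f s\<bar>" "- (E * f s) \<le> E * \<bar>f s\<bar>"
    using assms mult_left_mono[of "f s" "\<bar>f s\<bar>" E] mult_left_mono[of "- f s" "\<bar>f s\<bar>" E]
    by (simp_all add: E_def)
  have "f t - G / L \<le> E * (f s - G / L)"
    unfolding E_def by (rule *) (use assms in auto)
  then have "f t \<le> E * \<bar>f s\<bar> + G / L"
    using E(1,2) unfolding right_diff_distrib by linarith
  moreover have "- f t - G / L \<le> E * (- f s - G / L)"
    unfolding E_def
  proof (rule *[where e="\<lambda>r. - g r"])
    show "((\<lambda>t. - f t) has_real_derivative - L * - f r + - g r) (at r) \<and> \<bar>- g r\<bar> \<le> G"
      if "s < r" "r < t" for r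
      using assms(5)[OF that] DERIV_minus[of f "- L * f r + g r" r UNIV] by simp
  qed (intro continuous_intros assms)
  then have "- f t \<le> E * \<bar>f s\<bar> + G / L"
    using E(1,3) by (simp add: right_diff_distrib)
  ultimately show ?thesis unfolding E_def by (simp add: abs_le_iff)
qed

text \<open>Starting the decay estimate at s and letting s tend to minus infinity removes the
  initial value, because one constant bounds h at all earlier times.\<close>

lemma decay_from_minus_infinity:
  fixes h :: "real \<Rightarrow> real"
  assumes "0 < L" "continuous_on {..T} h" "\<And>t. t \<le> T \<Longrightarrow> h t \<le> B"
    and "\<And>r. r < T \<Longrightarrow> (h has_real_derivative h' r) (at r) \<and> h' r \<le> - L * h r"
  shows "t \<le> T \<Longrightarrow> h t \<le> 0"
proof -
  assume t: "t \<le> T"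
  have le: "h t \<le> exp (- L * (t - s)) * \<bar>B\<bar>" if "s \<le> t" for s
  proof -
    have "h t \<le> exp (- L * (t - s)) * h s"
      by (rule exp_decay[where h'=h', OF that]) (use t assms in \<open>auto intro: continuous_on_subset\<close>)
    also have "\<dots> \<le> exp (- L * (t - s)) * \<bar>B\<bar>"
      using assms(3)[of s] that t by (intro mult_left_mono) auto
    finally show ?thesis .
  qed
  have "((\<lambda>s. exp (- L * (t - s)) * \<bar>B\<bar>) \<longlongrightarrow> 0 * \<bar>B\<bar>) at_bot"
  proof (intro tendsto_mult_right)
    have "filterlim (\<lambda>s. - L * (t - s)) at_bot at_bot"
      using assms(1) by real_asymp
    then show "((\<lambda>s. exp (- L * (t - s))) \<longlongrightarrow> 0) at_bot"
      by (rule filterlim_compose[OF exp_at_bot])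
  qed
  then have "h t \<le> 0 * \<bar>B\<bar>"
    by (rule tendsto_lowerbound) (use le in \<open>auto simp: eventually_at_bot_linorder\<close>)
  then show "h t \<le> 0" by simp
qed

text \<open>C z / (L + \<gamma>) is a supersolution of f' = - L f + C z when z grows at least at
  rate \<gamma>, so the difference falls under \<open>decay_from_minus_infinity\<close>. The growth
  condition carries the factor C so that C may be negative: it then bounds the growth of z from
  above.\<close>

lemma slaving_le:
  fixes f :: "real \<Rightarrow> real"
  assumes "0 < L" "continuous_on {..T} f" "continuous_on {..T} z"
    and "\<And>t. t \<le> T \<Longrightarrow> f t \<le> F" "\<And>t. t \<le> T \<Longrightarrow> \<bar>z t\<bar> \<le> Z"
    and "\<And>r. r < T \<Longrightarrow> (f has_real_derivative - L * f r + g r) (at r) \<and> g r \<le> C * z r"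
    and "\<And>r. r < T \<Longrightarrow> (z has_real_derivative z' r) (at r) \<and> C * (\<gamma> * z r) \<le> C * z' r"
    and "L + \<gamma> > 0" "t \<le> T"
  shows "f t \<le> C * z t / (L + \<gamma>)"
proof -
  have "f t - C / (L + \<gamma>) * z t \<le> 0"
  proof (rule decay_from_minus_infinity[OF assms(1) _ _ _ assms(9), where B="F + \<bar>C / (L + \<gamma>)\<bar> * Z"
        and h'="\<lambda>r. - L * f r + g r - C / (L + \<gamma>) * z' r"])
    show "continuous_on {..T} (\<lambda>t. f t - C / (L + \<gamma>) * z t)"
      by (intro continuous_intros assms)
    show "f t - C / (L + \<gamma>) * z t \<le> F + \<bar>C / (L + \<gamma>)\<bar> * Z" if "t \<le> T" for t
    proof -
      have "- (C / (L + \<gamma>) * z t) \<le> \<bar>C / (L + \<gamma>)\<bar> * \<bar>z t\<bar>"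
        using abs_ge_minus_self[of "C / (L + \<gamma>) * z t"] by (simp only: abs_mult)
      also have "\<dots> \<le> \<bar>C / (L + \<gamma>)\<bar> * Z" by (intro mult_left_mono assms that) simp
      finally show ?thesis using assms(4)[OF that] by simp
    qed
    fix r assume r: "r < T"
    have "C * \<gamma> / (L + \<gamma>) * z r \<le> C / (L + \<gamma>) * z' r"
    proof -
      have "C * (\<gamma> * z r) / (L + \<gamma>) \<le> C * z' r / (L + \<gamma>)"
        using assms(7)[OF r] assms(8) by (intro divide_right_mono) auto
      then show ?thesis by (simp add: mult_ac)
    qed
    moreover have "C * z r - C * \<gamma> / (L + \<gamma>) * z r = L * (C / (L + \<gamma>) * z r)"
      using assms(8) by (simp add: divide_simps) (simp add: algebra_simps)
    ultimately have "- L * f r + g r - C / (L + \<gamma>) * z' r \<le> - L * (f r - C / (L + \<gamma>) * z r)"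
      using conjunct2[OF assms(6)[OF r]] unfolding right_diff_distrib by linarith
    moreover have "((\<lambda>t. f t - C / (L + \<gamma>) * z t) has_real_derivative
        - L * f r + g r - C / (L + \<gamma>) * z' r) (at r)"
      using DERIV_diff[OF conjunct1[OF assms(6)[OF r]] DERIV_cmult[OF conjunct1[OF assms(7)[OF r]], of "C / (L + \<gamma>)"]] .
    ultimately show "((\<lambda>t. f t - C / (L + \<gamma>) * z t) has_real_derivative
        - L * f r + g r - C / (L + \<gamma>) * z' r) (at r) \<and>
        - L * f r + g r - C / (L + \<gamma>) * z' r \<le> - L * (f r - C / (L + \<gamma>) * z r)" by simp
  qed
  then show ?thesis by (simp add: field_simps)
qed

lemma slaving_abs:
  fixes f :: "real \<Rightarrow> real"
  assumes "0 < L" "continuous_on {..T} f" "continuous_on {..T} z"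
    and "\<And>t. t \<le> T \<Longrightarrow> \<bar>f t\<bar> \<le> F" "\<And>t. t \<le> T \<Longrightarrow> \<bar>z t\<bar> \<le> Z"
    and "\<And>r. r < T \<Longrightarrow> (f has_real_derivative - L * f r + g r) (at r) \<and> \<bar>g r\<bar> \<le> C * z r"
    and "\<And>r. r < T \<Longrightarrow> (z has_real_derivative z' r) (at r) \<and> \<gamma> * z r \<le> z' r"
    and "L + \<gamma> > 0" "t \<le> T" "0 \<le> C"
  shows "\<bar>f t\<bar> \<le> C * z t / (L + \<gamma>)"
proof -
  have "f t \<le> C * z t / (L + \<gamma>)"
    by (rule slaving_le[OF assms(1,2,3) _ assms(5) _ _ assms(8,9), where g=g and z'=z' and F=F])
      (use assms(4,6,7,10) in \<open>auto simp: abs_le_iff intro: mult_left_mono\<close>)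
  moreover have "- f t \<le> C * z t / (L + \<gamma>)"
  proof (rule slaving_le[OF assms(1) _ assms(3) _ assms(5) _ _ assms(8,9), where g="\<lambda>r. - g r" and z'=z' and F=F])
    fix r assume "r < T"
    then show "((\<lambda>t. - f t) has_real_derivative - L * - f r + - g r) (at r) \<and> - g r \<le> C * z r"
      using assms(6)[of r] DERIV_minus[of f "- L * f r + g r" r UNIV] by (simp add: abs_le_iff)
  qed (use assms(2,4,7,10) in \<open>auto simp: abs_le_iff intro: mult_left_mono continuous_on_minus\<close>)
  ultimately show ?thesis by (simp add: abs_le_iff)
qed

text \<open>After the last time before t1 with f \<ge> c the function lies below c, where it cannot
  decrease; so it cannot have fallen below c.\<close>

lemma barrier:
  fixes f :: "real \<Rightarrow> real"
  assumes "continuous_on {t0..} f" "c \<le> f t0" "t0 \<le> t1"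
    and "\<And>t. t0 < t \<Longrightarrow> (f has_real_derivative f' t) (at t)"
    and "\<And>t. t0 < t \<Longrightarrow> f t < c \<Longrightarrow> 0 \<le> f' t"
  shows "c \<le> f t1"
proof (rule ccontr)
  assume n: "\<not> c \<le> f t1"
  define S where "S = {r \<in> {t0..t1}. c \<le> f r}"
  have S: "S \<noteq> {}" "bdd_above S" using assms(2,3) by (auto simp: S_def intro!: bdd_aboveI[where M=t1])
  have S_eq: "S = {t0..t1} \<inter> f -` {c..}" by (auto simp: S_def)
  have "closed S"
    unfolding S_eq by (rule continuous_closed_preimage[OF continuous_on_subset[OF assms(1)]]) auto
  then have sS: "Sup S \<in> S" using S closed_contains_Sup by blast
  then have s: "t0 \<le> Sup S" "Sup S \<le> t1" "c \<le> f (Sup S)" by (auto simp: S_def)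
  have "f (Sup S) \<le> f t1"
  proof (rule DERIV_nonneg_imp_increasing_open[OF s(2)])
    fix x assume x: "Sup S < x" "x < t1"
    then have "x \<notin> S" using S cSup_upper by (meson leD)
    then have "f x < c" using x s by (auto simp: S_def)
    then show "\<exists>y. (f has_real_derivative y) (at x) \<and> 0 \<le> y"
      using assms(4,5)[of x] x s by auto
  qed (use s in \<open>auto intro: continuous_on_subset[OF assms(1)]\<close>)
  with s n show False by simp
qed

text \<open>Continuous induction started at minus infinity. At the first time where f reaches 0 the
  condition still holds up to that time, and \<open>step\<close> contradicts f = 0 there; it thus
  suffices to improve \<le> to < at the right end.\<close>

lemma continuous_induction_left:
  fixes f :: "real \<Rightarrow> real"
  assumes cont: "continuous_on UNIV f"
    and start: "\<And>t. t \<le> t0 \<Longrightarrow> f t \<le> 0"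
    and step: "\<And>T. (\<And>t. t \<le> T \<Longrightarrow> f t \<le> 0) \<Longrightarrow> f T < 0"
  shows "f t < 0"
proof -
  have "f t \<le> 0" for t
  proof (rule ccontr)
    assume t: "\<not> f t \<le> 0"
    define S where "S = {r. 0 \<le> f r} \<inter> {t0..}"
    have tS: "t \<in> S" using t start[of t] by (cases "t \<le> t0") (auto simp: S_def)
    have S: "S \<noteq> {}" "bdd_below S" using tS by (auto simp: S_def intro!: bdd_belowI[where m=t0])
    have "closed S" unfolding S_def
      by (intro closed_Int closed_Collect_le cont) auto
    then have "Inf S \<in> S" using S closed_contains_Inf by blast
    then have "0 \<le> f (Inf S)" by (simp add: S_def)
    moreover have "f (Inf S) < 0"
    proof (rule step)
      fix r assume r: "r \<le> Inf S"
      have below: "f r' \<le> 0" if "r' < Inf S" for r'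
      proof -
        have "r' \<notin> S" using that S cInf_lower by (meson leD)
        then show ?thesis using start[of r'] by (cases "r' \<le> t0") (auto simp: S_def)
      qed
      show "f r \<le> 0"
      proof (cases "r = Inf S")
        case True
        have "(f \<longlongrightarrow> f (Inf S)) (at_left (Inf S))"
          using cont by (simp add: continuous_on_eq_continuous_at isCont_def filterlim_at_split)
        then have "f (Inf S) \<le> 0"
          by (rule tendsto_upperbound)
            (use below in \<open>auto simp: eventually_at_filter\<close>)
        then show ?thesis using True by simp
      qed (use r below in auto)
    qed
    ultimately show False by simp
  qed
  then show ?thesis using step by blast
qed

section \<open>Curves of square-summable sequences\<close>

text \<open>Dominated convergence for series (Tannery's theorem). It makes curves that are built
  mode by mode continuous in norm, once they have a common square-summable majorant.\<close>

lemma dominated_l2_tendsto: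
  assumes "\<And>k. ((\<lambda>s. a s k) \<longlongrightarrow> c k) F" "\<forall>\<^sub>F s in F. \<forall>k. \<bar>a s k\<bar> \<le> D k"
    and "sqs D" "\<And>k. \<bar>c k\<bar> \<le> D k" "F \<noteq> bot"
  shows "((\<lambda>s. l2norm (\<lambda>k. a s k - c k)) \<longlongrightarrow> 0) F"
proof -
  have "((\<lambda>s. \<Sum>k. (a s k - c k)\<^sup>2) \<longlongrightarrow> (\<Sum>k. 0)) F"
  proof (rule conjunct2[OF conjunct2[OF tannerys_theorem]])
    show "((\<lambda>s. (a s k - c k)\<^sup>2) \<longlongrightarrow> 0) F" for k
      using tendsto_power[OF tendsto_diff[OF assms(1)[of k] tendsto_const[of "c k"]], of 2] by simp
    have le: "norm ((a s k - c k)\<^sup>2) \<le> (2 * D k)\<^sup>2" if "\<forall>k. \<bar>a s k\<bar> \<le> D k" for s k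
    proof -
      have "\<bar>a s k - c k\<bar> \<le> \<bar>2 * D k\<bar>" using that assms(4)[of k] spec[OF that, of k] by linarith
      then show ?thesis by (simp add: abs_le_square_iff)
    qed
    show "\<forall>\<^sub>F (k, s) in sequentially \<times>\<^sub>F F. norm ((a s k - c k)\<^sup>2) \<le> (2 * D k)\<^sup>2"
      unfolding eventually_prod_filter
      by (intro exI[of _ "\<lambda>_. True"] exI[of _ "\<lambda>s. \<forall>k. \<bar>a s k\<bar> \<le> D k"]) (use assms(2) le in auto)
    show "summable (\<lambda>k. (2 * D k)\<^sup>2)" using sqs_cmult[OF assms(3), of 2] by (simp add: sqs_def)
  qed (fact assms(5))
  from tendsto_real_sqrt[OF this] show ?thesis by (simp add: l2norm_def)
qed

lemma l2norm_tendsto: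
  assumes "\<forall>\<^sub>F s in F. sqs (a s)" "sqs c" "((\<lambda>s. l2norm (\<lambda>k. a s k - c k)) \<longlongrightarrow> 0) F"
  shows "((\<lambda>s. l2norm (a s)) \<longlongrightarrow> l2norm c) F"
proof (rule LIM_zero_cancel, rule Lim_null_comparison[OF _ assms(3)])
  show "\<forall>\<^sub>F s in F. norm (l2norm (a s) - l2norm c) \<le> l2norm (\<lambda>k. a s k - c k)"
    using assms(1) by eventually_elim (use l2norm_reverse_triangle assms(2) in simp)
qed

lemma component_tendsto:
  assumes "\<forall>\<^sub>F s in F. sqs (a s)" "sqs c" "((\<lambda>s. l2norm (\<lambda>k. a s k - c k)) \<longlongrightarrow> 0) F"
  shows "((\<lambda>s. a s k) \<longlongrightarrow> c k) F"
proof (rule LIM_zero_cancel, rule Lim_null_comparison[OF _ assms(3)])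
  show "\<forall>\<^sub>F s in F. norm (a s k - c k) \<le> l2norm (\<lambda>k. a s k - c k)"
    using assms(1) by eventually_elim (use abs_le_l2norm[OF sqs_diff] assms(2) in auto)
qed

text \<open>The quadratic term is Lipschitz on bounded sets for each fixed k, with a constant
  growing like k; this componentwise continuity identifies limits of orbits as fixed points.\<close>

lemma ks_bil_tendsto:
  assumes "\<forall>\<^sub>F s in F. sqs (a s)" "sqs c" "((\<lambda>s. l2norm (\<lambda>k. a s k - c k)) \<longlongrightarrow> 0) F"
  shows "((\<lambda>s. ks_bil (a s) (a s) k) \<longlongrightarrow> ks_bil c c k) F"
proof (rule LIM_zero_cancel, rule Lim_null_comparison)
  show "\<forall>\<^sub>F s in F. norm (ks_bil (a s) (a s) k - ks_bil c c k)
      \<le> 3 * real k * ((l2norm (a s) + l2norm c) * l2norm (\<lambda>k. a s k - c k))"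
    using assms(1) by eventually_elim (use ks_bil_diff_bound assms(2) in auto)
  have "((\<lambda>s. 3 * real k * ((l2norm (a s) + l2norm c) * l2norm (\<lambda>k. a s k - c k))) \<longlongrightarrow>
      3 * real k * ((l2norm c + l2norm c) * 0)) F"
    by (intro tendsto_intros l2norm_tendsto assms)
  then show "((\<lambda>s. 3 * real k * ((l2norm (a s) + l2norm c) * l2norm (\<lambda>k. a s k - c k))) \<longlongrightarrow> 0) F"
    by simp
qed

section \<open>Existence of solutions\<close>

text \<open>
  The discrete metric on the indices: it makes the bounded continuous functions on
  \<open>nat \<times> real\<close> a complete metric space.
\<close>

instantiation nat :: metric_space
begin

definition dist_nat :: "nat \<Rightarrow> nat \<Rightarrow> real" where
  "dist_nat m n = (if m = n then 0 else 1)"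

definition uniformity_nat :: "(nat \<times> nat) filter" where
  "(uniformity :: (nat \<times> nat) filter) = (INF e\<in>{0<..}. principal {(x, y). dist x y < e})"

instance
proof
  show "open U \<longleftrightarrow> (\<forall>x\<in>U. \<forall>\<^sub>F (x', y) in uniformity. x' = x \<longrightarrow> y \<in> U)" for U :: "nat set"
  proof -
    have "\<forall>\<^sub>F (x', y) in uniformity. x' = x \<longrightarrow> y \<in> U" if "x \<in> U" for x
      unfolding uniformity_nat_def
      by (rule eventually_INF1[of 1]) (use that in \<open>auto simp: eventually_principal dist_nat_def\<close>)
    then show ?thesis by (auto intro: open_discrete)
  qed
qed (auto simp: uniformity_nat_def dist_nat_def)

end

text \<open>
  Clamping each component of the state to \<open>[-M k, M k]\<close> with \<open>M\<close> square-summable makes the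
  quadratic term globally Lipschitz, so that Picard iteration yields global curves.
\<close>

definition clamped :: "(nat \<Rightarrow> real) \<Rightarrow> (nat \<Rightarrow> real) \<Rightarrow> nat \<Rightarrow> real" where
  "clamped M a k = max (- M k) (min (M k) (a k))"

definition ks_clamp :: "(nat \<Rightarrow> real) \<Rightarrow> (nat \<Rightarrow> real) \<Rightarrow> nat \<Rightarrow> real" where
  "ks_clamp M a k = ks_bil (clamped M a) (clamped M a) k"

text \<open>The value at k = 0 is 0 by division by zero. The exponent is dictated by the balance of
  the iteration: the linear part gains k^3, the quadratic term costs k, and k^-2 is
  square-summable.\<close>

definition invsq :: "nat \<Rightarrow> real" where
  "invsq k = 1 / (real k)\<^sup>2"

lemma sqs_invsq: "sqs invsq"
proof -
  have "summable (\<lambda>n. inverse (real n ^ 4))" by (rule inverse_power_summable) simp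
  then show ?thesis unfolding sqs_def invsq_def
    by (simp add: power_divide inverse_eq_divide flip: power_mult)
qed

lemma invsq_nonneg [simp]: "0 \<le> invsq k"
  by (simp add: invsq_def)

lemma sqs_invsq_bound:
  assumes "\<And>k. \<bar>v k\<bar> \<le> B * invsq k" "0 \<le> B"
  shows "sqs v" "l2norm v \<le> B * l2norm invsq"
proof -
  have s: "sqs (\<lambda>k. B * invsq k)" by (intro sqs_cmult sqs_invsq)
  have le: "\<bar>v k\<bar> \<le> \<bar>B * invsq k\<bar>" for k using assms by simp
  show "sqs v" by (rule sqs_mono[OF s le])
  show "l2norm v \<le> B * l2norm invsq"
    using l2norm_mono[OF s le] l2norm_cmult[OF sqs_invsq, of B] assms(2) by simp
qed

lemma clamped_le: "0 \<le> M k \<Longrightarrow> \<bar>clamped M a k\<bar> \<le> M k" "0 \<le> M k \<Longrightarrow> \<bar>clamped M a k\<bar> \<le> \<bar>a k\<bar>"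
  by (auto simp: clamped_def)

lemma clamped_lipschitz: "\<bar>clamped M a k - clamped M b k\<bar> \<le> \<bar>a k - b k\<bar>"
  unfolding clamped_def by linarith

lemma clamped_id: "(\<And>k. \<bar>a k\<bar> \<le> M k) \<Longrightarrow> clamped M a = a"
  by (rule ext) (auto simp: clamped_def abs_le_iff max_def min_def, smt+)

context
  fixes M :: "nat \<Rightarrow> real"
  assumes M: "\<And>k. 0 \<le> M k" "sqs M"
begin

lemma sqs_clamped: "sqs (clamped M a)"
  by (rule sqs_mono[OF M(2)]) (use clamped_le(1)[OF M(1)] M(1) in simp)

lemma l2norm_clamped: "l2norm (clamped M a) \<le> l2norm M"
  by (rule l2norm_mono[OF M(2)]) (use clamped_le(1)[OF M(1)] M(1) in simp)

lemma l2norm_clamped_le: "sqs a \<Longrightarrow> l2norm (clamped M a) \<le> l2norm a"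
  by (rule l2norm_mono[OF _ clamped_le(2)[where M=M, OF M(1)]])

lemma ks_clamp_bound: "\<bar>ks_clamp M a k\<bar> \<le> 3 * real k * (l2norm M)\<^sup>2"
proof -
  have "l2norm (clamped M a) * l2norm (clamped M a) \<le> l2norm M * l2norm M"
    by (intro mult_mono l2norm_clamped l2norm_nonneg sqs_clamped M)
  from mult_left_mono[OF this, of "3 * real k"] ks_bil_bound[OF sqs_clamped sqs_clamped, of a a k]
  show ?thesis unfolding ks_clamp_def power2_eq_square by simp
qed

text \<open>Clamping only shrinks components, so the bound remains quadratic in the actual state.
  Near minus infinity the forcing must vanish quadratically with the state, which the constant bound
  \<open>ks_clamp_bound\<close> does not give.\<close>

lemma ks_clamp_bound_l2norm: "sqs a \<Longrightarrow> \<bar>ks_clamp M a k\<bar> \<le> 3 * real k * (l2norm a)\<^sup>2"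
proof -
  assume a: "sqs a"
  have "l2norm (clamped M a) * l2norm (clamped M a) \<le> l2norm a * l2norm a"
    by (intro mult_mono l2norm_clamped_le l2norm_nonneg sqs_clamped a)
  from mult_left_mono[OF this, of "3 * real k"] ks_bil_bound[OF sqs_clamped sqs_clamped, of a a k]
  show ?thesis unfolding ks_clamp_def power2_eq_square by simp
qed

text \<open>Clamping is 1-Lipschitz in each component and confines both states to norm
  \<open>l2norm M\<close>, which makes the constant global and proportional to
  \<open>l2norm M\<close>.\<close>

lemma ks_clamp_lipschitz:
  assumes "sqs (\<lambda>k. a k - b k)"
  shows "\<bar>ks_clamp M a k - ks_clamp M b k\<bar> \<le> 6 * real k * l2norm M * l2norm (\<lambda>k. a k - b k)"
proof -
  have "l2norm (\<lambda>k. clamped M a k - clamped M b k) \<le> l2norm (\<lambda>k. a k - b k)"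
    by (rule l2norm_mono[OF assms]) (rule clamped_lipschitz)
  then have "(l2norm (clamped M a) + l2norm (clamped M b)) * l2norm (\<lambda>k. clamped M a k - clamped M b k)
      \<le> (l2norm M + l2norm M) * l2norm (\<lambda>k. a k - b k)"
    by (intro mult_mono add_mono l2norm_clamped l2norm_nonneg sqs_diff sqs_clamped add_nonneg_nonneg M)
  from mult_left_mono[OF this, of "3 * real k"]
    ks_bil_diff_bound[OF sqs_clamped[of a] sqs_clamped[of b], of k]
  show ?thesis unfolding ks_clamp_def by (simp add: algebra_simps)
qed

lemma ks_clamp_continuous:
  fixes a :: "real \<Rightarrow> nat \<Rightarrow> real"
  assumes "\<And>k. continuous_on UNIV (\<lambda>t. a t k)"
    and dom: "\<And>T. \<exists>D. sqs D \<and> (\<forall>t. \<bar>t\<bar> \<le> T \<longrightarrow> (\<forall>k. \<bar>a t k\<bar> \<le> D k))"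
  shows "continuous_on UNIV (\<lambda>t. ks_clamp M (a t) k)"
  unfolding continuous_on_def
proof (intro ballI)
  fix t :: real
  obtain D where D: "sqs D" "\<And>s k. \<bar>s\<bar> \<le> \<bar>t\<bar> + 1 \<Longrightarrow> \<bar>a s k\<bar> \<le> D k" using dom by meson
  have ev: "\<forall>\<^sub>F s in at t. \<bar>s\<bar> \<le> \<bar>t\<bar> + 1"
    unfolding eventually_at by (rule exI[of _ 1]) (auto simp: dist_real_def)
  have s: "sqs (a s)" if "\<bar>s\<bar> \<le> \<bar>t\<bar> + 1" for s
    by (rule sqs_mono[OF D(1) order_trans[OF D(2)[OF that] abs_ge_self]])
  have "((\<lambda>s. l2norm (\<lambda>k. a s k - a t k)) \<longlongrightarrow> 0) (at t)"
  proof (rule dominated_l2_tendsto[OF _ _ D(1)])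
    show "((\<lambda>s. a s k) \<longlongrightarrow> a t k) (at t)" for k
      using assms(1)[of k] by (simp add: continuous_on_eq_continuous_at isCont_def)
    show "\<forall>\<^sub>F s in at t. \<forall>k. \<bar>a s k\<bar> \<le> D k" using ev by eventually_elim (use D in auto)
  qed (use D in auto)
  then have lim: "((\<lambda>s. 6 * real k * l2norm M * l2norm (\<lambda>k. a s k - a t k)) \<longlongrightarrow> 0) (at t)"
    by (rule tendsto_mult_right_zero)
  show "((\<lambda>s. ks_clamp M (a s) k) \<longlongrightarrow> ks_clamp M (a t) k) (at t)"
  proof (rule LIM_zero_cancel, rule Lim_null_comparison[OF _ lim])
    show "\<forall>\<^sub>F s in at t. norm (ks_clamp M (a s) k - ks_clamp M (a t) k)
        \<le> 6 * real k * l2norm M * l2norm (\<lambda>k. a s k - a t k)"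
      using ev by eventually_elim (use ks_clamp_lipschitz sqs_diff s in simp)
  qed
qed

text \<open>
  \<open>J k g\<close> stands for the solution of \<open>f' = \<lambda>\<^sub>k f + g\<close> selected by an
  initial condition (at time \<open>0\<close>, or at \<open>-\<infinity>\<close>), and \<open>E t / k\<^sup>2\<close> is the weight of the norm in
  which the iteration contracts.
\<close>

lemma mild_fixed_point:
  fixes J :: "nat \<Rightarrow> (real \<Rightarrow> real) \<Rightarrow> real \<Rightarrow> real" and b :: "real \<Rightarrow> nat \<Rightarrow> real"
  assumes J_cont: "\<And>k g G. k \<ge> 1 \<Longrightarrow> continuous_on UNIV g \<Longrightarrow> (\<And>s. \<bar>g s\<bar> \<le> G * E s) \<Longrightarrow>
      continuous_on UNIV (J k g)"
    and J_diff: "\<And>k g h G G1 G2 t. k \<ge> 1 \<Longrightarrow> continuous_on UNIV g \<Longrightarrow> continuous_on UNIV h \<Longrightarrow>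
      (\<And>s. \<bar>g s\<bar> \<le> G1 * E s) \<Longrightarrow> (\<And>s. \<bar>h s\<bar> \<le> G2 * E s) \<Longrightarrow>
      (\<And>s. \<bar>g s - h s\<bar> \<le> G * E s) \<Longrightarrow> \<bar>J k g t - J k h t\<bar> \<le> G * E t / (\<kappa> * real k ^ 3)"
    and J_zero: "\<And>k t. k \<ge> 1 \<Longrightarrow> J k (\<lambda>s. 0) t = 0"
    and b_cont: "\<And>k. continuous_on UNIV (\<lambda>t. b t k)"
    and b_dom: "\<And>T. \<exists>D. sqs D \<and> (\<forall>t. \<bar>t\<bar> \<le> T \<longrightarrow> (\<forall>k. \<bar>b t k\<bar> \<le> D k))"
    and growth: "\<And>B. \<exists>G\<ge>0. \<forall>a s. (\<forall>k. \<bar>a k - b s k\<bar> \<le> B * E s * invsq k) \<longrightarrow>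
      (\<forall>k. \<bar>ks_clamp M a k\<bar> \<le> real k * G * E s)"
    and \<kappa>: "0 < \<kappa>" "12 * l2norm M * l2norm invsq \<le> \<kappa>"
    and E: "\<And>t. 0 < E t" "continuous_on UNIV E" "mono E"
  shows "\<exists>a C. (\<forall>t k. k \<ge> 1 \<longrightarrow> a t k = b t k + J k (\<lambda>s. ks_clamp M (a s) k) t) \<and>
    (\<forall>t k. \<bar>a t k - b t k\<bar> \<le> C * E t * invsq k) \<and> (\<forall>t. a t 0 = b t 0) \<and>
    (\<forall>k. continuous_on UNIV (\<lambda>t. a t k)) \<and>
    (\<forall>T. \<exists>D. sqs D \<and> (\<forall>t. \<bar>t\<bar> \<le> T \<longrightarrow> (\<forall>k. \<bar>a t k\<bar> \<le> D k)))"
proof -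
  have E0 [simp]: "0 \<le> E t" "E t \<noteq> 0" "\<bar>E t\<bar> = E t" for t using E(1)[of t] by auto
  \<comment> \<open>The unknown curve is b + E w / k^2 with w bounded and continuous on the product
    of the discrete index set and the line; the weighted norm of the perturbation is then the
    supremum norm of w.\<close>
  define cv where "cv w t k = b t k + E t * apply_bcontfun w (k, t) * invsq k"
    for w :: "(nat \<times> real) \<Rightarrow>\<^sub>C real" and t k
  define g where "g w k s = ks_clamp M (cv w s) k" for w k s
  \<comment> \<open>The integral equation solved for w. Index 0 carries no equation and is set to
    0.\<close>
  define \<Psi> where "\<Psi> w = (\<lambda>(k, t). if k = 0 then 0 else (real k)\<^sup>2 * inverse (E t) * J k (g w k) t)" for w
  have wb: "\<bar>apply_bcontfun w x\<bar> \<le> norm w" for w :: "(nat \<times> real) \<Rightarrow>\<^sub>C real" and x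
    using norm_bounded[of w x] by simp
  have cvb: "\<bar>cv w t k - b t k\<bar> \<le> norm w * E t * invsq k" for w t k
  proof -
    have "\<bar>cv w t k - b t k\<bar> = \<bar>apply_bcontfun w (k, t)\<bar> * (E t * invsq k)"
      by (simp add: cv_def abs_mult)
    also have "\<dots> \<le> norm w * (E t * invsq k)" by (intro mult_right_mono wb) simp
    finally show ?thesis by (simp add: mult.assoc)
  qed
  have w_cont: "continuous_on UNIV (\<lambda>t. apply_bcontfun w (k, t))" for w :: "(nat \<times> real) \<Rightarrow>\<^sub>C real" and k
    by (rule continuous_on_compose2[OF continuous_on_apply_bcontfun]) (auto intro!: continuous_intros)
  have cv_cont: "continuous_on UNIV (\<lambda>t. cv w t k)" for w k
    unfolding cv_def by (intro continuous_intros b_cont w_cont E)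
  have cv_dom: "\<exists>D. sqs D \<and> (\<forall>t. \<bar>t\<bar> \<le> T \<longrightarrow> (\<forall>k. \<bar>cv w t k\<bar> \<le> D k))" for w T
  proof -
    obtain D where D: "sqs D" "\<And>s k. \<bar>s\<bar> \<le> T \<Longrightarrow> \<bar>b s k\<bar> \<le> D k" using b_dom by meson
    show ?thesis
    proof (intro exI[of _ "\<lambda>k. D k + norm w * E T * invsq k"] conjI allI impI)
      show "sqs (\<lambda>k. D k + norm w * E T * invsq k)"
        by (intro sqs_add sqs_cmult D sqs_invsq)
      fix t k assume t: "\<bar>t\<bar> \<le> T"
      have "norm w * E t * invsq k \<le> norm w * E T * invsq k"
        using t by (intro mult_right_mono mult_left_mono monoD[OF E(3)]) auto
      then show "\<bar>cv w t k\<bar> \<le> D k + norm w * E T * invsq k"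
        using cvb[of w t k] D(2)[OF t, of k] by linarith
    qed
  qed
  have g_cont: "continuous_on UNIV (g w k)" for w k
    unfolding g_def by (rule ks_clamp_continuous[OF cv_cont cv_dom])
  have g_bound: "\<exists>G\<ge>0. \<forall>k s. \<bar>g w k s\<bar> \<le> real k * G * E s" for w
  proof -
    obtain G where G: "G \<ge> 0" "\<And>a s. (\<forall>k. \<bar>a k - b s k\<bar> \<le> norm w * E s * invsq k) \<Longrightarrow>
      (\<forall>k. \<bar>ks_clamp M a k\<bar> \<le> real k * G * E s)" using growth[of "norm w"] by blast
    show ?thesis unfolding g_def using G(1) G(2)[of "cv w s" s for s] cvb by blast
  qed
  \<comment> \<open>The exponents balance: k^2 from the weight and k from the quadratic term cancel
    the k^3 gained by \<open>J\<close>, leaving a bound independent of k.\<close>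
  have kk: "(real k)\<^sup>2 * inverse (E t) * (real k * G * E t / (\<kappa> * real k ^ 3)) = G / \<kappa>"
    if "k \<ge> 1" for k t G
    using that \<kappa>(1) by (simp add: field_simps power2_eq_square power3_eq_cube exp_minus)
  have \<Psi>_in: "\<Psi> w \<in> bcontfun" for w
  proof -
    obtain G where G: "G \<ge> 0" "\<And>k s. \<bar>g w k s\<bar> \<le> real k * G * E s" using g_bound by blast
    show ?thesis
    proof (rule bcontfun_normI)
      have 1: "continuous_on ({k} \<times> UNIV) (\<Psi> w)" for k
      proof (cases "k = 0")
        case True
        have "continuous_on ({k} \<times> UNIV) (\<lambda>x::nat \<times> real. 0 :: real)" by (rule continuous_on_const)
        then show ?thesis by (rule continuous_on_eq) (auto simp: \<Psi>_def True)
      next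
        case False
        then have "continuous_on UNIV (J k (g w k))" using J_cont[OF _ g_cont G(2)] by simp
        then have "continuous_on UNIV (\<lambda>t. (real k)\<^sup>2 * inverse (E t) * J k (g w k) t)"
          by (intro continuous_intros E) simp
        then have "continuous_on ({k} \<times> UNIV) (\<lambda>x. (real k)\<^sup>2 * inverse (E (snd x)) * J k (g w k) (snd x))"
          by (rule continuous_on_compose2) (auto intro!: continuous_intros)
        then show ?thesis by (rule continuous_on_eq) (auto simp: \<Psi>_def False)
      qed
      \<comment> \<open>Each slice with fixed k is open because the indices are discrete, so
        continuity may be checked for one k at a time.\<close>
      have "continuous_on (\<Union>k\<in>UNIV. {k} \<times> UNIV) (\<Psi> w)"
        by (rule continuous_on_open_UN) (auto intro!: open_Times 1 open_discrete)
      moreover have "(\<Union>k\<in>UNIV. {k} \<times> (UNIV :: real set)) = (UNIV :: (nat \<times> real) set)" by auto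
      ultimately show "continuous_on UNIV (\<Psi> w)" by simp
      fix x :: "nat \<times> real"
      obtain k t where x: "x = (k, t)" by force
      show "norm (\<Psi> w x) \<le> G / \<kappa>"
      proof (cases "k = 0")
        case True then show ?thesis using G \<kappa> by (simp add: \<Psi>_def x)
      next
        case False
        then have k: "k \<ge> 1" by simp
        \<comment> \<open>Boundedness is the difference estimate compared with zero forcing.\<close>
        have z: "\<And>s. \<bar>0 :: real\<bar> \<le> 0 * E s" by simp
        have "\<bar>J k (g w k) t - J k (\<lambda>s. 0) t\<bar> \<le> real k * G * E t / (\<kappa> * real k ^ 3)"
          by (rule J_diff[OF k g_cont continuous_on_const G(2) z]) (use G(2) in simp)
        then have "\<bar>J k (g w k) t\<bar> \<le> real k * G * E t / (\<kappa> * real k ^ 3)"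
          using J_zero[OF k] by simp
        from mult_left_mono[OF this, of "(real k)\<^sup>2 * inverse (E t)"]
        show ?thesis using kk[OF k] False by (simp add: \<Psi>_def x abs_mult)
      qed
    qed
  qed
  have \<Psi>_lip: "dist (Bcontfun (\<Psi> w)) (Bcontfun (\<Psi> w')) \<le> 1/2 * dist w w'" for w w'
  proof (rule dist_bound)
    fix x :: "nat \<times> real"
    obtain k t where x: "x = (k, t)" by force
    obtain G1 where G1: "\<And>k s. \<bar>g w k s\<bar> \<le> real k * G1 * E s" using g_bound by blast
    obtain G2 where G2: "\<And>k s. \<bar>g w' k s\<bar> \<le> real k * G2 * E s" using g_bound by blast
    define G where "G = 6 * l2norm M * l2norm invsq * dist w w'"
    have diff: "\<bar>g w k s - g w' k s\<bar> \<le> real k * G * E s" for k s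
    proof -
      have "\<bar>cv w s k - cv w' s k\<bar> \<le> (dist w w' * E s) * invsq k" for k
      proof -
        have "\<bar>cv w s k - cv w' s k\<bar> = \<bar>apply_bcontfun w (k, s) - apply_bcontfun w' (k, s)\<bar> * (E s * invsq k)"
        proof -
          have "cv w s k - cv w' s k = (apply_bcontfun w (k, s) - apply_bcontfun w' (k, s)) * (E s * invsq k)"
            by (simp add: cv_def algebra_simps)
          then show ?thesis by (simp add: abs_mult)
        qed
        also have "\<dots> \<le> dist w w' * (E s * invsq k)"
          using dist_bounded[of w "(k, s)" w'] by (intro mult_right_mono) (auto simp: dist_real_def)
        finally show ?thesis by (simp add: mult.assoc)
      qed
      note * = sqs_invsq_bound[OF this]
      have "\<bar>g w k s - g w' k s\<bar> \<le> 6 * real k * l2norm M * l2norm (\<lambda>k. cv w s k - cv w' s k)"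
        unfolding g_def by (rule ks_clamp_lipschitz) (use * in simp)
      also have "\<dots> \<le> 6 * real k * l2norm M * (dist w w' * E s * l2norm invsq)"
        using * l2norm_nonneg[OF M(2)] by (intro mult_left_mono) auto
      finally show ?thesis by (simp add: G_def mult_ac)
    qed
    have "dist (\<Psi> w x) (\<Psi> w' x) \<le> G / \<kappa>"
    proof (cases "k = 0")
      case True
      have "0 \<le> G" unfolding G_def using l2norm_nonneg[OF M(2)] l2norm_nonneg[OF sqs_invsq] by simp
      then show ?thesis using \<kappa> True by (simp add: \<Psi>_def x)
    next
      case False
      then have k: "k \<ge> 1" by simp
      have "\<bar>J k (g w k) t - J k (g w' k) t\<bar> \<le> real k * G * E t / (\<kappa> * real k ^ 3)"
        by (rule J_diff[OF k g_cont g_cont G1 G2 diff])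
      from mult_left_mono[OF this, of "(real k)\<^sup>2 * inverse (E t)"]
      have "\<bar>(real k)\<^sup>2 * inverse (E t) * (J k (g w k) t - J k (g w' k) t)\<bar> \<le> G / \<kappa>"
        using kk[OF k] by (simp add: abs_mult)
      then show ?thesis using False by (simp add: \<Psi>_def x dist_real_def right_diff_distrib)
    qed
    also have "\<dots> \<le> 1/2 * dist w w'"
    proof -
      \<comment> \<open>The Lipschitz constant 6 \<open>l2norm M * l2norm invsq\<close> of the
        forcing is at most half the gain \<kappa> of the linear part; this gives the contraction
        factor 1/2.\<close>
      have "12 * l2norm M * l2norm invsq * dist w w' \<le> \<kappa> * dist w w'"
        by (intro mult_right_mono \<kappa>) simp
      then show ?thesis using \<kappa>(1) by (simp add: G_def field_simps)
    qed
    finally show "dist (apply_bcontfun (Bcontfun (\<Psi> w)) x) (apply_bcontfun (Bcontfun (\<Psi> w')) x) \<le> 1/2 * dist w w'"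
      by (simp add: Bcontfun_inverse[OF \<Psi>_in])
  qed
  have "\<exists>!w. Bcontfun (\<Psi> w) = w"
    by (rule banach_fix_type[of "1/2" "\<lambda>w. Bcontfun (\<Psi> w)"]) (use \<Psi>_lip in auto)
  then obtain w where "Bcontfun (\<Psi> w) = w" by blast
  then have fp: "apply_bcontfun w (k, t) = (real k)\<^sup>2 * inverse (E t) * J k (g w k) t" if "k \<ge> 1" for k t
  proof -
    have "apply_bcontfun w = \<Psi> w"
      using Bcontfun_inverse[OF \<Psi>_in, of w] unfolding \<open>Bcontfun (\<Psi> w) = w\<close> .
    then show ?thesis using that by (simp add: \<Psi>_def)
  qed
  have "cv w t k = b t k + J k (\<lambda>s. ks_clamp M (cv w s) k) t" if k: "k \<ge> 1" for t k
  proof -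
    have "E t * ((real k)\<^sup>2 * inverse (E t) * J k (g w k) t) * invsq k = J k (g w k) t"
      using k by (simp add: invsq_def exp_minus field_simps)
    then show ?thesis unfolding cv_def[of w t k] fp[OF k] by (simp add: g_def[abs_def])
  qed
  moreover have "cv w t 0 = b t 0" for t by (simp add: cv_def invsq_def)
  ultimately show ?thesis
    by (intro exI[of _ "cv w"] exI[of _ "norm w"] conjI allI impI cvb cv_cont cv_dom)
qed

end

section \<open>Variation of constants for scalar equations, from time 0 and from minus
  infinity\<close>

definition antideriv :: "(real \<Rightarrow> real) \<Rightarrow> real \<Rightarrow> real" where
  "antideriv g = (SOME P. (\<forall>t. (P has_real_derivative g t) (at t)) \<and> P 0 = 0)"

lemma
  assumes "continuous_on UNIV g"
  shows antideriv_deriv: "(antideriv g has_real_derivative g t) (at t)"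
    and antideriv_0: "antideriv g 0 = 0"
proof -
  have "isCont g x" for x using assms by (simp add: continuous_on_eq_continuous_at)
  \<comment> \<open>An antiderivative on the whole line, negative times included; it is normalised
    to vanish at 0 afterwards.\<close>
  then obtain F where F: "\<And>x. (F has_real_derivative g x) (at x)"
    using einterval_antiderivative[of "-\<infinity>" "\<infinity>" g]
    by (auto simp: has_real_derivative_iff_has_vector_derivative)
  have "\<exists>P. (\<forall>t. (P has_real_derivative g t) (at t)) \<and> P 0 = 0"
    by (rule exI[of _ "\<lambda>x. F x - F 0"]) (use DERIV_diff[OF F DERIV_const, of "F 0"] in simp)
  from someI_ex[OF this] show "(antideriv g has_real_derivative g t) (at t)" "antideriv g 0 = 0"
    unfolding antideriv_def by auto
qed

text \<open>With E the primitive of the majorant G exp (c t), both P - E and - P - E are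
  nonincreasing.\<close>

lemma increment_exp_bound:
  fixes P :: "real \<Rightarrow> real"
  assumes "\<And>t. (P has_real_derivative p t) (at t)" "\<And>t. t \<ge> s \<Longrightarrow> \<bar>p t\<bar> \<le> G * exp (c * t)" "0 < c" "s \<le> t"
  shows "\<bar>P t - P s\<bar> \<le> G / c * (exp (c * t) - exp (c * s))"
proof -
  define E where "E t = G / c * exp (c * t)" for t
  have E: "(E has_real_derivative G * exp (c * t)) (at t)" for t
    unfolding E_def[abs_def] using assms(3) by (auto intro!: derivative_eq_intros)
  have 1: "P t - E t \<le> P s - E s"
  proof (rule DERIV_nonpos_imp_nonincreasing[OF assms(4)])
    fix x assume "s \<le> x"
    then have "p x - G * exp (c * x) \<le> 0" using assms(2)[of x] by (simp add: abs_le_iff)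
    then show "\<exists>y. ((\<lambda>t. P t - E t) has_real_derivative y) (at x) \<and> y \<le> 0"
      using DERIV_diff[OF assms(1) E, of x] by blast
  qed
  have 2: "- P t - E t \<le> - P s - E s"
  proof (rule DERIV_nonpos_imp_nonincreasing[OF assms(4)])
    fix x assume "s \<le> x"
    then have "- p x - G * exp (c * x) \<le> 0" using assms(2)[of x] by (simp add: abs_le_iff)
    then show "\<exists>y. ((\<lambda>t. - P t - E t) has_real_derivative y) (at x) \<and> y \<le> 0"
      using DERIV_diff[OF DERIV_minus[OF assms(1)] E, of x] by blast
  qed
  show ?thesis using 1 2 by (simp add: E_def right_diff_distrib abs_le_iff)
qed

text \<open>Variation of constants: the solution of f' = l f + g with f(0) = 0.\<close>

definition duhamel :: "real \<Rightarrow> (real \<Rightarrow> real) \<Rightarrow> real \<Rightarrow> real" where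
  "duhamel l g t = exp (l * t) * antideriv (\<lambda>s. exp (- l * s) * g s) t"

lemma weighted_antideriv:
  assumes "continuous_on UNIV g"
  shows "(antideriv (\<lambda>s. exp (- l * s) * g s) has_real_derivative exp (- l * t) * g t) (at t)"
  by (rule antideriv_deriv) (intro continuous_intros assms)

lemma duhamel_shift_deriv:
  assumes "continuous_on UNIV g"
  shows "((\<lambda>t. exp (l * t) * (antideriv (\<lambda>s. exp (- l * s) * g s) t - C)) has_real_derivative
    l * (exp (l * t) * (antideriv (\<lambda>s. exp (- l * s) * g s) t - C)) + g t) (at t)"
proof -
  have e: "((\<lambda>t. exp (l * t)) has_real_derivative exp (l * t) * l) (at t)"
    by (auto intro!: derivative_eq_intros)
  have "exp (l * t) * (exp (- l * t) * g t) = g t"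
    by (simp add: mult.assoc[symmetric] exp_add[symmetric])
  then show ?thesis
    by (intro DERIV_cong[OF DERIV_mult[OF e DERIV_diff[OF weighted_antideriv[OF assms, of l t] DERIV_const[of C]]]])
      (simp add: mult_ac)
qed

lemma duhamel_deriv:
  "continuous_on UNIV g \<Longrightarrow> (duhamel l g has_real_derivative l * duhamel l g t + g t) (at t)"
  using duhamel_shift_deriv[of g l 0 t] unfolding duhamel_def[abs_def] by simp

lemma duhamel_0: "continuous_on UNIV g \<Longrightarrow> duhamel l g 0 = 0"
  unfolding duhamel_def by (subst antideriv_0) (auto intro!: continuous_intros)

text \<open>The integrating factor turns growth exp (K s) of the forcing into exp ((K - l) s), whose
  primitive gains the factor 1 / (K - l). The lower end s is free: 0 serves the initial value
  problem, and s tending to minus infinity serves the orbit leaving 0.\<close>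

lemma antideriv_diff_increment:
  assumes "continuous_on UNIV g" "continuous_on UNIV h"
    and "\<And>t. t \<ge> s \<Longrightarrow> \<bar>g t - h t\<bar> \<le> G * exp (K * t)" "l < K" "s \<le> t"
  defines "P \<equiv> \<lambda>g. antideriv (\<lambda>s. exp (- l * s) * g s)"
  shows "\<bar>(P g t - P h t) - (P g s - P h s)\<bar> \<le> G / (K - l) * (exp ((K - l) * t) - exp ((K - l) * s))"
proof (rule increment_exp_bound[where p="\<lambda>t. exp (- l * t) * g t - exp (- l * t) * h t"])
  show "((\<lambda>t. P g t - P h t) has_real_derivative exp (- l * t) * g t - exp (- l * t) * h t) (at t)" for t
    unfolding P_def by (intro DERIV_diff weighted_antideriv assms)
  fix t assume t: "s \<le> t"
  have "\<bar>exp (- l * t) * g t - exp (- l * t) * h t\<bar> = exp (- l * t) * \<bar>g t - h t\<bar>"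
    by (simp add: abs_mult flip: right_diff_distrib)
  also have "\<dots> \<le> exp (- l * t) * (G * exp (K * t))" using assms(3)[OF t] by (intro mult_left_mono) auto
  also have "\<dots> = G * exp ((K - l) * t)" by (simp add: exp_add[symmetric] algebra_simps flip: exp_add)
  finally show "\<bar>exp (- l * t) * g t - exp (- l * t) * h t\<bar> \<le> G * exp ((K - l) * t)" .
qed (use assms in auto)

lemma exp_split: "exp (l * t) * exp ((K - l) * t) = exp (K * t)" for l K t :: real
  by (simp add: exp_add[symmetric] algebra_simps)

lemma duhamel_diff_bound:
  assumes "continuous_on UNIV g" "continuous_on UNIV h"
    and "\<And>t. t \<ge> 0 \<Longrightarrow> \<bar>g t - h t\<bar> \<le> G * exp (K * t)" "l < K" "0 \<le> t"
  shows "\<bar>duhamel l g t - duhamel l h t\<bar> \<le> G * exp (K * t) / (K - l)"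
proof -
  define P where "P g = antideriv (\<lambda>s. exp (- l * s) * g s)" for g
  have 0: "P g 0 = 0" if "continuous_on UNIV g" for g
    unfolding P_def by (rule antideriv_0) (intro continuous_intros that)
  have G: "0 \<le> G" using assms(3)[of 0] by simp
  have "\<bar>P g t - P h t\<bar> \<le> G / (K - l) * (exp ((K - l) * t) - exp ((K - l) * 0))"
    using antideriv_diff_increment[OF assms(1,2) assms(3) assms(4,5)] 0[OF assms(1)] 0[OF assms(2)]
    unfolding P_def by simp
  also have "\<dots> \<le> G / (K - l) * exp ((K - l) * t)"
    using G assms by (intro mult_left_mono) auto
  finally have "exp (l * t) * \<bar>P g t - P h t\<bar> \<le> exp (l * t) * (G / (K - l) * exp ((K - l) * t))"
    by (rule mult_left_mono) simp
  also have "\<dots> = G / (K - l) * exp (K * t)" using exp_split[of l t K] by (simp add: mult_ac)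
  finally show ?thesis
    unfolding duhamel_def P_def[symmetric] by (simp add: abs_mult flip: right_diff_distrib)
qed

text \<open>The solution of \<open>f' = l f + g\<close> that decays faster than \<open>exp (l t)\<close> at \<open>-\<infinity>\<close>.\<close>

definition duhamel_left :: "real \<Rightarrow> (real \<Rightarrow> real) \<Rightarrow> real \<Rightarrow> real" where
  "duhamel_left l g t = exp (l * t) *
     (antideriv (\<lambda>s. exp (- l * s) * g s) t - lim (\<lambda>n. antideriv (\<lambda>s. exp (- l * s) * g s) (- real n)))"

lemma duhamel_left_deriv:
  "continuous_on UNIV g \<Longrightarrow> (duhamel_left l g has_real_derivative l * duhamel_left l g t + g t) (at t)"
  using duhamel_shift_deriv unfolding duhamel_left_def[abs_def] by blast

lemma antideriv_zero: "antideriv (\<lambda>s. 0) t = 0"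
proof -
  have "(antideriv (\<lambda>s. 0) has_real_derivative 0) (at x)" for x
    by (rule antideriv_deriv) (rule continuous_on_const)
  then have "antideriv (\<lambda>s. 0) t = antideriv (\<lambda>s. 0) 0" by (intro DERIV_isconst_all) blast
  also have "\<dots> = 0" by (rule antideriv_0) (rule continuous_on_const)
  finally show ?thesis .
qed

text \<open>The improper integral from minus infinity converges because l < K makes its integrand
  exponentially small there: increments to the left of - m are at most \<open>E m\<close>, so the
  values along the integers are Cauchy.\<close>

lemma antideriv_lim:
  assumes "continuous_on UNIV g" "\<And>t. \<bar>g t\<bar> \<le> G * exp (K * t)" "l < K"
  defines "P \<equiv> antideriv (\<lambda>s. exp (- l * s) * g s)"
  shows "(\<lambda>n. P (- real n)) \<longlonglongrightarrow> lim (\<lambda>n. P (- real n))"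
proof -
  define E where "E n = G / (K - l) * exp ((K - l) * - real n)" for n
  have G: "0 \<le> G" using assms(2)[of 0] by simp
  have inc: "\<bar>P (- real m) - P (- real n)\<bar> \<le> E m" if "m \<le> n" for m n
  proof -
    have "\<bar>P (- real m) - P (- real n)\<bar> \<le>
        G / (K - l) * (exp ((K - l) * - real m) - exp ((K - l) * - real n))"
      using antideriv_diff_increment[OF assms(1) continuous_on_const[of UNIV 0], where s="- real n" and t="- real m" and G=G and K=K and l=l]
        assms(2,3) that by (simp add: P_def antideriv_zero)
    also have "\<dots> \<le> E m" unfolding E_def using G assms by (intro mult_left_mono) auto
    finally show ?thesis .
  qed
  have "E \<longlonglongrightarrow> 0"
    unfolding E_def using assms(3) by real_asymp
  then have "Cauchy (\<lambda>n. P (- real n))"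
    unfolding Cauchy_altdef2
  proof (intro allI impI)
    fix e :: real assume "0 < e" "E \<longlonglongrightarrow> 0"
    then obtain N where "\<And>n. n \<ge> N \<Longrightarrow> \<bar>E n\<bar> < e" by (auto simp: LIMSEQ_def dist_real_def)
    then have N: "E N < e" by (metis abs_ge_self le_refl le_less_trans)
    have "dist (P (- real n)) (P (- real N)) < e" if "N \<le> n" for n
      using inc[OF that] N by (simp add: dist_real_def abs_minus_commute)
    then show "\<exists>N. \<forall>n\<ge>N. dist (P (- real n)) (P (- real N)) < e" by blast
  qed
  then have "convergent (\<lambda>n. P (- real n))" by (rule Cauchy_convergent)
  then show ?thesis by (simp add: convergent_LIMSEQ_iff)
qed

lemma duhamel_left_diff_bound:
  assumes "continuous_on UNIV g" "continuous_on UNIV h"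
    and "\<And>t. \<bar>g t\<bar> \<le> G1 * exp (K * t)" "\<And>t. \<bar>h t\<bar> \<le> G2 * exp (K * t)"
    and "\<And>t. \<bar>g t - h t\<bar> \<le> G * exp (K * t)" "l < K"
  shows "\<bar>duhamel_left l g t - duhamel_left l h t\<bar> \<le> G * exp (K * t) / (K - l)"
proof -
  define P where "P g = antideriv (\<lambda>s. exp (- l * s) * g s)" for g
  have G: "0 \<le> G" using assms(5)[of 0] by simp
  have "(\<lambda>n. \<bar>(P g t - P h t) - (P g (- real n) - P h (- real n))\<bar>) \<longlonglongrightarrow>
      \<bar>(P g t - P h t) - (lim (\<lambda>n. P g (- real n)) - lim (\<lambda>n. P h (- real n)))\<bar>"
    unfolding P_def
    by (intro tendsto_intros antideriv_lim[OF assms(1,3,6)] antideriv_lim[OF assms(2,4,6)])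
  moreover have "\<forall>\<^sub>F n in sequentially. \<bar>(P g t - P h t) - (P g (- real n) - P h (- real n))\<bar>
      \<le> G / (K - l) * exp ((K - l) * t)"
    using eventually_ge_at_top[of "nat \<lceil>- t\<rceil>"]
  proof eventually_elim
    case (elim n)
    then have "- real n \<le> t" by linarith
    from antideriv_diff_increment[OF assms(1,2) assms(5) assms(6) this]
    have "\<bar>(P g t - P h t) - (P g (- real n) - P h (- real n))\<bar>
        \<le> G / (K - l) * (exp ((K - l) * t) - exp ((K - l) * - real n))" by (simp add: P_def)
    also have "\<dots> \<le> G / (K - l) * exp ((K - l) * t)"
      using G assms(6) by (intro mult_left_mono) auto
    finally show ?case .
  qed
  ultimately have "\<bar>(P g t - P h t) - (lim (\<lambda>n. P g (- real n)) - lim (\<lambda>n. P h (- real n)))\<bar>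
      \<le> G / (K - l) * exp ((K - l) * t)"
    by (rule tendsto_upperbound) simp
  then have "exp (l * t) * \<bar>(P g t - P h t) - (lim (\<lambda>n. P g (- real n)) - lim (\<lambda>n. P h (- real n)))\<bar>
      \<le> exp (l * t) * (G / (K - l) * exp ((K - l) * t))"
    by (rule mult_left_mono) simp
  also have "\<dots> = G * exp (K * t) / (K - l)" using exp_split[of l t K] by (simp add: mult_ac)
  also have "exp (l * t) * \<bar>(P g t - P h t) - (lim (\<lambda>n. P g (- real n)) - lim (\<lambda>n. P h (- real n)))\<bar>
      = \<bar>duhamel_left l g t - duhamel_left l h t\<bar>"
  proof -
    have "duhamel_left l g t - duhamel_left l h t =
      exp (l * t) * ((P g t - P h t) - (lim (\<lambda>n. P g (- real n)) - lim (\<lambda>n. P h (- real n))))"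
      unfolding duhamel_left_def P_def by (simp add: algebra_simps)
    then show ?thesis by (simp add: abs_mult)
  qed
  finally show ?thesis .
qed

lemma duhamel_left_zero: "duhamel_left l (\<lambda>s. 0) t = 0"
  by (simp add: duhamel_left_def antideriv_zero)

lemma duhamel_zero: "duhamel l (\<lambda>s. 0) t = 0"
  by (simp add: duhamel_def antideriv_zero)

lemma ks_eig_le:
  assumes "3/4 \<le> \<mu>"
  shows "ks_eig \<mu> k \<le> 1" "2 \<le> k \<Longrightarrow> ks_eig \<mu> k \<le> - (real k ^ 4) / 2"
    "ks_eig \<mu> k \<le> (real k)\<^sup>2 - 3/4 * real k ^ 4"
proof -
  have "3/4 * real k ^ 4 \<le> \<mu> * real k ^ 4" using assms by (intro mult_right_mono) auto
  then show 1: "ks_eig \<mu> k \<le> (real k)\<^sup>2 - 3/4 * real k ^ 4"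
    by (simp add: ks_eig_def algebra_simps flip: power_add)
  show 2: "ks_eig \<mu> k \<le> - (real k ^ 4) / 2" if "2 \<le> k"
  proof -
    have "2\<^sup>2 \<le> (real k)\<^sup>2" using that by (intro power_mono) auto
    then have "4 * (real k)\<^sup>2 \<le> (real k)\<^sup>2 * (real k)\<^sup>2" by (intro mult_right_mono) auto
    then show ?thesis using 1 by (simp flip: power_add)
  qed
  show "ks_eig \<mu> k \<le> 1"
  proof (cases "2 \<le> k")
    case True
    have "0 \<le> real k ^ 4" by simp
    then show ?thesis using 2[OF True] by linarith
  next
    case False
    then have "k = 0 \<or> k = 1" by auto
    then show ?thesis using assms by (auto simp: ks_eig_def)
  qed
qed

text \<open>\<kappa> x^3 - x^4 / 2 is bounded above: beyond x = 2 \<kappa> the quartic dissipation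
  wins, and below it \<kappa> x^3 is at most \<kappa> (2 \<kappa>)^3. In the weight exp (K t) every
  mode thus gains \<kappa> k^3 for a \<kappa> as large as desired, so the iteration contracts on an
  unbounded time interval.\<close>

lemma ks_eig_weight_gap:
  assumes "3/4 \<le> \<mu>" "0 \<le> \<kappa>"
  shows "\<exists>K\<ge>2. \<forall>k\<ge>1. \<kappa> * real k ^ 3 \<le> K - ks_eig \<mu> k"
proof (intro exI[of _ "2 + \<kappa> * (2 * \<kappa>) ^ 3"] conjI allI impI)
  show "2 \<le> 2 + \<kappa> * (2 * \<kappa>) ^ 3" using assms by simp
  fix k :: nat assume "1 \<le> k"
  show "\<kappa> * real k ^ 3 \<le> 2 + \<kappa> * (2 * \<kappa>) ^ 3 - ks_eig \<mu> k"
  proof (cases "2 * \<kappa> \<le> real k \<and> 2 \<le> k")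
    case True
    then have "\<kappa> * real k ^ 3 \<le> (real k / 2) * real k ^ 3" by (intro mult_right_mono) auto
    also have "\<dots> = real k ^ 4 / 2" by (simp add: power3_eq_cube power4_eq_xxxx)
    also have "\<dots> \<le> - ks_eig \<mu> k" using ks_eig_le(2)[OF assms(1), of k] True by simp
    finally show ?thesis using assms(2) by (smt (verit) mult_nonneg_nonneg zero_le_power)
  next
    case False
    show ?thesis
    proof (cases "2 \<le> k")
      case True
      then have "real k ^ 3 \<le> (2 * \<kappa>) ^ 3" using False by (intro power_mono) auto
      then have "\<kappa> * real k ^ 3 \<le> \<kappa> * (2 * \<kappa>) ^ 3" using assms by (intro mult_left_mono) auto
      then show ?thesis using ks_eig_le(1)[OF assms(1), of k] by simp
    next
      case False
      then have k: "k = 1" using \<open>1 \<le> k\<close> by simp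
      have "\<kappa> \<le> 1 + \<kappa> * (2 * \<kappa>) ^ 3"
      proof (cases "\<kappa> \<le> 1")
        case False
        then have "1 \<le> (2 * \<kappa>) ^ 3" by (intro one_le_power) auto
        then have "\<kappa> * 1 \<le> \<kappa> * (2 * \<kappa>) ^ 3" using assms by (intro mult_left_mono) auto
        then show ?thesis by simp
      next
        case True
        have "0 \<le> \<kappa> * (2 * \<kappa>) ^ 3" using assms by simp
        then show ?thesis using True by linarith
      qed
      then show ?thesis using ks_eig_le(1)[OF assms(1), of k] k by simp
    qed
  qed
qed

lemma l2norm_invsq_ge_1: "1 \<le> l2norm invsq"
  using abs_le_l2norm[OF sqs_invsq, of 1] by (simp add: invsq_def)

lemma dominated_curve_continuous:
  fixes a :: "real \<Rightarrow> nat \<Rightarrow> real"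
  assumes "\<And>k. continuous_on UNIV (\<lambda>t. a t k)"
    and dom: "\<And>T. \<exists>D. sqs D \<and> (\<forall>t. \<bar>t\<bar> \<le> T \<longrightarrow> (\<forall>k. \<bar>a t k\<bar> \<le> D k))"
  shows "((\<lambda>s. l2norm (\<lambda>k. a s k - a t k)) \<longlongrightarrow> 0) (at t)" "sqs (a t)"
proof -
  obtain D where D: "sqs D" "\<And>s k. \<bar>s\<bar> \<le> \<bar>t\<bar> + 1 \<Longrightarrow> \<bar>a s k\<bar> \<le> D k" using dom by meson
  have ev: "\<forall>\<^sub>F s in at t. \<bar>s\<bar> \<le> \<bar>t\<bar> + 1"
    unfolding eventually_at by (rule exI[of _ 1]) (auto simp: dist_real_def)
  show "((\<lambda>s. l2norm (\<lambda>k. a s k - a t k)) \<longlongrightarrow> 0) (at t)"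
  proof (rule dominated_l2_tendsto[OF _ _ D(1)])
    show "((\<lambda>s. a s k) \<longlongrightarrow> a t k) (at t)" for k
      using assms(1)[of k] by (simp add: continuous_on_def)
    show "\<forall>\<^sub>F s in at t. \<forall>k. \<bar>a s k\<bar> \<le> D k" using ev by eventually_elim (use D in auto)
  qed (use D in auto)
  show "sqs (a t)"
    by (rule sqs_mono[OF D(1) order_trans[OF D(2) abs_ge_self]]) simp
qed

text \<open>The clamped equation is solved for all times; while the norm is at most R the damped
  modes stay below the clamp, so the curve is a true solution. Membership and norm continuity hold
  for all times, which lets continuity arguments run before solvability is known.\<close>

lemma forward_curve:
  assumes \<mu>: "3/4 \<le> \<mu>" and a0: "a0 \<in> ell2" and R: "0 \<le> R"
  obtains a where "a 0 = a0" "\<And>t. a t \<in> ell2"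
    "\<And>t. ((\<lambda>s. l2norm (\<lambda>k. a s k - a t k)) \<longlongrightarrow> 0) (at t)"
    "\<And>T. (\<And>t. 0 \<le> t \<Longrightarrow> t \<le> T \<Longrightarrow> l2norm (a t) \<le> R) \<Longrightarrow> ks_solution_on \<mu> {0..T} a"
proof -
  have s0: "sqs a0" "a0 0 = 0" using a0 by (auto simp: ell2_sqs ell2_def)
  \<comment> \<open>What each mode obeys while the norm is at most R: the first mode is at most R;
    for k \<ge> 2 the initial value is joined by forcing over damping, 3 k R^2 / (k^4 / 2) = 6 R^2 /
    k^3. The initial state enters as it is, since no decay of it is known.\<close>
  define M where "M k = \<bar>a0 k\<bar> + (R + 6 * R\<^sup>2) * invsq k" for k
  have M0: "0 \<le> M k" for k using R by (simp add: M_def)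
  have sM: "sqs M" unfolding M_def[abs_def]
    by (intro sqs_add sqs_cmult sqs_invsq sqs_mono[OF s0(1)]) auto
  define \<kappa> where "\<kappa> = 12 * l2norm M * l2norm invsq + 1"
  have \<kappa>: "0 < \<kappa>" using l2norm_nonneg[OF sM] l2norm_nonneg[OF sqs_invsq] by (simp add: \<kappa>_def add_nonneg_pos)
  obtain K where K: "2 \<le> K" "\<And>k. k \<ge> 1 \<Longrightarrow> \<kappa> * real k ^ 3 \<le> K - ks_eig \<mu> k"
    using ks_eig_weight_gap[OF \<mu>, of \<kappa>] \<kappa> by auto
  have eK: "ks_eig \<mu> k < K" for k using ks_eig_le(1)[OF \<mu>, of k] K by linarith
  \<comment> \<open>With \<open>max t 0\<close> everything is frozen at negative times, so the fixed
    point lemma on the whole line applies to an initial value problem.\<close>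
  define E where "E t = exp (K * max t 0)" for t
  define J where "J k g t = duhamel (ks_eig \<mu> k) g (max t 0)" for k g t
  define b where "b t k = exp (ks_eig \<mu> k * max t 0) * a0 k" for t k
  have duh_cont: "continuous_on UNIV (duhamel l g)" if "continuous_on UNIV g" for l g
    using duhamel_deriv[OF that] by (intro DERIV_continuous_on) (auto intro: has_field_derivative_at_within)
  have "\<exists>a C. (\<forall>t k. k \<ge> 1 \<longrightarrow> a t k = b t k + J k (\<lambda>s. ks_clamp M (a s) k) t) \<and>
    (\<forall>t k. \<bar>a t k - b t k\<bar> \<le> C * E t * invsq k) \<and> (\<forall>t. a t 0 = b t 0) \<and>
    (\<forall>k. continuous_on UNIV (\<lambda>t. a t k)) \<and>
    (\<forall>T. \<exists>D. sqs D \<and> (\<forall>t. \<bar>t\<bar> \<le> T \<longrightarrow> (\<forall>k. \<bar>a t k\<bar> \<le> D k)))"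
  proof (rule mild_fixed_point[OF M0 sM, where \<kappa>=\<kappa>])
    show "continuous_on UNIV (J k g)" if "continuous_on UNIV g" for k g
      unfolding J_def[abs_def] by (rule continuous_on_compose2[OF duh_cont[OF that]]) (auto intro!: continuous_intros)
    show "\<bar>J k g t - J k h t\<bar> \<le> G * E t / (\<kappa> * real k ^ 3)"
      if k: "k \<ge> 1" and g: "continuous_on UNIV g" "continuous_on UNIV h"
        and d: "\<And>s. \<bar>g s - h s\<bar> \<le> G * E s" for k g h G t
    proof -
      have "0 \<le> G * E 0" using d[of 0] by linarith
      then have G: "0 \<le> G" by (simp add: E_def)
      have "\<bar>J k g t - J k h t\<bar> \<le> G * exp (K * max t 0) / (K - ks_eig \<mu> k)"
        unfolding J_def
      proof (rule duhamel_diff_bound[OF g _ eK])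
        show "\<bar>g t - h t\<bar> \<le> G * exp (K * t)" if "0 \<le> t" for t
          using d[of t] that by (simp add: E_def max_def)
      qed simp
      also have "\<dots> \<le> G * E t / (\<kappa> * real k ^ 3)"
        unfolding E_def using K(2)[OF k] G \<kappa> k eK[of k] by (intro divide_left_mono mult_nonneg_nonneg mult_pos_pos) auto
      finally show ?thesis .
    qed
    show "J k (\<lambda>s. 0) t = 0" for k t by (simp add: J_def duhamel_zero)
    show "continuous_on UNIV (\<lambda>t. b t k)" for k unfolding b_def by (intro continuous_intros)
    show "\<exists>D. sqs D \<and> (\<forall>t. \<bar>t\<bar> \<le> T \<longrightarrow> (\<forall>k. \<bar>b t k\<bar> \<le> D k))" for T
    proof (intro exI[of _ "\<lambda>k. \<bar>exp \<bar>T\<bar> * a0 k\<bar>"] conjI allI impI)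
      show "sqs (\<lambda>k. \<bar>exp \<bar>T\<bar> * a0 k\<bar>)" by (rule sqs_mono[OF sqs_cmult[OF s0(1), of "exp \<bar>T\<bar>"]]) simp
      fix t k assume t: "\<bar>t\<bar> \<le> T"
      have "ks_eig \<mu> k * max t 0 \<le> 1 * max t 0" using ks_eig_le(1)[OF \<mu>] by (intro mult_right_mono) auto
      then have "exp (ks_eig \<mu> k * max t 0) \<le> exp \<bar>T\<bar>" using t by simp
      then show "\<bar>b t k\<bar> \<le> \<bar>exp \<bar>T\<bar> * a0 k\<bar>" by (simp add: b_def abs_mult mult_right_mono)
    qed
    show "\<exists>G\<ge>0. \<forall>a s. (\<forall>k. \<bar>a k - b s k\<bar> \<le> B * E s * invsq k) \<longrightarrow>
      (\<forall>k. \<bar>ks_clamp M a k\<bar> \<le> real k * G * E s)" for B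
    proof (intro exI[of _ "3 * (l2norm M)\<^sup>2"] conjI allI impI)
      fix a :: "nat \<Rightarrow> real" and s k
      have "1 \<le> E s" using K by (simp add: E_def)
      then have "3 * real k * (l2norm M)\<^sup>2 * 1 \<le> 3 * real k * (l2norm M)\<^sup>2 * E s" by (intro mult_left_mono) auto
      then show "\<bar>ks_clamp M a k\<bar> \<le> real k * (3 * (l2norm M)\<^sup>2) * E s"
        using ks_clamp_bound[OF M0 sM, of a k] by (simp add: mult_ac)
    qed simp
    show "0 < E t" for t by (simp add: E_def)
    show "continuous_on UNIV E" unfolding E_def[abs_def] by (intro continuous_intros)
    show "mono E" unfolding E_def[abs_def] mono_def using K by (auto intro!: mult_left_mono)
  qed (use \<kappa> in \<open>auto simp: \<kappa>_def\<close>)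
  then obtain a where a: "\<And>t k. k \<ge> 1 \<Longrightarrow> a t k = b t k + J k (\<lambda>s. ks_clamp M (a s) k) t"
    "\<And>t. a t 0 = b t 0" "\<And>k. continuous_on UNIV (\<lambda>t. a t k)"
    "\<And>T. \<exists>D. sqs D \<and> (\<forall>t. \<bar>t\<bar> \<le> T \<longrightarrow> (\<forall>k. \<bar>a t k\<bar> \<le> D k))" by metis
  define F where "F k t = ks_clamp M (a t) k" for k t
  have F_cont: "continuous_on UNIV (F k)" for k
    unfolding F_def[abs_def] by (rule ks_clamp_continuous[OF M0 sM a(3,4)])
  \<comment> \<open>\<open>A k\<close> agrees with mode k for t \<ge> 0 but is differentiable on the
    whole line, so the one-sided derivative at 0 is a restriction of a two-sided one.\<close>
  define A where "A k t = exp (ks_eig \<mu> k * t) * a0 k + duhamel (ks_eig \<mu> k) (F k) t" for k t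
  have aA: "a t k = A k t" if "0 \<le> t" "1 \<le> k" for t k
    using a(1)[OF that(2), of t] that by (simp add: A_def b_def J_def F_def[abs_def] max_def)
  have A_deriv: "(A k has_real_derivative ks_eig \<mu> k * A k t + F k t) (at t)" for k t
    unfolding A_def[abs_def] using duhamel_deriv[OF F_cont, of "ks_eig \<mu> k" k t]
    by (auto intro!: derivative_eq_intros simp: algebra_simps)
  have A_cont: "continuous_on S (A k)" for k S
    using A_deriv by (intro DERIV_continuous_on) (auto intro: has_field_derivative_at_within)
  note cont = dominated_curve_continuous[OF a(3,4)]
  have ell: "a t \<in> ell2" for t
    using cont(2)[of t] a(2)[of t] s0 by (simp add: ell2_def sqs_def b_def)
  show thesis
  proof (rule that[of a])
    show "a 0 = a0"
    proof
      fix k show "a 0 k = a0 k"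
      proof (cases "1 \<le> k")
        case True then show ?thesis using aA[of 0 k] duhamel_0[OF F_cont] by (simp add: A_def)
      next
        case False
        then have "k = 0" by simp
        then show ?thesis using a(2)[of 0] s0 by (simp add: b_def)
      qed
    qed
    show "ks_solution_on \<mu> {0..T} a" if bd: "\<And>t. 0 \<le> t \<Longrightarrow> t \<le> T \<Longrightarrow> l2norm (a t) \<le> R" for T
    proof -
      have inactive: "clamped M (a t) = a t" if t: "0 \<le> t" "t \<le> T" for t
      proof (rule clamped_id)
        fix k :: nat
        consider "k = 0" | "k = 1" | "2 \<le> k" by linarith
        then show "\<bar>a t k\<bar> \<le> M k"
        proof cases
          case 1 then show ?thesis using a(2)[of t] s0 M0[of k] by (simp add: b_def)
        next
          case 2
          have "0 \<le> 6 * R\<^sup>2" "0 \<le> \<bar>a0 1\<bar>" by auto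
          moreover have "\<bar>a t 1\<bar> \<le> R" using abs_le_l2norm[OF cont(2), of t 1] bd[OF t] by simp
          ultimately have "\<bar>a t 1\<bar> \<le> \<bar>a0 1\<bar> + (R + 6 * R\<^sup>2)" by linarith
          then show ?thesis using 2 by (simp add: M_def invsq_def)
        next
          case 3
          let ?L = "- ks_eig \<mu> k"
          have L: "real k ^ 4 / 2 \<le> ?L" using ks_eig_le(2)[OF \<mu> 3] by simp
          have L0: "0 < real k ^ 4 / 2" using 3 by simp
          then have Lp: "0 < ?L" using L by linarith
          have "\<bar>A k t\<bar> \<le> exp (- ?L * (t - 0)) * \<bar>A k 0\<bar> + 3 * real k * R\<^sup>2 / ?L"
          proof (rule forced_decay_abs[OF t(1) A_cont, where g="F k"])
            fix r assume r: "0 < r" "r < t"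
            have "(l2norm (a r))\<^sup>2 \<le> R\<^sup>2" using bd[of r] r t l2norm_nonneg[OF cont(2)] by (intro power_mono) auto
            then have "3 * real k * (l2norm (a r))\<^sup>2 \<le> 3 * real k * R\<^sup>2" by (intro mult_left_mono) auto
            then show "(A k has_real_derivative - ?L * A k r + F k r) (at r) \<and> \<bar>F k r\<bar> \<le> 3 * real k * R\<^sup>2"
              using A_deriv[of k r] ks_clamp_bound_l2norm[OF M0 sM cont(2), of r k] by (simp add: F_def)
          qed (use Lp in auto)
          also have "exp (- ?L * (t - 0)) * \<bar>A k 0\<bar> \<le> 1 * \<bar>A k 0\<bar>"
            using Lp t by (intro mult_right_mono) (auto simp: mult_nonpos_nonneg)
          also have "3 * real k * R\<^sup>2 / ?L \<le> 3 * real k * R\<^sup>2 / (real k ^ 4 / 2)"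
            using L L0 Lp by (intro divide_left_mono mult_pos_pos) auto
          also have "3 * real k * R\<^sup>2 / (real k ^ 4 / 2) = 6 * R\<^sup>2 * invsq k * (1 / real k)"
            using 3 by (simp add: invsq_def field_simps power2_eq_square power4_eq_xxxx)
          also have "\<dots> \<le> 6 * R\<^sup>2 * invsq k * 1" using 3 by (intro mult_left_mono) auto
          also have "1 * \<bar>A k 0\<bar> + 6 * R\<^sup>2 * invsq k * 1 \<le> M k"
            using R duhamel_0[OF F_cont] by (simp add: M_def A_def algebra_simps)
          finally show ?thesis using aA[OF t(1), of k] 3 by simp
        qed
      qed
      show ?thesis
        unfolding ks_solution_on_def
      proof (intro conjI ballI allI impI)
        fix t assume t: "t \<in> {0..T}"
        show "a t \<in> ell2" by (rule ell)
        show "((\<lambda>s. ell2_dist (a s) (a t)) \<longlongrightarrow> 0) (at t within {0..T})"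
          unfolding ell2_dist_l2norm by (rule tendsto_within_subset[OF cont(1)]) simp
        fix k :: nat assume k: "1 \<le> k"
        have "(A k has_real_derivative ks_field \<mu> (a t) k) (at t within {0..T})"
          using A_deriv[of k t] inactive[of t] aA[OF _ k, of t] t
          by (simp add: ks_field_eq[OF cont(2)] F_def ks_clamp_def has_field_derivative_at_within)
        then show "((\<lambda>s. a s k) has_real_derivative ks_field \<mu> (a t) k) (at t within {0..T})"
          by (rule has_field_derivative_transform_within[OF _ zero_less_one t]) (use aA k in auto)
      qed
    qed
  qed (rule ell, rule cont(1))
qed

text \<open>Lyapunov-Perron: exp ((1 - \<mu>) t) in the first mode plus a correction of order exp (2
  (1 - \<mu>) t), the size of the quadratic term. In that weight the integral from minus infinity
  converges for every mode, since all eigenvalues lie below 2 (1 - \<mu>).\<close>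

lemma unstable_orbit:
  assumes \<mu>: "3/4 \<le> \<mu>" "\<mu> < 1"
  obtains a t0 C where "ks_solution_on \<mu> {..t0} a"
    "\<And>t k. t \<le> t0 \<Longrightarrow> \<bar>a t k - (if k = 1 then exp ((1 - \<mu>) * t) else 0)\<bar> \<le> C * exp (2 * (1 - \<mu>) * t) * invsq k"
proof -
  define l where "l = 1 - \<mu>"
  have l: "0 < l" "l \<le> 1/4" using \<mu> by (auto simp: l_def)
  define Z where "Z = l2norm invsq"
  have Z: "1 \<le> Z" using l2norm_invsq_ge_1 by (simp add: Z_def)
  \<comment> \<open>Chosen so that 12 \<open>l2norm M * l2norm invsq\<close> equals l, the gain
    \<kappa> used below.\<close>
  define \<epsilon> where "\<epsilon> = l / (12 * Z\<^sup>2)"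
  have \<epsilon>: "0 < \<epsilon>" using l Z by (simp add: \<epsilon>_def)
  define M where "M k = \<epsilon> * invsq k" for k
  have M0: "0 \<le> M k" for k using \<epsilon> by (simp add: M_def)
  have sM: "sqs M" unfolding M_def[abs_def] by (intro sqs_cmult sqs_invsq)
  have nM: "l2norm M = \<epsilon> * Z" unfolding M_def[abs_def] Z_def using \<epsilon> by (simp add: l2norm_cmult[OF sqs_invsq])
  define E where "E t = exp (2 * l * t)" for t
  \<comment> \<open>Equality for k = 1; for k \<ge> 2 the dissipation k^4 / 2 suffices because l
    \<le> 1/4.\<close>
  have gap: "l * real k ^ 3 \<le> 2 * l - ks_eig \<mu> k" if k: "1 \<le> k" for k
  proof (cases "k = 1")
    case True then show ?thesis by (simp add: ks_eig_def l_def)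
  next
    case False
    then have k2: "2 \<le> k" using k by simp
    have "l * real k ^ 3 \<le> (real k / 2) * real k ^ 3" using l k2 by (intro mult_right_mono) auto
    also have "\<dots> = real k ^ 4 / 2" by (simp add: power3_eq_cube power4_eq_xxxx)
    finally show ?thesis using ks_eig_le(2)[OF \<mu>(1) k2] l by simp
  qed
  have eK: "ks_eig \<mu> k < 2 * l" if "1 \<le> k" for k
  proof -
    have "0 < l * real k ^ 3" using l that by simp
    then show ?thesis using gap[OF that] by linarith
  qed
  define b where "b t k = (if k = 1 then exp (l * t) else 0)" for t and k :: nat
  have b_le: "\<bar>b t k\<bar> \<le> exp (l * t) * invsq k" for t k by (simp add: b_def invsq_def)
  define J where "J k g t = duhamel_left (ks_eig \<mu> k) g t" for k g t
  have "\<exists>a C. (\<forall>t k. k \<ge> 1 \<longrightarrow> a t k = b t k + J k (\<lambda>s. ks_clamp M (a s) k) t) \<and>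
    (\<forall>t k. \<bar>a t k - b t k\<bar> \<le> C * E t * invsq k) \<and> (\<forall>t. a t 0 = b t 0) \<and>
    (\<forall>k. continuous_on UNIV (\<lambda>t. a t k)) \<and>
    (\<forall>T. \<exists>D. sqs D \<and> (\<forall>t. \<bar>t\<bar> \<le> T \<longrightarrow> (\<forall>k. \<bar>a t k\<bar> \<le> D k)))"
  proof (rule mild_fixed_point[OF M0 sM, where \<kappa>=l])
    show "continuous_on UNIV (J k g)" if "continuous_on UNIV g" for k g
      unfolding J_def[abs_def] using duhamel_left_deriv[OF that]
      by (intro DERIV_continuous_on) (auto intro: has_field_derivative_at_within)
    show "\<bar>J k g t - J k h t\<bar> \<le> G * E t / (l * real k ^ 3)"
      if k: "k \<ge> 1" and g: "continuous_on UNIV g" "continuous_on UNIV h"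
        and bd: "\<And>s. \<bar>g s\<bar> \<le> G1 * E s" "\<And>s. \<bar>h s\<bar> \<le> G2 * E s"
        and d: "\<And>s. \<bar>g s - h s\<bar> \<le> G * E s" for k g h G G1 G2 t
    proof -
      have "0 \<le> G * E 0" using d[of 0] by linarith
      then have G: "0 \<le> G" by (simp add: E_def)
      have "\<bar>J k g t - J k h t\<bar> \<le> G * exp (2 * l * t) / (2 * l - ks_eig \<mu> k)"
        unfolding J_def by (rule duhamel_left_diff_bound[OF g _ _ _ eK[OF k]]) (use bd d in \<open>auto simp: E_def\<close>)
      also have "\<dots> \<le> G * E t / (l * real k ^ 3)"
        unfolding E_def using gap[OF k] G l k eK[OF k] by (intro divide_left_mono mult_nonneg_nonneg mult_pos_pos) auto
      finally show ?thesis .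
    qed
    show "J k (\<lambda>s. 0) t = 0" for k t by (simp add: J_def duhamel_left_zero)
    show "continuous_on UNIV (\<lambda>t. b t k)" for k
      unfolding b_def by (cases "k = 1") (auto intro!: continuous_intros)
    show "\<exists>D. sqs D \<and> (\<forall>t. \<bar>t\<bar> \<le> T \<longrightarrow> (\<forall>k. \<bar>b t k\<bar> \<le> D k))" for T
    proof (intro exI[of _ "\<lambda>k. exp (l * T) * invsq k"] conjI allI impI)
      show "sqs (\<lambda>k. exp (l * T) * invsq k)" by (intro sqs_cmult sqs_invsq)
      fix t k assume t: "\<bar>t\<bar> \<le> T"
      have "exp (l * t) * invsq k \<le> exp (l * T) * invsq k" using t l by (intro mult_right_mono) auto
      then show "\<bar>b t k\<bar> \<le> exp (l * T) * invsq k" using b_le[of t k] by linarith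
    qed
    show "\<exists>G\<ge>0. \<forall>a s. (\<forall>k. \<bar>a k - b s k\<bar> \<le> B * E s * invsq k) \<longrightarrow>
      (\<forall>k. \<bar>ks_clamp M a k\<bar> \<le> real k * G * E s)" for B
    \<comment> \<open>The two summands serve the two signs of s: for s \<ge> 0 the bound by the
      clamp is enough, as E s \<ge> 1; for s < 0 the quadratic bound gives (exp (l s))^2 = E
      s.\<close>
    proof (intro exI[of _ "3 * (l2norm M)\<^sup>2 + 3 * ((1 + \<bar>B\<bar>) * Z)\<^sup>2"] conjI allI impI)
      fix a :: "nat \<Rightarrow> real" and s k
      assume d: "\<forall>k. \<bar>a k - b s k\<bar> \<le> B * E s * invsq k"
      show "\<bar>ks_clamp M a k\<bar> \<le> real k * (3 * (l2norm M)\<^sup>2 + 3 * ((1 + \<bar>B\<bar>) * Z)\<^sup>2) * E s"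
      proof (cases "0 \<le> s")
        case True
        then have "1 \<le> E s" using l by (simp add: E_def)
        then have "3 * real k * (l2norm M)\<^sup>2 * 1 \<le> 3 * real k * (l2norm M)\<^sup>2 * E s" by (intro mult_left_mono) auto
        moreover have "0 \<le> real k * (3 * ((1 + \<bar>B\<bar>) * Z)\<^sup>2) * E s" by (simp add: E_def)
        ultimately show ?thesis
          using ks_clamp_bound[OF M0 sM, of a k] by (simp add: algebra_simps)
      next
        case False
        have es: "E s \<le> exp (l * s)" using False l by (simp add: E_def mult_le_cancel_right)
        have "\<bar>a k\<bar> \<le> (1 + \<bar>B\<bar>) * exp (l * s) * invsq k" for k
        proof -
          have "B * E s * invsq k \<le> \<bar>B\<bar> * E s * invsq k" by (intro mult_right_mono) (auto simp: E_def)
          also have "\<dots> \<le> \<bar>B\<bar> * exp (l * s) * invsq k" by (intro mult_right_mono mult_left_mono es) auto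
          finally have "\<bar>a k - b s k\<bar> \<le> \<bar>B\<bar> * exp (l * s) * invsq k" using d by (meson order_trans)
          then show ?thesis using b_le[of s k] by (simp add: algebra_simps)
        qed
        note a = sqs_invsq_bound[OF this]
        have "(l2norm a)\<^sup>2 \<le> ((1 + \<bar>B\<bar>) * exp (l * s) * Z)\<^sup>2"
          using a l2norm_nonneg[of a] by (intro power_mono) (auto simp: Z_def)
        also have "\<dots> = ((1 + \<bar>B\<bar>) * Z)\<^sup>2 * E s"
          by (simp add: power_mult_distrib E_def power2_eq_square flip: exp_add)
        finally have "3 * real k * (l2norm a)\<^sup>2 \<le> 3 * real k * (((1 + \<bar>B\<bar>) * Z)\<^sup>2 * E s)"
          by (intro mult_left_mono) auto
        moreover have "0 \<le> real k * (3 * (l2norm M)\<^sup>2) * E s" by (simp add: E_def)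
        ultimately show ?thesis
          using ks_clamp_bound_l2norm[OF M0 sM, of a k] a by (simp add: algebra_simps)
      qed
    qed simp
    have "12 * (\<epsilon> * Z) * Z = l" using Z by (simp add: \<epsilon>_def power2_eq_square)
    then show "12 * l2norm M * l2norm invsq \<le> l" by (simp add: nM Z_def)
    show "0 < E t" for t by (simp add: E_def)
    show "continuous_on UNIV E" unfolding E_def[abs_def] by (intro continuous_intros)
    show "mono E" unfolding E_def[abs_def] mono_def using l by (auto intro!: mult_left_mono)
  qed (use l in auto)
  then obtain a C where a: "\<And>t k. k \<ge> 1 \<Longrightarrow> a t k = b t k + J k (\<lambda>s. ks_clamp M (a s) k) t"
    "\<And>t k. \<bar>a t k - b t k\<bar> \<le> C * E t * invsq k"
    "\<And>t. a t 0 = b t 0" "\<And>k. continuous_on UNIV (\<lambda>t. a t k)"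
    "\<And>T. \<exists>D. sqs D \<and> (\<forall>t. \<bar>t\<bar> \<le> T \<longrightarrow> (\<forall>k. \<bar>a t k\<bar> \<le> D k))" by metis
  define F where "F k t = ks_clamp M (a t) k" for k t
  have F_cont: "continuous_on UNIV (F k)" for k
    unfolding F_def[abs_def] by (rule ks_clamp_continuous[OF M0 sM a(4,5)])
  note cont = dominated_curve_continuous[OF a(4,5)]
  have ell: "a t \<in> ell2" for t
    using cont(2)[of t] a(3)[of t] by (simp add: ell2_def sqs_def b_def)
  have deriv: "((\<lambda>s. a s k) has_real_derivative ks_eig \<mu> k * a t k + F k t) (at t)" if k: "1 \<le> k" for k t
  proof -
    have "((\<lambda>s. b s k) has_real_derivative ks_eig \<mu> k * b t k) (at t)"
      by (cases "k = 1") (auto simp: b_def ks_eig_def l_def intro!: derivative_eq_intros)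
    from DERIV_add[OF this duhamel_left_deriv[OF F_cont, of "ks_eig \<mu> k" k t]]
    show ?thesis using a(1)[OF k] unfolding J_def F_def[abs_def] by (simp add: algebra_simps)
  qed
  \<comment> \<open>Early enough, leading term and correction together lie below the clamp
    \<open>M\<close>, so the clamped equation is the true one there.\<close>
  have "((\<lambda>t. exp (l * t) + \<bar>C\<bar> * exp (2 * l * t)) \<longlongrightarrow> 0) at_bot"
    using l by real_asymp
  then have "\<forall>\<^sub>F t in at_bot. exp (l * t) + \<bar>C\<bar> * exp (2 * l * t) < \<epsilon>"
    using \<epsilon> by (rule order_tendstoD)
  then obtain t0 where t0: "\<And>t. t \<le> t0 \<Longrightarrow> exp (l * t) + \<bar>C\<bar> * exp (2 * l * t) < \<epsilon>"
    by (auto simp: eventually_at_bot_linorder)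
  have inactive: "clamped M (a t) = a t" if t: "t \<le> t0" for t
  proof (rule clamped_id)
    fix k
    have "C * E t * invsq k \<le> \<bar>C\<bar> * E t * invsq k" by (intro mult_right_mono) (auto simp: E_def)
    then have "\<bar>a t k\<bar> \<le> (exp (l * t) + \<bar>C\<bar> * E t) * invsq k"
      using a(2)[of t k] b_le[of t k] by (simp add: algebra_simps)
    also have "\<dots> \<le> \<epsilon> * invsq k" using t0[OF t] by (intro mult_right_mono) (auto simp: E_def)
    finally show "\<bar>a t k\<bar> \<le> M k" by (simp add: M_def)
  qed
  show thesis
  proof (rule that[of t0 a C])
    show "ks_solution_on \<mu> {..t0} a"
      unfolding ks_solution_on_def
    proof (intro conjI ballI allI impI)
      fix t assume t: "t \<in> {..t0}"
      show "a t \<in> ell2" by (rule ell)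
      show "((\<lambda>s. ell2_dist (a s) (a t)) \<longlongrightarrow> 0) (at t within {..t0})"
        unfolding ell2_dist_l2norm by (rule tendsto_within_subset[OF cont(1)]) simp
      fix k :: nat assume k: "1 \<le> k"
      show "((\<lambda>s. a s k) has_real_derivative ks_field \<mu> (a t) k) (at t within {..t0})"
        using deriv[OF k, of t] inactive[of t] t
        by (simp add: ks_field_eq[OF cont(2)] F_def ks_clamp_def has_field_derivative_at_within)
    qed
    show "\<bar>a t k - (if k = 1 then exp ((1 - \<mu>) * t) else 0)\<bar> \<le> C * exp (2 * (1 - \<mu>) * t) * invsq k" for t k
      using a(2)[of t k] unfolding b_def E_def l_def .
  qed
qed

section \<open>Contraction estimate for the difference of two solutions\<close>

lemma ks_solutionD:
  assumes "ks_solution_on \<mu> I a" "t \<in> I"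
  shows "sqs (a t)" "a t 0 = 0" "((\<lambda>s. l2norm (\<lambda>k. a s k - a t k)) \<longlongrightarrow> 0) (at t within I)"
    "k \<ge> 1 \<Longrightarrow> ((\<lambda>s. a s k) has_real_derivative ks_eig \<mu> k * a t k + ks_bil (a t) (a t) k) (at t within I)"
proof -
  have "a t \<in> ell2" using assms unfolding ks_solution_on_def by blast
  then show s: "sqs (a t)" and "a t 0 = 0" by (simp_all add: ell2_def sqs_def)
  show "((\<lambda>s. l2norm (\<lambda>k. a s k - a t k)) \<longlongrightarrow> 0) (at t within I)"
    using assms unfolding ks_solution_on_def ell2_dist_l2norm by blast
  show "((\<lambda>s. a s k) has_real_derivative ks_eig \<mu> k * a t k + ks_bil (a t) (a t) k) (at t within I)" if "k \<ge> 1"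
    using assms that unfolding ks_solution_on_def ks_field_eq[OF s, symmetric] by blast
qed

lemma ks_solution_on_subset:
  assumes "ks_solution_on \<mu> I a" "J \<subseteq> I"
  shows "ks_solution_on \<mu> J a"
  unfolding ks_solution_on_def
proof (intro conjI ballI allI impI)
  fix t assume "t \<in> J"
  then have t: "t \<in> I" using assms(2) by auto
  show "a t \<in> ell2" "((\<lambda>s. ell2_dist (a s) (a t)) \<longlongrightarrow> 0) (at t within J)"
    using assms(1) t tendsto_within_subset[OF _ assms(2)] unfolding ks_solution_on_def by blast+
  show "((\<lambda>s. a s k) has_real_derivative ks_field \<mu> (a t) k) (at t within J)" if "1 \<le> k" for k
    using assms(1) t that DERIV_subset[OF _ assms(2)] unfolding ks_solution_on_def by blast
qed

lemma ks_solution_continuous: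
  assumes "ks_solution_on \<mu> I a"
  shows "continuous_on I (\<lambda>t. l2norm (a t))" "continuous_on I (\<lambda>t. a t k)"
    "ks_solution_on \<mu> I b \<Longrightarrow> continuous_on I (\<lambda>t. l2norm (\<lambda>k. a t k - b t k))"
proof -
  have ev: "\<forall>\<^sub>F s in at t within I. sqs (a s)" if "ks_solution_on \<mu> I a" for t a
    using ks_solutionD(1)[OF that] unfolding eventually_at_filter by auto
  show "continuous_on I (\<lambda>t. l2norm (a t))"
    unfolding continuous_on_def
    using l2norm_tendsto[OF ev[OF assms] ks_solutionD(1)[OF assms] ks_solutionD(3)[OF assms]] by blast
  show "continuous_on I (\<lambda>t. a t k)"
    unfolding continuous_on_def
    using component_tendsto[OF ev[OF assms] ks_solutionD(1)[OF assms] ks_solutionD(3)[OF assms]] by blast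
  assume b: "ks_solution_on \<mu> I b"
  show "continuous_on I (\<lambda>t. l2norm (\<lambda>k. a t k - b t k))"
    unfolding continuous_on_def
  proof
    fix t assume t: "t \<in> I"
    note sa = ks_solutionD(1)[OF assms] and sb = ks_solutionD(1)[OF b]
    show "((\<lambda>t. l2norm (\<lambda>k. a t k - b t k)) \<longlongrightarrow> l2norm (\<lambda>k. a t k - b t k)) (at t within I)"
    proof (rule l2norm_tendsto)
      show "\<forall>\<^sub>F s in at t within I. sqs (\<lambda>k. a s k - b s k)"
        using ev[OF assms] ev[OF b] by eventually_elim (rule sqs_diff)
      show "sqs (\<lambda>k. a t k - b t k)" by (intro sqs_diff sa sb t)
      show "((\<lambda>s. l2norm (\<lambda>k. a s k - b s k - (a t k - b t k))) \<longlongrightarrow> 0) (at t within I)"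
      proof (rule Lim_null_comparison)
        show "((\<lambda>s. l2norm (\<lambda>k. a s k - a t k) + l2norm (\<lambda>k. b s k - b t k)) \<longlongrightarrow> 0) (at t within I)"
          using tendsto_add[OF ks_solutionD(3)[OF assms t] ks_solutionD(3)[OF b t]] by simp
        show "\<forall>\<^sub>F s in at t within I. norm (l2norm (\<lambda>k. a s k - b s k - (a t k - b t k)))
            \<le> l2norm (\<lambda>k. a s k - a t k) + l2norm (\<lambda>k. b s k - b t k)"
          using ev[OF assms] ev[OF b]
        proof eventually_elim
          case (elim s)
          have d: "sqs (\<lambda>k. a s k - a t k)" "sqs (\<lambda>k. b s k - b t k)"
            using elim sa[OF t] sb[OF t] by (auto intro: sqs_diff)
          have "(\<lambda>k. a s k - b s k - (a t k - b t k)) = (\<lambda>k. (a s k - a t k) - (b s k - b t k))"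
            by (auto simp: algebra_simps)
          then show ?case using l2norm_diff_triangle[OF d] l2norm_nonneg[OF sqs_diff[OF d]] by simp
        qed
      qed
    qed
  qed
qed

lemma ks_solution_deriv_interior:
  assumes "ks_solution_on \<mu> I a" "t \<in> interior I" "k \<ge> 1"
  shows "((\<lambda>s. a s k) has_real_derivative ks_eig \<mu> k * a t k + ks_bil (a t) (a t) k) (at t)"
  using ks_solutionD(4)[OF assms(1) subsetD[OF interior_subset assms(2)] assms(3)]
  unfolding at_within_interior[OF assms(2)] .

text \<open>Parabolic smoothing: exp (- L t) \<le> 1 / (L t) turns a merely bounded initial mode
  into one of order k^-4 at times t \<ge> s, and the forcing contributes 6 R^2 / k^3. With decay
  k^-3 the products of a mode and its derivative are of order k^-2, which allows termwise
  differentiation of the squared norm.\<close>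

lemma smoothing:
  assumes \<mu>: "3/4 \<le> \<mu>" and a: "ks_solution_on \<mu> {0..T} a" and s: "0 < s"
  obtains C where "0 \<le> C" "\<And>t k. s \<le> t \<Longrightarrow> t \<le> T \<Longrightarrow> \<bar>a t k\<bar> \<le> C / real k ^ 3"
    "\<And>t. 0 \<le> t \<Longrightarrow> t \<le> T \<Longrightarrow> l2norm (a t) \<le> C"
proof -
  have "bounded ((\<lambda>t. l2norm (a t)) ` {0..T})"
    by (intro compact_imp_bounded compact_continuous_image ks_solution_continuous[OF a]) simp
  then obtain R where R: "\<And>t. t \<in> {0..T} \<Longrightarrow> \<bar>l2norm (a t)\<bar> \<le> R" and R0: "0 < R"
    unfolding bounded_pos by (metis imageI real_norm_def)
  define C where "C = R + 2 * R / s + 6 * R\<^sup>2"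
  have C: "R \<le> C" "0 \<le> C" using R0 s by (auto simp: C_def)
  show thesis
  proof (rule that[OF C(2)])
    show "l2norm (a t) \<le> C" if "0 \<le> t" "t \<le> T" for t using R[of t] that C by auto
    fix t and k :: nat assume t: "s \<le> t" "t \<le> T"
    then have tI: "t \<in> {0..T}" using s by auto
    consider "k = 0" | "k = 1" | "2 \<le> k" by linarith
    then show "\<bar>a t k\<bar> \<le> C / real k ^ 3"
    proof cases
      case 1 then show ?thesis using ks_solutionD(2)[OF a tI] by simp
    next
      case 2
      then show ?thesis using abs_le_l2norm[OF ks_solutionD(1)[OF a tI], of k] R[OF tI] C by simp
    next
      case 3
      let ?L = "- ks_eig \<mu> k"
      have L: "real k ^ 4 / 2 \<le> ?L" using ks_eig_le(2)[OF \<mu> 3] by simp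
      have L0: "0 < real k ^ 4 / 2" using 3 by simp
      then have Lp: "0 < ?L" using L by linarith
      have "\<bar>a t k\<bar> \<le> exp (- ?L * (t - 0)) * \<bar>a 0 k\<bar> + 3 * real k * R\<^sup>2 / ?L"
      proof (rule forced_decay_abs[where g="\<lambda>r. ks_bil (a r) (a r) k"])
        show "continuous_on {0..t} (\<lambda>t. a t k)"
          using ks_solution_continuous(2)[OF a] by (rule continuous_on_subset) (use t in auto)
        fix r assume r: "0 < r" "r < t"
        then have rI: "r \<in> {0..T}" using t by auto
        have "(l2norm (a r))\<^sup>2 \<le> R\<^sup>2"
          using R[OF rI] l2norm_nonneg[OF ks_solutionD(1)[OF a rI]] by (intro power_mono) auto
        then have "3 * real k * (l2norm (a r) * l2norm (a r)) \<le> 3 * real k * R\<^sup>2"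
          by (intro mult_left_mono) (auto simp: power2_eq_square)
        then have "\<bar>ks_bil (a r) (a r) k\<bar> \<le> 3 * real k * R\<^sup>2"
          using ks_bil_bound[OF ks_solutionD(1)[OF a rI] ks_solutionD(1)[OF a rI], of k] by linarith
        then show "((\<lambda>t. a t k) has_real_derivative - ?L * a r k + ks_bil (a r) (a r) k) (at r)
            \<and> \<bar>ks_bil (a r) (a r) k\<bar> \<le> 3 * real k * R\<^sup>2"
          using ks_solution_deriv_interior[OF a, of r k] r t 3 by simp
      qed (use Lp s t in auto)
      also have "exp (- ?L * (t - 0)) * \<bar>a 0 k\<bar> \<le> 1 / (real k ^ 4 / 2 * s) * R"
      proof (rule mult_mono)
        have "?L * t \<le> exp (?L * t)" using exp_ge_add_one_self[of "?L * t"] by linarith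
        moreover have "real k ^ 4 / 2 * s \<le> ?L * t" using L Lp t s by (intro mult_mono) auto
        ultimately have "real k ^ 4 / 2 * s \<le> exp (?L * t)" by linarith
        then have "1 / exp (?L * t) \<le> 1 / (real k ^ 4 / 2 * s)"
          using L0 s by (intro divide_left_mono mult_pos_pos) auto
        then show "exp (- ?L * (t - 0)) \<le> 1 / (real k ^ 4 / 2 * s)" by (simp add: exp_minus field_simps)
        have z: "0 \<in> {0..T}" using t s by auto
        show "\<bar>a 0 k\<bar> \<le> R" using abs_le_l2norm[OF ks_solutionD(1)[OF a z], of k] R[OF z] by simp
      qed (use s in auto)
      also have "\<dots> = (2 * R / s) * (1 / real k ^ 4)" by simp
      also have "\<dots> \<le> (2 * R / s) * (1 / real k ^ 3)"
        using 3 R0 s by (intro mult_left_mono divide_left_mono power_increasing mult_pos_pos) auto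
      also have "3 * real k * R\<^sup>2 / ?L \<le> 3 * real k * R\<^sup>2 / (real k ^ 4 / 2)"
        using L L0 Lp by (intro divide_left_mono mult_pos_pos) auto
      also have "3 * real k * R\<^sup>2 / (real k ^ 4 / 2) = 6 * R\<^sup>2 * (1 / real k ^ 3)"
        using 3 by (simp add: field_simps power3_eq_cube power4_eq_xxxx)
      finally have "\<bar>a t k\<bar> \<le> (2 * R / s + 6 * R\<^sup>2) * (1 / real k ^ 3)" by (simp add: algebra_simps)
      also have "\<dots> \<le> C * (1 / real k ^ 3)" using R0 by (intro mult_right_mono) (auto simp: C_def)
      finally show ?thesis by simp
    qed
  qed
qed

section \<open>Coupling of the difference to the first two modes of the sum\<close>

definition unit_seq :: "nat \<Rightarrow> nat \<Rightarrow> real" where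
  "unit_seq j k = (if k = j then 1 else 0)"

lemma sqs_unit_seq: "sqs (unit_seq j)"
  unfolding sqs_def by (rule summable_finite[of "{j}"]) (auto simp: unit_seq_def)

text \<open>A single mode j couples k only to k + j and to the distance of k and j; for k = j the
  latter contributes nothing.\<close>

lemma ks_bil_unit_seq:
  assumes "1 \<le> j"
  shows "ks_bil (unit_seq j) d k =
    real k * (d (k + j) + (if k < j then d (j - k) else 0) - (if j < k then d (k - j) else 0))"
proof -
  have "(\<Sum>i. unit_seq j (i + 1) * d (i + (k + 1))) = (\<Sum>i\<in>{j - 1}. unit_seq j (i + 1) * d (i + (k + 1)))"
    by (rule suminf_finite) (use assms in \<open>auto simp: unit_seq_def\<close>)
  then have 1: "(\<Sum>i. unit_seq j (i + 1) * d (i + (k + 1))) = d (k + j)"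
    using assms by (simp add: unit_seq_def add.commute)
  have 2: "(\<Sum>i. d (i + 1) * unit_seq j (i + (k + 1))) = (if k < j then d (j - k) else 0)"
  proof (cases "k < j")
    case True
    have "(\<Sum>i. d (i + 1) * unit_seq j (i + (k + 1))) = (\<Sum>i\<in>{j - k - 1}. d (i + 1) * unit_seq j (i + (k + 1)))"
      by (rule suminf_finite) (use True in \<open>auto simp: unit_seq_def\<close>)
    moreover have "Suc (j - Suc k) = j - k" using True by simp
    ultimately show ?thesis using True by (simp add: unit_seq_def)
  next
    case False
    then have "(\<lambda>i. d (i + 1) * unit_seq j (i + (k + 1))) = (\<lambda>i. 0)" by (auto simp: unit_seq_def)
    then show ?thesis using False by simp
  qed
  have 3: "(\<Sum>i = 1..k - 1. unit_seq j i * d (k - i)) = (if j < k then d (k - j) else 0)"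
  proof -
    have "(\<Sum>i = 1..k - 1. unit_seq j i * d (k - i)) = (\<Sum>i = 1..k - 1. if i = j then d (k - j) else 0)"
      by (rule sum.cong) (auto simp: unit_seq_def)
    also have "\<dots> = (if j < k then d (k - j) else 0)" using assms by auto
    finally show ?thesis .
  qed
  show ?thesis unfolding ks_bil_def 1 2 3 ..
qed

text \<open>Modes 1 and 2 of M are kept exactly because their signs matter in the energy estimate;
  the others enter only through a norm.\<close>

lemma ks_bil_modes:
  assumes "sqs M" "sqs d" "M 0 = 0"
  shows "ks_bil M d k = M 1 * ks_bil (unit_seq 1) d k + M 2 * ks_bil (unit_seq 2) d k + ks_bil (tail 3 M) d k"
proof -
  have "M = (\<lambda>k. (M 1 * unit_seq 1 k + M 2 * unit_seq 2 k) + tail 3 M k)"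
  proof
    fix k :: nat
    consider "k = 0" | "k = 1" | "k = 2" | "3 \<le> k" by linarith
    then show "M k = (M 1 * unit_seq 1 k + M 2 * unit_seq 2 k) + tail 3 M k"
      by cases (use assms(3) in \<open>auto simp: unit_seq_def tail_apply\<close>)
  qed
  then have "ks_bil M d k = ks_bil (\<lambda>k. (M 1 * unit_seq 1 k + M 2 * unit_seq 2 k) + tail 3 M k) d k" by (rule arg_cong[where f="\<lambda>M. ks_bil M d k"])
  note M = this
  have u: "sqs (\<lambda>k. x * unit_seq j k)" for x j by (intro sqs_cmult sqs_unit_seq)
  have "ks_bil (\<lambda>k. (M 1 * unit_seq 1 k + M 2 * unit_seq 2 k) + tail 3 M k) d k
      = M 1 * ks_bil (unit_seq 1) d k + M 2 * ks_bil (unit_seq 2) d k + ks_bil (tail 3 M) d k"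
    using ks_bil_add_left[OF sqs_add[OF u u] sqs_tail[OF assms(1)] assms(2), of "M 1" 1 "M 2" 2 3 k]
      ks_bil_add_left[OF u u assms(2), of "M 1" 1 "M 2" 2 k]
      ks_bil_cmult_left[OF sqs_unit_seq assms(2)] by simp
  with M show ?thesis by simp
qed

text \<open>Telescoping 1 / k^2 \<le> 1 / (k - 1) - 1 / k from k = 3 gives at most 1/2, and 1/2 <
  0.71^2.\<close>

lemma l2norm_tail_inverse: "sqs (tail 3 (\<lambda>k. 1 / real k))" "l2norm (tail 3 (\<lambda>k. 1 / real k)) \<le> 71/100"
proof -
  have *: "(\<Sum>k<n. (tail 3 (\<lambda>k. 1 / real k) k)\<^sup>2) \<le> (71/100)\<^sup>2" for n
  proof -
    have "(\<Sum>k<m + 3. (tail 3 (\<lambda>k. 1 / real k) k)\<^sup>2) \<le> 1/2 - 1 / (real m + 2)" for m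
    proof (induction m)
      case 0 then show ?case by (simp add: tail_apply numeral_3_eq_3)
    next
      case (Suc m)
      have "1 / (real m + 3)\<^sup>2 \<le> 1 / ((real m + 2) * (real m + 3))"
        by (intro divide_left_mono) (auto simp: power2_eq_square)
      also have "\<dots> = 1 / (real m + 2) - 1 / (real m + 3)" by (simp add: field_simps)
      finally have "1 / (real m + 3)\<^sup>2 \<le> 1 / (real m + 2) - 1 / (real m + 3)" .
      moreover have "(tail 3 (\<lambda>k. 1 / real k) (m + 3))\<^sup>2 = 1 / (real m + 3)\<^sup>2"
        by (simp add: tail_apply power_divide)
      moreover have "(\<Sum>k<Suc m + 3. (tail 3 (\<lambda>k. 1 / real k) k)\<^sup>2)
        = (\<Sum>k<m + 3. (tail 3 (\<lambda>k. 1 / real k) k)\<^sup>2) + (tail 3 (\<lambda>k. 1 / real k) (m + 3))\<^sup>2"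
        by (simp only: add_Suc sum.lessThan_Suc)
      moreover have e: "real (Suc m) + 2 = real m + 3" by simp
      ultimately show ?case using Suc.IH unfolding e by linarith
    qed
    moreover have "(\<Sum>k<n. (tail 3 (\<lambda>k. 1 / real k) k)\<^sup>2) \<le> (\<Sum>k<n + 3. (tail 3 (\<lambda>k. 1 / real k) k)\<^sup>2)"
      by (intro sum_mono2) auto
    moreover have "0 \<le> 1 / (real n + 2)" by simp
    moreover have "(1/2 :: real) \<le> (71/100)\<^sup>2" by (simp add: power2_eq_square)
    ultimately show ?thesis by (smt (verit))
  qed
  show "sqs (tail 3 (\<lambda>k. 1 / real k))" "l2norm (tail 3 (\<lambda>k. 1 / real k)) \<le> 71/100"
    by (rule l2norm_leI[OF *]; simp)+
qed

text \<open>
  A bound for the derivative of \<open>|d|\<^sup>2 / 2 + d\<^sub>1\<^sup>2 + \<eta> d\<^sub>1 d\<^sub>2\<close> along the difference \<open>d\<close> of two solutions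
  with sum \<open>M\<close>, where \<open>\<alpha> = |(M\<^sub>3, M\<^sub>4, \<dots>)|\<close> and \<open>H\<^sup>2 = \<Sum>\<^sub>k\<^sub>\<ge>\<^sub>3 k\<^sup>4 d\<^sub>k\<^sup>2\<close>. The cross
  term damps the unstable first mode through \<open>- 2 \<eta> M\<^sub>1 d\<^sub>1\<^sup>2\<close>; because of the larger weight of \<open>d\<^sub>1\<close>,
  its other contribution \<open>\<eta> (\<lambda>\<^sub>1 + \<lambda>\<^sub>2 + M\<^sub>2) d\<^sub>1 d\<^sub>2\<close> has the sign opposite to the coupling \<open>M\<^sub>1 d\<^sub>1 d\<^sub>2\<close>
  and offsets it.
\<close>

definition ks_form :: "real \<Rightarrow> real \<Rightarrow> real \<Rightarrow> real \<Rightarrow> real \<Rightarrow> real \<Rightarrow> real \<Rightarrow> real \<Rightarrow> real" where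
  "ks_form \<mu> \<eta> M1 M2 \<alpha> d1 d2 H =
     (3 * (ks_eig \<mu> 1 + M2) - 2 * \<eta> * M1) * d1\<^sup>2 + (ks_eig \<mu> 2 + \<eta> * M1) * d2\<^sup>2 - 23/36 * H\<^sup>2
     + (M1 + \<eta> * (ks_eig \<mu> 1 + ks_eig \<mu> 2 + M2)) * (d1 * d2)
     + (3 * \<bar>M2\<bar> / 9 + 2 * \<eta> * M1 / 9 + 2 * \<eta> * \<bar>M2\<bar> / 16 + \<bar>M2\<bar> / 3) * (\<bar>d1\<bar> * H)
     + (2 * M1 / 9 + 2 * \<bar>M2\<bar> / 16 + \<eta> * \<bar>M2\<bar> / 9 + M1 / 3 + \<bar>M2\<bar> / 3) * (\<bar>d2\<bar> * H)
     + (2 * M1 / 27 + 2 * \<bar>M2\<bar> / 27) * H\<^sup>2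
     + \<alpha> * (6 * \<bar>d1\<bar> * (\<bar>d2\<bar> + H / 9) + 2 * \<bar>d2\<bar> * (\<bar>d1\<bar> + \<bar>d2\<bar> + 2 * H / 9)
         + 2 * \<eta> * \<bar>d2\<bar> * (\<bar>d2\<bar> + H / 9) + 2 * \<eta> * \<bar>d1\<bar> * (\<bar>d1\<bar> + \<bar>d2\<bar> + 2 * H / 9)
         + 213/100 * H * (\<bar>d1\<bar> + \<bar>d2\<bar> + H / 9))"

lemma mult_le_abs: "x * y \<le> \<bar>x\<bar> * \<bar>y\<bar>" for x y :: real
  using abs_ge_self[of "x * y"] by (simp only: abs_mult)

section \<open>Energy estimate for a difference \<open>d\<close> of two solutions with sum
  \<open>M\<close>\<close>

context
  fixes \<mu> :: real and M d :: "nat \<Rightarrow> real" and C :: real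
  assumes \<mu>: "3/4 \<le> \<mu>"
    and M: "sqs M" "M 0 = 0" "0 \<le> M 1"
    and d: "d 0 = 0" "\<And>k. \<bar>d k\<bar> \<le> C / real k ^ 3" "0 \<le> C"
begin

abbreviation (input) "high_seq \<equiv> \<lambda>k. (real k)\<^sup>2 * d k"
abbreviation (input) "high_norm \<equiv> l2norm (tail 3 (\<lambda>k. (real k)\<^sup>2 * d k))"
abbreviation (input) "tail_size \<equiv> l2norm (tail 3 M)"

lemma sqs_d: "sqs d" and sqs_hk: "sqs high_seq"
proof -
  have 1: "\<bar>d k\<bar> \<le> \<bar>C * invsq k\<bar>" for k
  proof (cases "k = 0")
    case False
    have "C / real k ^ 3 \<le> C / real k ^ 2"
      using False d(3) by (intro divide_left_mono power_increasing mult_pos_pos) auto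
    then show ?thesis using d(2)[of k] d(3) by (simp add: invsq_def)
  qed (simp add: d)
  show "sqs d" by (rule sqs_mono[OF sqs_cmult[OF sqs_invsq] 1])
  have "sqs (\<lambda>k. C * inverse (real k))"
    using inverse_power_summable[of 2, where ?'a=real] by (intro sqs_cmult) (simp add: sqs_def power_inverse)
  moreover have "\<bar>high_seq k\<bar> \<le> \<bar>C * inverse (real k)\<bar>" for k
  proof (cases "k = 0")
    case False
    have "\<bar>high_seq k\<bar> \<le> (real k)\<^sup>2 * (C / real k ^ 3)" unfolding abs_mult using d(2)[of k] by (intro mult_mono) auto
    then show ?thesis using False d(3) by (simp add: power3_eq_cube power2_eq_square field_simps)
  qed simp
  ultimately show "sqs high_seq" by (rule sqs_mono)
qed

lemma H_nonneg: "0 \<le> high_norm" by (intro l2norm_nonneg sqs_tail sqs_hk)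
lemma alpha_nonneg: "0 \<le> tail_size" by (intro l2norm_nonneg sqs_tail M)

lemma d_le_H: "3 \<le> k \<Longrightarrow> \<bar>d k\<bar> \<le> high_norm / (real k)\<^sup>2"
  using abs_le_l2norm_tail[OF sqs_hk, of 3 k] by (simp add: abs_mult field_simps)

lemma tail3_le: "l2norm (tail 3 d) \<le> high_norm / 9"
proof -
  have "l2norm (tail 3 d) \<le> l2norm (\<lambda>k. (1/9) * tail 3 high_seq k)"
  proof (rule l2norm_mono[OF sqs_cmult[OF sqs_tail[OF sqs_hk]]])
    fix k
    have "1 * \<bar>d k\<bar> \<le> ((real k)\<^sup>2 / 9) * \<bar>d k\<bar>" if "3 \<le> k"
    proof (rule mult_right_mono)
      have "3\<^sup>2 \<le> (real k)\<^sup>2" using that by (intro power_mono) auto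
      then show "1 \<le> (real k)\<^sup>2 / 9" by simp
    qed simp
    then show "\<bar>tail 3 d k\<bar> \<le> \<bar>1 / 9 * tail 3 high_seq k\<bar>" by (auto simp: tail_apply abs_mult)
  qed
  then show ?thesis using l2norm_cmult[OF sqs_tail[OF sqs_hk], of "1/9" 3] by simp
qed

lemma tail2_le: "l2norm (tail 2 d) \<le> \<bar>d 2\<bar> + high_norm / 9"
proof -
  have "(l2norm (tail 2 d))\<^sup>2 = (d 2)\<^sup>2 + (l2norm (tail 3 d))\<^sup>2"
    using l2norm_tail_Suc[OF sqs_d, of 2] by (simp add: numeral_3_eq_3)
  also have "\<dots> \<le> (d 2)\<^sup>2 + (high_norm / 9)\<^sup>2"
    using tail3_le l2norm_nonneg[OF sqs_tail[OF sqs_d]] by (intro add_left_mono power_mono) auto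
  also have "\<dots> \<le> (\<bar>d 2\<bar> + high_norm / 9)\<^sup>2"
    using H_nonneg by (simp add: power2_sum)
  finally show ?thesis by (rule power2_le_imp_le) (use H_nonneg in simp)
qed

lemma l2norm_d_sq: "(l2norm d)\<^sup>2 \<le> (d 1)\<^sup>2 + (d 2)\<^sup>2 + high_norm\<^sup>2"
proof -
  have "(l2norm d)\<^sup>2 = (d 1)\<^sup>2 + ((d 2)\<^sup>2 + (l2norm (tail 3 d))\<^sup>2)"
    using l2norm_tail_Suc[OF sqs_d, of 0] l2norm_tail_Suc[OF sqs_d, of 1] l2norm_tail_Suc[OF sqs_d, of 2] d(1)
    by (simp add: numeral_3_eq_3 numeral_2_eq_2)
  also have "(l2norm (tail 3 d))\<^sup>2 \<le> high_norm\<^sup>2"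
    using tail3_le l2norm_nonneg[OF sqs_tail[OF sqs_d]] H_nonneg by (intro power_mono) auto
  finally show ?thesis by simp
qed

lemma l2norm_d_le: "l2norm d \<le> \<bar>d 1\<bar> + \<bar>d 2\<bar> + high_norm / 9"
proof -
  have "(l2norm d)\<^sup>2 = (d 1)\<^sup>2 + (l2norm (tail 2 d))\<^sup>2"
    using l2norm_tail_Suc[OF sqs_d, of 0] l2norm_tail_Suc[OF sqs_d, of 1] d(1)
    by (simp add: numeral_2_eq_2)
  also have "\<dots> \<le> (\<bar>d 1\<bar> + l2norm (tail 2 d))\<^sup>2"
    using l2norm_nonneg[OF sqs_tail[OF sqs_d], of 2] by (simp add: power2_sum)
  finally have "l2norm d \<le> \<bar>d 1\<bar> + l2norm (tail 2 d)"
    by (rule power2_le_imp_le) (use l2norm_nonneg[OF sqs_tail[OF sqs_d], of 2] in simp)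
  then show ?thesis using tail2_le by simp
qed

text \<open>In equation 1 the convolution is empty, and modes of M of index at least 3 meet only
  modes of d of index at least 2; hence d 1 is absent from the bound.\<close>

lemma ks_bil_tail_1: "\<bar>ks_bil (tail 3 M) d 1\<bar> \<le> 2 * tail_size * (\<bar>d 2\<bar> + high_norm / 9)"
proof -
  have A: "sqs (tail 3 M)" by (intro sqs_tail M)
  have 1: "\<bar>\<Sum>i. tail 3 M (i + 1) * d (i + (1 + 1))\<bar> \<le> tail_size * l2norm (tail 2 d)"
    using abs_suminf_mult_shift[OF A sqs_d, of 1 2]
      mult_right_mono[OF l2norm_tail_le[OF A, of 1] l2norm_nonneg[OF sqs_tail[OF sqs_d, of 2]]] by simp
  have "(\<lambda>i. d (i + 1) * tail 3 M (i + (1 + 1))) = (\<lambda>i. tail 2 d (i + 1) * tail 3 M (i + 2))"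
    by (auto simp: tail_apply fun_eq_iff)
  then have "\<bar>\<Sum>i. d (i + 1) * tail 3 M (i + (1 + 1))\<bar> \<le> l2norm (tail 1 (tail 2 d)) * l2norm (tail 2 (tail 3 M))"
    using abs_suminf_mult_shift[OF sqs_tail[OF sqs_d] A, of 2 1 2] by simp
  also have "\<dots> \<le> l2norm (tail 2 d) * tail_size"
    by (intro mult_mono l2norm_tail_le l2norm_nonneg sqs_tail A sqs_d)
  finally have "\<bar>ks_bil (tail 3 M) d 1\<bar> \<le> 2 * tail_size * l2norm (tail 2 d)"
    unfolding ks_bil_def using 1 by (simp add: mult.commute)
  also have "\<dots> \<le> 2 * tail_size * (\<bar>d 2\<bar> + high_norm / 9)"
    using tail2_le alpha_nonneg by (intro mult_left_mono) auto
  finally show ?thesis .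
qed

text \<open>The convolution only involves index 1, where the tail of M vanishes. Of the two series
  only one reaches d 1; the other contributes the tail of d from 3 on.\<close>

lemma ks_bil_tail_2: "\<bar>ks_bil (tail 3 M) d 2\<bar> \<le> 2 * tail_size * (\<bar>d 1\<bar> + \<bar>d 2\<bar> + 2 * high_norm / 9)"
proof -
  have A: "sqs (tail 3 M)" by (intro sqs_tail M)
  have 1: "\<bar>\<Sum>i. tail 3 M (i + 1) * d (i + (2 + 1))\<bar> \<le> tail_size * l2norm (tail 3 d)"
    using abs_suminf_mult_shift[OF A sqs_d, of 1 3]
      mult_right_mono[OF l2norm_tail_le[OF A, of 1] l2norm_nonneg[OF sqs_tail[OF sqs_d, of 3]]] by simp
  have 2: "\<bar>\<Sum>i. d (i + 1) * tail 3 M (i + (2 + 1))\<bar> \<le> l2norm d * tail_size"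
    using abs_suminf_mult_shift[OF sqs_d A, of 1 3]
      mult_mono[OF l2norm_tail_le[OF sqs_d, of 1] l2norm_tail_le[OF A, of 3]
        l2norm_nonneg[OF sqs_d] l2norm_nonneg[OF sqs_tail[OF A]]] by simp
  have 3: "(\<Sum>i = 1..2 - 1. tail 3 M i * d (2 - i)) = 0" by (simp add: tail_apply)
  have "\<bar>ks_bil (tail 3 M) d 2\<bar> \<le> 2 * (tail_size * l2norm (tail 3 d) + l2norm d * tail_size)"
    unfolding ks_bil_def 3 using 1 2 by simp
  also have "\<dots> = 2 * tail_size * (l2norm d + l2norm (tail 3 d))" by (simp add: algebra_simps)
  also have "\<dots> \<le> 2 * tail_size * (\<bar>d 1\<bar> + \<bar>d 2\<bar> + 2 * high_norm / 9)"
    using l2norm_d_le tail3_le alpha_nonneg by (intro mult_left_mono) auto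
  finally show ?thesis .
qed

abbreviation (input) "vel \<equiv> \<lambda>k. ks_eig \<mu> k * d k + ks_bil M d k"

text \<open>For k \<ge> 3 one has k^2 \<le> k^4 / 9, and 1/9 - 3/4 = -23/36. The factor k of each
  coupling term is absorbed into k^2 |d k| at the price 1/3, or 1/k for the tail of M, where a
  square-summable factor is needed to sum over k.\<close>

lemma high_modes_term:
  assumes "3 \<le> k"
  shows "d k * vel k \<le> - 23/36 * (high_seq k)\<^sup>2 + M 1 / 3 * (\<bar>high_seq k\<bar> * \<bar>d (k - 1)\<bar> + \<bar>high_seq k\<bar> * \<bar>d (k + 1)\<bar>)
    + \<bar>M 2\<bar> / 3 * (\<bar>high_seq k\<bar> * \<bar>d (k - 2)\<bar> + \<bar>high_seq k\<bar> * \<bar>d (k + 2)\<bar>) + 3 * tail_size * l2norm d * (\<bar>high_seq k\<bar> * \<bar>1 / real k\<bar>)"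
proof -
  have A: "sqs (tail 3 M)" by (intro sqs_tail M)
  have k2: "9 \<le> (real k)\<^sup>2" using power_mono[of 3 "real k" 2] assms by simp
  have "ks_eig \<mu> k \<le> - 23/36 * real k ^ 4"
  proof -
    have "9 * (real k)\<^sup>2 \<le> (real k)\<^sup>2 * (real k)\<^sup>2" using k2 by (intro mult_right_mono) auto
    then show ?thesis using ks_eig_le(3)[OF \<mu>, of k] by (simp flip: power_add)
  qed
  then have "ks_eig \<mu> k * (d k)\<^sup>2 \<le> - 23/36 * real k ^ 4 * (d k)\<^sup>2" by (rule mult_right_mono) simp
  also have "\<dots> = - 23/36 * (high_seq k)\<^sup>2" by (simp add: power_mult_distrib flip: power_mult)
  finally have 1: "ks_eig \<mu> k * (d k)\<^sup>2 \<le> - 23/36 * (high_seq k)\<^sup>2" .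
  have kd: "real k * \<bar>d k\<bar> \<le> \<bar>high_seq k\<bar> / 3"
  proof -
    have "real k * 3 \<le> real k * real k" using assms by (intro mult_left_mono) auto
    then have "real k * 3 * \<bar>d k\<bar> \<le> real k * real k * \<bar>d k\<bar>" by (intro mult_right_mono) auto
    then show ?thesis by (simp add: abs_mult power2_eq_square)
  qed
  have kd': "real k * \<bar>d k\<bar> = \<bar>high_seq k\<bar> * \<bar>1 / real k\<bar>"
    using assms by (simp add: abs_mult power2_eq_square)
  have b: "ks_bil M d k = real k * (M 1 * (d (k + 1) - d (k - 1))) + real k * (M 2 * (d (k + 2) - d (k - 2)))
      + ks_bil (tail 3 M) d k"
    unfolding ks_bil_modes[OF M(1) sqs_d M(2), of k] using assms by (simp add: ks_bil_unit_seq)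
  have "d k * (real k * (M 1 * (d (k + 1) - d (k - 1)))) \<le> \<bar>d k * real k\<bar> * \<bar>M 1 * (d (k + 1) - d (k - 1))\<bar>"
    unfolding mult.assoc[symmetric, of "d k"] by (rule mult_le_abs)
  also have "\<dots> \<le> (\<bar>high_seq k\<bar> / 3) * (M 1 * (\<bar>d (k - 1)\<bar> + \<bar>d (k + 1)\<bar>))"
    using kd M(3) abs_triangle_ineq4[of "d (k + 1)" "d (k - 1)"]
    by (intro mult_mono) (auto simp: abs_mult mult.commute intro!: mult_left_mono)
  finally have 2: "d k * (real k * (M 1 * (d (k + 1) - d (k - 1)))) \<le>
      M 1 / 3 * (\<bar>high_seq k\<bar> * \<bar>d (k - 1)\<bar> + \<bar>high_seq k\<bar> * \<bar>d (k + 1)\<bar>)" by (simp add: algebra_simps)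
  have "d k * (real k * (M 2 * (d (k + 2) - d (k - 2)))) \<le> \<bar>d k * real k\<bar> * \<bar>M 2 * (d (k + 2) - d (k - 2))\<bar>"
    unfolding mult.assoc[symmetric, of "d k"] by (rule mult_le_abs)
  also have "\<dots> \<le> (\<bar>high_seq k\<bar> / 3) * (\<bar>M 2\<bar> * (\<bar>d (k - 2)\<bar> + \<bar>d (k + 2)\<bar>))"
    using kd abs_triangle_ineq4[of "d (k + 2)" "d (k - 2)"]
    by (intro mult_mono) (auto simp: abs_mult mult.commute intro!: mult_left_mono)
  finally have 3: "d k * (real k * (M 2 * (d (k + 2) - d (k - 2)))) \<le>
      \<bar>M 2\<bar> / 3 * (\<bar>high_seq k\<bar> * \<bar>d (k - 2)\<bar> + \<bar>high_seq k\<bar> * \<bar>d (k + 2)\<bar>)" by (simp add: algebra_simps)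
  have "d k * ks_bil (tail 3 M) d k \<le> \<bar>d k\<bar> * \<bar>ks_bil (tail 3 M) d k\<bar>"
    by (rule mult_le_abs)
  also have "\<dots> \<le> \<bar>d k\<bar> * (3 * real k * (tail_size * l2norm d))"
    by (intro mult_left_mono ks_bil_bound A sqs_d) simp
  also have "\<dots> = 3 * tail_size * l2norm d * (real k * \<bar>d k\<bar>)" by simp
  finally have 4: "d k * ks_bil (tail 3 M) d k \<le> 3 * tail_size * l2norm d * (\<bar>high_seq k\<bar> * \<bar>1 / real k\<bar>)"
    by (simp only: kd')
  have "d k * vel k = ks_eig \<mu> k * (d k)\<^sup>2 + d k * (real k * (M 1 * (d (k + 1) - d (k - 1))))
     + d k * (real k * (M 2 * (d (k + 2) - d (k - 2)))) + d k * ks_bil (tail 3 M) d k"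
    unfolding b by (simp add: algebra_simps power2_eq_square)
  then show ?thesis using 1 2 3 4 by linarith
qed

text \<open>Cauchy-Schwarz pairs the sequence k^2 d k, k \<ge> 3, with d shifted by one or two
  places either way and, for the tail of M, with 1/k; hence 213/100 = 3 * 71/100.\<close>

lemma high_modes_sum:
  assumes "summable (\<lambda>k. d k * vel k)"
  shows "(\<Sum>k. d (k + 3) * vel (k + 3)) \<le> - 23/36 * high_norm\<^sup>2 + M 1 / 3 * (high_norm * (\<bar>d 2\<bar> + 2 * high_norm / 9))
    + \<bar>M 2\<bar> / 3 * (high_norm * (\<bar>d 1\<bar> + \<bar>d 2\<bar> + 2 * high_norm / 9)) + 213/100 * tail_size * (high_norm * (\<bar>d 1\<bar> + \<bar>d 2\<bar> + high_norm / 9))"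
proof -
  define P where "P n i = \<bar>high_seq (i + 3)\<bar> * \<bar>d (i + n)\<bar>" for n i
  define Q where "Q i = \<bar>high_seq (i + 3)\<bar> * \<bar>tail 3 (\<lambda>k. 1 / real k) (i + 3)\<bar>" for i
  have P: "summable (P n)" "suminf (P n) \<le> high_norm * l2norm (tail n d)" for n
  proof -
    show "summable (P n)" unfolding P_def[abs_def]
      by (rule summable_abs_mult[OF sqs_shift[OF sqs_hk] sqs_shift[OF sqs_d]])
    show "suminf (P n) \<le> high_norm * l2norm (tail n d)" unfolding P_def[abs_def]
      using suminf_abs_mult_le[OF sqs_shift[OF sqs_hk, of 3] sqs_shift[OF sqs_d, of n]]
      unfolding l2norm_shift[OF sqs_hk] l2norm_shift[OF sqs_d] .
  qed
  note inv = l2norm_tail_inverse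
  have Q: "summable Q" "suminf Q \<le> high_norm * (71/100)"
  proof -
    have "l2norm (tail 3 (tail 3 (\<lambda>k. 1 / real k))) \<le> 71/100"
      using l2norm_tail_le[OF inv(1), of 3] inv(2) by simp
    then have "high_norm * l2norm (tail 3 (tail 3 (\<lambda>k. 1 / real k))) \<le> high_norm * (71/100)"
      using H_nonneg by (intro mult_left_mono) auto
    then show "suminf Q \<le> high_norm * (71/100)"
      unfolding Q_def[abs_def]
      using suminf_abs_mult_le[OF sqs_shift[OF sqs_hk, of 3] sqs_shift[OF inv(1), of 3]]
      unfolding l2norm_shift[OF sqs_hk] l2norm_shift[OF inv(1)] by linarith
    show "summable Q" unfolding Q_def[abs_def]
      by (rule summable_abs_mult[OF sqs_shift[OF sqs_hk] sqs_shift[OF inv(1)]])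
  qed
  define T where "T i = - 23/36 * (high_seq (i + 3))\<^sup>2 + M 1 / 3 * (P 2 i + P 4 i) + \<bar>M 2\<bar> / 3 * (P 1 i + P 5 i)
    + 3 * tail_size * l2norm d * Q i" for i
  have "T sums (- 23/36 * high_norm\<^sup>2 + M 1 / 3 * (suminf (P 2) + suminf (P 4))
      + \<bar>M 2\<bar> / 3 * (suminf (P 1) + suminf (P 5)) + 3 * tail_size * l2norm d * suminf Q)"
    unfolding T_def[abs_def]
    by (intro sums_add sums_mult tail_sums_shift sqs_hk summable_sums P(1) Q(1))
  then have T: "summable T" "suminf T = - 23/36 * high_norm\<^sup>2 + M 1 / 3 * (suminf (P 2) + suminf (P 4))
      + \<bar>M 2\<bar> / 3 * (suminf (P 1) + suminf (P 5)) + 3 * tail_size * l2norm d * suminf Q"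
    by (auto simp: sums_iff)
  have s2: "suminf (P 2) \<le> high_norm * (\<bar>d 2\<bar> + high_norm / 9)"
    using P(2)[of 2] mult_left_mono[OF tail2_le H_nonneg] by linarith
  have s4: "suminf (P n) \<le> high_norm * (high_norm / 9)" if "3 \<le> n" for n
    using P(2)[of n] mult_left_mono[OF order_trans[OF l2norm_tail_mono[OF sqs_d that] tail3_le] H_nonneg] by linarith
  have s1: "suminf (P 1) \<le> high_norm * (\<bar>d 1\<bar> + \<bar>d 2\<bar> + high_norm / 9)"
    using P(2)[of 1] mult_left_mono[OF order_trans[OF l2norm_tail_le[OF sqs_d] l2norm_d_le] H_nonneg, of 1] by linarith
  have "(\<Sum>k. d (k + 3) * vel (k + 3)) \<le> suminf T"
  proof (rule suminf_le[OF _ _ T(1)])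
    show "d (i + 3) * vel (i + 3) \<le> T i" for i
    proof -
      have "i + 3 - 1 = i + 2" "i + 3 - 2 = i + 1" "i + 3 + 1 = i + 4" "i + 3 + 2 = i + 5" "3 \<le> i + 3"
        "tail 3 (\<lambda>k. 1 / real k) (i + 3) = 1 / real (i + 3)" by (simp_all add: tail_apply)
      then show ?thesis using high_modes_term[of "i + 3"] unfolding T_def P_def Q_def by (simp only:)
    qed
    show "summable (\<lambda>k. d (k + 3) * vel (k + 3))"
      using assms by (subst summable_iff_shift)
  qed
  also have "\<dots> \<le> - 23/36 * high_norm\<^sup>2 + M 1 / 3 * (high_norm * (\<bar>d 2\<bar> + high_norm / 9) + high_norm * (high_norm / 9))
      + \<bar>M 2\<bar> / 3 * (high_norm * (\<bar>d 1\<bar> + \<bar>d 2\<bar> + high_norm / 9) + high_norm * (high_norm / 9)) + 3 * tail_size * (\<bar>d 1\<bar> + \<bar>d 2\<bar> + high_norm / 9) * (high_norm * (71/100))"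
    unfolding T(2)
  proof (intro add_mono order_refl)
    show "M 1 / 3 * (suminf (P 2) + suminf (P 4)) \<le> M 1 / 3 * (high_norm * (\<bar>d 2\<bar> + high_norm / 9) + high_norm * (high_norm / 9))"
      using M(3) s4[of 4] by (intro mult_left_mono add_mono s2) auto
    show "\<bar>M 2\<bar> / 3 * (suminf (P 1) + suminf (P 5)) \<le> \<bar>M 2\<bar> / 3 * (high_norm * (\<bar>d 1\<bar> + \<bar>d 2\<bar> + high_norm / 9) + high_norm * (high_norm / 9))"
      using s4[of 5] by (intro mult_left_mono add_mono s1) auto
    have "l2norm d * suminf Q \<le> (\<bar>d 1\<bar> + \<bar>d 2\<bar> + high_norm / 9) * (high_norm * (71/100))"
    proof (rule mult_mono[OF l2norm_d_le Q(2)])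
      show "0 \<le> suminf Q" by (rule suminf_nonneg[OF Q(1)]) (simp add: Q_def)
    qed (use H_nonneg in simp)
    from mult_left_mono[OF this, of "3 * tail_size"]
    show "3 * tail_size * l2norm d * suminf Q \<le> 3 * tail_size * (\<bar>d 1\<bar> + \<bar>d 2\<bar> + high_norm / 9) * (high_norm * (71/100))"
      using alpha_nonneg by (simp add: mult.assoc)
  qed
  also have "\<dots> = - 23/36 * high_norm\<^sup>2 + M 1 / 3 * (high_norm * (\<bar>d 2\<bar> + 2 * high_norm / 9))
    + \<bar>M 2\<bar> / 3 * (high_norm * (\<bar>d 1\<bar> + \<bar>d 2\<bar> + 2 * high_norm / 9)) + 213/100 * tail_size * (high_norm * (\<bar>d 1\<bar> + \<bar>d 2\<bar> + high_norm / 9))"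
    by (simp add: algebra_simps)
  finally show ?thesis .
qed

lemma energy_form_le:
  assumes "summable (\<lambda>k. d k * vel k)" and \<eta>: "0 \<le> \<eta>"
  shows "(\<Sum>k. d k * vel k) + 2 * d 1 * vel 1 + \<eta> * (vel 1 * d 2 + d 1 * vel 2)
    \<le> ks_form \<mu> \<eta> (M 1) (M 2) tail_size (d 1) (d 2) high_norm"
proof -
  define r1 where "r1 = ks_bil (tail 3 M) d 1"
  define r2 where "r2 = ks_bil (tail 3 M) d 2"
  have b1: "ks_bil M d 1 = M 1 * d 2 + M 2 * (d 3 + d 1) + r1"
    unfolding ks_bil_modes[OF M(1) sqs_d M(2), of 1] r1_def
    by (simp add: ks_bil_unit_seq numeral_2_eq_2 numeral_3_eq_3)
  have b2: "ks_bil M d 2 = 2 * (M 1 * (d 3 - d 1)) + 2 * (M 2 * d 4) + r2"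
    unfolding ks_bil_modes[OF M(1) sqs_d M(2), of 2] r2_def
    by (simp add: ks_bil_unit_seq)
  have "(\<Sum>k. d k * vel k) = (\<Sum>k. d (k + 3) * vel (k + 3)) + (\<Sum>k<3. d k * vel k)"
    by (rule suminf_split_initial_segment[OF assms(1)])
  also have "(\<Sum>k<3. d k * vel k) = d 1 * vel 1 + d 2 * vel 2"
    using d(1) by (simp add: numeral_3_eq_3 numeral_2_eq_2)
  finally have s: "(\<Sum>k. d k * vel k) = (\<Sum>k. d (k + 3) * vel (k + 3)) + (d 1 * vel 1 + d 2 * vel 2)" .
  have d3: "\<bar>d 3\<bar> \<le> high_norm / 9" and d4: "\<bar>d 4\<bar> \<le> high_norm / 16"
    using d_le_H[of 3] d_le_H[of 4] by (simp_all add: power2_eq_square)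
  have pr: "x * y \<le> \<bar>x\<bar> * B" if "\<bar>y\<bar> \<le> B" for x y B :: real
    using order_trans[OF mult_le_abs mult_left_mono[OF that]] by simp
  have i1: "d 1 * r1 \<le> \<bar>d 1\<bar> * (2 * tail_size * (\<bar>d 2\<bar> + high_norm / 9))"
    and i2: "\<eta> * (d 2 * r1) \<le> \<eta> * (\<bar>d 2\<bar> * (2 * tail_size * (\<bar>d 2\<bar> + high_norm / 9)))"
    unfolding r1_def by (intro pr ks_bil_tail_1 mult_left_mono[OF _ \<eta>])+
  have i3: "\<eta> * (d 1 * r2) \<le> \<eta> * (\<bar>d 1\<bar> * (2 * tail_size * (\<bar>d 1\<bar> + \<bar>d 2\<bar> + 2 * high_norm / 9)))"
    and i4: "d 2 * r2 \<le> \<bar>d 2\<bar> * (2 * tail_size * (\<bar>d 1\<bar> + \<bar>d 2\<bar> + 2 * high_norm / 9))"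
    unfolding r2_def by (intro pr ks_bil_tail_2 mult_left_mono[OF _ \<eta>])+
  have i5: "M 2 * d 1 * d 3 \<le> \<bar>M 2\<bar> * \<bar>d 1\<bar> * (high_norm / 9)" using pr[OF d3, of "M 2 * d 1"] by (simp add: abs_mult)
  have i6: "\<eta> * (M 2 * d 1 * d 4) \<le> \<eta> * (\<bar>M 2\<bar> * \<bar>d 1\<bar> * (high_norm / 16))"
    using pr[OF d4, of "M 2 * d 1"] \<eta> by (intro mult_left_mono) (simp_all add: abs_mult)
  have i7: "\<eta> * (M 1 * d 1 * d 3) \<le> \<eta> * (M 1 * \<bar>d 1\<bar> * (high_norm / 9))"
    using pr[OF d3, of "M 1 * d 1"] \<eta> M(3) by (intro mult_left_mono) (simp_all add: abs_mult)
  have i8: "M 1 * d 2 * d 3 \<le> M 1 * \<bar>d 2\<bar> * (high_norm / 9)"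
    using pr[OF d3, of "M 1 * d 2"] M(3) by (simp add: abs_mult)
  have i9: "M 2 * d 2 * d 4 \<le> \<bar>M 2\<bar> * \<bar>d 2\<bar> * (high_norm / 16)"
    using pr[OF d4, of "M 2 * d 2"] by (simp add: abs_mult)
  have i10: "\<eta> * (M 2 * d 2 * d 3) \<le> \<eta> * (\<bar>M 2\<bar> * \<bar>d 2\<bar> * (high_norm / 9))"
    using pr[OF d3, of "M 2 * d 2"] \<eta> by (intro mult_left_mono) (simp_all add: abs_mult)
  have "(\<Sum>k. d k * vel k) + 2 * d 1 * vel 1 + \<eta> * (vel 1 * d 2 + d 1 * vel 2) =
      (\<Sum>k. d (k + 3) * vel (k + 3)) + (3 * (ks_eig \<mu> 1 + M 2) - 2 * \<eta> * M 1) * (d 1)\<^sup>2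
      + (ks_eig \<mu> 2 + \<eta> * M 1) * (d 2)\<^sup>2 + (M 1 + \<eta> * (ks_eig \<mu> 1 + ks_eig \<mu> 2 + M 2)) * (d 1 * d 2)
      + 3 * (M 2 * d 1 * d 3) + 3 * (d 1 * r1) + 2 * (M 1 * d 2 * d 3) + 2 * (M 2 * d 2 * d 4) + d 2 * r2
      + 2 * (\<eta> * (M 1 * d 1 * d 3)) + 2 * (\<eta> * (M 2 * d 1 * d 4)) + \<eta> * (d 1 * r2)
      + \<eta> * (M 2 * d 2 * d 3) + \<eta> * (d 2 * r1)"
    unfolding s b1 b2 by algebra
  also have "\<dots> \<le> (- 23/36 * high_norm\<^sup>2 + M 1 / 3 * (high_norm * (\<bar>d 2\<bar> + 2 * high_norm / 9))
      + \<bar>M 2\<bar> / 3 * (high_norm * (\<bar>d 1\<bar> + \<bar>d 2\<bar> + 2 * high_norm / 9)) + 213/100 * tail_size * (high_norm * (\<bar>d 1\<bar> + \<bar>d 2\<bar> + high_norm / 9)))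
      + (3 * (ks_eig \<mu> 1 + M 2) - 2 * \<eta> * M 1) * (d 1)\<^sup>2
      + (ks_eig \<mu> 2 + \<eta> * M 1) * (d 2)\<^sup>2 + (M 1 + \<eta> * (ks_eig \<mu> 1 + ks_eig \<mu> 2 + M 2)) * (d 1 * d 2)
      + 3 * (\<bar>M 2\<bar> * \<bar>d 1\<bar> * (high_norm / 9)) + 3 * (\<bar>d 1\<bar> * (2 * tail_size * (\<bar>d 2\<bar> + high_norm / 9))) + 2 * (M 1 * \<bar>d 2\<bar> * (high_norm / 9))
      + 2 * (\<bar>M 2\<bar> * \<bar>d 2\<bar> * (high_norm / 16)) + \<bar>d 2\<bar> * (2 * tail_size * (\<bar>d 1\<bar> + \<bar>d 2\<bar> + 2 * high_norm / 9))
      + 2 * (\<eta> * (M 1 * \<bar>d 1\<bar> * (high_norm / 9))) + 2 * (\<eta> * (\<bar>M 2\<bar> * \<bar>d 1\<bar> * (high_norm / 16)))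
      + \<eta> * (\<bar>d 1\<bar> * (2 * tail_size * (\<bar>d 1\<bar> + \<bar>d 2\<bar> + 2 * high_norm / 9)))
      + \<eta> * (\<bar>M 2\<bar> * \<bar>d 2\<bar> * (high_norm / 9)) + \<eta> * (\<bar>d 2\<bar> * (2 * tail_size * (\<bar>d 2\<bar> + high_norm / 9)))"
    by (intro add_mono order_refl high_modes_sum[OF assms(1)] i1 i2 i3 i4 i6 i7 i10
        mult_left_mono[OF i5] mult_left_mono[OF i8] mult_left_mono[OF i9] mult_left_mono[OF i1] 
        mult_left_mono[OF i6] mult_left_mono[OF i7]) simp_all
  also have "\<dots> = ks_form \<mu> \<eta> (M 1) (M 2) tail_size (d 1) (d 2) high_norm"
    unfolding ks_form_def by (simp add: field_simps power2_eq_square)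
  finally show ?thesis .
qed

end

text \<open>Differentiation of the squared norm term by term, by the Weierstrass test. The majorant
  has to be uniform on an open interval around r.\<close>

lemma square_sum_deriv:
  fixes d dd :: "real \<Rightarrow> nat \<Rightarrow> real"
  assumes "\<And>t k. t \<in> {s<..<T} \<Longrightarrow> ((\<lambda>t. d t k) has_real_derivative dd t k) (at t)"
    and "\<And>t k. t \<in> {s<..<T} \<Longrightarrow> \<bar>d t k * dd t k\<bar> \<le> B * inverse (real k ^ 2)"
    and "r \<in> {s<..<T}" "sqs (d r)"
  shows "((\<lambda>t. \<Sum>k. (d t k)\<^sup>2) has_real_derivative 2 * (\<Sum>k. d r k * dd r k)) (at r)"
    "summable (\<lambda>k. d r k * dd r k)"
proof -
  have B: "summable (\<lambda>k. B * inverse (real k ^ 2))"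
    by (intro summable_mult inverse_power_summable) simp
  show s: "summable (\<lambda>k. d r k * dd r k)"
    by (rule summable_comparison_test'[OF B, of 0]) (use assms(2)[OF assms(3)] in simp)
  have "((\<lambda>t. \<Sum>k. (d t k)\<^sup>2) has_real_derivative (\<Sum>k. 2 * (d r k * dd r k))) (at r)"
  proof (rule has_field_derivative_series'(2)[where S="{s<..<T}" and x0=r])
    show "((\<lambda>t. (d t n)\<^sup>2) has_real_derivative 2 * (d x n * dd x n)) (at x within {s<..<T})"
      if "x \<in> {s<..<T}" for n x
      using DERIV_power[OF has_field_derivative_at_within[OF assms(1)[OF that, of n]], of 2] by (simp add: mult_ac)
    show "uniformly_convergent_on {s<..<T} (\<lambda>n x. \<Sum>i<n. 2 * (d x i * dd x i))"
    proof (rule Weierstrass_m_test')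
      show "norm (2 * (d x n * dd x n)) \<le> 2 * (B * inverse (real n ^ 2))" if "x \<in> {s<..<T}" for n x
        using assms(2)[OF that, of n] by (simp add: abs_mult)
      show "summable (\<lambda>k. 2 * (B * inverse (real k ^ 2)))" by (intro summable_mult B)
    qed
  qed (use assms(3,4) in \<open>auto simp: sqs_def interior_open\<close>)
  then show "((\<lambda>t. \<Sum>k. (d t k)\<^sup>2) has_real_derivative 2 * (\<Sum>k. d r k * dd r k)) (at r)"
    by (simp add: suminf_mult[OF s])
qed

text \<open>W = |d|^2 / 2 + d_1^2 + \<eta> d_1 d_2 lies between |d|^2 / 4 and 2 |d|^2 because \<eta>
  \<le> 1/2, and it satisfies W' \<le> - (c / 2) W. Taking roots gives the factor 3 and the rate c /
  4.\<close>

lemma contraction: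
  fixes a b :: "real \<Rightarrow> nat \<Rightarrow> real"
  assumes \<mu>: "3/4 \<le> \<mu>" and a: "ks_solution_on \<mu> {0..T} a" and b: "ks_solution_on \<mu> {0..T} b"
    and T: "0 \<le> T" and \<eta>: "0 \<le> \<eta>" "\<eta> \<le> 1/2" and c: "0 < c"
    and pos: "\<And>t. 0 \<le> t \<Longrightarrow> t \<le> T \<Longrightarrow> 0 \<le> a t 1 + b t 1"
    and form: "\<And>t d1 d2 H. 0 \<le> t \<Longrightarrow> t \<le> T \<Longrightarrow> 0 \<le> H \<Longrightarrow>
      ks_form \<mu> \<eta> (a t 1 + b t 1) (a t 2 + b t 2) (l2norm (tail 3 (\<lambda>k. a t k + b t k))) d1 d2 H
        \<le> - c * (d1\<^sup>2 + d2\<^sup>2 + H\<^sup>2)"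
  shows "l2norm (\<lambda>k. a T k - b T k) \<le> 3 * exp (- c / 4 * T) * l2norm (\<lambda>k. a 0 k - b 0 k)"
proof -
  define d where "d t k = a t k - b t k" for t k
  define M where "M t k = a t k + b t k" for t k
  define W where "W t = (l2norm (d t))\<^sup>2 / 2 + (d t 1)\<^sup>2 + \<eta> * (d t 1 * d t 2)" for t
  have sqs: "sqs (d t)" "sqs (M t)" if "t \<in> {0..T}" for t
    unfolding d_def[abs_def] M_def[abs_def]
    by (intro sqs_diff sqs_add ks_solutionD(1)[OF a that] ks_solutionD(1)[OF b that])+
  have zero: "d t 0 = 0" "M t 0 = 0" if "t \<in> {0..T}" for t
    using ks_solutionD(2)[OF a that] ks_solutionD(2)[OF b that] by (simp_all add: d_def M_def)
  have d12: "\<eta> * \<bar>d t 1 * d t 2\<bar> \<le> ((d t 1)\<^sup>2 + (d t 2)\<^sup>2) / 4" for t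
  proof -
    have "\<eta> * \<bar>d t 1 * d t 2\<bar> \<le> 1/2 * \<bar>d t 1 * d t 2\<bar>" using \<eta> by (intro mult_right_mono) auto
    moreover have "2 * (\<bar>d t 1\<bar> * \<bar>d t 2\<bar>) \<le> (d t 1)\<^sup>2 + (d t 2)\<^sup>2"
      using sum_squares_bound[of "\<bar>d t 1\<bar>" "\<bar>d t 2\<bar>"] by simp
    ultimately show ?thesis by (simp add: abs_mult)
  qed
  have low: "(d t 1)\<^sup>2 + (d t 2)\<^sup>2 \<le> (l2norm (d t))\<^sup>2" if "t \<in> {0..T}" for t
    using sum_le_l2norm_sq[OF sqs(1)[OF that], of "{1, 2}"] by simp
  have eta_abs: "\<bar>\<eta> * (d t 1 * d t 2)\<bar> \<le> ((d t 1)\<^sup>2 + (d t 2)\<^sup>2) / 4" for t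
    using d12[of t] \<eta> by (simp add: abs_mult)
  have le4: "N \<le> 4 * (N / 2 + x + e)" if "x + y \<le> N" "\<bar>e\<bar> \<le> (x + y) / 4" "0 \<le> x" for N x y e :: real
    using that by argo
  have W_low: "(l2norm (d t))\<^sup>2 \<le> 4 * W t" if "t \<in> {0..T}" for t
    unfolding W_def by (rule le4[OF low[OF that] eta_abs]) simp
  have le2: "N / 2 + x + e \<le> 2 * S" if "N \<le> S" "x + y \<le> S" "\<bar>e\<bar> \<le> (x + y) / 4" "0 \<le> x" "0 \<le> y" for N x y e S :: real
    using that by argo
  have W_up: "W t \<le> 2 * S" if "t \<in> {0..T}" "(l2norm (d t))\<^sup>2 \<le> S" "(d t 1)\<^sup>2 + (d t 2)\<^sup>2 \<le> S" for t S
    unfolding W_def by (rule le2[OF that(2,3) eta_abs]) auto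
  have "W T \<le> exp (- c / 2 * (T - 0)) * W 0"
  proof (rule exp_decay[OF T])
    show "continuous_on {0..T} W"
      unfolding W_def d_def
      by (intro continuous_intros ks_solution_continuous(3)[OF a b] ks_solution_continuous(2)[OF a]
          ks_solution_continuous(2)[OF b]) simp
    fix r assume r: "0 < r" "r < T"
    define dd where "dd t k = (if k = 0 then 0 else ks_eig \<mu> k * d t k + ks_bil (M t) (d t) k)" for t k
    \<comment> \<open>Smoothing from time r / 2 on gives uniform decay on a whole neighbourhood of
      r.\<close>
    obtain Ca where Ca: "0 \<le> Ca" "\<And>t k. r / 2 \<le> t \<Longrightarrow> t \<le> T \<Longrightarrow> \<bar>a t k\<bar> \<le> Ca / real k ^ 3"
      "\<And>t. 0 \<le> t \<Longrightarrow> t \<le> T \<Longrightarrow> l2norm (a t) \<le> Ca" using smoothing[OF \<mu> a, of "r/2"] r by auto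
    obtain Cb where Cb: "0 \<le> Cb" "\<And>t k. r / 2 \<le> t \<Longrightarrow> t \<le> T \<Longrightarrow> \<bar>b t k\<bar> \<le> Cb / real k ^ 3"
      "\<And>t. 0 \<le> t \<Longrightarrow> t \<le> T \<Longrightarrow> l2norm (b t) \<le> Cb" using smoothing[OF \<mu> b, of "r/2"] r by auto
    define C where "C = Ca + Cb"
    have C0: "0 \<le> C" using Ca Cb by (simp add: C_def)
    have dC: "\<bar>d t k\<bar> \<le> C / real k ^ 3" if "r / 2 \<le> t" "t \<le> T" for t k
      using Ca(2)[OF that, of k] Cb(2)[OF that, of k] by (simp add: d_def C_def add_divide_distrib)
    have nC: "l2norm (d t) \<le> C" "l2norm (M t) \<le> C" if "r / 2 \<le> t" "t \<le> T" for t
    proof -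
      have t: "t \<in> {0..T}" "0 \<le> t" using that r by auto
      note s = ks_solutionD(1)[OF a t(1)] ks_solutionD(1)[OF b t(1)]
      show "l2norm (d t) \<le> C" "l2norm (M t) \<le> C"
        using l2norm_diff_triangle[OF s] l2norm_triangle[OF s] Ca(3)[OF t(2) that(2)] Cb(3)[OF t(2) that(2)]
        by (simp_all add: d_def[abs_def] M_def[abs_def] C_def)
    qed
    have deriv: "((\<lambda>t. d t k) has_real_derivative dd t k) (at t)" if t: "t \<in> {r/2<..<T}" for t k
    proof (cases "k = 0")
      case True
      have "\<forall>\<^sub>F s in nhds t. s \<in> {0<..<T}"
        by (rule eventually_nhds_in_open) (use t r in auto)
      then have "\<forall>\<^sub>F s in nhds t. d s k = 0" by eventually_elim (use zero(1) True in auto)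
      then show ?thesis using True DERIV_cong_ev[of t t "\<lambda>s. d s k" "\<lambda>s. 0"] by (simp add: dd_def)
    next
      case False
      have ti: "t \<in> interior {0..T}" "t \<in> {0..T}" using t r by auto
      have "ks_bil (a t) (a t) k - ks_bil (b t) (b t) k = ks_bil (M t) (d t) k"
        unfolding M_def[abs_def] d_def[abs_def]
        by (rule ks_bil_diff[OF ks_solutionD(1)[OF a ti(2)] ks_solutionD(1)[OF b ti(2)]])
      then have "(ks_eig \<mu> k * a t k + ks_bil (a t) (a t) k) - (ks_eig \<mu> k * b t k + ks_bil (b t) (b t) k) = dd t k"
        using False by (simp add: dd_def d_def algebra_simps)
      moreover have "((\<lambda>t. d t k) has_real_derivative
          (ks_eig \<mu> k * a t k + ks_bil (a t) (a t) k) - (ks_eig \<mu> k * b t k + ks_bil (b t) (b t) k)) (at t)"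
        unfolding d_def
        by (intro DERIV_diff ks_solution_deriv_interior[OF a ti(1)] ks_solution_deriv_interior[OF b ti(1)])
          (use False in auto)
      ultimately show ?thesis by simp
    qed
    define B where "B = C * ((1 + \<bar>\<mu>\<bar>) * C + 3 * C\<^sup>2)"
    have dom: "\<bar>d t k * dd t k\<bar> \<le> B * inverse (real k ^ 2)" if t: "t \<in> {r/2<..<T}" for t k
    proof (cases "k = 0")
      case False
      have tt: "r / 2 \<le> t" "t \<le> T" "t \<in> {0..T}" using t r by auto
      have "(real k)\<^sup>2 \<le> real k ^ 4" using False by (intro power_increasing) auto
      then have "\<bar>ks_eig \<mu> k\<bar> \<le> (1 + \<bar>\<mu>\<bar>) * real k ^ 4"
      proof -
        have "ks_eig \<mu> k = (real k)\<^sup>2 - \<mu> * real k ^ 4" by (simp add: ks_eig_def algebra_simps flip: power_add)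
        then have "\<bar>ks_eig \<mu> k\<bar> \<le> (real k)\<^sup>2 + \<bar>\<mu>\<bar> * real k ^ 4"
          using abs_triangle_ineq4[of "(real k)\<^sup>2" "\<mu> * real k ^ 4"] by (simp add: abs_mult)
        then show ?thesis using \<open>(real k)\<^sup>2 \<le> real k ^ 4\<close> by (simp add: algebra_simps)
      qed
      then have "\<bar>ks_eig \<mu> k\<bar> * \<bar>d t k\<bar> \<le> ((1 + \<bar>\<mu>\<bar>) * real k ^ 4) * (C / real k ^ 3)"
        by (intro mult_mono dC tt) auto
      also have "\<dots> = (1 + \<bar>\<mu>\<bar>) * C * real k" using False by (simp add: power3_eq_cube power4_eq_xxxx)
      finally have 1: "\<bar>ks_eig \<mu> k * d t k\<bar> \<le> (1 + \<bar>\<mu>\<bar>) * C * real k" by (simp add: abs_mult)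
      have "l2norm (M t) * l2norm (d t) \<le> C * C"
        by (intro mult_mono nC tt C0 l2norm_nonneg sqs)
      then have "3 * real k * (l2norm (M t) * l2norm (d t)) \<le> 3 * real k * (C * C)" by (intro mult_left_mono) auto
      then have 2: "\<bar>ks_bil (M t) (d t) k\<bar> \<le> 3 * C\<^sup>2 * real k"
        using ks_bil_bound[OF sqs(2)[OF tt(3)] sqs(1)[OF tt(3)], of k] by (simp add: power2_eq_square mult_ac)
      have "\<bar>dd t k\<bar> \<le> ((1 + \<bar>\<mu>\<bar>) * C + 3 * C\<^sup>2) * real k"
        using 1 2 False abs_triangle_ineq[of "ks_eig \<mu> k * d t k" "ks_bil (M t) (d t) k"]
        by (simp add: dd_def algebra_simps)
      then have "\<bar>d t k\<bar> * \<bar>dd t k\<bar> \<le> (C / real k ^ 3) * (((1 + \<bar>\<mu>\<bar>) * C + 3 * C\<^sup>2) * real k)"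
        using dC[OF tt(1,2), of k] C0 by (intro mult_mono) auto
      also have "\<dots> = B * inverse (real k ^ 2)"
        using False by (simp add: B_def power2_eq_square power3_eq_cube field_simps)
      finally show ?thesis by (simp add: abs_mult)
    qed (simp add: dd_def)
    have rI: "r \<in> {r/2<..<T}" "r \<in> {0..T}" "r / 2 \<le> r" "r \<le> T" using r by auto
    note sq = square_sum_deriv[OF deriv dom rI(1) sqs(1)[OF rI(2)]]
    define W' where "W' = (\<Sum>k. d r k * dd r k) + 2 * d r 1 * dd r 1 + \<eta> * (dd r 1 * d r 2 + d r 1 * dd r 2)"
    have "((\<lambda>t. (\<Sum>k. (d t k)\<^sup>2) / 2 + (d t 1)\<^sup>2 + \<eta> * (d t 1 * d t 2)) has_real_derivative W') (at r)"
      unfolding W'_def using sq(1) deriv[OF rI(1), of 1] deriv[OF rI(1), of 2]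
      by (auto intro!: derivative_eq_intros simp: algebra_simps)
    then have W': "(W has_real_derivative W') (at r)"
    proof (rule has_field_derivative_transform_within_open[where S="{0<..<T}"])
      show "(\<Sum>k. (d x k)\<^sup>2) / 2 + (d x 1)\<^sup>2 + \<eta> * (d x 1 * d x 2) = W x" if "x \<in> {0<..<T}" for x
        using l2norm_sq[OF sqs(1), of x] that by (simp add: W_def)
    qed (use r in auto)
    let ?H = "l2norm (tail 3 (\<lambda>k. (real k)\<^sup>2 * d r k))"
    define S where "S = (d r 1)\<^sup>2 + (d r 2)\<^sup>2 + ?H\<^sup>2"
    have ctx: "0 \<le> M r 1" "\<And>k. \<bar>d r k\<bar> \<le> C / real k ^ 3"
      using pos[of r] r dC[OF rI(3,4)] by (auto simp: M_def)
    have dd_eq: "(\<lambda>k. d r k * dd r k) = (\<lambda>k. d r k * (ks_eig \<mu> k * d r k + ks_bil (M r) (d r) k))"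
      using zero(1)[OF rI(2)] by (auto simp: dd_def)
    have "W' \<le> ks_form \<mu> \<eta> (M r 1) (M r 2) (l2norm (tail 3 (M r))) (d r 1) (d r 2) ?H"
      using energy_form_le[OF \<mu> sqs(2)[OF rI(2)] zero(2)[OF rI(2)] ctx(1) zero(1)[OF rI(2)] ctx(2) C0
          sq(2)[unfolded dd_eq] \<eta>(1)]
      unfolding W'_def dd_eq by (simp add: dd_def)
    also have "\<dots> \<le> - c * S"
      using form[of r ?H "d r 1" "d r 2"] r
        H_nonneg[OF \<mu> sqs(2)[OF rI(2)] zero(2)[OF rI(2)] ctx(1) zero(1)[OF rI(2)] ctx(2) C0]
      by (simp add: M_def[abs_def] S_def)
    also have "\<dots> \<le> - c / 2 * W r"
    proof -
      have "W r \<le> 2 * S"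
        unfolding S_def
        using l2norm_d_sq[OF \<mu> sqs(2)[OF rI(2)] zero(2)[OF rI(2)] ctx(1) zero(1)[OF rI(2)] ctx(2) C0]
        by (intro W_up[OF rI(2)]) simp_all
      then have "c / 2 * W r \<le> c / 2 * (2 * S)" using c by (intro mult_left_mono) auto
      then show ?thesis by simp
    qed
    finally show "(W has_real_derivative W') (at r) \<and> W' \<le> - c / 2 * W r" using W' by simp
  qed
  also have "\<dots> \<le> exp (- c / 2 * (T - 0)) * (2 * (l2norm (d 0))\<^sup>2)"
    using W_up[of 0 "(l2norm (d 0))\<^sup>2"] low[of 0] T by (intro mult_left_mono) auto
  finally have "(l2norm (d T))\<^sup>2 \<le> 8 * exp (- c / 2 * T) * (l2norm (d 0))\<^sup>2"
    using W_low[of T] T by simp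
  \<comment> \<open>8 = 4 * 2 is rounded up to a perfect square.\<close>
  also have "\<dots> \<le> 9 * exp (- c / 2 * T) * (l2norm (d 0))\<^sup>2" by (intro mult_right_mono) auto
  also have "\<dots> = (3 * exp (- c / 4 * T) * l2norm (d 0))\<^sup>2"
  proof -
    have "(exp (- c / 4 * T))\<^sup>2 = exp (- c / 2 * T)"
      unfolding power2_eq_square exp_add[symmetric] by (rule arg_cong[where f=exp]) (simp add: field_simps)
    then show ?thesis by (simp only: power_mult_distrib) simp
  qed
  finally have "l2norm (d T) \<le> 3 * exp (- c / 4 * T) * l2norm (d 0)"
    by (rule power2_le_imp_le) (use l2norm_nonneg[OF sqs(1)[of 0]] T in simp)
  then show ?thesis by (simp add: d_def[abs_def])
qed

section \<open>Trapping region along the unstable manifold\<close>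

text \<open>In a correlation at lag k one factor always has index above k, so the two series are
  bounded with a tail; only the convolution keeps both full norms.\<close>

lemma ks_bil_bound_tail:
  assumes "sqs a" "sqs b"
  shows "\<bar>ks_bil a b k\<bar> \<le> real k * (l2norm a * l2norm b + l2norm a * l2norm (tail (k + 1) b)
    + l2norm b * l2norm (tail (k + 1) a))"
proof -
  have "\<bar>\<Sum>i. a (i + 1) * b (i + (k + 1))\<bar> \<le> l2norm a * l2norm (tail (k + 1) b)"
    by (rule order_trans[OF abs_suminf_mult_shift[OF assms]])
      (intro mult_right_mono l2norm_tail_le assms l2norm_nonneg sqs_tail)
  moreover have "\<bar>\<Sum>i. b (i + 1) * a (i + (k + 1))\<bar> \<le> l2norm b * l2norm (tail (k + 1) a)"
    by (rule order_trans[OF abs_suminf_mult_shift[OF assms(2,1)]])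
      (intro mult_right_mono l2norm_tail_le assms l2norm_nonneg sqs_tail)
  ultimately have "\<bar>(\<Sum>i. a (i + 1) * b (i + (k + 1))) + (\<Sum>i. b (i + 1) * a (i + (k + 1)))
       - (\<Sum>i = 1..k - 1. a i * b (k - i))\<bar>
      \<le> l2norm a * l2norm b + l2norm a * l2norm (tail (k + 1) b) + l2norm b * l2norm (tail (k + 1) a)"
    using conv_le[OF assms, of k] by linarith
  from mult_left_mono[OF this, of "real k"] show ?thesis
    unfolding ks_bil_def by (simp add: abs_mult)
qed

text \<open>For k \<ge> 4, k^6 \<ge> 64 (k - 1) k (k + 1); the reciprocals of (k - 1) k (k + 1)
  telescope to 1/24 from k = 4 on, and 1/(64 * 24) = 1/1536 < 1/39^2.\<close>

lemma l2norm_tail_inverse_cube: "sqs (tail 4 (\<lambda>k. 1 / real k ^ 3))" "l2norm (tail 4 (\<lambda>k. 1 / real k ^ 3)) \<le> 1/39"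
proof -
  have *: "(\<Sum>k<n. (tail 4 (\<lambda>k. 1 / real k ^ 3) k)\<^sup>2) \<le> (1/39)\<^sup>2" for n
  proof -
    have "(\<Sum>k<m + 4. (tail 4 (\<lambda>k. 1 / real k ^ 3) k)\<^sup>2)
        \<le> 1/1536 - 1 / (128 * ((real m + 3) * (real m + 4)))" for m
    proof (induction m)
      case 0 then show ?case by (simp add: tail_apply eval_nat_numeral)
    next
      case (Suc m)
      let ?r = "real m"
      have "64 * ((?r + 3) * (?r + 4) * (?r + 5)) \<le> (?r + 4) ^ 3 * (?r + 4) ^ 3"
      proof (rule mult_mono)
        show "64 \<le> (?r + 4) ^ 3" using power_mono[of 4 "?r + 4" 3] by simp
        show "(?r + 3) * (?r + 4) * (?r + 5) \<le> (?r + 4) ^ 3"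
          by (simp add: power3_eq_cube algebra_simps)
      qed auto
      then have "1 / ((?r + 4) ^ 3 * (?r + 4) ^ 3) \<le> 1 / (64 * ((?r + 3) * (?r + 4) * (?r + 5)))"
        by (intro divide_left_mono mult_pos_pos) auto
      also have "\<dots> = 1 / (128 * ((?r + 3) * (?r + 4))) - 1 / (128 * ((?r + 4) * (?r + 5)))"
      proof -
        have "?r + 3 > 0" "?r + 4 > 0" "?r + 5 > 0" by auto
        then show ?thesis by (simp add: divide_simps)
      qed
      finally have "1 / ((?r + 4) ^ 3 * (?r + 4) ^ 3) \<le>
        1 / (128 * ((?r + 3) * (?r + 4))) - 1 / (128 * ((?r + 4) * (?r + 5)))" .
      moreover have "(tail 4 (\<lambda>k. 1 / real k ^ 3) (m + 4))\<^sup>2 = 1 / ((?r + 4) ^ 3 * (?r + 4) ^ 3)"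
        by (simp add: tail_apply power_divide power2_eq_square)
      moreover have "(\<Sum>k<Suc m + 4. (tail 4 (\<lambda>k. 1 / real k ^ 3) k)\<^sup>2)
        = (\<Sum>k<m + 4. (tail 4 (\<lambda>k. 1 / real k ^ 3) k)\<^sup>2) + (tail 4 (\<lambda>k. 1 / real k ^ 3) (m + 4))\<^sup>2"
        by (simp only: add_Suc sum.lessThan_Suc)
      moreover have e: "real (Suc m) + 3 = ?r + 4" "real (Suc m) + 4 = ?r + 5" by simp_all
      ultimately show ?case using Suc.IH unfolding e by linarith
    qed
    moreover have "(\<Sum>k<n. (tail 4 (\<lambda>k. 1 / real k ^ 3) k)\<^sup>2) \<le> (\<Sum>k<n + 4. (tail 4 (\<lambda>k. 1 / real k ^ 3) k)\<^sup>2)"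
      by (intro sum_mono2) auto
    moreover have "0 \<le> 1 / (128 * ((real n + 3) * (real n + 4)))" by simp
    moreover have "(1/1536 :: real) \<le> (1/39)\<^sup>2" by (simp add: power2_eq_square)
    ultimately show ?thesis by (smt (verit))
  qed
  show "sqs (tail 4 (\<lambda>k. 1 / real k ^ 3))" "l2norm (tail 4 (\<lambda>k. 1 / real k ^ 3)) \<le> 1/39"
    by (rule l2norm_leI[OF *]; simp)+
qed

lemma l2norm_tail4_le:
  assumes "\<And>k. 4 \<le> k \<Longrightarrow> \<bar>a k\<bar> \<le> B * (1 / real k ^ 3)" "0 \<le> B"
  shows "l2norm (tail 4 a) \<le> B / 39"
proof -
  have "l2norm (tail 4 a) \<le> l2norm (\<lambda>k. B * tail 4 (\<lambda>k. 1 / real k ^ 3) k)"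
    by (rule l2norm_mono[OF sqs_cmult[OF l2norm_tail_inverse_cube(1)]])
      (use assms in \<open>auto simp: tail_apply abs_mult\<close>)
  also have "\<dots> = B * l2norm (tail 4 (\<lambda>k. 1 / real k ^ 3))"
    using l2norm_cmult[OF l2norm_tail_inverse_cube(1), of B] assms(2) by simp
  also have "\<dots> \<le> B * (1/39)" by (intro mult_left_mono l2norm_tail_inverse_cube assms)
  finally show ?thesis by simp
qed

lemma tail_tail: "tail m (tail n a) = tail (max m n) a"
  by (auto simp: tail_apply fun_eq_iff)

section \<open>Low components of the quadratic term, expanded in a dominant first mode\<close>

context
  fixes a :: "nat \<Rightarrow> real"
  assumes a: "sqs a" "a 0 = 0"
begin

lemma ks_bil_first_mode:
  "ks_bil a a k = a 1 * ks_bil (unit_seq 1) a k + a 1 * ks_bil (unit_seq 1) (tail 2 a) k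
    + ks_bil (tail 2 a) (tail 2 a) k"
proof -
  have u: "sqs (\<lambda>k. a 1 * unit_seq 1 k)" by (intro sqs_cmult sqs_unit_seq)
  have b: "sqs (tail 2 a)" by (rule sqs_tail[OF a(1)])
  have e: "a = (\<lambda>k. a 1 * unit_seq 1 k + tail 2 a k)"
  proof
    fix k :: nat
    consider "k = 0" | "k = 1" | "2 \<le> k" by linarith
    then show "a k = a 1 * unit_seq 1 k + tail 2 a k"
      by cases (use a(2) in \<open>auto simp: unit_seq_def tail_apply\<close>)
  qed
  have *: "ks_bil a c k = a 1 * ks_bil (unit_seq 1) c k + ks_bil (tail 2 a) c k" if c: "sqs c" for c
    using arg_cong[OF e, of "\<lambda>a. ks_bil a c k"] ks_bil_add_left[OF u b c, of k]
      ks_bil_cmult_left[OF sqs_unit_seq c] by simp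
  show ?thesis
    using *[OF a(1)] *[OF b] ks_bil_commute[of "tail 2 a" a k] by simp
qed

lemma suminf_tail2:
  "(\<Sum>i. tail 2 a (i + 1) * tail 2 a (i + (k + 1))) = (\<Sum>i. a (i + 2) * a (i + (k + 2)))"
proof -
  have b: "sqs (tail 2 a)" by (rule sqs_tail[OF a(1)])
  have "(\<Sum>i. tail 2 a (i + 1) * tail 2 a (i + (k + 1))) =
      (\<Sum>i. tail 2 a (i + 1 + 1) * tail 2 a (i + 1 + (k + 1))) + (\<Sum>i<1. tail 2 a (i + 1) * tail 2 a (i + (k + 1)))"
    using suminf_split_initial_segment[OF sqs_mult_shift[OF b b, of 1 "k + 1"], of 1] by simp
  also have "(\<lambda>i. tail 2 a (i + 1 + 1) * tail 2 a (i + 1 + (k + 1))) = (\<lambda>i. a (i + 2) * a (i + (k + 2)))"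
    by (auto simp: tail_apply fun_eq_iff)
  also have "(\<Sum>i<1. tail 2 a (i + 1) * tail 2 a (i + (k + 1))) = 0" by (simp add: tail_apply)
  finally show ?thesis by simp
qed

text \<open>2 a_1 a_2 is the coupling that saturates the growth of a_1. The rest of the correlation
  at lag 1 does not contain a_1 and becomes O(a_1^5) once the modes are slaved.\<close>

lemma ks_bil_1: "\<bar>ks_bil a a 1 - 2 * a 1 * a 2\<bar> \<le> 2 * \<bar>a 2\<bar> * \<bar>a 3\<bar> + 2 * l2norm (tail 3 a) * l2norm (tail 4 a)"
proof -
  have "(\<Sum>i. a (i + 2) * a (i + (1 + 2))) = (\<Sum>i. a (i + 3) * a (i + 4)) + a 2 * a 3"
    using suminf_split_initial_segment[OF sqs_mult_shift[OF a(1) a(1), of 2 3], of 1]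
    by (simp add: numeral_eq_Suc)
  then have "ks_bil a a 1 - 2 * a 1 * a 2 = 2 * (a 2 * a 3) + 2 * (\<Sum>i. a (i + 3) * a (i + 4))"
    unfolding ks_bil_first_mode[of 1] ks_bil_def[of "tail 2 a"] suminf_tail2
    by (simp add: ks_bil_unit_seq tail_apply numeral_2_eq_2)
  moreover have "\<bar>\<Sum>i. a (i + 3) * a (i + 4)\<bar> \<le> l2norm (tail 3 a) * l2norm (tail 4 a)"
    by (rule abs_suminf_mult_shift[OF a(1) a(1)])
  moreover have "\<bar>2 * (a 2 * a 3)\<bar> = 2 * \<bar>a 2\<bar> * \<bar>a 3\<bar>" by (simp add: abs_mult)
  ultimately show ?thesis by linarith
qed

text \<open>The forcing - 2 a_1^2 is the convolution of the first mode with itself; it drives a_2 to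
  negative values.\<close>

lemma ks_bil_2: "\<bar>ks_bil a a 2 + 2 * (a 1)\<^sup>2\<bar> \<le> 4 * a 1 * \<bar>a 3\<bar> + 4 * l2norm (tail 2 a) * l2norm (tail 4 a)"
  if "0 \<le> a 1"
proof -
  have "ks_bil a a 2 + 2 * (a 1)\<^sup>2 = 4 * a 1 * a 3 + 4 * (\<Sum>i. a (i + 2) * a (i + (2 + 2)))"
    unfolding ks_bil_first_mode[of 2] ks_bil_def[of "tail 2 a"] suminf_tail2
    by (simp add: ks_bil_unit_seq tail_apply power2_eq_square algebra_simps numeral_3_eq_3)
  moreover have "\<bar>\<Sum>i. a (i + 2) * a (i + (2 + 2))\<bar> \<le> l2norm (tail 2 a) * l2norm (tail 4 a)"
    using abs_suminf_mult_shift[OF a(1) a(1), of 2 4] by simp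
  moreover have "\<bar>4 * a 1 * a 3\<bar> = 4 * a 1 * \<bar>a 3\<bar>" using that by (simp add: abs_mult)
  ultimately show ?thesis by linarith
qed

text \<open>The dominant term is - 6 a_1 a_2; with a_2 of order a_1^2 this makes a_3 cubic.\<close>

lemma ks_bil_3: "\<bar>ks_bil a a 3\<bar> \<le> 6 * a 1 * (\<bar>a 2\<bar> + l2norm (tail 4 a)) + 6 * l2norm (tail 2 a) * l2norm (tail 4 a)"
  if "0 \<le> a 1"
proof -
  have c: "(\<Sum>i = 1..3 - 1. tail 2 a i * tail 2 a (3 - i)) = 0"
  proof (rule sum.neutral, rule ballI)
    fix i :: nat assume "i \<in> {1..3 - 1}"
    then have "i = 1 \<or> i = 2" by auto
    then show "tail 2 a i * tail 2 a (3 - i) = 0" by (auto simp: tail_apply)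
  qed
  have "ks_bil a a 3 = 6 * a 1 * a 4 - 6 * a 1 * a 2 + 6 * (\<Sum>i. a (i + 2) * a (i + (3 + 2)))"
    unfolding ks_bil_first_mode[of 3] ks_bil_def[of "tail 2 a"] suminf_tail2 c
    by (simp add: ks_bil_unit_seq tail_apply algebra_simps)
  moreover have "\<bar>\<Sum>i. a (i + 2) * a (i + (3 + 2))\<bar> \<le> l2norm (tail 2 a) * l2norm (tail 4 a)"
    using abs_suminf_mult_shift[OF a(1) a(1), of 2 5]
      mult_left_mono[OF l2norm_tail_mono[OF a(1), of 4 5] l2norm_nonneg[OF sqs_tail[OF a(1)], of 2]] by simp
  moreover have "\<bar>6 * a 1 * a 4\<bar> \<le> 6 * a 1 * l2norm (tail 4 a)"
    using that mult_left_mono[OF abs_le_l2norm_tail[OF a(1), of 4 4], of "6 * a 1"] by (simp add: abs_mult)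
  moreover have "\<bar>6 * a 1 * a 2\<bar> = 6 * a 1 * \<bar>a 2\<bar>" using that by (simp add: abs_mult)
  ultimately show ?thesis unfolding distrib_left by linarith
qed

text \<open>For k \<ge> 4 the first mode meets only the neighbours k - 1 \<ge> 3 and k + 1, so the
  part linear in a_1 involves only tails from 3 on.\<close>

lemma ks_bil_ge_4: "\<bar>ks_bil a a k\<bar> \<le> real k * (2 * a 1 * (l2norm (tail 3 a) + l2norm (tail 4 a))
    + (l2norm (tail 2 a))\<^sup>2 + 2 * l2norm (tail 2 a) * l2norm (tail 4 a))"
  if "0 \<le> a 1" "4 \<le> k"
proof -
  have b: "sqs (tail 2 a)" by (rule sqs_tail[OF a(1)])
  have "ks_bil a a k = real k * (2 * a 1 * (a (k + 1) - a (k - 1))) + ks_bil (tail 2 a) (tail 2 a) k"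
    unfolding ks_bil_first_mode[of k] using that by (simp add: ks_bil_unit_seq tail_apply algebra_simps)
  moreover have "\<bar>2 * a 1 * (a (k + 1) - a (k - 1))\<bar> \<le> 2 * a 1 * (l2norm (tail 3 a) + l2norm (tail 4 a))"
  proof -
    have "3 \<le> k - 1" using that by simp
    then have "\<bar>a (k + 1) - a (k - 1)\<bar> \<le> l2norm (tail 3 a) + l2norm (tail 4 a)"
      using abs_le_l2norm_tail[OF a(1), of 4 "k + 1"] abs_le_l2norm_tail[OF a(1), of 3 "k - 1"] that
        abs_triangle_ineq4[of "a (k + 1)" "a (k - 1)"] by simp
    then have "2 * a 1 * \<bar>a (k + 1) - a (k - 1)\<bar> \<le> 2 * a 1 * (l2norm (tail 3 a) + l2norm (tail 4 a))"
      using that by (intro mult_left_mono) auto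
    then show ?thesis using that by (simp add: abs_mult)
  qed
  moreover have "\<bar>ks_bil (tail 2 a) (tail 2 a) k\<bar> \<le>
      real k * ((l2norm (tail 2 a))\<^sup>2 + 2 * l2norm (tail 2 a) * l2norm (tail 4 a))"
  proof -
    have "l2norm (tail 2 a) * l2norm (tail (k + 1) (tail 2 a)) \<le> l2norm (tail 2 a) * l2norm (tail 4 a)"
      using that by (intro mult_left_mono l2norm_nonneg b) (simp add: tail_tail l2norm_tail_mono[OF a(1)])
    then have "real k * (l2norm (tail 2 a) * l2norm (tail 2 a) + l2norm (tail 2 a) * l2norm (tail (k + 1) (tail 2 a))
        + l2norm (tail 2 a) * l2norm (tail (k + 1) (tail 2 a)))
        \<le> real k * ((l2norm (tail 2 a))\<^sup>2 + 2 * l2norm (tail 2 a) * l2norm (tail 4 a))"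
      by (intro mult_left_mono) (auto simp: power2_eq_square)
    then show ?thesis using ks_bil_bound_tail[OF b b, of k] by linarith
  qed
  ultimately show ?thesis
  proof -
    assume 1: "ks_bil a a k = real k * (2 * a 1 * (a (k + 1) - a (k - 1))) + ks_bil (tail 2 a) (tail 2 a) k"
      and 2: "\<bar>2 * a 1 * (a (k + 1) - a (k - 1))\<bar> \<le> 2 * a 1 * (l2norm (tail 3 a) + l2norm (tail 4 a))"
      and 3: "\<bar>ks_bil (tail 2 a) (tail 2 a) k\<bar> \<le>
      real k * ((l2norm (tail 2 a))\<^sup>2 + 2 * l2norm (tail 2 a) * l2norm (tail 4 a))"
    have "\<bar>real k * (2 * a 1 * (a (k + 1) - a (k - 1)))\<bar> \<le> real k * (2 * a 1 * (l2norm (tail 3 a) + l2norm (tail 4 a)))"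
      using mult_left_mono[OF 2, of "real k"] by (simp add: abs_mult)
    then have "\<bar>ks_bil a a k\<bar> \<le> real k * (2 * a 1 * (l2norm (tail 3 a) + l2norm (tail 4 a)))
        + real k * ((l2norm (tail 2 a))\<^sup>2 + 2 * l2norm (tail 2 a) * l2norm (tail 4 a))"
      unfolding 1 using 3 by linarith
    then show ?thesis by (simp only: distrib_left add.assoc)
  qed
qed

end

lemma power_Suc_le: "0 < x \<Longrightarrow> x \<le> X \<Longrightarrow> x ^ Suc n \<le> X * x ^ n" for x X :: real
  by (simp add: mult_right_mono)

lemma mult_power3: "x * x ^ 3 = x ^ 4" for x :: real
  by (simp add: power3_eq_cube power4_eq_xxxx)

lemma sum_squares_scaled:
  fixes u v z :: real
  assumes "\<bar>u\<bar> \<le> p * z" "\<bar>v\<bar> \<le> q * z" "p\<^sup>2 + q\<^sup>2 \<le> r\<^sup>2"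
  shows "u\<^sup>2 + v\<^sup>2 \<le> (r * z)\<^sup>2"
proof -
  have "u\<^sup>2 \<le> p\<^sup>2 * z\<^sup>2" "v\<^sup>2 \<le> q\<^sup>2 * z\<^sup>2"
    using power_mono[OF assms(1) abs_ge_zero, of 2] power_mono[OF assms(2) abs_ge_zero, of 2]
    by (simp_all add: power_mult_distrib)
  moreover have "(p\<^sup>2 + q\<^sup>2) * z\<^sup>2 \<le> r\<^sup>2 * z\<^sup>2" using assms(3) by (rule mult_right_mono) simp
  ultimately show ?thesis unfolding power_mult_distrib distrib_right by linarith
qed

lemma interior_atMost_real: "t < T \<Longrightarrow> t \<in> interior {..T}" for t T :: real
  by (rule interiorI[of "{..<T}"]) auto

section \<open>The cone around the first mode\<close>

lemma cone_l2norm_le: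
  assumes "sqs a" "a 0 = 0" "0 \<le> a 1" "(l2norm (tail 2 a))\<^sup>2 \<le> (a 1)\<^sup>2 / 10"
  shows "l2norm a \<le> 105/100 * a 1"
proof -
  have "(l2norm a)\<^sup>2 = (a 1)\<^sup>2 + (l2norm (tail 2 a))\<^sup>2"
    using l2norm_tail_Suc[OF assms(1), of 0] l2norm_tail_Suc[OF assms(1), of 1] assms(2)
    by (simp add: numeral_2_eq_2)
  also have "\<dots> \<le> 11025/10000 * (a 1)\<^sup>2" using assms(4) zero_le_power2[of "a 1"] by linarith
  also have "\<dots> = (105/100 * a 1)\<^sup>2" by (simp add: power_mult_distrib power2_eq_square)
  finally show ?thesis by (rule power2_le_imp_le) (use assms(3) in simp)
qed

lemma cone_tail2_le:
  assumes "0 \<le> a 1" "(l2norm (tail 2 a))\<^sup>2 \<le> (a 1)\<^sup>2 / 10"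
  shows "l2norm (tail 2 a) \<le> 317/1000 * a 1"
proof -
  have "(l2norm (tail 2 a))\<^sup>2 \<le> 100489/1000000 * (a 1)\<^sup>2"
    using assms(2) zero_le_power2[of "a 1"] by linarith
  also have "\<dots> = (317/1000 * a 1)\<^sup>2" by (simp add: power_mult_distrib power2_eq_square)
  finally show ?thesis by (rule power2_le_imp_le) (use assms(1) in simp)
qed

text \<open>Twice the correlation at lag 1 is at most 2 * 1.05 * 0.317 * a_1^2, below 0.6 a_1 for
  a_1 \<le> 4/5, and the linear term has a favourable sign. This crude rate starts the
  bootstrap.\<close>

lemma cone_growth:
  assumes a: "sqs a" "a 0 = 0" "0 \<le> a 1" "(l2norm (tail 2 a))\<^sup>2 \<le> (a 1)\<^sup>2 / 10" "a 1 \<le> 4/5" "\<mu> < 1"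
  shows "- (6/10) * a 1 \<le> (1 - \<mu>) * a 1 + ks_bil a a 1"
proof -
  have "l2norm (tail 1 a) * l2norm (tail 2 a) \<le> (105/100 * a 1) * (317/1000 * a 1)"
    using cone_l2norm_le[OF a(1-4)] cone_tail2_le[OF a(3,4)] l2norm_nonneg[OF sqs_tail[OF a(1)]]
      l2norm_tail_le[OF a(1), of 1] a(3)
    by (intro mult_mono) auto
  moreover have "\<bar>\<Sum>i. a (i + 1) * a (i + (1 + 1))\<bar> \<le> l2norm (tail 1 a) * l2norm (tail 2 a)"
    using abs_suminf_mult_shift[OF a(1) a(1), of 1 2] by simp
  ultimately have "\<bar>ks_bil a a 1\<bar> \<le> 2 * ((105/100 * a 1) * (317/1000 * a 1))"
    unfolding ks_bil_def by simp
  also have "\<dots> \<le> 6/10 * a 1"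
  proof -
    have "a 1 * a 1 \<le> 4/5 * a 1" using a by (intro mult_right_mono) auto
    then show ?thesis using a(3) by simp
  qed
  finally have "\<bar>ks_bil a a 1\<bar> \<le> 6/10 * a 1" .
  moreover have "0 \<le> (1 - \<mu>) * a 1" using a by simp
  ultimately show ?thesis by linarith
qed

section \<open>Bootstrap for the slaved modes of an orbit that has been in the cone since minus
  infinity\<close>

context
  fixes \<mu> T :: real and a :: "real \<Rightarrow> nat \<Rightarrow> real"
  assumes \<mu>: "3/4 \<le> \<mu>" "\<mu> < 1"
    and sol: "ks_solution_on \<mu> {..T} a"
    and hyp: "\<And>t. t \<le> T \<Longrightarrow> 0 < a t 1 \<and> a t 1 \<le> 4/5 \<and> (l2norm (tail 2 (a t)))\<^sup>2 \<le> (a t 1)\<^sup>2 / 10"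
begin

lemma orbit_sqs: "t \<le> T \<Longrightarrow> sqs (a t)" "t \<le> T \<Longrightarrow> a t 0 = 0"
  using ks_solutionD(1,2)[OF sol] by auto

lemma first_mode_bounds: "t \<le> T \<Longrightarrow> 0 < a t 1" "t \<le> T \<Longrightarrow> a t 1 \<le> 4/5"
  using hyp by auto

lemma first_mode_powers: assumes "t \<le> T" shows "a t 1 ^ 3 \<le> 4/5 * (a t 1)\<^sup>2" "a t 1 ^ 4 \<le> 4/5 * a t 1 ^ 3"
  "a t 1 ^ 5 \<le> 4/5 * a t 1 ^ 4" "a t 1 ^ 6 \<le> 4/5 * a t 1 ^ 5" "0 < a t 1 ^ n"
  using power_Suc_le[OF first_mode_bounds[OF assms], of 2] power_Suc_le[OF first_mode_bounds[OF assms], of 3]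
    power_Suc_le[OF first_mode_bounds[OF assms], of 4] power_Suc_le[OF first_mode_bounds[OF assms], of 5] first_mode_bounds[OF assms]
  by simp_all

lemma orbit_tail_nonneg: "t \<le> T \<Longrightarrow> 0 \<le> l2norm (tail n (a t))"
  by (intro l2norm_nonneg sqs_tail orbit_sqs)

lemma first_mode_deriv: "t < T \<Longrightarrow>
  ((\<lambda>t. a t 1) has_real_derivative (1 - \<mu>) * a t 1 + ks_bil (a t) (a t) 1) (at t)"
  using ks_solution_deriv_interior[OF sol, of t 1] by (simp add: ks_eig_def interior_atMost_real)

lemma first_mode_pow_deriv:
  assumes "t < T"
  shows "((\<lambda>t. a t 1 ^ n) has_real_derivative
    real n * (((1 - \<mu>) * a t 1 + ks_bil (a t) (a t) 1) * a t 1 ^ (n - 1))) (at t)"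
  using DERIV_power[OF first_mode_deriv[OF assms], of n] by (simp add: mult_ac)

lemma first_mode_pow_growth:
  assumes "t < T" "1 \<le> n" "- \<gamma> * a t 1 \<le> (1 - \<mu>) * a t 1 + ks_bil (a t) (a t) 1"
  shows "- (real n * \<gamma>) * a t 1 ^ n \<le> real n * (((1 - \<mu>) * a t 1 + ks_bil (a t) (a t) 1) * a t 1 ^ (n - 1))"
proof -
  have "(- \<gamma> * a t 1) * a t 1 ^ (n - 1) \<le> ((1 - \<mu>) * a t 1 + ks_bil (a t) (a t) 1) * a t 1 ^ (n - 1)"
    using first_mode_bounds(1)[of t] assms by (intro mult_right_mono) auto
  moreover have "(- \<gamma> * a t 1) * a t 1 ^ (n - 1) = - \<gamma> * a t 1 ^ n"
    using assms(2) by (cases n) auto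
  ultimately have "- \<gamma> * a t 1 ^ n \<le> ((1 - \<mu>) * a t 1 + ks_bil (a t) (a t) 1) * a t 1 ^ (n - 1)"
    by linarith
  then have "real n * (- \<gamma> * a t 1 ^ n) \<le> real n * (((1 - \<mu>) * a t 1 + ks_bil (a t) (a t) 1) * a t 1 ^ (n - 1))"
    by (rule mult_left_mono) simp
  then show ?thesis by (simp add: mult_ac)
qed

lemma orbit_l2norm_le: "t \<le> T \<Longrightarrow> l2norm (a t) \<le> 105/100 * a t 1"
  by (rule cone_l2norm_le[OF orbit_sqs]) (use hyp[of t] in auto)

lemma orbit_tail2_le: "t \<le> T \<Longrightarrow> l2norm (tail 2 (a t)) \<le> 317/1000 * a t 1"
  by (rule cone_tail2_le) (use hyp[of t] in auto)

text \<open>If a_1 decays at most at rate \<gamma>, then a_1^n decays at most at rate n \<gamma>,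
  and a mode with damping L forced by C a_1^n follows it with the factor C / (L - n \<gamma>).
  \<open>L\<close> is any lower bound of the damping, so that one rational number serves a range of
  \<mu>.\<close>

lemma mode_slaved:
  assumes k: "2 \<le> k" and n: "1 \<le> n" and C: "0 \<le> C" and L: "L \<le> - ks_eig \<mu> k" "0 < L - real n * \<gamma>" "0 \<le> \<gamma>"
    and N: "\<And>t. t \<le> T \<Longrightarrow> \<bar>ks_bil (a t) (a t) k\<bar> \<le> C * a t 1 ^ n"
    and G: "\<And>t. t \<le> T \<Longrightarrow> - \<gamma> * a t 1 \<le> (1 - \<mu>) * a t 1 + ks_bil (a t) (a t) 1"
    and t: "t \<le> T"
  shows "\<bar>a t k\<bar> \<le> C / (L - real n * \<gamma>) * a t 1 ^ n"
proof -
  have "0 \<le> real n * \<gamma>" using L by simp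
  then have pos: "0 < - ks_eig \<mu> k" "0 < - ks_eig \<mu> k + - (real n * \<gamma>)" using L by linarith+
  have "\<bar>a t k\<bar> \<le> C * a t 1 ^ n / (- ks_eig \<mu> k + - (real n * \<gamma>))"
  proof (rule slaving_abs[OF pos(1) _ _ _ _ _ _ pos(2) t C])
    show "continuous_on {..T} (\<lambda>t. a t k)" "continuous_on {..T} (\<lambda>t. a t 1 ^ n)"
      by (intro continuous_intros ks_solution_continuous(2)[OF sol])+
    show "\<bar>a t k\<bar> \<le> 105/100 * (4/5)" if "t \<le> T" for t
      using abs_le_l2norm[OF orbit_sqs(1)[OF that], of k] orbit_l2norm_le[OF that] first_mode_bounds[OF that] by linarith
    show "\<bar>a t 1 ^ n\<bar> \<le> 1" if "t \<le> T" for t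
      using first_mode_bounds[OF that] by (simp add: power_le_one)
    show "((\<lambda>t. a t k) has_real_derivative - (- ks_eig \<mu> k) * a r k + ks_bil (a r) (a r) k) (at r)
        \<and> \<bar>ks_bil (a r) (a r) k\<bar> \<le> C * a r 1 ^ n" if "r < T" for r
      using ks_solution_deriv_interior[OF sol, of r k] N[of r] that k by (simp add: interior_atMost_real)
    show "((\<lambda>t. a t 1 ^ n) has_real_derivative
        real n * (((1 - \<mu>) * a r 1 + ks_bil (a r) (a r) 1) * a r 1 ^ (n - 1))) (at r) \<and>
        - (real n * \<gamma>) * a r 1 ^ n \<le> real n * (((1 - \<mu>) * a r 1 + ks_bil (a r) (a r) 1) * a r 1 ^ (n - 1))"
      if "r < T" for r
      using first_mode_pow_deriv[OF that] first_mode_pow_growth[OF that n G] that by simp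
  qed
  also have "\<dots> \<le> C * a t 1 ^ n / (L - real n * \<gamma>)"
    using L pos C first_mode_bounds(1)[OF t] by (intro divide_left_mono mult_pos_pos mult_nonneg_nonneg) auto
  finally show ?thesis by simp
qed

lemma first_mode_growth: "t \<le> T \<Longrightarrow> - (6/10) * a t 1 \<le> (1 - \<mu>) * a t 1 + ks_bil (a t) (a t) 1"
  by (rule cone_growth[OF orbit_sqs]) (use hyp[of t] \<mu> in auto)

lemma eig_high: "4 \<le> k \<Longrightarrow> 11/16 * real k ^ 4 \<le> - ks_eig \<mu> k"
proof -
  assume k: "4 \<le> k"
  have "4\<^sup>2 \<le> (real k)\<^sup>2" using k by (intro power_mono) auto
  then have "16 * (real k)\<^sup>2 \<le> (real k)\<^sup>2 * (real k)\<^sup>2" by (intro mult_right_mono) auto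
  then show ?thesis using ks_eig_le(3)[OF \<mu>(1), of k] by (simp flip: power_add)
qed

text \<open>0.68 lies below 11/16 by 0.0075, and 0.0075 * 4^4 = 1.92 covers n * 6/10 for n \<le> 3.
  Each mode is then bounded by a multiple of k^-3, and \<open>l2norm_tail4_le\<close> sums these
  bounds.\<close>

lemma tail4_slaved:
  assumes n: "n = 2 \<or> n = 3" and C: "0 \<le> C"
    and N: "\<And>t k. t \<le> T \<Longrightarrow> 4 \<le> k \<Longrightarrow> \<bar>ks_bil (a t) (a t) k\<bar> \<le> real k * (C * a t 1 ^ n)"
    and t: "t \<le> T"
  shows "l2norm (tail 4 (a t)) \<le> C * (1000/680) / 39 * a t 1 ^ n"
proof -
  have "\<bar>a t k\<bar> \<le> C * (1000/680) * a t 1 ^ n * (1 / real k ^ 3)" if k: "4 \<le> k" for k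
  proof -
    have k4: "256 \<le> real k ^ 4" using power_mono[of 4 "real k" 4] k by simp
    have L: "680/1000 * real k ^ 4 + real n * (6/10) \<le> 11/16 * real k ^ 4" using n k4 by auto
    have "\<bar>a t k\<bar> \<le> real k * C / ((680/1000 * real k ^ 4 + real n * (6/10)) - real n * (6/10)) * a t 1 ^ n"
    proof (rule mode_slaved[OF _ _ _ _ _ _ _ first_mode_growth t])
      show "680/1000 * real k ^ 4 + real n * (6/10) \<le> - ks_eig \<mu> k" using L eig_high[OF k] by linarith
      show "\<bar>ks_bil (a t) (a t) k\<bar> \<le> real k * C * a t 1 ^ n" if "t \<le> T" for t
        using N[OF that k] by (simp add: mult.assoc)
    qed (use n k C k4 in auto)
    also have "real k * C / ((680/1000 * real k ^ 4 + real n * (6/10)) - real n * (6/10)) * a t 1 ^ n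
        = C * (1000/680) * a t 1 ^ n * (1 / real k ^ 3)"
      using k by (simp add: field_simps power3_eq_cube power4_eq_xxxx)
    finally show ?thesis .
  qed
  from l2norm_tail4_le[OF this] show ?thesis using C first_mode_bounds(1)[OF t] by (simp add: mult_ac)
qed

lemma eig2: "- ks_eig \<mu> 2 = 4 * (4 * \<mu> - 1)" and eig3: "207/4 \<le> - ks_eig \<mu> 3"
  using \<mu> by (simp_all add: ks_eig_def)

text \<open>First round, from the cone alone: the forcing constants are 1.05^2 + 2 * 1.05 * 0.317
  \<le> 1.77 for k \<ge> 4 and 2 + 4 * 1.05 * 0.317 \<le> 3.332 for k = 2, the latter divided by 8 -
  1.2. Inserting both results into \<open>ks_bil_3\<close> makes a_3 cubic.\<close>

lemma coarse_mode_bounds: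
  assumes t: "t \<le> T"
  shows "l2norm (tail 4 (a t)) \<le> 67/1000 * (a t 1)\<^sup>2" "\<bar>a t 2\<bar> \<le> 49/100 * (a t 1)\<^sup>2"
    "\<bar>a t 3\<bar> \<le> 7/100 * a t 1 ^ 3"
proof -
  have t4: "l2norm (tail 4 (a t)) \<le> 67/1000 * (a t 1)\<^sup>2" if t: "t \<le> T" for t
  proof -
    have "l2norm (tail 4 (a t)) \<le> 177/100 * (1000/680) / 39 * (a t 1)\<^sup>2"
    proof (rule tail4_slaved[OF _ _ _ t])
      fix t and k :: nat assume t: "t \<le> T" and k: "4 \<le> k"
      note s = orbit_sqs(1)[OF t]
      have 1: "l2norm (a t) * l2norm (a t) \<le> (105/100 * a t 1) * (105/100 * a t 1)"
        using orbit_l2norm_le[OF t] l2norm_nonneg[OF s] first_mode_bounds[OF t] by (intro mult_mono) auto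
      have "l2norm (tail (k + 1) (a t)) \<le> l2norm (tail 2 (a t))" using k by (intro l2norm_tail_mono s) auto
      then have 2: "l2norm (a t) * l2norm (tail (k + 1) (a t)) \<le> (105/100 * a t 1) * (317/1000 * a t 1)"
        using orbit_l2norm_le[OF t] l2norm_nonneg[OF s] orbit_tail2_le[OF t] orbit_tail_nonneg[OF t] first_mode_bounds[OF t]
        by (intro mult_mono) auto
      have "l2norm (a t) * l2norm (a t) + l2norm (a t) * l2norm (tail (k + 1) (a t))
          + l2norm (a t) * l2norm (tail (k + 1) (a t)) \<le> 177/100 * (a t 1)\<^sup>2"
      proof -
        have "(105/100 * a t 1) * (105/100 * a t 1) = 11025/10000 * (a t 1)\<^sup>2"
          "(105/100 * a t 1) * (317/1000 * a t 1) = 33285/100000 * (a t 1)\<^sup>2"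
          by (simp_all add: power2_eq_square)
        then show ?thesis using 1 2 zero_le_power2[of "a t 1"] by linarith
      qed
      then have "real k * (l2norm (a t) * l2norm (a t) + l2norm (a t) * l2norm (tail (k + 1) (a t))
          + l2norm (a t) * l2norm (tail (k + 1) (a t))) \<le> real k * (177/100 * (a t 1)\<^sup>2)"
        by (intro mult_left_mono) auto
      then show "\<bar>ks_bil (a t) (a t) k\<bar> \<le> real k * (177/100 * (a t 1)\<^sup>2)"
        using ks_bil_bound_tail[OF s s, of k] by linarith
    qed auto
    also have "\<dots> \<le> 67/1000 * (a t 1)\<^sup>2" using first_mode_powers(5)[OF t, of 2] by simp
    finally show ?thesis .
  qed
  then show "l2norm (tail 4 (a t)) \<le> 67/1000 * (a t 1)\<^sup>2" using t by blast
  have a2: "\<bar>a t 2\<bar> \<le> 49/100 * (a t 1)\<^sup>2" if t: "t \<le> T" for t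
  proof -
    have "\<bar>a t 2\<bar> \<le> (3332/1000) / (8 - real 2 * (6/10)) * (a t 1)\<^sup>2"
    proof (rule mode_slaved[OF _ _ _ _ _ _ _ first_mode_growth t])
      fix t assume t: "t \<le> T"
      note s = orbit_sqs(1)[OF t]
      have "l2norm (tail 1 (a t)) * l2norm (tail 3 (a t)) \<le> (105/100 * a t 1) * (317/1000 * a t 1)"
        using orbit_l2norm_le[OF t] l2norm_tail_le[OF s, of 1] orbit_tail2_le[OF t] orbit_tail_nonneg[OF t] first_mode_bounds[OF t]
          l2norm_tail_mono[OF s, of 2 3] by (intro mult_mono) auto
      moreover have "\<bar>\<Sum>i. a t (i + 1) * a t (i + (2 + 1))\<bar> \<le> l2norm (tail 1 (a t)) * l2norm (tail 3 (a t))"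
        using abs_suminf_mult_shift[OF s s, of 1 3] by simp
      moreover have "ks_bil (a t) (a t) 2 = 4 * (\<Sum>i. a t (i + 1) * a t (i + (2 + 1))) - 2 * (a t 1)\<^sup>2"
        unfolding ks_bil_def by (simp add: power2_eq_square)
      ultimately show "\<bar>ks_bil (a t) (a t) 2\<bar> \<le> 3332/1000 * (a t 1)\<^sup>2"
        using zero_le_square[of "a t 1"] by (simp add: power2_eq_square abs_le_iff)
    qed (use \<mu> in \<open>simp_all add: eig2\<close>)
    then show ?thesis by simp
  qed
  then show "\<bar>a t 2\<bar> \<le> 49/100 * (a t 1)\<^sup>2" using t by blast
  have "\<bar>a t 3\<bar> \<le> (347/100) / (207/4 - real 3 * (6/10)) * a t 1 ^ 3"
  proof (rule mode_slaved[OF _ _ _ _ _ _ _ first_mode_growth t])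
    fix t assume t: "t \<le> T"
    have x: "0 \<le> a t 1" using first_mode_bounds[OF t] by simp
    have "6 * a t 1 * (\<bar>a t 2\<bar> + l2norm (tail 4 (a t))) \<le> 6 * a t 1 * (49/100 * (a t 1)\<^sup>2 + 67/1000 * (a t 1)\<^sup>2)"
      using a2[OF t] t4[OF t] x by (intro mult_left_mono) auto
    moreover have "l2norm (tail 2 (a t)) * l2norm (tail 4 (a t)) \<le> (317/1000 * a t 1) * (67/1000 * (a t 1)\<^sup>2)"
      using orbit_tail2_le[OF t] t4[OF t] orbit_tail_nonneg[OF t] x by (intro mult_mono) auto
    ultimately show "\<bar>ks_bil (a t) (a t) 3\<bar> \<le> 347/100 * a t 1 ^ 3"
      using ks_bil_3[OF orbit_sqs[OF t] x] zero_le_power[OF x, of 3]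
      by (simp add: power2_eq_square power3_eq_cube algebra_simps)
  qed (use eig3 in simp_all)
  then show "\<bar>a t 3\<bar> \<le> 7/100 * a t 1 ^ 3" using first_mode_powers(5)[OF t, of 3] by simp
qed

lemma tail3_sq: "t \<le> T \<Longrightarrow> (l2norm (tail 3 (a t)))\<^sup>2 = (a t 3)\<^sup>2 + (l2norm (tail 4 (a t)))\<^sup>2"
  and tail2_sq: "t \<le> T \<Longrightarrow> (l2norm (tail 2 (a t)))\<^sup>2 = (a t 2)\<^sup>2 + (l2norm (tail 3 (a t)))\<^sup>2"
  using l2norm_tail_Suc[OF orbit_sqs(1), of t 3] l2norm_tail_Suc[OF orbit_sqs(1), of t 2] by (simp_all add: eval_nat_numeral)

text \<open>Second round: quadratic bounds for the tails make the forcing of the modes k \<ge> 4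
  cubic, so their norm becomes O(a_1^3). The longer tails follow by adding squares.\<close>

lemma improved_tail_bounds:
  assumes t: "t \<le> T"
  shows "l2norm (tail 4 (a t)) \<le> 22/1000 * a t 1 ^ 3" "l2norm (tail 3 (a t)) \<le> 875/10000 * (a t 1)\<^sup>2"
    "l2norm (tail 2 (a t)) \<le> 1/2 * (a t 1)\<^sup>2"
proof -
  have t3: "l2norm (tail 3 (a t)) \<le> 875/10000 * (a t 1)\<^sup>2" if t: "t \<le> T" for t
  proof -
    have "\<bar>a t 3\<bar> \<le> 56/1000 * (a t 1)\<^sup>2" using coarse_mode_bounds(3)[OF t] first_mode_powers(1)[OF t] by linarith
    moreover have "\<bar>l2norm (tail 4 (a t))\<bar> \<le> 67/1000 * (a t 1)\<^sup>2"
      using coarse_mode_bounds(1)[OF t] orbit_tail_nonneg[OF t] by simp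
    ultimately have "(l2norm (tail 3 (a t)))\<^sup>2 \<le> (875/10000 * (a t 1)\<^sup>2)\<^sup>2"
      unfolding tail3_sq[OF t] by (rule sum_squares_scaled) (simp add: power2_eq_square)
    then show ?thesis by (rule power2_le_imp_le) simp
  qed
  then show "l2norm (tail 3 (a t)) \<le> 875/10000 * (a t 1)\<^sup>2" using t by blast
  have t2: "l2norm (tail 2 (a t)) \<le> 1/2 * (a t 1)\<^sup>2" if t: "t \<le> T" for t
  proof -
    have "\<bar>l2norm (tail 3 (a t))\<bar> \<le> 875/10000 * (a t 1)\<^sup>2"
      using t3[OF t] orbit_tail_nonneg[OF t] by simp
    with coarse_mode_bounds(2)[OF t] have "(l2norm (tail 2 (a t)))\<^sup>2 \<le> (1/2 * (a t 1)\<^sup>2)\<^sup>2"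
      unfolding tail2_sq[OF t] by (rule sum_squares_scaled) (simp add: power2_eq_square)
    then show ?thesis by (rule power2_le_imp_le) simp
  qed
  then show "l2norm (tail 2 (a t)) \<le> 1/2 * (a t 1)\<^sup>2" using t by blast
  have "l2norm (tail 4 (a t)) \<le> 57/100 * (1000/680) / 39 * a t 1 ^ 3"
  proof (rule tail4_slaved[OF _ _ _ t])
    fix t and k :: nat assume t: "t \<le> T" and k: "4 \<le> k"
    have x: "0 \<le> a t 1" using first_mode_bounds[OF t] by simp
    have "2 * a t 1 * (l2norm (tail 3 (a t)) + l2norm (tail 4 (a t)))
        \<le> 2 * a t 1 * (875/10000 * (a t 1)\<^sup>2 + 67/1000 * (a t 1)\<^sup>2)"
      using t3[OF t] coarse_mode_bounds(1)[OF t] x by (intro mult_left_mono add_mono) auto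
    moreover have "(l2norm (tail 2 (a t)))\<^sup>2 \<le> (1/2 * (a t 1)\<^sup>2)\<^sup>2"
      using t2[OF t] orbit_tail_nonneg[OF t] by (intro power_mono) auto
    moreover have "l2norm (tail 2 (a t)) * l2norm (tail 4 (a t)) \<le> (1/2 * (a t 1)\<^sup>2) * (67/1000 * (a t 1)\<^sup>2)"
      using t2[OF t] coarse_mode_bounds(1)[OF t] orbit_tail_nonneg[OF t] by (intro mult_mono) auto
    moreover have "(a t 1)\<^sup>2 * (a t 1)\<^sup>2 \<le> 4/5 * a t 1 ^ 3"
      using first_mode_powers(2)[OF t] by (simp add: power4_eq_xxxx power2_eq_square mult.assoc)
    ultimately have "2 * a t 1 * (l2norm (tail 3 (a t)) + l2norm (tail 4 (a t)))
        + (l2norm (tail 2 (a t)))\<^sup>2 + 2 * l2norm (tail 2 (a t)) * l2norm (tail 4 (a t)) \<le> 57/100 * a t 1 ^ 3"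
      using first_mode_powers(5)[OF t, of 3] by (simp add: power2_eq_square power3_eq_cube algebra_simps)
    then have "real k * (2 * a t 1 * (l2norm (tail 3 (a t)) + l2norm (tail 4 (a t)))
        + (l2norm (tail 2 (a t)))\<^sup>2 + 2 * l2norm (tail 2 (a t)) * l2norm (tail 4 (a t))) \<le> real k * (57/100 * a t 1 ^ 3)"
      by (intro mult_left_mono) auto
    then show "\<bar>ks_bil (a t) (a t) k\<bar> \<le> real k * (57/100 * a t 1 ^ 3)"
      using ks_bil_ge_4[OF orbit_sqs[OF t] x k] by linarith
  qed auto
  then show "l2norm (tail 4 (a t)) \<le> 22/1000 * a t 1 ^ 3" using first_mode_powers(5)[OF t, of 3] by linarith
qed

text \<open>Stated with parameters p and q because it is applied twice, with the coarse and with the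
  refined constants.\<close>

lemma ks_bil_2_error:
  assumes t: "t \<le> T" and b: "\<bar>a t 3\<bar> \<le> p * a t 1 ^ 3" "l2norm (tail 2 (a t)) \<le> q * (a t 1)\<^sup>2" "0 \<le> q"
  shows "\<bar>ks_bil (a t) (a t) 2 + 2 * (a t 1)\<^sup>2\<bar> \<le> (4 * p + 4 * q * (22/1000) * (4/5)) * a t 1 ^ 4"
proof -
  have x: "0 \<le> a t 1" using first_mode_bounds[OF t] by simp
  have 1: "4 * a t 1 * \<bar>a t 3\<bar> \<le> 4 * a t 1 * (p * a t 1 ^ 3)" using b x by (intro mult_left_mono) auto
  have 2: "l2norm (tail 2 (a t)) * l2norm (tail 4 (a t)) \<le> (q * (a t 1)\<^sup>2) * (22/1000 * a t 1 ^ 3)"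
    using b improved_tail_bounds(1)[OF t] orbit_tail_nonneg[OF t] by (intro mult_mono) auto
  have 3: "(q * (a t 1)\<^sup>2) * (22/1000 * a t 1 ^ 3) = q * (22/1000) * a t 1 ^ 5"
    by (simp flip: power_add)
  have "q * (22/1000) * a t 1 ^ 5 \<le> q * (22/1000) * (4/5 * a t 1 ^ 4)"
    using first_mode_powers(3)[OF t] b by (intro mult_left_mono) auto
  moreover have "4 * a t 1 * (p * a t 1 ^ 3) = 4 * p * a t 1 ^ 4" by (simp add: mult_power3[symmetric])
  moreover have "q * (22/1000) * (4/5 * a t 1 ^ 4) = q * (22/1000) * (4/5) * a t 1 ^ 4" by simp
  ultimately show ?thesis using ks_bil_2[OF orbit_sqs[OF t] x] 1 2 3 unfolding distrib_right mult.assoc by linarith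
qed

lemma ks_bil_1_error:
  assumes t: "t \<le> T" and b: "\<bar>a t 3\<bar> \<le> p * a t 1 ^ 3" "\<bar>a t 2\<bar> \<le> q * (a t 1)\<^sup>2"
    "l2norm (tail 3 (a t)) \<le> r * (a t 1)\<^sup>2" "0 \<le> q" "0 \<le> r"
  shows "\<bar>ks_bil (a t) (a t) 1 - 2 * a t 1 * a t 2\<bar> \<le> (2 * q * p + 2 * r * (22/1000)) * a t 1 ^ 5"
proof -
  have x: "0 \<le> a t 1" using first_mode_bounds[OF t] by simp
  have 1: "\<bar>a t 2\<bar> * \<bar>a t 3\<bar> \<le> (q * (a t 1)\<^sup>2) * (p * a t 1 ^ 3)"
    using b x by (intro mult_mono) auto
  have 2: "l2norm (tail 3 (a t)) * l2norm (tail 4 (a t)) \<le> (r * (a t 1)\<^sup>2) * (22/1000 * a t 1 ^ 3)"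
    using b improved_tail_bounds(1)[OF t] orbit_tail_nonneg[OF t] by (intro mult_mono) auto
  have e: "(a t 1)\<^sup>2 * a t 1 ^ 3 = a t 1 ^ 5" by (simp flip: power_add)
  have "(q * (a t 1)\<^sup>2) * (p * a t 1 ^ 3) = q * p * a t 1 ^ 5"
    "(r * (a t 1)\<^sup>2) * (22/1000 * a t 1 ^ 3) = r * (22/1000) * a t 1 ^ 5"
    unfolding e[symmetric] by (simp_all add: mult_ac)
  then show ?thesis using ks_bil_1[OF orbit_sqs[OF t]] 1 2 by (simp add: algebra_simps)
qed

text \<open>Turns bounds on a_2 and on the error into a rate for a_1, the input of the next round of
  slaving. A negative \<gamma> is allowed and then expresses growth.\<close>

lemma growth_lower:
  assumes t: "t \<le> T" and b: "\<bar>a t 2\<bar> \<le> q * (a t 1)\<^sup>2"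
    "\<bar>ks_bil (a t) (a t) 1 - 2 * a t 1 * a t 2\<bar> \<le> e * a t 1 ^ 5" "0 \<le> q" "0 \<le> e"
    and X: "a t 1 \<le> X" and g: "2 * q * X\<^sup>2 + e * X ^ 4 - (1 - \<mu>) \<le> \<gamma>"
  shows "- \<gamma> * a t 1 \<le> (1 - \<mu>) * a t 1 + ks_bil (a t) (a t) 1"
proof -
  have x: "0 \<le> a t 1" using first_mode_bounds[OF t] by simp
  have sq: "(a t 1)\<^sup>2 \<le> X\<^sup>2" "a t 1 ^ 4 \<le> X ^ 4" using x X by (auto intro!: power_mono)
  have "- (2 * a t 1 * a t 2) \<le> 2 * a t 1 * (q * (a t 1)\<^sup>2)"
    using mult_left_mono[of "- a t 2" "q * (a t 1)\<^sup>2" "2 * a t 1"] b(1) x by simp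
  also have "\<dots> \<le> 2 * a t 1 * (q * X\<^sup>2)" using sq b x by (intro mult_left_mono) auto
  finally have 1: "- (2 * a t 1 * a t 2) \<le> 2 * a t 1 * (q * X\<^sup>2)" .
  have "e * a t 1 ^ 5 = a t 1 * (e * a t 1 ^ 4)" by (simp add: power_Suc[of _ 4, simplified])
  also have "\<dots> \<le> a t 1 * (e * X ^ 4)" using sq b x by (intro mult_left_mono) auto
  finally have 2: "e * a t 1 ^ 5 \<le> a t 1 * (e * X ^ 4)" .
  have "a t 1 * (2 * q * X\<^sup>2 + e * X ^ 4 - (1 - \<mu>)) \<le> a t 1 * \<gamma>" using g x by (intro mult_left_mono)
  then have "2 * a t 1 * (q * X\<^sup>2) + a t 1 * (e * X ^ 4) - (1 - \<mu>) * a t 1 \<le> \<gamma> * a t 1"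
    by (simp add: algebra_simps)
  then show ?thesis using 1 2 b(2) unfolding abs_le_iff by linarith
qed

lemma second_mode_slaved:
  assumes C: "\<And>t. t \<le> T \<Longrightarrow> \<bar>ks_bil (a t) (a t) 2 + 2 * (a t 1)\<^sup>2\<bar> \<le> f * a t 1 ^ 4" "0 \<le> f"
    and G: "\<And>t. t \<le> T \<Longrightarrow> - \<gamma> * a t 1 \<le> (1 - \<mu>) * a t 1 + ks_bil (a t) (a t) 1" "0 \<le> \<gamma>"
    and X: "\<And>t. t \<le> T \<Longrightarrow> a t 1 \<le> X"
    and L: "0 < 4 * (4 * \<mu> - 1) - 2 * \<gamma>" and t: "t \<le> T"
  shows "\<bar>a t 2\<bar> \<le> (2 + f * X\<^sup>2) / (4 * (4 * \<mu> - 1) - 2 * \<gamma>) * (a t 1)\<^sup>2"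
proof -
  have "\<bar>a t 2\<bar> \<le> (2 + f * X\<^sup>2) / (4 * (4 * \<mu> - 1) - real 2 * \<gamma>) * (a t 1)\<^sup>2"
  proof (rule mode_slaved[OF _ _ _ _ _ G(2) _ G(1) t])
    fix t assume t: "t \<le> T"
    have "a t 1 ^ 4 = (a t 1)\<^sup>2 * (a t 1)\<^sup>2" by (simp flip: power_add)
    also have "\<dots> \<le> X\<^sup>2 * (a t 1)\<^sup>2" using first_mode_bounds(1)[OF t] X[OF t] by (intro mult_right_mono power_mono) auto
    finally have "f * a t 1 ^ 4 \<le> f * (X\<^sup>2 * (a t 1)\<^sup>2)" using C(2) by (intro mult_left_mono)
    then show "\<bar>ks_bil (a t) (a t) 2\<bar> \<le> (2 + f * X\<^sup>2) * (a t 1)\<^sup>2"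
      using C(1)[OF t] zero_le_power2[of "a t 1"] unfolding distrib_right mult.assoc abs_le_iff by linarith
  qed (use L C in \<open>simp_all add: eig2\<close>)
  then show ?thesis by simp
qed

text \<open>Two passes of the loop between the rate of a_1 and the bound for a_2: 0.49 gives the
  rate 0.657 and hence 0.33, which gives the rate 0.4522 and hence 0.312. In the final comparison
  the damping 4 (4 \<mu> - 1) is replaced by its least value 8.\<close>

lemma second_mode_bound:
  assumes t: "t \<le> T"
  shows "\<bar>a t 2\<bar> \<le> 312/1000 * (a t 1)\<^sup>2"
proof -
  note bil2 = ks_bil_2_error[OF _ coarse_mode_bounds(3) improved_tail_bounds(3)]
  note bil1 = ks_bil_1_error[OF _ coarse_mode_bounds(3) coarse_mode_bounds(2) improved_tail_bounds(2)]
  have x2: "(4/5 :: real)\<^sup>2 = 64/100" "(4/5 :: real) ^ 4 = 4096/10000" by (simp_all add: power2_eq_square power4_eq_xxxx)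
  have le: "c / y * (a t 1)\<^sup>2 \<le> c' * (a t 1)\<^sup>2" if "8 - z \<le> y" "c \<le> c' * (8 - z)" "0 \<le> c" "0 < 8 - z" "0 < c'" for c y z c' t
  proof -
    have "c / y \<le> c / (8 - z)" using that by (intro divide_left_mono mult_pos_pos) auto
    also have "\<dots> \<le> c'" using that by (simp add: pos_divide_le_eq)
    finally show ?thesis by (intro mult_right_mono) auto
  qed
  have y1: "\<bar>a t 2\<bar> \<le> 33/100 * (a t 1)\<^sup>2" if t: "t \<le> T" for t
  proof -
    have g: "- (657/1000) * a t 1 \<le> (1 - \<mu>) * a t 1 + ks_bil (a t) (a t) 1" if t: "t \<le> T" for t
      by (rule growth_lower[OF t coarse_mode_bounds(2)[OF t] bil1 _ _ first_mode_bounds(2)[OF t]]) (use t \<mu> in \<open>simp_all add: x2\<close>)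
    have "\<bar>a t 2\<bar> \<le> (2 + (4 * (7/100) + 4 * (1/2) * (22/1000) * (4/5)) * (4/5)\<^sup>2) / (4 * (4 * \<mu> - 1) - 2 * (657/1000)) * (a t 1)\<^sup>2"
      by (rule second_mode_slaved[OF bil2 _ g _ first_mode_bounds(2) _ t]) (use \<mu> in auto)
    also have "\<dots> \<le> 33/100 * (a t 1)\<^sup>2" by (rule le[where z="2 * (657/1000)"]) (use \<mu> in \<open>simp_all add: x2\<close>)
    finally show ?thesis .
  qed
  have g: "- (4522/10000) * a t 1 \<le> (1 - \<mu>) * a t 1 + ks_bil (a t) (a t) 1" if t: "t \<le> T" for t
    by (rule growth_lower[OF t y1[OF t] bil1 _ _ first_mode_bounds(2)[OF t]]) (use t \<mu> in \<open>simp_all add: x2\<close>)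
  have "\<bar>a t 2\<bar> \<le> (2 + (4 * (7/100) + 4 * (1/2) * (22/1000) * (4/5)) * (4/5)\<^sup>2) / (4 * (4 * \<mu> - 1) - 2 * (4522/10000)) * (a t 1)\<^sup>2"
    by (rule second_mode_slaved[OF bil2 _ g _ first_mode_bounds(2) _ t]) (use \<mu> in auto)
  also have "\<dots> \<le> 312/1000 * (a t 1)\<^sup>2" by (rule le[where z="2 * (4522/10000)"]) (use \<mu> in \<open>simp_all add: x2\<close>)
  finally show ?thesis .
qed

text \<open>Third round, with 0.312 in place of 0.49 in the forcing of a_3. The tail from 3 is now
  cubic as a whole, since a_3 and the tail from 4 both are.\<close>

lemma refined_tail_bounds:
  assumes t: "t \<le> T"
  shows "\<bar>a t 3\<bar> \<le> 41/1000 * a t 1 ^ 3" "l2norm (tail 3 (a t)) \<le> 47/1000 * a t 1 ^ 3"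
    "l2norm (tail 2 (a t)) \<le> 315/1000 * (a t 1)\<^sup>2"
proof -
  have a3: "\<bar>a t 3\<bar> \<le> 41/1000 * a t 1 ^ 3" if t: "t \<le> T" for t
  proof -
    have "\<bar>a t 3\<bar> \<le> (2025/1000) / (207/4 - real 3 * (6/10)) * a t 1 ^ 3"
    proof (rule mode_slaved[OF _ _ _ _ _ _ _ first_mode_growth t])
      fix t assume t: "t \<le> T"
      have x: "0 \<le> a t 1" using first_mode_bounds[OF t] by simp
      have "6 * a t 1 * (\<bar>a t 2\<bar> + l2norm (tail 4 (a t))) \<le> 6 * a t 1 * (312/1000 * (a t 1)\<^sup>2 + 22/1000 * a t 1 ^ 3)"
        using second_mode_bound[OF t] improved_tail_bounds(1)[OF t] x by (intro mult_left_mono) auto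
      moreover have "6 * a t 1 * (312/1000 * (a t 1)\<^sup>2 + 22/1000 * a t 1 ^ 3) = 1872/1000 * a t 1 ^ 3 + 132/1000 * a t 1 ^ 4"
        by (simp add: power2_eq_square power3_eq_cube power4_eq_xxxx algebra_simps)
      moreover have "l2norm (tail 2 (a t)) * l2norm (tail 4 (a t)) \<le> (1/2 * (a t 1)\<^sup>2) * (22/1000 * a t 1 ^ 3)"
        using improved_tail_bounds[OF t] orbit_tail_nonneg[OF t] by (intro mult_mono) auto
      moreover have "(1/2 * (a t 1)\<^sup>2) * (22/1000 * a t 1 ^ 3) = 11/1000 * a t 1 ^ 5" by (simp flip: power_add)
      ultimately show "\<bar>ks_bil (a t) (a t) 3\<bar> \<le> 2025/1000 * a t 1 ^ 3"
        using ks_bil_3[OF orbit_sqs[OF t] x] first_mode_powers(2,3)[OF t] by linarith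
    qed (use eig3 in simp_all)
    then show ?thesis using first_mode_powers(5)[OF t, of 3] by simp
  qed
  then show "\<bar>a t 3\<bar> \<le> 41/1000 * a t 1 ^ 3" using t by blast
  have "\<bar>l2norm (tail 4 (a t))\<bar> \<le> 22/1000 * a t 1 ^ 3"
    using improved_tail_bounds(1)[OF t] orbit_tail_nonneg[OF t] by simp
  with a3[OF t] have "(l2norm (tail 3 (a t)))\<^sup>2 \<le> (47/1000 * a t 1 ^ 3)\<^sup>2"
    unfolding tail3_sq[OF t] by (rule sum_squares_scaled) (simp add: power2_eq_square)
  then show t3: "l2norm (tail 3 (a t)) \<le> 47/1000 * a t 1 ^ 3"
    by (rule power2_le_imp_le) (use first_mode_powers(5)[OF t, of 3] in simp)
  have "l2norm (tail 3 (a t)) \<le> 376/10000 * (a t 1)\<^sup>2" using t3 first_mode_powers(1)[OF t] by linarith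
  then have "\<bar>l2norm (tail 3 (a t))\<bar> \<le> 376/10000 * (a t 1)\<^sup>2" using orbit_tail_nonneg[OF t] by simp
  with second_mode_bound[OF t] have "(l2norm (tail 2 (a t)))\<^sup>2 \<le> (315/1000 * (a t 1)\<^sup>2)\<^sup>2"
    unfolding tail2_sq[OF t] by (rule sum_squares_scaled) (simp add: power2_eq_square)
  then show "l2norm (tail 2 (a t)) \<le> 315/1000 * (a t 1)\<^sup>2" by (rule power2_le_imp_le) simp
qed

lemma quadratic_term_bounds:
  assumes t: "t \<le> T"
  shows "\<bar>ks_bil (a t) (a t) 2 + 2 * (a t 1)\<^sup>2\<bar> \<le> 187/1000 * a t 1 ^ 4"
    "\<bar>ks_bil (a t) (a t) 1 - 2 * a t 1 * a t 2\<bar> \<le> 28/1000 * a t 1 ^ 5"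
proof -
  have "\<bar>ks_bil (a t) (a t) 2 + 2 * (a t 1)\<^sup>2\<bar> \<le> (4 * (41/1000) + 4 * (315/1000) * (22/1000) * (4/5)) * a t 1 ^ 4"
    by (rule ks_bil_2_error[OF t refined_tail_bounds(1,3)[OF t]]) simp
  also have "\<dots> \<le> 187/1000 * a t 1 ^ 4" using first_mode_powers(5)[OF t, of 4] by (intro mult_right_mono) auto
  finally show "\<bar>ks_bil (a t) (a t) 2 + 2 * (a t 1)\<^sup>2\<bar> \<le> 187/1000 * a t 1 ^ 4" .
  have "l2norm (tail 3 (a t)) \<le> 376/10000 * (a t 1)\<^sup>2" using refined_tail_bounds(2)[OF t] first_mode_powers(1)[OF t] by linarith
  then have "\<bar>ks_bil (a t) (a t) 1 - 2 * a t 1 * a t 2\<bar> \<le> (2 * (312/1000) * (41/1000) + 2 * (376/10000) * (22/1000)) * a t 1 ^ 5"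
    by (intro ks_bil_1_error[OF t refined_tail_bounds(1)[OF t] second_mode_bound[OF t]]) auto
  also have "\<dots> \<le> 28/1000 * a t 1 ^ 5" using first_mode_powers(5)[OF t, of 5] by (intro mult_right_mono) auto
  finally show "\<bar>ks_bil (a t) (a t) 1 - 2 * a t 1 * a t 2\<bar> \<le> 28/1000 * a t 1 ^ 5" .
qed

text \<open>Slaving with the negative forcing - c a_1^2. Here the growth of a_1 must be bounded from
  above: the faster a_1 grows, the further a_2 lags behind.\<close>

lemma second_mode_slaved_above:
  assumes c: "0 \<le> c" "\<And>t. t \<le> T \<Longrightarrow> ks_bil (a t) (a t) 2 \<le> - c * (a t 1)\<^sup>2"
    and G: "\<And>t. t \<le> T \<Longrightarrow> (1 - \<mu>) * a t 1 + ks_bil (a t) (a t) 1 \<le> \<gamma> * a t 1" "0 \<le> \<gamma>"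
    and t: "t \<le> T"
  shows "a t 2 \<le> - c / (4 * (4 * \<mu> - 1) + 2 * \<gamma>) * (a t 1)\<^sup>2"
proof -
  have L: "0 < 4 * (4 * \<mu> - 1)" using \<mu> by simp
  then have pos: "0 < 4 * (4 * \<mu> - 1) + 2 * \<gamma>" using G(2) by linarith
  have "a t 2 \<le> - c * (a t 1)\<^sup>2 / (4 * (4 * \<mu> - 1) + 2 * \<gamma>)"
  proof (rule slaving_le[OF L _ _ _ _ _ _ pos t])
    show "continuous_on {..T} (\<lambda>t. a t 2)" "continuous_on {..T} (\<lambda>t. (a t 1)\<^sup>2)"
      by (intro continuous_intros ks_solution_continuous(2)[OF sol])+
    show "a t 2 \<le> 105/100 * (4/5)" if "t \<le> T" for t
      using abs_le_l2norm[OF orbit_sqs(1)[OF that], of 2] orbit_l2norm_le[OF that] first_mode_bounds[OF that] by linarith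
    show "\<bar>(a t 1)\<^sup>2\<bar> \<le> 1" if "t \<le> T" for t
      using first_mode_bounds[OF that] by (simp add: power_le_one)
    show "((\<lambda>t. a t 2) has_real_derivative - (4 * (4 * \<mu> - 1)) * a r 2 + ks_bil (a r) (a r) 2) (at r)
        \<and> ks_bil (a r) (a r) 2 \<le> - c * (a r 1)\<^sup>2" if "r < T" for r
      using ks_solution_deriv_interior[OF sol, of r 2] c(2)[of r] that
      unfolding eig2[symmetric] by (simp add: interior_atMost_real)
    show "((\<lambda>t. (a t 1)\<^sup>2) has_real_derivative
        real 2 * (((1 - \<mu>) * a r 1 + ks_bil (a r) (a r) 1) * a r 1 ^ (2 - 1))) (at r) \<and>
        - c * (2 * \<gamma> * (a r 1)\<^sup>2) \<le> - c * (real 2 * (((1 - \<mu>) * a r 1 + ks_bil (a r) (a r) 1) * a r 1 ^ (2 - 1)))"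
      if r: "r < T" for r
    proof
      show "((\<lambda>t. (a t 1)\<^sup>2) has_real_derivative
        real 2 * (((1 - \<mu>) * a r 1 + ks_bil (a r) (a r) 1) * a r 1 ^ (2 - 1))) (at r)"
        by (rule first_mode_pow_deriv[OF r])
      have "((1 - \<mu>) * a r 1 + ks_bil (a r) (a r) 1) * a r 1 \<le> (\<gamma> * a r 1) * a r 1"
        using G(1)[of r] r first_mode_bounds(1)[of r] by (intro mult_right_mono) auto
      then have "real 2 * (((1 - \<mu>) * a r 1 + ks_bil (a r) (a r) 1) * a r 1 ^ (2 - 1)) \<le> 2 * \<gamma> * (a r 1)\<^sup>2"
        by (simp add: power2_eq_square)
      then show "- c * (2 * \<gamma> * (a r 1)\<^sup>2) \<le> - c * (real 2 * (((1 - \<mu>) * a r 1 + ks_bil (a r) (a r) 1) * a r 1 ^ (2 - 1)))"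
        using c(1) by (intro mult_left_mono_neg) auto
    qed
  qed
  then show ?thesis by simp
qed

lemma growth_upper:
  assumes t: "t \<le> T" and y: "a t 2 \<le> q * (a t 1)\<^sup>2" "0 \<le> q" and X: "a t 1 \<le> X"
    and g: "(1 - \<mu>) + 2 * q * X\<^sup>2 + 28/1000 * X ^ 4 \<le> \<gamma>"
  shows "(1 - \<mu>) * a t 1 + ks_bil (a t) (a t) 1 \<le> \<gamma> * a t 1"
proof -
  have x: "0 \<le> a t 1" using first_mode_bounds[OF t] by simp
  have sq: "(a t 1)\<^sup>2 \<le> X\<^sup>2" "a t 1 ^ 4 \<le> X ^ 4" using x X by (auto intro!: power_mono)
  have "2 * a t 1 * a t 2 \<le> 2 * a t 1 * (q * (a t 1)\<^sup>2)" using y x by (intro mult_left_mono) auto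
  also have "\<dots> \<le> 2 * a t 1 * (q * X\<^sup>2)" using sq y x by (intro mult_left_mono) auto
  finally have 1: "2 * a t 1 * a t 2 \<le> 2 * a t 1 * (q * X\<^sup>2)" .
  have "a t 1 ^ 5 = a t 1 * a t 1 ^ 4" by (simp add: power_Suc[of _ 4, simplified])
  also have "\<dots> \<le> a t 1 * X ^ 4" using sq x by (intro mult_left_mono) auto
  finally have 2: "a t 1 ^ 5 \<le> a t 1 * X ^ 4" .
  have "a t 1 * ((1 - \<mu>) + 2 * q * X\<^sup>2 + 28/1000 * X ^ 4) \<le> a t 1 * \<gamma>" using g x by (intro mult_left_mono)
  then have "(1 - \<mu>) * a t 1 + 2 * a t 1 * (q * X\<^sup>2) + 28/1000 * (a t 1 * X ^ 4) \<le> \<gamma> * a t 1"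
    by (simp add: algebra_simps)
  then show ?thesis using 1 2 quadratic_term_bounds(2)[OF t] unfolding abs_le_iff by linarith
qed

text \<open>Two passes: the crude growth rate 1 already shows a_2 \<le> 0; then the coupling 2 a_1
  a_2 only helps, a_1 grows at most at rate 1 - \<mu> plus the error, and the factor
  improves.\<close>

lemma y_upper:
  assumes X: "\<And>t. t \<le> T \<Longrightarrow> a t 1 \<le> X" "X \<le> 4/5"
    and g: "(1 - \<mu>) + 28/1000 * X ^ 4 \<le> g" and t: "t \<le> T"
  shows "a t 2 \<le> - (2 - 187/1000 * X\<^sup>2) / (4 * (4 * \<mu> - 1) + 2 * g) * (a t 1)\<^sup>2"
proof -
  have X0: "0 < X" using X(1)[OF t] first_mode_bounds(1)[OF t] by linarith
  have X2: "X\<^sup>2 \<le> 64/100" using power_mono[OF X(2), of 2] X0 by (simp add: power2_eq_square)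
  have X4: "X ^ 4 \<le> 4096/10000" using power_mono[OF X(2), of 4] X0 by (simp add: power4_eq_xxxx)
  have N: "ks_bil (a t) (a t) 2 \<le> - (2 - 187/1000 * X\<^sup>2) * (a t 1)\<^sup>2" if t: "t \<le> T" for t
  proof -
    have "a t 1 ^ 4 = (a t 1)\<^sup>2 * (a t 1)\<^sup>2" by (simp flip: power_add)
    also have "\<dots> \<le> X\<^sup>2 * (a t 1)\<^sup>2" using first_mode_bounds(1)[OF t] X(1)[OF t] by (intro mult_right_mono power_mono) auto
    finally have "a t 1 ^ 4 \<le> X\<^sup>2 * (a t 1)\<^sup>2" .
    moreover have "- (2 - 187/1000 * X\<^sup>2) * (a t 1)\<^sup>2 = 187/1000 * (X\<^sup>2 * (a t 1)\<^sup>2) - 2 * (a t 1)\<^sup>2"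
      by (simp add: algebra_simps)
    ultimately show ?thesis using quadratic_term_bounds(1)[OF t] by linarith
  qed
  have neg: "a t 2 \<le> 0 * (a t 1)\<^sup>2" if t: "t \<le> T" for t
  proof -
    have "a t 2 \<le> - (2 - 187/1000 * X\<^sup>2) / (4 * (4 * \<mu> - 1) + 2 * 1) * (a t 1)\<^sup>2"
    proof (rule second_mode_slaved_above[OF _ N _ _ t])
      fix t assume t: "t \<le> T"
      show "(1 - \<mu>) * a t 1 + ks_bil (a t) (a t) 1 \<le> 1 * a t 1"
        by (rule growth_upper[OF t _ _ X(1)[OF t], where q="312/1000"])
          (use second_mode_bound[OF t] \<mu> X2 X4 in auto)
    qed (use X2 in auto)
    also have "\<dots> \<le> 0 * (a t 1)\<^sup>2" using X2 \<mu> by (intro mult_right_mono) (auto simp: divide_nonpos_pos)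
    finally show ?thesis .
  qed
  have "0 \<le> X ^ 4" by simp
  then have g0: "0 \<le> g" using g \<mu> by linarith
  show ?thesis
  proof (rule second_mode_slaved_above[OF _ N _ g0 t])
    fix t assume t: "t \<le> T"
    show "(1 - \<mu>) * a t 1 + ks_bil (a t) (a t) 1 \<le> g * a t 1"
      by (rule growth_upper[OF t neg[OF t] _ X(1)[OF t]]) (use g in auto)
  qed (use X2 in auto)
qed

lemma y_lower:
  assumes X: "\<And>t. t \<le> T \<Longrightarrow> a t 1 \<le> X"
    and g: "2 * (312/1000) * X\<^sup>2 + 28/1000 * X ^ 4 - (1 - \<mu>) \<le> g" "0 \<le> g" "0 < 4 * (4 * \<mu> - 1) - 2 * g"
    and t: "t \<le> T"
  shows "\<bar>a t 2\<bar> \<le> (2 + 187/1000 * X\<^sup>2) / (4 * (4 * \<mu> - 1) - 2 * g) * (a t 1)\<^sup>2"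
  by (rule second_mode_slaved[OF quadratic_term_bounds(1) _ growth_lower[OF _ second_mode_bound quadratic_term_bounds(2) _ _ X g(1)] g(2) X g(3) t]) auto

end

text \<open>Continuous induction on the largest of three defects. The opening of the cone is not
  attained because the tail from 2 is at most 0.315 a_1^2 with 0.315^2 < 1/10; a_1 = X is excluded
  because a_1 would have a negative derivative there by \<open>num\<close>; a_1 stays positive
  because it decays at most exponentially. Being in the cone supplies the norm bound on which
  solvability depends.\<close>

lemma cone_invariant:
  fixes a :: "real \<Rightarrow> nat \<Rightarrow> real"
  assumes \<mu>: "3/4 \<le> \<mu>" "\<mu> < 1"
    and ell: "\<And>t. sqs (a t)" "\<And>t. a t 0 = 0"
    and cont: "\<And>t. ((\<lambda>s. l2norm (\<lambda>k. a s k - a t k)) \<longlongrightarrow> 0) (at t)"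
    and sol: "\<And>T. (\<And>t. t \<le> T \<Longrightarrow> l2norm (a t) \<le> 1) \<Longrightarrow> ks_solution_on \<mu> {..T} a"
    and start: "\<And>t. t \<le> t0 \<Longrightarrow> 0 < a t 1 \<and> a t 1 \<le> X \<and> (l2norm (tail 2 (a t)))\<^sup>2 \<le> (a t 1)\<^sup>2 / 10"
    and X: "X \<le> 4/5"
    and num: "(1 - \<mu>) + 28/1000 * X ^ 4 \<le> g"
      "(1 - \<mu>) - 2 * (2 - 187/1000 * X\<^sup>2) / (4 * (4 * \<mu> - 1) + 2 * g) * X\<^sup>2 + 28/1000 * X ^ 4 < 0"
  shows "0 < a t 1 \<and> a t 1 \<le> X \<and> (l2norm (tail 2 (a t)))\<^sup>2 \<le> (a t 1)\<^sup>2 / 10"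
proof -
  define f where "f t = max (max (- a t 1) (a t 1 - X)) ((l2norm (tail 2 (a t)))\<^sup>2 - (a t 1)\<^sup>2 / 10)" for t
  have ev: "\<forall>\<^sub>F s in F. sqs (a s)" for F using ell by simp
  have lim: "((\<lambda>s. a s k) \<longlongrightarrow> a t k) (at t)" "((\<lambda>s. l2norm (a s)) \<longlongrightarrow> l2norm (a t)) (at t)" for t k
    by (rule component_tendsto[OF ev ell(1) cont], rule l2norm_tendsto[OF ev ell(1) cont])
  have tl: "(l2norm (tail 2 (a t)))\<^sup>2 = (l2norm (a t))\<^sup>2 - (a t 1)\<^sup>2" for t
    using l2norm_tail_Suc[OF ell(1)[of t], of 0] l2norm_tail_Suc[OF ell(1)[of t], of 1] ell(2)[of t]
    by (simp add: numeral_2_eq_2)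
  have c1: "continuous_on UNIV (\<lambda>t. a t 1)" and c2: "continuous_on UNIV (\<lambda>t. l2norm (a t))"
    unfolding continuous_on_def using lim by auto
  have "continuous_on UNIV f"
    unfolding f_def[abs_def] tl by (intro continuous_intros c1 c2) auto
  moreover have "f t \<le> 0" if "t \<le> t0" for t
    using start[OF that] by (simp add: f_def)
  moreover have "f T < 0" if le: "\<And>t. t \<le> T \<Longrightarrow> f t \<le> 0" for T
  proof -
    have h: "0 \<le> a t 1" "a t 1 \<le> X" "(l2norm (tail 2 (a t)))\<^sup>2 \<le> (a t 1)\<^sup>2 / 10" if "t \<le> T" for t
      using le[OF that] by (simp_all add: f_def)
    have "l2norm (a t) \<le> 1" if "t \<le> T" for t
      using cone_l2norm_le[OF ell h(1,3)[OF that]] h(2)[OF that] X by linarith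
    then have s: "ks_solution_on \<mu> {..T} a" by (rule sol)
    have pos: "0 < a t 1" if t: "t \<le> T" for t
    proof -
      \<comment> \<open>Goes back to a time at which positivity is known from
        \<open>start\<close>.\<close>
      define r where "r = min t t0"
      have "exp (- (6/10) * (t - r)) * a r 1 \<le> a t 1"
      proof (rule exp_growth)
        show "continuous_on {r..t} (\<lambda>t. a t 1)" using c1 by (rule continuous_on_subset) simp
        fix q assume q: "r < q" "q < t"
        show "((\<lambda>t. a t 1) has_real_derivative ks_eig \<mu> 1 * a q 1 + ks_bil (a q) (a q) 1) (at q) \<and>
            - (6/10) * a q 1 \<le> ks_eig \<mu> 1 * a q 1 + ks_bil (a q) (a q) 1"
          using ks_solution_deriv_interior[OF s interior_atMost_real, of q 1] q t
            cone_growth[OF ell h(1,3)[of q], of \<mu>] h(2)[of q] X \<mu>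
          by (simp add: ks_eig_def)
      qed (simp add: r_def)
      moreover have "0 < a r 1" using start[of r] by (simp add: r_def)
      moreover have "0 < exp (- (6/10) * (t - r)) * a r 1" using \<open>0 < a r 1\<close> by simp
      ultimately show ?thesis by linarith
    qed
    have hyp: "0 < a t 1 \<and> a t 1 \<le> 4/5 \<and> (l2norm (tail 2 (a t)))\<^sup>2 \<le> (a t 1)\<^sup>2 / 10" if "t \<le> T" for t
      using pos[OF that] h[OF that] X by simp
    note b4 = refined_tail_bounds(3)[OF \<mu> s hyp order_refl]
    have x: "0 < a T 1" "a T 1 \<le> X" using pos h(2) by auto
    have "(l2norm (tail 2 (a T)))\<^sup>2 < (a T 1)\<^sup>2 / 10"
    proof -
      have "(l2norm (tail 2 (a T)))\<^sup>2 \<le> (315/1000 * (a T 1)\<^sup>2)\<^sup>2"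
        using b4 l2norm_nonneg[OF sqs_tail[OF ell(1)]] by (intro power_mono) auto
      also have "\<dots> = 99225/1000000 * ((a T 1)\<^sup>2 * (a T 1)\<^sup>2)" by (simp add: power2_eq_square)
      also have "\<dots> \<le> 99225/1000000 * (1 * (a T 1)\<^sup>2)"
        using x X by (intro mult_left_mono mult_right_mono) (auto simp: power_le_one)
      also have "\<dots> < (a T 1)\<^sup>2 / 10" using x by simp
      finally show ?thesis .
    qed
    moreover have "a T 1 < X"
    proof (rule ccontr)
      assume "\<not> a T 1 < X"
      then have e: "a T 1 = X" using x by simp
      have "ks_eig \<mu> 1 * a T 1 + ks_bil (a T) (a T) 1 < 0"
      proof -
        have eig: "ks_eig \<mu> 1 = 1 - \<mu>" by (simp add: ks_eig_def)
        have "2 * a T 1 * a T 2 \<le> 2 * X * (- (2 - 187/1000 * X\<^sup>2) / (4 * (4 * \<mu> - 1) + 2 * g) * X\<^sup>2)"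
          using y_upper[OF \<mu> s hyp h(2) X num(1) order_refl] x unfolding e by (intro mult_left_mono) auto
        moreover have "\<bar>ks_bil (a T) (a T) 1 - 2 * a T 1 * a T 2\<bar> \<le> 28/1000 * X ^ 5"
          using quadratic_term_bounds(2)[OF \<mu> s hyp order_refl] unfolding e .
        ultimately have "ks_eig \<mu> 1 * a T 1 + ks_bil (a T) (a T) 1 \<le>
            (1 - \<mu>) * X + 2 * X * (- (2 - 187/1000 * X\<^sup>2) / (4 * (4 * \<mu> - 1) + 2 * g) * X\<^sup>2) + 28/1000 * X ^ 5"
          unfolding e eig abs_le_iff by linarith
        also have "\<dots> = X * ((1 - \<mu>) - 2 * (2 - 187/1000 * X\<^sup>2) / (4 * (4 * \<mu> - 1) + 2 * g) * X\<^sup>2 + 28/1000 * X ^ 4)"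
        proof -
          have eq: "p * X + 2 * X * (- N / D * X2) + c * X5 = X * (p - 2 * N / D * X2 + c * X4)"
            if "X5 = X * X4" for p N D X2 c X4 X5 :: real
            unfolding that by (simp add: algebra_simps)
          show ?thesis by (rule eq) (simp add: power_Suc[of X 4, simplified])
        qed
        also have "\<dots> < 0" using num(2) x e by (intro mult_pos_neg) auto
        finally show ?thesis .
      qed
      \<comment> \<open>A negative derivative at T means values above X just before T, against the
        cone condition at those times.\<close>
      from has_real_derivative_neg_dec_left[OF ks_solutionD(4)[OF s, of T 1] this]
      obtain d where d: "0 < d" "\<And>h. 0 < h \<Longrightarrow> h < d \<Longrightarrow> a T 1 < a (T - h) 1" by auto
      have "a T 1 < a (T - d / 2) 1" using d(1) by (intro d(2)) auto
      then show False using h(2)[of "T - d / 2"] d(1) e by simp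
    qed
    ultimately show "f T < 0" using x by (simp add: f_def)
  qed
  ultimately have "f t < 0" by (rule continuous_induction_left)
  then show ?thesis by (simp add: f_def)
qed

text \<open>Below c the function grows exponentially, so it must reach c; afterwards
  \<open>barrier\<close> applies.\<close>

lemma eventually_above:
  fixes x :: "real \<Rightarrow> real"
  assumes "\<And>t. (x has_real_derivative x' t) (at t)" "\<And>t. 0 < x t"
    and "\<And>t. x t < c \<Longrightarrow> r * x t \<le> x' t" "0 < r"
  obtains t0 where "\<And>t. t0 \<le> t \<Longrightarrow> c \<le> x t"
proof -
  have cont: "continuous_on S x" for S
    using assms(1) by (intro DERIV_continuous_on) (auto intro: has_field_derivative_at_within)
  have "\<exists>t0. c \<le> x t0"
  proof (rule ccontr)
    assume "\<nexists>t0. c \<le> x t0"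
    then have lt: "x t < c" for t by (simp add: not_le)
    have "exp (r * (t - 0)) * x 0 \<le> x t" if "0 \<le> t" for t
      by (rule exp_growth[OF that cont]) (use assms lt in auto)
    then have le: "exp (r * t) * x 0 \<le> c" if "0 \<le> t" for t using lt[of t] that by force
    have "r * t * x 0 \<le> c" if "0 \<le> t" for t
    proof -
      have "r * t \<le> exp (r * t)" using exp_ge_add_one_self[of "r * t"] by linarith
      then have "r * t * x 0 \<le> exp (r * t) * x 0" using assms(2)[of 0] by (intro mult_right_mono) auto
      then show ?thesis using le[OF that] by linarith
    qed
    moreover have "r * ((c + 1) / (r * x 0)) * x 0 = c + 1" using assms(2)[of 0] assms(4) by simp
    moreover have "0 \<le> (c + 1) / (r * x 0)" using assms(2)[of 0] lt[of 0] assms(4) by simp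
    ultimately show False by force
  qed
  then obtain t0 where t0: "c \<le> x t0" by blast
  have "c \<le> x t" if "t0 \<le> t" for t
  proof (rule barrier[OF cont t0 that])
    show "0 \<le> x' t" if "x t < c" for t
      using assms(3)[OF that] assms(2)[of t] assms(4) mult_pos_pos[of r "x t"] by linarith
  qed (rule assms(1))
  then show thesis by (rule that)
qed

section \<open>Negativity of the form on explicit boxes\<close>

definition in_box :: "real \<Rightarrow> real \<Rightarrow> real \<Rightarrow> real \<Rightarrow> real \<Rightarrow> (nat \<Rightarrow> real) \<Rightarrow> bool" where
  "in_box l1 u1 l2 u2 \<alpha> M \<longleftrightarrow> l1 \<le> M 1 \<and> M 1 \<le> u1 \<and> l2 \<le> M 2 \<and> M 2 \<le> u2 \<and> l2norm (tail 3 M) \<le> \<alpha>"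

text \<open>Completing the square; the condition on P is that of a nonpositive discriminant.\<close>

lemma amgm_weighted: "P * (x * y) \<le> p * x\<^sup>2 + q * y\<^sup>2"
  if "P\<^sup>2 \<le> 4 * p * q" "0 \<le> x" "0 \<le> y" "0 < p" for P p q x y :: real
proof -
  have "4 * p * (p * x\<^sup>2 + q * y\<^sup>2 - P * (x * y)) = (2 * p * x - P * y)\<^sup>2 + (4 * p * q - P\<^sup>2) * y\<^sup>2"
    by (simp add: power2_eq_square algebra_simps)
  also have "\<dots> \<ge> 0" using that by simp
  finally show ?thesis using that(4) by (simp add: zero_le_mult_iff)
qed

text \<open>Each diagonal coefficient is divided into the rate c and two shares: p1 and q1 pay for
  the cross term d_1 d_2, p2 and q2 for d_1 h, p3 and q3 for d_2 h, each time by
  \<open>amgm_weighted\<close>.\<close>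

lemma ks_form_le:
  assumes A: "3 * (ks_eig \<mu> 1 + M2) - 2 * \<eta> * M1 + \<alpha> * (2 * \<eta>) \<le> - (c + p1 + p2)"
    and B: "ks_eig \<mu> 2 + \<eta> * M1 + \<alpha> * (2 + 2 * \<eta>) \<le> - (c + q1 + p3)"
    and H: "- 23/36 + (2 * M1 / 27 + 2 * \<bar>M2\<bar> / 27) + \<alpha> * (213/900) \<le> - (c + q2 + q3)"
    and P1: "\<bar>M1 + \<eta> * (ks_eig \<mu> 1 + ks_eig \<mu> 2 + M2)\<bar> + \<alpha> * (8 + 2 * \<eta>) \<le> P1"
    and P2: "(3 * \<bar>M2\<bar> / 9 + 2 * \<eta> * M1 / 9 + 2 * \<eta> * \<bar>M2\<bar> / 16 + \<bar>M2\<bar> / 3) + \<alpha> * (6/9 + 4 * \<eta> / 9 + 213/100) \<le> P2"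
    and P3: "(2 * M1 / 9 + 2 * \<bar>M2\<bar> / 16 + \<eta> * \<bar>M2\<bar> / 9 + M1 / 3 + \<bar>M2\<bar> / 3) + \<alpha> * (4/9 + 2 * \<eta> / 9 + 213/100) \<le> P3"
    and sq: "P1\<^sup>2 \<le> 4 * p1 * q1" "P2\<^sup>2 \<le> 4 * p2 * q2" "P3\<^sup>2 \<le> 4 * p3 * q3" "0 < p1" "0 < p2" "0 < p3"
    and nn: "0 \<le> h"
  shows "ks_form \<mu> \<eta> M1 M2 \<alpha> d1 d2 h \<le> - c * (d1\<^sup>2 + d2\<^sup>2 + h\<^sup>2)"
proof -
  define x y where "x = \<bar>d1\<bar>" and "y = \<bar>d2\<bar>"
  have xy: "0 \<le> x" "0 \<le> y" "d1\<^sup>2 = x\<^sup>2" "d2\<^sup>2 = y\<^sup>2" by (auto simp: x_def y_def)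
  define k where "k = M1 + \<eta> * (ks_eig \<mu> 1 + ks_eig \<mu> 2 + M2)"
  have k: "k * (d1 * d2) \<le> \<bar>k\<bar> * (x * y)"
    using mult_le_abs[of k "d1 * d2"] by (simp add: x_def y_def abs_mult)
  have "ks_form \<mu> \<eta> M1 M2 \<alpha> d1 d2 h =
      (3 * (ks_eig \<mu> 1 + M2) - 2 * \<eta> * M1 + \<alpha> * (2 * \<eta>)) * x\<^sup>2 + (ks_eig \<mu> 2 + \<eta> * M1 + \<alpha> * (2 + 2 * \<eta>)) * y\<^sup>2
      + (- 23/36 + (2 * M1 / 27 + 2 * \<bar>M2\<bar> / 27) + \<alpha> * (213/900)) * h\<^sup>2
      + (k * (d1 * d2) + \<alpha> * (8 + 2 * \<eta>) * (x * y))
      + ((3 * \<bar>M2\<bar> / 9 + 2 * \<eta> * M1 / 9 + 2 * \<eta> * \<bar>M2\<bar> / 16 + \<bar>M2\<bar> / 3) + \<alpha> * (6/9 + 4 * \<eta> / 9 + 213/100)) * (x * h)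
      + ((2 * M1 / 9 + 2 * \<bar>M2\<bar> / 16 + \<eta> * \<bar>M2\<bar> / 9 + M1 / 3 + \<bar>M2\<bar> / 3) + \<alpha> * (4/9 + 2 * \<eta> / 9 + 213/100)) * (y * h)"
    unfolding ks_form_def xy(3,4) x_def[symmetric] y_def[symmetric] k_def[symmetric]
    by (simp add: field_simps power2_eq_square)
  also have "\<dots> \<le> - (c + p1 + p2) * x\<^sup>2 + - (c + q1 + p3) * y\<^sup>2 + - (c + q2 + q3) * h\<^sup>2
      + P1 * (x * y) + P2 * (x * h) + P3 * (y * h)"
  proof (intro add_mono mult_right_mono A B H P2 P3)
    have "k * (d1 * d2) + \<alpha> * (8 + 2 * \<eta>) * (x * y) \<le> (\<bar>k\<bar> + \<alpha> * (8 + 2 * \<eta>)) * (x * y)"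
      using k by (simp add: algebra_simps)
    also have "\<dots> \<le> P1 * (x * y)" using P1 xy by (intro mult_right_mono) (auto simp: k_def)
    finally show "k * (d1 * d2) + \<alpha> * (8 + 2 * \<eta>) * (x * y) \<le> P1 * (x * y)" .
  qed (use xy nn in auto)
  also have "\<dots> \<le> - c * (x\<^sup>2 + y\<^sup>2 + h\<^sup>2)"
    using amgm_weighted[OF sq(1) xy(1,2) sq(4)] amgm_weighted[OF sq(2) xy(1) nn sq(5)]
      amgm_weighted[OF sq(3) xy(2) nn sq(6)] by (simp add: algebra_simps)
  finally show ?thesis by (simp add: xy)
qed

text \<open>The box holds the sums of two states with a_1 between 0.66 and 0.8, with a small margin.
  There 3 (1/4 + M_2) can be as large as 0.18; the term - 2 \<eta> M_1 \<le> -0.917 turns the first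
  diagonal coefficient negative. The coefficient of d_1 d_2 lies between -1.53 and -1.16, and the
  damping -8 of the second mode affords the share q1 that controls it.\<close>

lemma ks_form_75:
  assumes b: "in_box (131/100) (161/100) (-36/100) (-19/100) (5/100) M" and \<alpha>: "0 \<le> l2norm (tail 3 M)" and h: "0 \<le> h"
  shows "ks_form (3/4) (35/100) (M 1) (M 2) (l2norm (tail 3 M)) d1 d2 h \<le> - (1/100) * (d1\<^sup>2 + d2\<^sup>2 + h\<^sup>2)"
proof -
  have e: "ks_eig (3/4) (Suc 0) = 1/4" "ks_eig (3/4) 2 = -8" by (simp_all add: ks_eig_def)
  show ?thesis
    by (rule ks_form_le[where ?p1.0="3/10" and ?q1.0="33/10" and ?p2.0="1/4" and ?q2.0="29/100" and ?p3.0=3 and ?q3.0="125/1000"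
          and ?P1.0="198/100" and ?P2.0="535/1000" and ?P3.0="122/100"]; (use b \<alpha> h in \<open>auto simp: e in_box_def power2_eq_square abs_if; argo\<close>))
qed

text \<open>Near \<mu> = 1 the first mode is almost neutral: 3 (1/100 + M_2) is at most 0.0012, and
  - 2 \<eta> M_1 \<le> -0.061 leaves little more than the 0.05 taken by the rate and the shares p1,
  p2. The small p1 is compensated by q1 = 7, available from the damping -11.84 of the second
  mode.\<close>

lemma ks_form_99:
  assumes b: "in_box (339/1000) (381/1000) (-124/10000) (-96/10000) (8/10000) M" and \<alpha>: "0 \<le> l2norm (tail 3 M)" and h: "0 \<le> h"
  shows "ks_form (99/100) (9/100) (M 1) (M 2) (l2norm (tail 3 M)) d1 d2 h \<le> - (1/100) * (d1\<^sup>2 + d2\<^sup>2 + h\<^sup>2)"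
proof -
  have e: "ks_eig (99/100) (Suc 0) = 1/100" "ks_eig (99/100) 2 = -1184/100" by (simp_all add: ks_eig_def)
  show ?thesis
    by (rule ks_form_le[where ?p1.0="2/100" and ?q1.0="7" and ?p2.0="2/100" and ?q2.0="1/100" and ?p3.0=1 and ?q3.0="2/100"
          and ?P1.0="74/100" and ?P2.0="2/100" and ?P3.0="23/100"]; (use b \<alpha> h in \<open>auto simp: e in_box_def power2_eq_square abs_if; argo\<close>))
qed

section \<open>Regularity\<close>

lemma summable_inverse_power: "2 \<le> n \<Longrightarrow> summable (\<lambda>k. C / real k ^ n)"
  using summable_mult[OF inverse_power_summable[where ?'a=real], of n C] by (simp add: divide_inverse)

text \<open>One of i and k - i is at least k / 2, so its factor is at most 8 / k^3.\<close>

lemma conv_weight_le: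
  assumes "1 \<le> i" "i < k"
  shows "1 / real i ^ 3 * (1 / real (k - i) ^ 3) \<le> 8 / real k ^ 3 * (1 / real i ^ 3 + 1 / real (k - i) ^ 3)"
proof -
  have half: "1 / real m ^ 3 \<le> 8 / real k ^ 3" if "k \<le> 2 * m" "1 \<le> m" for m
  proof -
    have "real k \<le> 2 * real m" using that by linarith
    then have "real k ^ 3 \<le> (2 * real m) ^ 3" by (intro power_mono) auto
    then have "real k ^ 3 \<le> 8 * real m ^ 3" by (simp add: power_mult_distrib)
    then have "8 / (8 * real m ^ 3) \<le> 8 / real k ^ 3"
      using that assms by (intro divide_left_mono mult_pos_pos) auto
    then show ?thesis by simp
  qed
  show ?thesis
  proof (cases "k \<le> 2 * i")
    case True
    have "1 / real i ^ 3 * (1 / real (k - i) ^ 3) \<le> 8 / real k ^ 3 * (1 / real (k - i) ^ 3)"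
      using half[OF True assms(1)] by (intro mult_right_mono) auto
    also have "\<dots> \<le> 8 / real k ^ 3 * (1 / real i ^ 3 + 1 / real (k - i) ^ 3)" by (intro mult_left_mono) auto
    finally show ?thesis .
  next
    case False
    then have "1 / real (k - i) ^ 3 \<le> 8 / real k ^ 3" using assms by (intro half) auto
    then have "1 / real i ^ 3 * (1 / real (k - i) ^ 3) \<le> 1 / real i ^ 3 * (8 / real k ^ 3)"
      by (intro mult_left_mono) auto
    also have "1 / real i ^ 3 * (8 / real k ^ 3) = 8 / real k ^ 3 * (1 / real i ^ 3)" by simp
    also have "\<dots> \<le> 8 / real k ^ 3 * (1 / real i ^ 3 + 1 / real (k - i) ^ 3)" by (intro mult_left_mono) auto
    finally show ?thesis .
  qed
qed

text \<open>Decay k^-3 survives correlation and convolution because the k^-3 are summable; the outer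
  factor k leaves k^-2. \<open>D\<close> is independent of the sequence, so the estimate is uniform
  along an orbit.\<close>

lemma ks_bil_decay:
  "\<exists>D\<ge>0. \<forall>a C k. (\<forall>k. \<bar>a k\<bar> \<le> C / real k ^ 3) \<longrightarrow> 0 \<le> C \<longrightarrow> 1 \<le> k \<longrightarrow>
    \<bar>ks_bil a a k\<bar> \<le> D * C\<^sup>2 / (real k)\<^sup>2"
proof -
  define Z where "Z = (\<Sum>k. 1 / real k ^ 3)"
  have sZ: "summable (\<lambda>k. 1 / real k ^ 3)" by (rule summable_inverse_power) simp
  have Z0: "0 \<le> Z" unfolding Z_def by (rule suminf_nonneg[OF sZ]) simp
  have sZ1: "summable (\<lambda>k. 1 / real (k + 1) ^ 3)" using sZ by (subst summable_iff_shift)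
  have Z1: "(\<Sum>k. 1 / real (k + 1) ^ 3) = Z"
    using suminf_split_initial_segment[OF sZ, of 1] by (simp add: Z_def)
  show ?thesis
  proof (intro exI[of _ "18 * Z"] conjI allI impI)
    show "0 \<le> 18 * Z" using Z0 by simp
    fix a :: "nat \<Rightarrow> real" and C and k :: nat
    assume "\<forall>k. \<bar>a k\<bar> \<le> C / real k ^ 3" and C: "0 \<le> C" and k: "1 \<le> k"
    then have a: "\<bar>a k\<bar> \<le> C / real k ^ 3" for k by blast
    have le: "\<bar>a (i + 1) * a (i + (k + 1))\<bar> \<le> C\<^sup>2 / real k ^ 3 * (1 / real (i + 1) ^ 3)" for i
    proof -
      have "C / real (i + (k + 1)) ^ 3 \<le> C / real k ^ 3"
        using C k by (intro divide_left_mono power_mono mult_pos_pos) auto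
      then have "\<bar>a (i + 1)\<bar> * \<bar>a (i + (k + 1))\<bar> \<le> C / real (i + 1) ^ 3 * (C / real k ^ 3)"
        by (intro mult_mono a order_trans[OF a]) (use C in auto)
      also have "\<dots> = C\<^sup>2 / real k ^ 3 * (1 / real (i + 1) ^ 3)" by (simp add: power2_eq_square)
      finally show ?thesis by (simp only: abs_mult)
    qed
    have "norm (\<Sum>i. a (i + 1) * a (i + (k + 1))) \<le> (\<Sum>i. C\<^sup>2 / real k ^ 3 * (1 / real (i + 1) ^ 3))"
      by (rule norm_suminf_le[OF le[folded real_norm_def] summable_mult[OF sZ1]])
    also have "\<dots> = C\<^sup>2 / real k ^ 3 * Z" unfolding suminf_mult[OF sZ1] Z1 ..
    finally have 1: "\<bar>\<Sum>i. a (i + 1) * a (i + (k + 1))\<bar> \<le> C\<^sup>2 / real k ^ 3 * Z" by simp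
    have "\<bar>\<Sum>i = 1..k - 1. a i * a (k - i)\<bar> \<le> (\<Sum>i = 1..k - 1. \<bar>a i * a (k - i)\<bar>)" by (rule sum_abs)
    also have "\<dots> \<le> (\<Sum>i = 1..k - 1. C\<^sup>2 * (8 / real k ^ 3) * (1 / real i ^ 3 + 1 / real (k - i) ^ 3))"
    proof (rule sum_mono)
      fix i assume i: "i \<in> {1..k - 1}"
      have "\<bar>a i\<bar> * \<bar>a (k - i)\<bar> \<le> (C / real i ^ 3) * (C / real (k - i) ^ 3)"
        using C by (intro mult_mono a) auto
      also have "\<dots> = C\<^sup>2 * (1 / real i ^ 3 * (1 / real (k - i) ^ 3))" by (simp add: power2_eq_square)
      also have "\<dots> \<le> C\<^sup>2 * (8 / real k ^ 3 * (1 / real i ^ 3 + 1 / real (k - i) ^ 3))"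
        using i k by (intro mult_left_mono conv_weight_le) auto
      finally show "\<bar>a i * a (k - i)\<bar> \<le> C\<^sup>2 * (8 / real k ^ 3) * (1 / real i ^ 3 + 1 / real (k - i) ^ 3)"
        by (simp add: abs_mult mult.assoc)
    qed
    also have "\<dots> = C\<^sup>2 * (8 / real k ^ 3) * ((\<Sum>i = 1..k - 1. 1 / real i ^ 3) + (\<Sum>i = 1..k - 1. 1 / real (k - i) ^ 3))"
      by (simp only: sum_distrib_left[symmetric] sum.distrib)
    also have "(\<Sum>i = 1..k - 1. 1 / real (k - i) ^ 3) = (\<Sum>i = 1..k - 1. 1 / real i ^ 3)"
      using conv_reflect[of "\<lambda>i j. 1 / real j ^ 3" k] by simp
    also have "C\<^sup>2 * (8 / real k ^ 3) * ((\<Sum>i = 1..k - 1. 1 / real i ^ 3) + (\<Sum>i = 1..k - 1. 1 / real i ^ 3))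
        \<le> C\<^sup>2 * (8 / real k ^ 3) * (Z + Z)"
      unfolding Z_def by (intro mult_left_mono add_mono sum_le_suminf[OF sZ]) auto
    finally have 2: "\<bar>\<Sum>i = 1..k - 1. a i * a (k - i)\<bar> \<le> 16 * (C\<^sup>2 / real k ^ 3 * Z)" by simp
    have "\<bar>ks_bil a a k\<bar> \<le> real k * (18 * (C\<^sup>2 / real k ^ 3 * Z))"
      unfolding ks_bil_def abs_mult using 1 2 by (intro mult_mono) auto
    also have "\<dots> = 18 * Z * C\<^sup>2 / (real k)\<^sup>2" using k by (simp add: power3_eq_cube power2_eq_square[of "real k"])
    finally show "\<bar>ks_bil a a k\<bar> \<le> 18 * Z * C\<^sup>2 / (real k)\<^sup>2" .
  qed
qed

text \<open>An orbit bounded since minus infinity has no initial layer: each damped mode is at most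
  forcing over damping. One pass gives k * k^-4 = k^-3, a second one k^-2 * k^-4 = k^-6, enough for
  four derivatives of the sine series.\<close>

lemma full_orbit_decay:
  assumes \<mu>: "3/4 \<le> \<mu>" and a: "ks_solution_on \<mu> UNIV a" and R: "\<And>t. l2norm (a t) \<le> R"
  obtains C where "0 \<le> C" "\<And>t k. \<bar>a t k\<bar> \<le> C / real k ^ 6" "\<And>t k. 1 \<le> k \<Longrightarrow> \<bar>ks_bil (a t) (a t) k\<bar> \<le> C / (real k)\<^sup>2"
proof -
  note s = ks_solutionD(1)[OF a UNIV_I] and z = ks_solutionD(2)[OF a UNIV_I]
  have R0: "0 \<le> R" using R[of 0] l2norm_nonneg[OF s, of 0] by linarith
  have comp: "\<bar>a t k\<bar> \<le> 2 * G / real k ^ 4" if k: "2 \<le> k" and G: "0 \<le> G" "\<And>t. \<bar>ks_bil (a t) (a t) k\<bar> \<le> G" for t k G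
  proof -
    have L: "real k ^ 4 / 2 \<le> - ks_eig \<mu> k" "0 < real k ^ 4 / 2" using ks_eig_le(2)[OF \<mu> k] k by simp_all
    then have Lp: "0 < - ks_eig \<mu> k" by linarith
    have "\<bar>a t k\<bar> \<le> G * 1 / (- ks_eig \<mu> k + 0)"
    \<comment> \<open>Slaving to the constant 1, with rate \<gamma> = 0.\<close>
    proof (rule slaving_abs[where T=t and f="\<lambda>t. a t k" and g="\<lambda>r. ks_bil (a r) (a r) k" and z="\<lambda>_. 1" and z'="\<lambda>_. 0" and F=R and Z=1, OF Lp])
      show "continuous_on {..t} (\<lambda>t. a t k)"
        using ks_solution_continuous(2)[OF a] by (rule continuous_on_subset) simp
      show "\<bar>a t k\<bar> \<le> R" for t using abs_le_l2norm[OF s, of t k] R[of t] by linarith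
      show "((\<lambda>t. a t k) has_real_derivative - (- ks_eig \<mu> k) * a r k + ks_bil (a r) (a r) k) (at r)
          \<and> \<bar>ks_bil (a r) (a r) k\<bar> \<le> G * 1" for r
        using ks_solution_deriv_interior[OF a, of r k] G k by simp
    qed (use Lp G in auto)
    also have "\<dots> \<le> G / (real k ^ 4 / 2)" unfolding mult_1_right add_0_right
      using L Lp G by (intro divide_left_mono mult_pos_pos) auto
    finally show ?thesis by (simp add: mult.commute)
  qed
  define C1 where "C1 = R + 6 * R\<^sup>2"
  have C1: "0 \<le> C1" "R \<le> C1" "6 * R\<^sup>2 \<le> C1" using R0 by (simp_all add: C1_def)
  have d3: "\<bar>a t k\<bar> \<le> C1 / real k ^ 3" for t k
  proof -
    consider "k = 0" | "k = 1" | "2 \<le> k" by linarith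
    then show ?thesis
    proof cases
      case 1 then show ?thesis using z by simp
    next
      case 2 then show ?thesis using abs_le_l2norm[OF s, of t k] R[of t] C1 by simp
    next
      case 3
      have "\<bar>ks_bil (a t) (a t) k\<bar> \<le> 3 * real k * R\<^sup>2" for t
      proof -
        have "l2norm (a t) * l2norm (a t) \<le> R * R" by (intro mult_mono R R0 l2norm_nonneg s)
        then have "3 * real k * (l2norm (a t) * l2norm (a t)) \<le> 3 * real k * R\<^sup>2"
          by (intro mult_left_mono) (auto simp: power2_eq_square)
        then show ?thesis using ks_bil_bound[OF s s, of t t k] by linarith
      qed
      then have "\<bar>a t k\<bar> \<le> 2 * (3 * real k * R\<^sup>2) / real k ^ 4" by (intro comp[OF 3]) auto
      also have "\<dots> = 6 * R\<^sup>2 / real k ^ 3" using 3 by (simp add: power3_eq_cube power4_eq_xxxx)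
      also have "\<dots> \<le> C1 / real k ^ 3" using C1 by (intro divide_right_mono) auto
      finally show ?thesis .
    qed
  qed
  obtain D where D: "0 \<le> D" "\<forall>a C k. (\<forall>k. \<bar>a k\<bar> \<le> C / real k ^ 3) \<longrightarrow> 0 \<le> C \<longrightarrow> 1 \<le> k \<longrightarrow>
    \<bar>ks_bil a a k\<bar> \<le> D * C\<^sup>2 / (real k)\<^sup>2" using ks_bil_decay by blast
  have bil: "\<bar>ks_bil (a t) (a t) k\<bar> \<le> D * C1\<^sup>2 / (real k)\<^sup>2" if "1 \<le> k" for t k
    by (rule D(2)[rule_format, OF d3 C1(1) that])
  define C where "C = R + 2 * (D * C1\<^sup>2)"
  have C: "0 \<le> C" "R \<le> C" "2 * (D * C1\<^sup>2) \<le> C" "D * C1\<^sup>2 \<le> C" using R0 D(1) by (simp_all add: C_def)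
  show thesis
  proof (rule that[OF C(1)])
    show "\<bar>ks_bil (a t) (a t) k\<bar> \<le> C / (real k)\<^sup>2" if "1 \<le> k" for t k
      using bil[OF that, of t] divide_right_mono[OF C(4), of "(real k)\<^sup>2"] by simp
    fix t and k :: nat
    consider "k = 0" | "k = 1" | "2 \<le> k" by linarith
    then show "\<bar>a t k\<bar> \<le> C / real k ^ 6"
    proof cases
      case 1 then show ?thesis using z by simp
    next
      case 2 then show ?thesis using abs_le_l2norm[OF s, of t k] R[of t] C by simp
    next
      case 3
      have "\<bar>a t k\<bar> \<le> 2 * (D * C1\<^sup>2 / (real k)\<^sup>2) / real k ^ 4"
        using 3 D(1) by (intro comp[OF 3] bil) auto
      also have "\<dots> = 2 * (D * C1\<^sup>2) / real k ^ 6" by (simp flip: power_add)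
      also have "\<dots> \<le> C / real k ^ 6" using C by (intro divide_right_mono) auto
      finally show ?thesis .
    qed
  qed
qed

section \<open>Fourier series\<close>

definition sinS :: "(nat \<Rightarrow> real) \<Rightarrow> real \<Rightarrow> real" where
  "sinS c x = (\<Sum>k. c k * sin (real k * x))"

definition cosS :: "(nat \<Rightarrow> real) \<Rightarrow> real \<Rightarrow> real" where
  "cosS c x = (\<Sum>k. c k * cos (real k * x))"

lemma trig_summable:
  assumes "summable (\<lambda>k. \<bar>c k\<bar>)"
  shows "summable (\<lambda>k. \<bar>c k * sin (real k * x)\<bar>)" "summable (\<lambda>k. \<bar>c k * cos (real k * x)\<bar>)"
    "summable (\<lambda>k. c k * sin (real k * x))" "summable (\<lambda>k. c k * cos (real k * x))"
proof -
  show 1: "summable (\<lambda>k. \<bar>c k * sin (real k * x)\<bar>)"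
    by (rule summable_comparison_test'[OF assms, of 0]) (simp add: abs_mult mult_left_le)
  show 2: "summable (\<lambda>k. \<bar>c k * cos (real k * x)\<bar>)"
    by (rule summable_comparison_test'[OF assms, of 0]) (simp add: abs_mult mult_left_le)
  show "summable (\<lambda>k. c k * sin (real k * x))" "summable (\<lambda>k. c k * cos (real k * x))"
    by (rule summable_rabs_cancel[OF 1], rule summable_rabs_cancel[OF 2])
qed

lemma sinS_deriv:
  assumes "summable (\<lambda>k. \<bar>real k * c k\<bar>)"
  shows "(sinS c has_real_derivative cosS (\<lambda>k. real k * c k) x) (at x)"
  unfolding sinS_def[abs_def] cosS_def
proof (rule has_field_derivative_series'(2)[of UNIV "\<lambda>k x. c k * sin (real k * x)"
      "\<lambda>k x. real k * c k * cos (real k * x)" 0 x])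
  show "((\<lambda>x. c n * sin (real n * x)) has_real_derivative real n * c n * cos (real n * x)) (at x within UNIV)" for n x
    by (auto intro!: derivative_eq_intros)
  show "uniformly_convergent_on UNIV (\<lambda>n x. \<Sum>i<n. real i * c i * cos (real i * x))"
    by (rule Weierstrass_m_test'[OF _ assms]) (simp add: abs_mult mult_left_le)
qed simp_all

lemma cosS_deriv:
  assumes "summable (\<lambda>k. \<bar>real k * c k\<bar>)" "summable (\<lambda>k. \<bar>c k\<bar>)"
  shows "(cosS c has_real_derivative - sinS (\<lambda>k. real k * c k) x) (at x)"
proof -
  have "(cosS c has_real_derivative (\<Sum>k. - (real k * c k * sin (real k * x)))) (at x)"
    unfolding cosS_def[abs_def]
  proof (rule has_field_derivative_series'(2)[of UNIV "\<lambda>k x. c k * cos (real k * x)"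
      "\<lambda>k x. - (real k * c k * sin (real k * x))" 0 x])
    show "((\<lambda>x. c n * cos (real n * x)) has_real_derivative - (real n * c n * sin (real n * x))) (at x within UNIV)" for n x
      by (auto intro!: derivative_eq_intros)
    show "uniformly_convergent_on UNIV (\<lambda>n x. \<Sum>i<n. - (real i * c i * sin (real i * x)))"
      by (rule Weierstrass_m_test'[OF _ assms(1)]) (simp add: abs_mult mult_left_le)
  qed (use summable_rabs_cancel[OF assms(2)] in simp_all)
  then show ?thesis unfolding sinS_def by (simp add: suminf_minus trig_summable(3)[OF assms(1)])
qed

lemma sinS_add_cmult:
  assumes "summable (\<lambda>k. \<bar>c k\<bar>)" "summable (\<lambda>k. \<bar>d k\<bar>)"
  shows "sinS (\<lambda>k. p * c k + q * d k) x = p * sinS c x + q * sinS d x"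
proof -
  have "sinS (\<lambda>k. p * c k + q * d k) x = (\<Sum>k. p * (c k * sin (real k * x)) + q * (d k * sin (real k * x)))"
    unfolding sinS_def by (simp add: algebra_simps)
  also have "\<dots> = (\<Sum>k. p * (c k * sin (real k * x))) + (\<Sum>k. q * (d k * sin (real k * x)))"
    by (rule suminf_add[symmetric]) (intro summable_mult trig_summable assms)+
  also have "\<dots> = p * sinS c x + q * sinS d x"
    unfolding sinS_def using trig_summable(3)[OF assms(1)] trig_summable(3)[OF assms(2)] by (simp add: suminf_mult)
  finally show ?thesis .
qed

text \<open>The real part of the square of the series of a_k exp (i k x), by the Cauchy product and
  the addition theorem: frequencies add.\<close>

lemma cosS_sinS_sums:
  assumes a: "summable (\<lambda>k. \<bar>a k\<bar>)"
  shows "(\<lambda>k. (\<Sum>i\<le>k. a i * a (k - i)) * cos (real k * x)) sums ((cosS a x)\<^sup>2 - (sinS a x)\<^sup>2)"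
proof -
  note t = trig_summable[OF a, of x]
  have "(\<lambda>k. (\<Sum>i\<le>k. a i * cos (real i * x) * (a (k - i) * cos (real (k - i) * x)))
      - (\<Sum>i\<le>k. a i * sin (real i * x) * (a (k - i) * sin (real (k - i) * x)))) sums
      (cosS a x * cosS a x - sinS a x * sinS a x)"
    unfolding cosS_def sinS_def
    by (intro sums_diff Cauchy_product_sums) (use t(1,2) in simp_all)
  moreover have "(\<Sum>i\<le>k. a i * cos (real i * x) * (a (k - i) * cos (real (k - i) * x)))
      - (\<Sum>i\<le>k. a i * sin (real i * x) * (a (k - i) * sin (real (k - i) * x)))
      = (\<Sum>i\<le>k. a i * a (k - i)) * cos (real k * x)" for k
  proof -
    have "a i * cos (real i * x) * (a (k - i) * cos (real (k - i) * x))
        - a i * sin (real i * x) * (a (k - i) * sin (real (k - i) * x)) = a i * a (k - i) * cos (real k * x)"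
      if "i \<le> k" for i
    proof -
      have "real k * x = real i * x + real (k - i) * x" using that by (simp add: of_nat_diff algebra_simps)
      then show ?thesis by (simp add: cos_add algebra_simps)
    qed
    then show ?thesis by (simp add: sum_subtractf[symmetric] sum_distrib_right)
  qed
  ultimately show ?thesis by (simp add: power2_eq_square)
qed

text \<open>The squared modulus of the series of a_k exp (i k x), expanded over pairs of indices and
  regrouped by the difference of frequencies. Absolute summability over the pairs permits the
  regrouping; the diagonal gives the constant term.\<close>

lemma cosS_sinS_differences:
  assumes a: "summable (\<lambda>k. \<bar>a k\<bar>)"
  shows "(\<lambda>k. 2 * (\<Sum>i. a i * a (i + (k + 1))) * cos (real (k + 1) * x)) sums
    ((cosS a x)\<^sup>2 + (sinS a x)\<^sup>2 - (\<Sum>i. (a i)\<^sup>2))"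
proof -
  define F where "F = (\<lambda>(i, j). a i * a j * cos (real i * x - real j * x))"
  have F_le: "\<bar>F (i, j)\<bar> \<le> \<bar>a i\<bar> * \<bar>a j\<bar>" for i j by (simp add: F_def abs_mult mult_left_le)
  have nF: "summable (\<lambda>j. norm (F (i, j)))" for i
    by (rule summable_comparison_test'[OF summable_mult[OF a, of "\<bar>a i\<bar>"], of 0]) (use F_le in simp)
  have "\<forall>i\<in>UNIV. (\<lambda>y. norm (F (i, y))) summable_on UNIV"
    using norm_summable_imp_summable_on[of "\<lambda>y. norm (F (i, y))" for i] nF by simp
  moreover have "(\<lambda>i. norm (infsum (\<lambda>y. norm (F (i, y))) UNIV)) summable_on UNIV"
  proof (rule norm_summable_imp_summable_on, rule summable_comparison_test'[OF summable_mult2[OF a, of "\<Sum>j. \<bar>a j\<bar>"], of 0])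
    fix i :: nat
    have "((\<lambda>y. norm (F (i, y))) has_sum (\<Sum>y. norm (F (i, y)))) UNIV"
      by (rule norm_summable_imp_has_sum) (use nF in \<open>auto simp: summable_sums\<close>)
    then have "infsum (\<lambda>y. norm (F (i, y))) UNIV = (\<Sum>y. norm (F (i, y)))" by (rule infsumI)
    also have "\<dots> \<le> (\<Sum>y. \<bar>a i\<bar> * \<bar>a y\<bar>)"
      by (rule suminf_le[OF _ nF summable_mult[OF a]]) (use F_le in simp)
    also have "\<dots> = \<bar>a i\<bar> * (\<Sum>j. \<bar>a j\<bar>)" by (rule suminf_mult[OF a])
    finally show "norm (norm (norm (infsum (\<lambda>y. norm (F (i, y))) UNIV))) \<le> \<bar>a i\<bar> * (\<Sum>j. \<bar>a j\<bar>)"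
      by (simp add: infsum_nonneg)
  qed
  ultimately have absF: "(\<lambda>y. norm (F y)) summable_on (UNIV \<times> UNIV)"
    using Infinite_Sum.abs_summable_on_Sigma_iff[of F UNIV "\<lambda>_. UNIV"] by blast
  have summF: "F summable_on S" for S
    by (rule summable_on_subset_banach[OF abs_summable_summable[OF absF]]) simp
  define V where "V = infsum F (UNIV \<times> UNIV)"
  have V: "(F has_sum V) (UNIV \<times> UNIV)" unfolding V_def by (rule has_sum_infsum[OF summF])
  have cs: "(\<lambda>i. a i * cos (real i * x)) sums cosS a x" and sn: "(\<lambda>i. a i * sin (real i * x)) sums sinS a x"
    unfolding cosS_def sinS_def by (intro summable_sums trig_summable a)+
  have Vcs: "V = (cosS a x)\<^sup>2 + (sinS a x)\<^sup>2"
  proof -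
    have row: "((\<lambda>j. F (i, j)) has_sum (a i * cos (real i * x) * cosS a x + a i * sin (real i * x) * sinS a x)) UNIV" for i
    proof (rule norm_summable_imp_has_sum[OF nF])
      have "(\<lambda>j. a i * cos (real i * x) * (a j * cos (real j * x)) + a i * sin (real i * x) * (a j * sin (real j * x)))
          sums (a i * cos (real i * x) * cosS a x + a i * sin (real i * x) * sinS a x)"
        by (intro sums_add sums_mult cs sn)
      then show "(\<lambda>j. F (i, j)) sums (a i * cos (real i * x) * cosS a x + a i * sin (real i * x) * sinS a x)"
        by (simp add: F_def cos_diff algebra_simps)
    qed
    have "((\<lambda>i. a i * cos (real i * x) * cosS a x + a i * sin (real i * x) * sinS a x) has_sum V) UNIV"
      by (rule has_sum_SigmaD[OF V row])
    then have "(\<lambda>i. a i * cos (real i * x) * cosS a x + a i * sin (real i * x) * sinS a x) sums V"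
      by (rule has_sum_imp_sums)
    moreover have "(\<lambda>i. a i * cos (real i * x) * cosS a x + a i * sin (real i * x) * sinS a x) sums
        (cosS a x * cosS a x + sinS a x * sinS a x)"
      by (intro sums_add sums_mult2 cs sn)
    ultimately show ?thesis unfolding power2_eq_square by (rule sums_unique2)
  qed
  \<comment> \<open>\<open>h\<close> and \<open>h'\<close> enumerate the pairs above and below the
    diagonal by their lag k + 1; F is symmetric, so both halves have the same sum U.\<close>
  define h where "h = (\<lambda>(k, i). (i, i + (k + 1)) :: nat \<times> nat)"
  define h' where "h' = (\<lambda>(k, i). (i + (k + 1), i) :: nat \<times> nat)"
  define dg where "dg = (\<lambda>i. (i, i) :: nat \<times> nat)"
  have inj: "inj_on h (UNIV \<times> UNIV)" "inj_on h' (UNIV \<times> UNIV)" "inj_on dg UNIV"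
    by (auto simp: inj_on_def h_def h'_def dg_def)
  define U where "U = infsum F (h ` (UNIV \<times> UNIV))"
  have U: "(F has_sum U) (h ` (UNIV \<times> UNIV))" unfolding U_def by (rule has_sum_infsum[OF summF])
  have Fh: "F \<circ> h = F \<circ> h'"
  proof
    fix y :: "nat \<times> nat"
    obtain k i where y: "y = (k, i)" by force
    have "cos (real i * x - real (i + (k + 1)) * x) = cos (real (i + (k + 1)) * x - real i * x)"
      using cos_minus[of "real i * x - real (i + (k + 1)) * x"] by simp
    then show "(F \<circ> h) y = (F \<circ> h') y" by (simp add: F_def h_def h'_def y mult.commute)
  qed
  have U': "(F has_sum U) (h' ` (UNIV \<times> UNIV))"
    using U unfolding has_sum_reindex[OF inj(1)] has_sum_reindex[OF inj(2)] Fh .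
  have "summable (\<lambda>i. \<bar>(a i)\<^sup>2\<bar>)"
  proof (rule summable_comparison_test'[OF summable_mult2[OF a, of "\<Sum>j. \<bar>a j\<bar>"], of 0])
    fix i
    have "\<bar>a i\<bar> \<le> (\<Sum>j. \<bar>a j\<bar>)" using sum_le_suminf[OF a, of "{i}"] by simp
    then show "norm \<bar>(a i)\<^sup>2\<bar> \<le> \<bar>a i\<bar> * (\<Sum>j. \<bar>a j\<bar>)"
      using mult_left_mono[of "\<bar>a i\<bar>" "\<Sum>j. \<bar>a j\<bar>" "\<bar>a i\<bar>"] by (simp add: power2_eq_square)
  qed
  then have "((\<lambda>i. (a i)\<^sup>2) has_sum (\<Sum>i. (a i)\<^sup>2)) UNIV"
    by (intro norm_summable_imp_has_sum summable_sums) (auto intro: summable_rabs_cancel)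
  then have Dg: "(F has_sum (\<Sum>i. (a i)\<^sup>2)) (dg ` UNIV)"
    unfolding has_sum_reindex[OF inj(3)] by (simp add: o_def F_def dg_def power2_eq_square)
  have part: "(UNIV \<times> UNIV) = dg ` UNIV \<union> (h ` (UNIV \<times> UNIV) \<union> h' ` (UNIV \<times> UNIV))"
  proof (intro equalityI subsetI)
    fix y :: "nat \<times> nat" assume "y \<in> UNIV \<times> UNIV"
    obtain i j where y: "y = (i, j)" by force
    consider "i = j" | "i < j" | "j < i" by linarith
    then show "y \<in> dg ` UNIV \<union> (h ` (UNIV \<times> UNIV) \<union> h' ` (UNIV \<times> UNIV))"
    proof cases
      case 1 then show ?thesis by (simp add: y dg_def)
    next
      case 2
      then have "y = h (j - i - 1, i)" by (simp add: y h_def)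
      then show ?thesis by blast
    next
      case 3
      then have "y = h' (i - j - 1, j)" by (simp add: y h'_def)
      then show ?thesis by blast
    qed
  qed simp
  have "(F has_sum ((\<Sum>i. (a i)\<^sup>2) + (U + U))) (dg ` UNIV \<union> (h ` (UNIV \<times> UNIV) \<union> h' ` (UNIV \<times> UNIV)))"
    by (intro has_sum_Un_disjoint Dg U U') (auto simp: h_def h'_def dg_def)
  then have VU: "V = (\<Sum>i. (a i)\<^sup>2) + (U + U)"
    unfolding part[symmetric] by (rule has_sum_unique[OF V])
  have "((\<lambda>k. (\<Sum>i. a i * a (i + (k + 1))) * cos (real (k + 1) * x)) has_sum U) UNIV"
  proof (rule has_sum_SigmaD[OF U[unfolded has_sum_reindex[OF inj(1)]]])
    fix k
    have sm: "summable (\<lambda>i. \<bar>a i * a (i + (k + 1))\<bar>)"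
    proof (rule summable_comparison_test'[OF summable_mult2[OF a, of "\<Sum>j. \<bar>a j\<bar>"], of 0])
      fix i
      have "\<bar>a (i + (k + 1))\<bar> \<le> (\<Sum>j. \<bar>a j\<bar>)" using sum_le_suminf[OF a, of "{i + (k + 1)}"] by simp
      then show "norm \<bar>a i * a (i + (k + 1))\<bar> \<le> \<bar>a i\<bar> * (\<Sum>j. \<bar>a j\<bar>)" by (simp add: abs_mult mult_left_mono)
    qed
    have "(\<lambda>i. a i * a (i + (k + 1)) * cos (real (k + 1) * x)) sums ((\<Sum>i. a i * a (i + (k + 1))) * cos (real (k + 1) * x))"
      by (intro sums_mult2 summable_sums summable_rabs_cancel[OF sm])
    moreover have "summable (\<lambda>i. norm (a i * a (i + (k + 1)) * cos (real (k + 1) * x)))"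
      by (rule summable_comparison_test'[OF sm, of 0]) (simp add: abs_mult mult_left_le)
    ultimately have "((\<lambda>i. a i * a (i + (k + 1)) * cos (real (k + 1) * x)) has_sum
        ((\<Sum>i. a i * a (i + (k + 1))) * cos (real (k + 1) * x))) UNIV" by (intro norm_summable_imp_has_sum)
    moreover have "(F \<circ> h) (k, i) = a i * a (i + (k + 1)) * cos (real (k + 1) * x)" for i
    proof -
      have "cos (real i * x - real (i + (k + 1)) * x) = cos (- (real (k + 1) * x))"
        by (rule arg_cong[where f=cos]) (simp add: algebra_simps)
      then show ?thesis by (simp only: F_def h_def o_def prod.case cos_minus)
    qed
    ultimately show "((\<lambda>i. (F \<circ> h) (k, i)) has_sum ((\<Sum>i. a i * a (i + (k + 1))) * cos (real (k + 1) * x))) UNIV"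
      by (simp only:)
  qed
  then have "(\<lambda>k. 2 * ((\<Sum>i. a i * a (i + (k + 1))) * cos (real (k + 1) * x))) sums (2 * U)"
    by (intro sums_mult has_sum_imp_sums)
  moreover have "2 * U = (cosS a x)\<^sup>2 + (sinS a x)\<^sup>2 - (\<Sum>i. (a i)\<^sup>2)"
    using VU Vcs by simp
  ultimately show ?thesis by (simp add: mult.assoc)
qed

lemma power4_divide_power6: "x ^ 4 * (c / x ^ 6) = c / x\<^sup>2" if "x \<noteq> 0" for x c :: real
proof -
  have "x ^ 6 = x ^ 4 * x\<^sup>2" by (simp flip: power_add)
  then show ?thesis using that by (simp only: times_divide_eq_right) (simp add: field_simps)
qed

lemma decay_summable:
  assumes "\<And>k. \<bar>c k\<bar> \<le> C / real k ^ 6" "j \<le> 4"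
  shows "summable (\<lambda>k. \<bar>real k ^ j * c k\<bar>)"
proof (rule summable_comparison_test'[OF summable_inverse_power[of 2 "\<bar>C\<bar>"], of 0])
  fix k :: nat
  show "norm \<bar>real k ^ j * c k\<bar> \<le> \<bar>C\<bar> / (real k)\<^sup>2"
  proof (cases "k = 0")
    case True then show ?thesis using assms(1)[of 0] by simp
  next
    case False
    have "real k ^ j \<le> real k ^ 4" using False assms(2) by (intro power_increasing) auto
    moreover have "\<bar>c k\<bar> \<le> \<bar>C\<bar> / real k ^ 6"
      using assms(1)[of k] divide_right_mono[OF abs_ge_self[of C], of "real k ^ 6"] by simp
    ultimately have "real k ^ j * \<bar>c k\<bar> \<le> real k ^ 4 * (\<bar>C\<bar> / real k ^ 6)" by (intro mult_mono) auto
    also have "\<dots> = \<bar>C\<bar> / (real k)\<^sup>2" using False by (intro power4_divide_power6) simp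
    finally show ?thesis by (simp add: abs_mult)
  qed
qed simp

lemma sinS_derivs:
  assumes c: "\<And>j. j \<le> 4 \<Longrightarrow> summable (\<lambda>k. \<bar>real k ^ j * c k\<bar>)"
  shows "(deriv ^^ 2) (sinS c) x = - sinS (\<lambda>k. real k ^ 2 * c k) x"
    "(deriv ^^ 4) (sinS c) x = sinS (\<lambda>k. real k ^ 4 * c k) x"
    "j < 4 \<Longrightarrow> (deriv ^^ j) (sinS c) field_differentiable at x"
proof -
  define S where "S j = sinS (\<lambda>k. real k ^ j * c k)" for j
  define D where "D j = cosS (\<lambda>k. real k ^ j * c k)" for j
  have shift: "real k * (real k ^ j * c k) = real k ^ Suc j * c k" for j k by (simp only: power_Suc mult.assoc)
  have dS: "(S j has_real_derivative D (Suc j) x) (at x)" if "Suc j \<le> 4" for j x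
    using sinS_deriv[of "\<lambda>k. real k ^ j * c k" x] c[OF that] c[of j] that unfolding S_def D_def shift by (simp only: Suc_leD)
  have dD: "(D j has_real_derivative - S (Suc j) x) (at x)" if "Suc j \<le> 4" for j x
    using cosS_deriv[of "\<lambda>k. real k ^ j * c k" x] c[OF that] c[of j] that unfolding S_def D_def shift by (simp only: Suc_leD)
  have 0: "sinS c = S 0" by (simp add: S_def)
  have 1: "deriv (sinS c) = D 1" unfolding 0 by (rule ext, rule DERIV_imp_deriv) (use dS[of 0] in simp)
  have 2: "deriv (deriv (sinS c)) = (\<lambda>x. - S 2 x)"
    unfolding 1 by (rule ext, rule DERIV_imp_deriv) (use dD[of 1] in \<open>simp add: numeral_2_eq_2\<close>)
  have 3: "deriv (deriv (deriv (sinS c))) = (\<lambda>x. - D 3 x)"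
    unfolding 2 by (rule ext, rule DERIV_imp_deriv, rule DERIV_minus) (use dS[of 2] in \<open>simp add: numeral_3_eq_3 numeral_2_eq_2\<close>)
  have 4: "deriv (deriv (deriv (deriv (sinS c)))) = S 4"
    unfolding 3 by (rule ext, rule DERIV_imp_deriv) (use DERIV_minus[OF dD[of 3]] in \<open>simp add: eval_nat_numeral\<close>)
  show "(deriv ^^ 2) (sinS c) x = - sinS (\<lambda>k. real k ^ 2 * c k) x"
    using fun_cong[OF 2, of x] by (simp add: S_def numeral_2_eq_2)
  show "(deriv ^^ 4) (sinS c) x = sinS (\<lambda>k. real k ^ 4 * c k) x"
    using fun_cong[OF 4, of x] by (simp add: S_def eval_nat_numeral)
  assume "j < 4"
  then consider "j = 0" | "j = 1" | "j = 2" | "j = 3" by linarith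
  then show "(deriv ^^ j) (sinS c) field_differentiable at x"
  proof cases
    case 1 then show ?thesis using dS[of 0 x] by (auto simp: 0 field_differentiable_def)
  next
    case 2 then show ?thesis using dD[of 1 x] by (auto simp: 1 field_differentiable_def)
  next
    case 3
    then show ?thesis using DERIV_minus[OF dS[of 2 x]] by (auto simp: 2 numeral_2_eq_2 field_differentiable_def)
  next
    case 4
    then show ?thesis using DERIV_minus[OF dD[of 3 x]] \<open>deriv (deriv (deriv (sinS c))) = (\<lambda>x. - D 3 x)\<close>
      by (auto simp: numeral_3_eq_3 field_differentiable_def)
  qed
qed

text \<open>With c and s the cosine and sine series of a, 2 s^2 is the difference of c^2 + s^2 and
  c^2 - s^2. The former supplies the two infinite sums of \<open>ks_bil\<close>, the latter its
  convolution. The division by k anticipates the x-derivative of the square.\<close>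

lemma sine_square:
  assumes a: "sqs a" "a 0 = 0" "summable (\<lambda>k. \<bar>a k\<bar>)"
  shows "(sinS (\<lambda>k. - 2 * a k) x)\<^sup>2 =
    cosS (\<lambda>k. if k = 0 then 2 * (\<Sum>i. (a i)\<^sup>2) else 2 * ks_bil a a k / real k) x"
proof -
  define e where "e k = (if k = 0 then 2 * (\<Sum>i. (a i)\<^sup>2) else 2 * ks_bil a a k / real k)" for k
  have e_Suc: "e (k + 1) = 4 * (\<Sum>i. a i * a (i + (k + 1))) - 2 * (\<Sum>i\<le>k + 1. a i * a (k + 1 - i))" for k
  proof -
    have "(\<Sum>i. a i * a (i + (k + 1))) = (\<Sum>i. a (i + 1) * a (i + 1 + (k + 1)))"
      using suminf_split_initial_segment[OF sqs_mult_shift[OF a(1) a(1), of 0 "k + 1"], of 1] a(2) by simp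
    moreover have "(\<Sum>i\<le>k + 1. a i * a (k + 1 - i)) = (\<Sum>i = 1..k + 1 - 1. a i * a (k + 1 - i))"
    proof (rule sum.mono_neutral_right)
      show "\<forall>i\<in>{..k + 1} - {1..k + 1 - 1}. a i * a (k + 1 - i) = 0"
      proof
        fix i assume "i \<in> {..k + 1} - {1..k + 1 - 1}"
        then have "i = 0 \<or> i = k + 1" by auto
        then show "a i * a (k + 1 - i) = 0" using a(2) by auto
      qed
    qed auto
    moreover have "e (k + 1) = 2 * ((\<Sum>i. a (i + 1) * a (i + (k + 1 + 1))) + (\<Sum>i. a (i + 1) * a (i + (k + 1 + 1)))
        - (\<Sum>i = 1..k + 1 - 1. a i * a (k + 1 - i)))"
      unfolding e_def ks_bil_def by simp
    ultimately show ?thesis by (simp add: add_ac)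
  qed
  define s where "s = sinS a x"
  define c where "c = cosS a x"
  have d: "(\<lambda>k. 2 * (\<Sum>i. a i * a (i + (k + 1))) * cos (real (k + 1) * x)) sums (c\<^sup>2 + s\<^sup>2 - (\<Sum>i. (a i)\<^sup>2))"
    unfolding s_def c_def by (rule cosS_sinS_differences[OF a(3)])
  have "(\<lambda>k. (\<Sum>i\<le>k. a i * a (k - i)) * cos (real k * x)) sums (c\<^sup>2 - s\<^sup>2)"
    unfolding s_def c_def by (rule cosS_sinS_sums[OF a(3)])
  from sums_split_initial_segment[OF this, of 1]
  have p: "(\<lambda>k. (\<Sum>i\<le>k + 1. a i * a (k + 1 - i)) * cos (real (k + 1) * x)) sums (c\<^sup>2 - s\<^sup>2)"
    using a(2) by simp
  have "(\<lambda>k. 2 * (2 * (\<Sum>i. a i * a (i + (k + 1))) * cos (real (k + 1) * x))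
      - 2 * ((\<Sum>i\<le>k + 1. a i * a (k + 1 - i)) * cos (real (k + 1) * x))) sums
      (2 * (c\<^sup>2 + s\<^sup>2 - (\<Sum>i. (a i)\<^sup>2)) - 2 * (c\<^sup>2 - s\<^sup>2))"
    by (intro sums_diff sums_mult d p)
  moreover have "2 * (2 * (\<Sum>i. a i * a (i + (k + 1))) * cos (real (k + 1) * x))
      - 2 * ((\<Sum>i\<le>k + 1. a i * a (k + 1 - i)) * cos (real (k + 1) * x)) = e (k + 1) * cos (real (k + 1) * x)" for k
    unfolding e_Suc by (simp add: left_diff_distrib)
  moreover have "2 * (c\<^sup>2 + s\<^sup>2 - (\<Sum>i. (a i)\<^sup>2)) - 2 * (c\<^sup>2 - s\<^sup>2) = 4 * s\<^sup>2 - e 0" by (simp add: e_def)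
  ultimately have "(\<lambda>k. e (k + 1) * cos (real (k + 1) * x)) sums (4 * s\<^sup>2 - e 0)" by simp
  then have "(\<lambda>k. e (Suc k) * cos (real (Suc k) * x)) sums (4 * s\<^sup>2 - e 0 * cos (real 0 * x))" by simp
  then have "(\<lambda>k. e k * cos (real k * x)) sums (4 * s\<^sup>2)"
    by (subst (asm) sums_Suc_iff) simp
  then have "cosS e x = 4 * s\<^sup>2" unfolding cosS_def by (simp add: sums_iff)
  moreover have "sinS (\<lambda>k. - 2 * a k) x = - 2 * s"
    using sinS_add_cmult[OF a(3) a(3), of "-2" 0 x] by (simp add: s_def)
  ultimately show ?thesis unfolding e_def[abs_def] by (simp add: power_mult_distrib)
qed

text \<open>Coefficients of order k^-6 allow four termwise derivatives in x; their time derivatives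
  are O(k^-2) uniformly in t, which allows one in t. With the normalisation -2 a_k the sine
  coefficients of (u^2)_x are -2 times those of the quadratic term, as the equation
  requires.\<close>

lemma classical_solution:
  assumes \<mu>: "3/4 \<le> \<mu>" and a: "ks_solution_on \<mu> UNIV a" and R: "\<And>t. l2norm (a t) \<le> R"
  defines "u \<equiv> \<lambda>t. sinS (\<lambda>k. - 2 * a t k)"
  shows "ks_classical_solution \<mu> u" "sine_series (a t) (u t)"
proof -
  obtain C where C: "0 \<le> C" "\<And>t k. \<bar>a t k\<bar> \<le> C / real k ^ 6"
    "\<And>t k. 1 \<le> k \<Longrightarrow> \<bar>ks_bil (a t) (a t) k\<bar> \<le> C / (real k)\<^sup>2"
    using full_orbit_decay[OF \<mu> a R] by blast
  note s = ks_solutionD(1)[OF a UNIV_I] and z = ks_solutionD(2)[OF a UNIV_I]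
  define c where "c t k = - 2 * a t k" for t k
  have c_dec: "\<bar>c t k\<bar> \<le> (2 * C) / real k ^ 6" for t k using C(2)[of t k] by (simp add: c_def)
  have c_sum: "summable (\<lambda>k. \<bar>real k ^ j * c t k\<bar>)" if "j \<le> 4" for j t
    by (rule decay_summable[OF c_dec that])
  have c_sum0: "summable (\<lambda>k. \<bar>c t k\<bar>)" for t using c_sum[of 0] by simp
  have a_sum: "summable (\<lambda>k. \<bar>a t k\<bar>)" for t using decay_summable[OF C(2)[of t], of 0] by simp
  have bil_sum: "summable (\<lambda>k. \<bar>2 * ks_bil (a t) (a t) k\<bar>)" for t
  proof (rule summable_comparison_test'[OF summable_inverse_power[of 2 "2 * C"], of 1])
    show "norm \<bar>2 * ks_bil (a t) (a t) k\<bar> \<le> 2 * C / (real k)\<^sup>2" if "1 \<le> k" for k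
      using C(3)[OF that, of t] by (simp only: abs_mult real_norm_def abs_abs times_divide_eq_right[symmetric])
  qed simp
  have u: "u t = sinS (c t)" for t by (simp add: u_def c_def[abs_def])
  have sums: "(\<lambda>k. c t k * sin (real k * x)) sums u t x" for t x
    unfolding u sinS_def by (intro summable_sums trig_summable c_sum0)
  show "sine_series (a t) (u t)"
    unfolding sine_series_def using sums[of t] by (simp add: c_def)
  show "ks_classical_solution \<mu> u"
    unfolding ks_classical_solution_def
  proof (intro conjI allI impI)
    fix t x
    have "(\<lambda>k. - (c t k * sin (real k * - x))) sums (- u t (- x))" by (intro sums_minus sums)
    then show "u t x = - u t (- x)" using sums[of t x] by (simp add: sums_unique2)
    have "sin (real k * (x + 2 * pi)) = sin (real k * x)" for k
    proof -
      have "real k * (x + 2 * pi) = real k * x + 2 * real k * pi" by (simp add: algebra_simps)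
      then show ?thesis by (simp add: sin_add)
    qed
    then show "u t x = u t (x + 2 * pi)" using sums[of t x] sums[of t "x + 2 * pi"] by (simp add: sums_unique2)
    show "(deriv ^^ j) (u t) field_differentiable at x" if "j < 4" for j
      unfolding u by (rule sinS_derivs(3)[OF c_sum that])
    define e where "e k = (if k = 0 then 2 * (\<Sum>i. (a t i)\<^sup>2) else 2 * ks_bil (a t) (a t) k / real k)" for k
    have ke: "real k * e k = 2 * ks_bil (a t) (a t) k" for k by (simp add: e_def ks_bil_def)
    have "(\<lambda>y. (u t y)\<^sup>2) = cosS e"
      unfolding u_def e_def[abs_def] by (rule ext, rule sine_square[OF s z a_sum])
    moreover have "(cosS e has_real_derivative - sinS (\<lambda>k. real k * e k) x) (at x)"
    proof (rule cosS_deriv)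
      show "summable (\<lambda>k. \<bar>real k * e k\<bar>)" unfolding ke by (rule bil_sum)
      show "summable (\<lambda>k. \<bar>e k\<bar>)"
      proof (rule summable_comparison_test'[OF bil_sum[of t], of 1])
        fix k :: nat assume "1 \<le> k"
        then have "1 * \<bar>e k\<bar> \<le> real k * \<bar>e k\<bar>" by (intro mult_right_mono) auto
        then show "norm \<bar>e k\<bar> \<le> \<bar>2 * ks_bil (a t) (a t) k\<bar>" unfolding ke[symmetric] by (simp add: abs_mult)
      qed
    qed
    ultimately have d2: "deriv (\<lambda>y. (u t y)\<^sup>2) x = - sinS (\<lambda>k. 2 * ks_bil (a t) (a t) k) x"
      unfolding ke by (simp add: DERIV_imp_deriv)
    define v where "v t k = - 2 * (ks_eig \<mu> k * a t k + ks_bil (a t) (a t) k)" for t k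
    have v_eq: "v t k = 1 * (- \<mu> * (real k ^ 4 * c t k) + 1 * (real k ^ 2 * c t k)) + - 1 * (2 * ks_bil (a t) (a t) k)" for k
      unfolding v_def c_def ks_eig_def by (simp add: algebra_simps power2_eq_square power4_eq_xxxx)
    have lin_sum: "summable (\<lambda>k. \<bar>- \<mu> * (real k ^ 4 * c t k) + 1 * (real k ^ 2 * c t k)\<bar>)"
    proof (rule summable_comparison_test'[OF summable_add[OF summable_mult[OF c_sum[of 4], of "\<bar>\<mu>\<bar>"] c_sum[of 2]], of 0])
      show "norm \<bar>- \<mu> * (real k ^ 4 * c t k) + 1 * (real k ^ 2 * c t k)\<bar> \<le> \<bar>\<mu>\<bar> * \<bar>real k ^ 4 * c t k\<bar> + \<bar>real k ^ 2 * c t k\<bar>" for k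
        using abs_triangle_ineq[of "- \<mu> * (real k ^ 4 * c t k)" "real k ^ 2 * c t k"] by (simp add: abs_mult)
    qed simp_all
    have rhs: "sinS (v t) x = - \<mu> * (deriv ^^ 4) (u t) x - (deriv ^^ 2) (u t) x + deriv (\<lambda>y. (u t y)\<^sup>2) x"
    proof -
      have "sinS (v t) x = 1 * sinS (\<lambda>k. - \<mu> * (real k ^ 4 * c t k) + 1 * (real k ^ 2 * c t k)) x
          + - 1 * sinS (\<lambda>k. 2 * ks_bil (a t) (a t) k) x"
        unfolding v_eq[abs_def] by (rule sinS_add_cmult[OF lin_sum bil_sum])
      also have "sinS (\<lambda>k. - \<mu> * (real k ^ 4 * c t k) + 1 * (real k ^ 2 * c t k)) x
          = - \<mu> * sinS (\<lambda>k. real k ^ 4 * c t k) x + 1 * sinS (\<lambda>k. real k ^ 2 * c t k) x"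
        by (intro sinS_add_cmult c_sum) auto
      finally show ?thesis
        using sinS_derivs(1)[OF c_sum, of t x] sinS_derivs(2)[OF c_sum, of t x] unfolding d2 unfolding u by simp
    qed
    have "((\<lambda>s. \<Sum>k. c s k * sin (real k * x)) has_real_derivative (\<Sum>k. v t k * sin (real k * x))) (at t)"
    proof (rule has_field_derivative_series'(2)[of UNIV "\<lambda>k s. c s k * sin (real k * x)"
          "\<lambda>k s. v s k * sin (real k * x)" t t])
      show "((\<lambda>s. c s k * sin (real k * x)) has_real_derivative v r k * sin (real k * x)) (at r within UNIV)" for k r
      proof (cases "k = 0")
        case False
        then have "((\<lambda>s. a s k) has_real_derivative ks_eig \<mu> k * a r k + ks_bil (a r) (a r) k) (at r)"
          using ks_solutionD(4)[OF a UNIV_I, of k r] by simp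
        from DERIV_cmult_right[OF DERIV_cmult[OF this, of "- 2"], of "sin (real k * x)"]
        show ?thesis unfolding c_def v_def by simp
      qed simp
      show "uniformly_convergent_on UNIV (\<lambda>n s. \<Sum>i<n. v s i * sin (real i * x))"
      proof (rule Weierstrass_m_test')
        show "summable (\<lambda>k. 2 * ((1 + \<bar>\<mu>\<bar>) * C + C) / real k ^ 2)" by (rule summable_inverse_power) simp
        fix k r
        show "norm (v r k * sin (real k * x)) \<le> 2 * ((1 + \<bar>\<mu>\<bar>) * C + C) / real k ^ 2"
        proof (cases "k = 0")
          case False
          have "\<bar>ks_eig \<mu> k\<bar> \<le> (1 + \<bar>\<mu>\<bar>) * real k ^ 4"
          proof -
            have "ks_eig \<mu> k = (real k)\<^sup>2 - \<mu> * real k ^ 4" by (simp add: ks_eig_def algebra_simps flip: power_add)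
            then have "\<bar>ks_eig \<mu> k\<bar> \<le> (real k)\<^sup>2 + \<bar>\<mu>\<bar> * real k ^ 4"
              using abs_triangle_ineq4[of "(real k)\<^sup>2" "\<mu> * real k ^ 4"] by (simp add: abs_mult)
            moreover have "(real k)\<^sup>2 \<le> real k ^ 4" using False by (intro power_increasing) auto
            ultimately show ?thesis by (simp add: algebra_simps)
          qed
          then have "\<bar>ks_eig \<mu> k\<bar> * \<bar>a r k\<bar> \<le> ((1 + \<bar>\<mu>\<bar>) * real k ^ 4) * (C / real k ^ 6)"
            by (intro mult_mono C) auto
          also have "\<dots> = (1 + \<bar>\<mu>\<bar>) * C / (real k)\<^sup>2"
            using False power4_divide_power6[of "real k" C] by (simp only: mult.assoc) simp
          finally have 1: "\<bar>ks_eig \<mu> k * a r k\<bar> \<le> (1 + \<bar>\<mu>\<bar>) * C / (real k)\<^sup>2" by (simp add: abs_mult)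
          have 2: "\<bar>ks_bil (a r) (a r) k\<bar> \<le> C / (real k)\<^sup>2" using False by (intro C) auto
          have "\<bar>v r k\<bar> \<le> 2 * ((1 + \<bar>\<mu>\<bar>) * C / (real k)\<^sup>2 + C / (real k)\<^sup>2)"
            unfolding v_def abs_mult using 1 2
            by (intro mult_mono order_trans[OF abs_triangle_ineq] add_mono) auto
          also have "\<dots> = 2 * ((1 + \<bar>\<mu>\<bar>) * C + C) / real k ^ 2" by (simp add: add_divide_distrib)
          finally have v: "\<bar>v r k\<bar> \<le> 2 * ((1 + \<bar>\<mu>\<bar>) * C + C) / real k ^ 2" .
          have "\<bar>v r k\<bar> * \<bar>sin (real k * x)\<bar> \<le> \<bar>v r k\<bar> * 1" by (intro mult_left_mono) auto
          then show ?thesis using v by (simp add: abs_mult)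
        qed simp
      qed
      show "summable (\<lambda>k. c t k * sin (real k * x))" using sums[of t x] by (simp add: sums_iff)
    qed simp_all
    then show "((\<lambda>s. u s x) has_real_derivative
        - \<mu> * (deriv ^^ 4) (u t) x - (deriv ^^ 2) (u t) x + deriv (\<lambda>y. (u t y)\<^sup>2) x) (at t)"
      unfolding rhs[symmetric] unfolding u sinS_def .
  qed
qed

section \<open>The global unstable orbit\<close>

lemma ks_solution_on_cong:
  assumes "ks_solution_on \<mu> I a" "\<And>t. t \<in> I \<Longrightarrow> a t = b t"
  shows "ks_solution_on \<mu> I b"
  unfolding ks_solution_on_def
proof (intro conjI ballI allI impI)
  fix t assume t: "t \<in> I"
  note a = assms(1)[unfolded ks_solution_on_def]
  show "b t \<in> ell2" using a t assms(2)[OF t] by metis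
  have "((\<lambda>s. ell2_dist (a s) (b t)) \<longlongrightarrow> 0) (at t within I)" using a t assms(2)[OF t] by metis
  then show "((\<lambda>s. ell2_dist (b s) (b t)) \<longlongrightarrow> 0) (at t within I)"
    by (rule Lim_transform_eventually) (auto simp: eventually_at_filter assms(2))
  fix k :: nat assume "1 \<le> k"
  then have "((\<lambda>s. a s k) has_real_derivative ks_field \<mu> (b t) k) (at t within I)"
    using a t assms(2)[OF t] by metis
  then show "((\<lambda>s. b s k) has_real_derivative ks_field \<mu> (b t) k) (at t within I)"
    by (rule has_field_derivative_transform_within[of _ _ _ _ 1]) (use t assms(2) in auto)
qed

text \<open>The solution property at t depends on the domain only through the filter
  \<open>at t within I\<close>.\<close>

lemma ks_solution_on_local:
  assumes "\<And>t. t \<in> I \<Longrightarrow> \<exists>J. ks_solution_on \<mu> J a \<and> t \<in> J \<and> at t within I = at t within J"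
  shows "ks_solution_on \<mu> I a"
  unfolding ks_solution_on_def
proof (intro conjI ballI)
  fix t assume "t \<in> I"
  then obtain J where J: "ks_solution_on \<mu> J a" "t \<in> J" "at t within I = at t within J"
    using assms by blast
  show "a t \<in> ell2" "((\<lambda>s. ell2_dist (a s) (a t)) \<longlongrightarrow> 0) (at t within I)"
    "\<forall>k\<ge>1. ((\<lambda>s. a s k) has_real_derivative ks_field \<mu> (a t) k) (at t within I)"
    using J(1,2) unfolding J(3) ks_solution_on_def by blast+
qed

lemma ks_solution_on_UNIV:
  assumes "\<And>T. ks_solution_on \<mu> {..T} a"
  shows "ks_solution_on \<mu> UNIV a"
proof (rule ks_solution_on_local, intro exI conjI)
  fix t :: real
  show "ks_solution_on \<mu> {..t + 1} a" by (rule assms)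
  show "at t within UNIV = at t within {..t + 1}"
    by (rule at_within_nhd[of _ "{..<t + 1}"]) auto
qed simp

lemma ks_solution_on_atLeast:
  assumes "\<And>T. ks_solution_on \<mu> {0..T} a"
  shows "ks_solution_on \<mu> {0..} a"
proof (rule ks_solution_on_local, intro exI conjI)
  fix t :: real assume t: "t \<in> {0..}"
  show "ks_solution_on \<mu> {0..t + 1} a" by (rule assms)
  show "at t within {0..} = at t within {0..t + 1}"
    by (rule at_within_nhd[of _ "{..<t + 1}"]) auto
  show "t \<in> {0..t + 1}" using t by simp
qed

lemma at_within_closed_bot:
  fixes S :: "real set"
  assumes "closed S" "t \<notin> S"
  shows "at t within S = bot"
  using assms closed_limpt trivial_limit_within by metis

text \<open>A limit along a union is a limit along both parts. At a point outside a closed set the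
  filter is trivial and imposes nothing; at a common point both one-sided derivatives equal the
  field, so they agree.\<close>

lemma ks_solution_on_Un:
  assumes a: "ks_solution_on \<mu> I a" "ks_solution_on \<mu> J a" and cl: "closed I" "closed J"
  shows "ks_solution_on \<mu> (I \<union> J) a"
proof -
  have lim: "((\<lambda>s. ell2_dist (a s) (a t)) \<longlongrightarrow> 0) (at t within S) \<and>
      (\<forall>k\<ge>1. ((\<lambda>s. (a s k - a t k) / (s - t)) \<longlongrightarrow> ks_field \<mu> (a t) k) (at t within S))"
    if "ks_solution_on \<mu> S a" "closed S" for S t
    using that(1) at_within_closed_bot[OF that(2), of t]
    unfolding ks_solution_on_def has_field_derivative_iff by (cases "t \<in> S") auto
  show ?thesis
    unfolding ks_solution_on_def has_field_derivative_iff Lim_within_Un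
    using lim[OF a(1) cl(1)] lim[OF a(2) cl(2)] a[unfolded ks_solution_on_def] by blast
qed

lemma filterlim_shift_within:
  fixes t h :: real
  assumes "\<And>s. s \<in> J \<Longrightarrow> s + h \<in> I"
  shows "filterlim (\<lambda>s. s + h) (at (t + h) within I) (at t within J)"
  unfolding filterlim_at using assms
  by (intro conjI tendsto_intros) (auto simp: eventually_at_filter)

lemma ks_solution_on_shift:
  assumes a: "ks_solution_on \<mu> I a" and J: "\<And>t. t \<in> J \<Longrightarrow> t + h \<in> I"
  shows "ks_solution_on \<mu> J (\<lambda>t. a (t + h))"
  unfolding ks_solution_on_def has_field_derivative_iff
proof (intro conjI ballI allI impI)
  fix t assume t: "t \<in> J"
  note s = a[unfolded ks_solution_on_def has_field_derivative_iff]
  show "a (t + h) \<in> ell2" using s J[OF t] by blast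
  show "((\<lambda>s. ell2_dist (a (s + h)) (a (t + h))) \<longlongrightarrow> 0) (at t within J)"
    using filterlim_compose[OF _ filterlim_shift_within[OF J]] s J[OF t] by blast
  fix k :: nat assume "1 \<le> k"
  then have "((\<lambda>s. (a s k - a (t + h) k) / (s - (t + h))) \<longlongrightarrow> ks_field \<mu> (a (t + h)) k) (at (t + h) within I)"
    using s J[OF t] by blast
  from filterlim_compose[OF this filterlim_shift_within[OF J]]
  show "((\<lambda>s. (a (s + h) k - a (t + h) k) / (s - t)) \<longlongrightarrow> ks_field \<mu> (a (t + h)) k) (at t within J)"
    by simp
qed

lemma ks_solution_on_const:
  assumes "ks_fixed_point \<mu> p"
  shows "ks_solution_on \<mu> I (\<lambda>t. p)"
  using assms unfolding ks_solution_on_def ks_fixed_point_def ell2_dist_def by simp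

text \<open>The correction is quadratic in E = exp ((1 - \<mu>) t), so early enough both a_1 - E and
  the tail are at most E / 10; then (1/10)^2 \<le> (9/10)^2 / 10 places the orbit in the
  cone.\<close>

lemma unstable_orbit_in_cone:
  assumes \<mu>: "3/4 \<le> \<mu>" "\<mu> < 1" and X: "0 < X"
  obtains a t0 where "ks_solution_on \<mu> {..t0} a" "((\<lambda>t. a t 1) \<longlongrightarrow> 0) at_bot"
    "\<And>t. t \<le> t0 \<Longrightarrow> 0 < a t 1 \<and> a t 1 \<le> X \<and> (l2norm (tail 2 (a t)))\<^sup>2 \<le> (a t 1)\<^sup>2 / 10"
proof -
  obtain a t0 C where sol: "ks_solution_on \<mu> {..t0} a"
    and dev: "\<And>t k. t \<le> t0 \<Longrightarrow> \<bar>a t k - (if k = 1 then exp ((1 - \<mu>) * t) else 0)\<bar> \<le> C * exp (2 * (1 - \<mu>) * t) * invsq k"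
    by (rule unstable_orbit[OF \<mu>], rule that)
  define E where "E t = exp ((1 - \<mu>) * t)" for t
  define D where "D = max C 1 * l2norm invsq"
  have "max C 1 * 1 \<le> D" unfolding D_def using l2norm_invsq_ge_1 by (intro mult_left_mono) auto
  then have D: "1 \<le> D" and CD: "C \<le> D" by auto
  have E2: "exp (2 * (1 - \<mu>) * t) = (E t)\<^sup>2" for t by (simp add: E_def algebra_simps flip: exp_double)
  have E0: "0 < E t" for t by (simp add: E_def)
  note dev' = dev[unfolded E2, folded E_def]
  have "filterlim (\<lambda>t. (1 - \<mu>) * t) at_bot at_bot"
    using \<mu> by (intro filterlim_tendsto_pos_mult_at_bot[OF tendsto_const]) (auto simp: filterlim_ident)
  then have Elim: "(E \<longlongrightarrow> 0) at_bot" unfolding E_def[abs_def] by (rule filterlim_compose[OF exp_at_bot])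
  have "\<forall>\<^sub>F t in at_bot. E t < min (X / 2) (1 / (10 * D))"
    using Elim X D by (intro order_tendstoD(2)[OF Elim]) auto
  then obtain t1 where t1: "\<And>t. t \<le> t1 \<Longrightarrow> E t < min (X / 2) (1 / (10 * D))"
    unfolding eventually_at_bot_linorder by blast
  have first: "\<bar>a t 1 - E t\<bar> \<le> E t / 10" and tl: "l2norm (tail 2 (a t)) \<le> E t / 10"
    if "t \<le> t0" "t \<le> t1" for t
  proof -
    have "E t * D \<le> 1 / 10" using t1[OF that(2)] D by (simp add: field_simps)
    then have DE: "D * (E t)\<^sup>2 \<le> E t / 10"
      using mult_right_mono[of "E t * D" "1/10" "E t"] E0[of t] by (simp add: power2_eq_square mult_ac)
    have "\<bar>a t 1 - E t\<bar> \<le> C * (E t)\<^sup>2" using dev'[OF that(1), of 1] by (simp add: invsq_def)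
    also have "\<dots> \<le> D * (E t)\<^sup>2" using CD by (intro mult_right_mono) auto
    finally show "\<bar>a t 1 - E t\<bar> \<le> E t / 10" using DE by linarith
    have "\<bar>tail 2 (a t) k\<bar> \<le> (max C 1 * (E t)\<^sup>2) * invsq k" for k
    proof (cases "2 \<le> k")
      case True
      then have "\<bar>a t k\<bar> \<le> C * (E t)\<^sup>2 * invsq k" using dev'[OF that(1), of k] by simp
      also have "\<dots> \<le> max C 1 * (E t)\<^sup>2 * invsq k" by (intro mult_right_mono) auto
      finally show ?thesis using True by (simp add: tail_def)
    qed (simp add: tail_def)
    from sqs_invsq_bound(2)[OF this] show "l2norm (tail 2 (a t)) \<le> E t / 10"
      using DE unfolding D_def by (simp only: mult_ac) simp
  qed
  have cone: "0 < a t 1 \<and> a t 1 \<le> X \<and> (l2norm (tail 2 (a t)))\<^sup>2 \<le> (a t 1)\<^sup>2 / 10" if "t \<le> min t0 t1" for t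
  proof -
    have t: "t \<le> t0" "t \<le> t1" using that by auto
    have lo: "9/10 * E t \<le> a t 1" and hi: "a t 1 \<le> 11/10 * E t" using first[OF t] by linarith+
    have "(9/10 * E t)\<^sup>2 \<le> (a t 1)\<^sup>2" using lo E0[of t] by (intro power_mono) auto
    moreover have "(l2norm (tail 2 (a t)))\<^sup>2 \<le> (E t / 10)\<^sup>2"
      using tl[OF t] l2norm_nonneg[OF sqs_tail[OF ks_solutionD(1)[OF sol]], of t 2] t by (intro power_mono) auto
    moreover have "(E t / 10)\<^sup>2 \<le> (9/10 * E t)\<^sup>2 / 10" by (simp add: power2_eq_square)
    ultimately have "(l2norm (tail 2 (a t)))\<^sup>2 \<le> (a t 1)\<^sup>2 / 10" by linarith
    moreover have "0 < a t 1" using lo E0[of t] by linarith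
    moreover have "a t 1 \<le> X" using hi E0[of t] t1[OF t(2)] by (simp add: min_def split: if_splits)
    ultimately show ?thesis by blast
  qed
  have "((\<lambda>t. a t 1) \<longlongrightarrow> 0) at_bot"
  proof (rule Lim_null_comparison)
    show "((\<lambda>t. 2 * E t) \<longlongrightarrow> 0) at_bot" by (rule tendsto_mult_right_zero[OF Elim])
    show "\<forall>\<^sub>F t in at_bot. norm (a t 1) \<le> 2 * E t"
      unfolding eventually_at_bot_linorder
    proof (intro exI[of _ "min t0 t1"] allI impI)
      fix t assume "t \<le> min t0 t1"
      then have "\<bar>a t 1 - E t\<bar> \<le> E t / 10" by (intro first) auto
      then show "norm (a t 1) \<le> 2 * E t" using E0[of t] unfolding real_norm_def by linarith
    qed
  qed
  moreover have "ks_solution_on \<mu> {..min t0 t1} a" by (rule ks_solution_on_subset[OF sol]) auto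
  ultimately show thesis by (intro that[of "min t0 t1" a] cone)
qed

text \<open>The local orbit is continued by a forward curve of the clamped equation. The invariant
  cone bounds its norm by 1.05 * 4/5 < 1, which shows afterwards that the curve solves the true
  equation for all times.\<close>

lemma global_unstable_orbit:
  assumes \<mu>: "3/4 \<le> \<mu>" "\<mu> < 1" and X: "0 < X" "X \<le> 4/5"
    and num: "(1 - \<mu>) + 28/1000 * X ^ 4 \<le> g"
      "(1 - \<mu>) - 2 * (2 - 187/1000 * X\<^sup>2) / (4 * (4 * \<mu> - 1) + 2 * g) * X\<^sup>2 + 28/1000 * X ^ 4 < 0"
  obtains a where "ks_solution_on \<mu> UNIV a" "((\<lambda>t. l2norm (a t)) \<longlongrightarrow> 0) at_bot"
    "\<And>t. 0 < a t 1 \<and> a t 1 \<le> X \<and> (l2norm (tail 2 (a t)))\<^sup>2 \<le> (a t 1)\<^sup>2 / 10"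
proof -
  obtain L t0 where L: "ks_solution_on \<mu> {..t0} L" and Llim: "((\<lambda>t. L t 1) \<longlongrightarrow> 0) at_bot"
    and Lc: "\<And>t. t \<le> t0 \<Longrightarrow> 0 < L t 1 \<and> L t 1 \<le> X \<and> (l2norm (tail 2 (L t)))\<^sup>2 \<le> (L t 1)\<^sup>2 / 10"
    using unstable_orbit_in_cone[OF \<mu> X(1)] by blast
  have L0: "L t0 \<in> ell2" using L unfolding ks_solution_on_def by simp
  obtain F where F0: "F 0 = L t0" and Fell: "\<And>t. F t \<in> ell2"
    and Fcont: "\<And>t. ((\<lambda>s. l2norm (\<lambda>k. F s k - F t k)) \<longlongrightarrow> 0) (at t)"
    and Fsol: "\<And>T. (\<And>t. 0 \<le> t \<Longrightarrow> t \<le> T \<Longrightarrow> l2norm (F t) \<le> 1) \<Longrightarrow> ks_solution_on \<mu> {0..T} F"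
    using forward_curve[OF \<mu>(1) L0, of 1] by auto
  define A where "A t = (if t \<le> t0 then L t else F (t + - t0))" for t
  have AL: "A t = L t" if "t \<le> t0" for t using that by (simp add: A_def)
  have AF: "A t = F (t + - t0)" if "t0 \<le> t" for t using that F0 by (auto simp: A_def)
  have ell: "A t \<in> ell2" for t
    using L Fell unfolding ks_solution_on_def A_def by auto
  have s: "sqs (A t)" "A t 0 = 0" for t using ell[of t] by (auto simp: ell2_def sqs_def)
  have cont: "((\<lambda>s. l2norm (\<lambda>k. A s k - A t k)) \<longlongrightarrow> 0) (at t)" for t
  proof -
    have "((\<lambda>s. l2norm (\<lambda>k. A s k - A t k)) \<longlongrightarrow> 0) (at t within {..t0})"
    proof (cases "t \<le> t0")
      case True
      then have "((\<lambda>s. l2norm (\<lambda>k. L s k - A t k)) \<longlongrightarrow> 0) (at t within {..t0})"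
        using ks_solutionD(3)[OF L, of t] by (simp add: AL)
      then show ?thesis by (rule Lim_transform_eventually) (auto simp: eventually_at_filter AL)
    qed (simp add: at_within_closed_bot)
    moreover have "((\<lambda>s. l2norm (\<lambda>k. A s k - A t k)) \<longlongrightarrow> 0) (at t within {t0..})"
    proof (cases "t0 \<le> t")
      case True
      then have "((\<lambda>s. l2norm (\<lambda>k. F (s + - t0) k - A t k)) \<longlongrightarrow> 0) (at t within {t0..})"
        using filterlim_compose[OF Fcont[of "t + - t0"] filterlim_shift_within[of "{t0..}" "- t0" UNIV t]]
        by (simp add: AF)
      then show ?thesis by (rule Lim_transform_eventually) (auto simp: eventually_at_filter AF)
    qed (simp add: at_within_closed_bot)
    ultimately have "((\<lambda>s. l2norm (\<lambda>k. A s k - A t k)) \<longlongrightarrow> 0) (at t within ({..t0} \<union> {t0..}))"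
      unfolding Lim_within_Un by blast
    moreover have "{..t0} \<union> {t0..} = UNIV" by auto
    ultimately show ?thesis by simp
  qed
  have LA: "ks_solution_on \<mu> {..t0} A" by (rule ks_solution_on_cong[OF L]) (simp add: AL)
  have sol: "ks_solution_on \<mu> {..T} A" if b: "\<And>t. t \<le> T \<Longrightarrow> l2norm (A t) \<le> 1" for T
  proof (cases "T \<le> t0")
    case True
    then show ?thesis by (intro ks_solution_on_subset[OF LA]) auto
  next
    case False
    have "ks_solution_on \<mu> {0..T - t0} F"
    proof (rule Fsol)
      show "l2norm (F t) \<le> 1" if "0 \<le> t" "t \<le> T - t0" for t
        using b[of "t + t0"] AF[of "t + t0"] that by simp
    qed
    then have "ks_solution_on \<mu> {t0..T} (\<lambda>t. F (t + - t0))" by (rule ks_solution_on_shift) auto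
    then have "ks_solution_on \<mu> {t0..T} A" by (rule ks_solution_on_cong) (simp add: AF)
    from ks_solution_on_Un[OF LA this] have "ks_solution_on \<mu> ({..t0} \<union> {t0..T}) A" by simp
    moreover have "{..t0} \<union> {t0..T} = {..T}" using False by auto
    ultimately show ?thesis by simp
  qed
  have cone: "0 < A t 1 \<and> A t 1 \<le> X \<and> (l2norm (tail 2 (A t)))\<^sup>2 \<le> (A t 1)\<^sup>2 / 10" for t
  proof (rule cone_invariant[OF \<mu> s cont sol _ X(2) num])
    show "0 < A t 1 \<and> A t 1 \<le> X \<and> (l2norm (tail 2 (A t)))\<^sup>2 \<le> (A t 1)\<^sup>2 / 10" if "t \<le> t0" for t
      unfolding AL[OF that] by (rule Lc[OF that])
  qed
  have le: "l2norm (A t) \<le> 105/100 * A t 1" for t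
    by (rule cone_l2norm_le[OF s]) (use cone[of t] in auto)
  have "ks_solution_on \<mu> {..T} A" for T
  proof (rule sol)
    show "l2norm (A t) \<le> 1" for t using le[of t] cone[of t] X(2) by linarith
  qed
  then have "ks_solution_on \<mu> UNIV A" by (rule ks_solution_on_UNIV)
  moreover have "((\<lambda>t. l2norm (A t)) \<longlongrightarrow> 0) at_bot"
  proof (rule Lim_null_comparison)
    show "((\<lambda>t. 105/100 * L t 1) \<longlongrightarrow> 0) at_bot" by (rule tendsto_mult_right_zero[OF Llim])
    show "\<forall>\<^sub>F t in at_bot. norm (l2norm (A t)) \<le> 105/100 * L t 1"
      unfolding eventually_at_bot_linorder
    proof (intro exI[of _ t0] allI impI)
      show "norm (l2norm (A t)) \<le> 105/100 * L t 1" if "t \<le> t0" for t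
        using le[of t] l2norm_nonneg[OF s(1)[of t]] unfolding AL[OF that] by simp
    qed
  qed
  ultimately show thesis using that cone by blast
qed

section \<open>The attracting fixed point\<close>

lemma tail_add: "tail n (\<lambda>k. a k + b k) = (\<lambda>k. tail n a k + tail n b k)"
  by (auto simp: tail_def)

lemma tail_diff: "tail n (\<lambda>k. a k - b k) = (\<lambda>k. tail n a k - tail n b k)"
  by (auto simp: tail_def)

lemma in_box_add:
  assumes s: "sqs a" "sqs b" and "in_box l1 u1 l2 u2 \<alpha> a" "in_box m1 v1 m2 v2 \<beta> b"
  shows "in_box (l1 + m1) (u1 + v1) (l2 + m2) (u2 + v2) (\<alpha> + \<beta>) (\<lambda>k. a k + b k)"
  using assms(3,4) l2norm_triangle[OF sqs_tail[OF s(1), of 3] sqs_tail[OF s(2), of 3]]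
  unfolding in_box_def tail_add by auto

lemma in_box_near:
  assumes s: "sqs a" "sqs p" and p: "in_box l1 u1 l2 u2 \<alpha> p" and d: "l2norm (\<lambda>k. a k - p k) \<le> r"
  shows "in_box (l1 - r) (u1 + r) (l2 - r) (u2 + r) (\<alpha> + r) a"
proof -
  have c: "\<bar>a k - p k\<bar> \<le> r" for k using abs_le_l2norm[OF sqs_diff[OF s], of k] d by linarith
  have "l2norm (tail 3 a) \<le> l2norm (tail 3 p) + l2norm (\<lambda>k. tail 3 a k - tail 3 p k)"
    by (intro l2norm_le_add_diff sqs_tail s)
  also have "l2norm (\<lambda>k. tail 3 a k - tail 3 p k) \<le> l2norm (\<lambda>k. a k - p k)"
    using l2norm_tail_le[OF sqs_diff[OF s], of 3] unfolding tail_diff .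
  finally show ?thesis using p d c[of 1] c[of 2] unfolding in_box_def by linarith
qed

lemma in_box_mono:
  "in_box l1 u1 l2 u2 \<alpha> a \<Longrightarrow> m1 \<le> l1 \<Longrightarrow> u1 \<le> v1 \<Longrightarrow> m2 \<le> l2 \<Longrightarrow> u2 \<le> v2 \<Longrightarrow> \<alpha> \<le> \<beta> \<Longrightarrow>
    in_box m1 v1 m2 v2 \<beta> a"
  unfolding in_box_def by linarith

text \<open>By the mean value theorem on [t, t + 1] the increments, which tend to 0, are values of
  x' at points tending to infinity.\<close>

lemma convergent_imp_deriv_limit_0:
  fixes x :: "real \<Rightarrow> real"
  assumes d: "\<And>t. 0 < t \<Longrightarrow> (x has_real_derivative x' t) (at t)"
    and x: "(x \<longlongrightarrow> p) at_top" and x': "(x' \<longlongrightarrow> D) at_top"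
  shows "D = 0"
proof -
  have "\<exists>z. t < z \<and> z < t + 1 \<and> x (t + 1) - x t = x' z" if "0 < t" for t
    using MVT2[of t "t + 1" x x'] d that by auto
  then obtain z where z: "\<And>t. 0 < t \<Longrightarrow> t < z t \<and> z t < t + 1 \<and> x (t + 1) - x t = x' (z t)" by metis
  have "filterlim z at_top at_top"
    by (rule filterlim_at_top_mono[OF filterlim_ident])
      (use z in \<open>auto simp: eventually_at_top_dense intro!: exI[of _ 0] less_imp_le\<close>)
  then have "((\<lambda>t. x' (z t)) \<longlongrightarrow> D) at_top" by (rule filterlim_compose[OF x'])
  then have "((\<lambda>t. x (t + 1) - x t) \<longlongrightarrow> D) at_top"
    by (rule Lim_transform_eventually) (use z in \<open>auto simp: eventually_at_top_dense intro!: exI[of _ 0]\<close>)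
  moreover have "((\<lambda>t. x (t + 1) - x t) \<longlongrightarrow> p - p) at_top"
    by (intro tendsto_diff x filterlim_compose[OF x]) real_asymp
  ultimately show ?thesis using tendsto_unique[OF trivial_limit_at_top_linorder] by fastforce
qed

text \<open>The limit is formed mode by mode along the integers; the norm estimate reaches it
  through finite partial sums.\<close>

lemma l2_limit_exists:
  fixes a :: "real \<Rightarrow> nat \<Rightarrow> real"
  assumes s: "\<And>t. 0 \<le> t \<Longrightarrow> sqs (a t)" and B: "(B \<longlongrightarrow> 0) at_top"
    and cauchy: "\<And>s t. 0 \<le> s \<Longrightarrow> s \<le> t \<Longrightarrow> l2norm (\<lambda>k. a s k - a t k) \<le> B s"
  obtains p where "sqs p" "\<And>t. 0 \<le> t \<Longrightarrow> l2norm (\<lambda>k. a t k - p k) \<le> B t" "\<And>k. ((\<lambda>t. a t k) \<longlongrightarrow> p k) at_top"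
proof -
  have comp: "\<bar>a s k - a t k\<bar> \<le> B s" if "0 \<le> s" "s \<le> t" for s t k
    using abs_le_l2norm[OF sqs_diff[OF s s], of s t k] cauchy[OF that] that by simp
  have "Cauchy (\<lambda>n. a (real n) k)" for k
  proof (rule metric_CauchyI)
    fix e :: real assume e: "0 < e"
    have "(\<lambda>n. B (real n)) \<longlonglongrightarrow> 0" by (rule filterlim_compose[OF B filterlim_real_sequentially])
    then have "\<forall>\<^sub>F n in sequentially. B (real n) < e / 2" using e by (intro order_tendstoD(2)) auto
    then obtain N where N: "B (real N) < e / 2" unfolding eventually_sequentially by blast
    have "dist (a (real m) k) (a (real n) k) < e" if "N \<le> m" "N \<le> n" for m n
      using comp[of "real N" "real m" k] comp[of "real N" "real n" k] that N unfolding dist_real_def by simp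
    then show "\<exists>M. \<forall>m\<ge>M. \<forall>n\<ge>M. dist (a (real m) k) (a (real n) k) < e" by blast
  qed
  then have "\<exists>l. (\<lambda>n. a (real n) k) \<longlonglongrightarrow> l" for k by (metis Cauchy_convergent convergent_def)
  then obtain p where p: "\<And>k. (\<lambda>n. a (real n) k) \<longlonglongrightarrow> p k" by metis
  have near: "sqs (\<lambda>k. a t k - p k) \<and> l2norm (\<lambda>k. a t k - p k) \<le> B t" if t: "0 \<le> t" for t
  proof -
    have B0: "0 \<le> B t" using comp[OF t order_refl, of 0] by simp
    have "(\<Sum>k<N. (a t k - p k)\<^sup>2) \<le> (B t)\<^sup>2" for N
    proof (rule tendsto_upperbound)
      show "(\<lambda>n. \<Sum>k<N. (a t k - a (real n) k)\<^sup>2) \<longlonglongrightarrow> (\<Sum>k<N. (a t k - p k)\<^sup>2)"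
        by (intro tendsto_intros p)
      show "\<forall>\<^sub>F n in sequentially. (\<Sum>k<N. (a t k - a (real n) k)\<^sup>2) \<le> (B t)\<^sup>2"
        unfolding eventually_sequentially
      proof (intro exI allI impI)
        fix n assume n: "nat \<lceil>t\<rceil> \<le> n"
        then have tn: "t \<le> real n" by linarith
        have d: "sqs (\<lambda>k. a t k - a (real n) k)" by (intro sqs_diff s t) simp
        have "(\<Sum>k<N. (a t k - a (real n) k)\<^sup>2) \<le> (l2norm (\<lambda>k. a t k - a (real n) k))\<^sup>2"
          unfolding l2norm_sq[OF d] using d unfolding sqs_def by (intro sum_le_suminf) auto
        also have "\<dots> \<le> (B t)\<^sup>2" by (intro power_mono cauchy t tn l2norm_nonneg d)
        finally show "(\<Sum>k<N. (a t k - a (real n) k)\<^sup>2) \<le> (B t)\<^sup>2" .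
      qed
    qed simp
    from l2norm_leI[OF this B0] show ?thesis by blast
  qed
  have "sqs (\<lambda>k. a 0 k - (a 0 k - p k))"
    using near[of 0] by (intro sqs_diff[of "a 0" "\<lambda>k. a 0 k - p k"] s) simp_all
  moreover have "(\<lambda>k. a 0 k - (a 0 k - p k)) = p" by simp
  ultimately have sp: "sqs p" by simp
  have "((\<lambda>t. a t k) \<longlongrightarrow> p k) at_top" for k
  proof (rule LIM_zero_cancel, rule Lim_null_comparison[OF _ B])
    show "\<forall>\<^sub>F t in at_top. norm (a t k - p k) \<le> B t"
      unfolding eventually_at_top_linorder
    proof (intro exI allI impI)
      fix t :: real assume "0 \<le> t"
      then show "norm (a t k - p k) \<le> B t" using near[of t] abs_le_l2norm[of "\<lambda>k. a t k - p k" k] by auto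
    qed
  qed
  then show thesis using that sp near by blast
qed

lemma exp_rate_tendsto_0: "0 < c \<Longrightarrow> ((\<lambda>t. K * exp (- c * t)) \<longlongrightarrow> 0) at_top" for c K :: real
  by real_asymp

section \<open>Attraction and convergence inside a contracting box\<close>

context
  fixes \<mu> \<eta> c l1 u1 l2 u2 \<alpha> :: real
  assumes \<mu>: "3/4 \<le> \<mu>" and \<eta>: "0 \<le> \<eta>" "\<eta> \<le> 1/2" and c: "0 < c" and l1: "0 \<le> l1"
    and form: "\<And>M H d1 d2. in_box l1 u1 l2 u2 \<alpha> M \<Longrightarrow> 0 \<le> l2norm (tail 3 M) \<Longrightarrow> 0 \<le> H \<Longrightarrow>
      ks_form \<mu> \<eta> (M 1) (M 2) (l2norm (tail 3 M)) d1 d2 H \<le> - c * (d1\<^sup>2 + d2\<^sup>2 + H\<^sup>2)"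
begin

lemma contraction_in_box:
  assumes a: "ks_solution_on \<mu> {0..T} a" and b: "ks_solution_on \<mu> {0..T} b" and T: "0 \<le> T"
    and box: "\<And>t. 0 \<le> t \<Longrightarrow> t \<le> T \<Longrightarrow> in_box l1 u1 l2 u2 \<alpha> (\<lambda>k. a t k + b t k)"
  shows "l2norm (\<lambda>k. a T k - b T k) \<le> 3 * exp (- c / 4 * T) * l2norm (\<lambda>k. a 0 k - b 0 k)"
proof (rule contraction[OF \<mu> a b T \<eta> c])
  fix t assume t: "0 \<le> t" "t \<le> T"
  show "0 \<le> a t 1 + b t 1" using box[OF t] l1 unfolding in_box_def by linarith
  have "sqs (\<lambda>k. a t k + b t k)"
    using ks_solutionD(1)[OF a, of t] ks_solutionD(1)[OF b, of t] t by (intro sqs_add) auto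
  then have "0 \<le> l2norm (tail 3 (\<lambda>k. a t k + b t k))" by (intro l2norm_nonneg sqs_tail)
  then show "ks_form \<mu> \<eta> (a t 1 + b t 1) (a t 2 + b t 2) (l2norm (tail 3 (\<lambda>k. a t k + b t k))) d1 d2 H
      \<le> - c * (d1\<^sup>2 + d2\<^sup>2 + H\<^sup>2)" if "0 \<le> H" for d1 d2 H
    using form[OF box[OF t] _ that] by blast
qed

context
  fixes m1 v1 m2 v2 \<beta> r :: real
  assumes r: "0 < r"
    and slack: "l1 \<le> 2 * m1 - r" "2 * v1 + r \<le> u1" "l2 \<le> 2 * m2 - r" "2 * v2 + r \<le> u2" "2 * \<beta> + r \<le> \<alpha>"
begin

text \<open>Twice the small box, enlarged by r, fits into the box where the form is negative;
  \<open>slack\<close> states this room.\<close>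

lemma box_sum_near:
  assumes "sqs a" "sqs p" "sqs q" "in_box m1 v1 m2 v2 \<beta> p" "in_box m1 v1 m2 v2 \<beta> q"
    and "l2norm (\<lambda>k. a k - q k) \<le> r"
  shows "in_box l1 u1 l2 u2 \<alpha> (\<lambda>k. a k + p k)"
  by (rule in_box_mono[OF in_box_add[OF assms(1,2) in_box_near[OF assms(1,3,5,6)] assms(4)]])
    (use slack in auto)

text \<open>While the orbit is r-close to p the contraction estimate compares it with the constant
  solution p; its factor 3 is the reason for starting within r / 3. Solvability is conditional on
  closeness, so the lemma covers given solutions as well as clamped curves.\<close>

lemma attracted_near_fixed_point:
  fixes a :: "real \<Rightarrow> nat \<Rightarrow> real"
  assumes p: "ks_fixed_point \<mu> p" "in_box m1 v1 m2 v2 \<beta> p"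
    and ell: "\<And>t. 0 \<le> t \<Longrightarrow> sqs (a t)"
    and cont: "continuous_on {0..} (\<lambda>t. l2norm (\<lambda>k. a t k - p k))"
    and sol: "\<And>T. (\<And>t. 0 \<le> t \<Longrightarrow> t \<le> T \<Longrightarrow> l2norm (\<lambda>k. a t k - p k) \<le> r) \<Longrightarrow> ks_solution_on \<mu> {0..T} a"
    and start: "l2norm (\<lambda>k. a 0 k - p k) < r / 3"
  shows "ks_solution_on \<mu> {0..} a"
    "0 \<le> t \<Longrightarrow> l2norm (\<lambda>k. a t k - p k) \<le> 3 * exp (- c / 4 * t) * l2norm (\<lambda>k. a 0 k - p k)"
proof -
  \<comment> \<open>Continued constantly to negative times, to fit
    \<open>continuous_induction_left\<close>.\<close>
  define f where "f t = l2norm (\<lambda>k. a (max 0 t) k - p k) - r" for t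
  have sp: "sqs p" using p(1) by (simp add: ks_fixed_point_def ell2_sqs)
  have nn: "0 \<le> l2norm (\<lambda>k. a t k - p k)" if "0 \<le> t" for t by (intro l2norm_nonneg sqs_diff ell that sp)
  have decay: "l2norm (\<lambda>k. a T k - p k) \<le> 3 * exp (- c / 4 * T) * l2norm (\<lambda>k. a 0 k - p k)"
    if T: "0 \<le> T" and h: "\<And>t. 0 \<le> t \<Longrightarrow> t \<le> T \<Longrightarrow> l2norm (\<lambda>k. a t k - p k) \<le> r" for T
  proof (rule contraction_in_box[OF sol[OF h] ks_solution_on_const[OF p(1)] T])
    show "in_box l1 u1 l2 u2 \<alpha> (\<lambda>k. a t k + p k)" if "0 \<le> t" "t \<le> T" for t
      by (rule box_sum_near[OF ell sp sp p(2) p(2) h]) (use that in auto)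
  qed
  have cf: "continuous_on UNIV f"
  proof -
    have "continuous_on UNIV (\<lambda>t::real. max 0 t)" by (intro continuous_intros)
    moreover have "range (max 0) \<subseteq> {0 :: real..}" by auto
    ultimately have "continuous_on UNIV (\<lambda>t. l2norm (\<lambda>k. a (max 0 t) k - p k))"
      by (rule continuous_on_compose2[OF cont])
    then show ?thesis unfolding f_def[abs_def] by (intro continuous_on_diff continuous_on_const)
  qed
  have neg: "f t < 0" for t
  proof (rule continuous_induction_left[OF cf, of 0])
    show "f t \<le> 0" if "t \<le> 0" for t using that start r by (simp add: f_def max_def)
    fix T assume h: "\<And>t. t \<le> T \<Longrightarrow> f t \<le> 0"
    show "f T < 0"
    proof (cases "0 \<le> T")
      case True
      have "l2norm (\<lambda>k. a T k - p k) \<le> 3 * exp (- c / 4 * T) * l2norm (\<lambda>k. a 0 k - p k)"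
      proof (rule decay[OF True])
        show "l2norm (\<lambda>k. a t k - p k) \<le> r" if "0 \<le> t" "t \<le> T" for t
          using h[OF that(2)] that(1) by (simp add: f_def)
      qed
      also have "\<dots> \<le> 3 * 1 * l2norm (\<lambda>k. a 0 k - p k)"
        using nn[of 0] c True by (intro mult_right_mono mult_left_mono) auto
      finally show ?thesis using start True by (simp add: f_def)
    next
      case False
      then show ?thesis using start nn[of 0] by (simp add: f_def max_def)
    qed
  qed
  have near: "l2norm (\<lambda>k. a t k - p k) \<le> r" if "0 \<le> t" for t using neg[of t] that by (simp add: f_def)
  show "ks_solution_on \<mu> {0..} a" by (intro ks_solution_on_atLeast sol near)
  show "0 \<le> t \<Longrightarrow> l2norm (\<lambda>k. a t k - p k) \<le> 3 * exp (- c / 4 * t) * l2norm (\<lambda>k. a 0 k - p k)"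
    by (intro decay near)
qed

text \<open>The exponential estimate gives stability and the convergence of every solution starting
  near p; existence comes from clamped curves, whose norm stays below
  \<open>l2norm p + r\<close>.\<close>

lemma attracting_in_box:
  assumes p: "ks_fixed_point \<mu> p" "in_box m1 v1 m2 v2 \<beta> p"
  shows "ks_attracting_fixed_point \<mu> p"
proof -
  have sp: "sqs p" using p(1) by (simp add: ks_fixed_point_def ell2_sqs)
  have near: "l2norm (\<lambda>k. a t k - p k) \<le> 3 * exp (- c / 4 * t) * l2norm (\<lambda>k. a 0 k - p k)"
    if "ks_solution_on \<mu> {0..} a" "l2norm (\<lambda>k. a 0 k - p k) < r / 3" "0 \<le> t" for a t
  proof (rule attracted_near_fixed_point(2)[where a = a and p = p and t = t, OF p _ _ _ that(2,3)])
    show "sqs (a t)" if "0 \<le> t" for t using ks_solutionD(1)[OF \<open>ks_solution_on \<mu> {0..} a\<close>, of t] that by simp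
    show "continuous_on {0..} (\<lambda>t. l2norm (\<lambda>k. a t k - p k))"
      by (rule ks_solution_continuous(3)[OF that(1) ks_solution_on_const[OF p(1)]])
    show "ks_solution_on \<mu> {0..T} a" for T by (rule ks_solution_on_subset[OF that(1)]) auto
  qed
  have "ks_stable \<mu> p"
    unfolding ks_stable_def ell2_dist_l2norm
  proof (intro allI impI)
    fix \<epsilon> :: real assume \<epsilon>: "0 < \<epsilon>"
    show "\<exists>\<delta>>0. \<forall>a. ks_solution_on \<mu> {0..} a \<and> l2norm (\<lambda>k. a 0 k - p k) < \<delta> \<longrightarrow>
        (\<forall>t\<ge>0. l2norm (\<lambda>k. a t k - p k) < \<epsilon>)"
    proof (intro exI[of _ "min (r / 3) (\<epsilon> / 3)"] conjI allI impI)
      show "0 < min (r / 3) (\<epsilon> / 3)" using r \<epsilon> by simp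
      fix a :: "real \<Rightarrow> nat \<Rightarrow> real" and t :: real
      assume a: "ks_solution_on \<mu> {0..} a \<and> l2norm (\<lambda>k. a 0 k - p k) < min (r / 3) (\<epsilon> / 3)" and t: "0 \<le> t"
      then have "0 \<le> l2norm (\<lambda>k. a 0 k - p k)"
        using ks_solutionD(1)[of \<mu> "{0..}" a 0] by (intro l2norm_nonneg sqs_diff sp) auto
      then have "3 * exp (- c / 4 * t) * l2norm (\<lambda>k. a 0 k - p k) \<le> 3 * 1 * l2norm (\<lambda>k. a 0 k - p k)"
        using c t by (intro mult_right_mono mult_left_mono) auto
      then show "l2norm (\<lambda>k. a t k - p k) < \<epsilon>" using near[of a t] a t by auto
    qed
  qed
  moreover have "\<exists>\<delta>>0. \<forall>b\<in>ell2. ell2_dist b p < \<delta> \<longrightarrow>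
        (\<exists>a. ks_solution_on \<mu> {0..} a \<and> a 0 = b) \<and>
        (\<forall>a. ks_solution_on \<mu> {0..} a \<and> a 0 = b \<longrightarrow> ((\<lambda>t. ell2_dist (a t) p) \<longlongrightarrow> 0) at_top)"
    unfolding ell2_dist_l2norm
  proof (intro exI[of _ "r / 3"] conjI ballI impI)
    show "0 < r / 3" using r by simp
    fix b assume b: "b \<in> ell2" and bp: "l2norm (\<lambda>k. b k - p k) < r / 3"
    have R: "0 \<le> l2norm p + r" using l2norm_nonneg[OF sp] r by simp
    obtain a where a0: "a 0 = b" and ell: "\<And>t. a t \<in> ell2"
      and ac: "\<And>t. ((\<lambda>s. l2norm (\<lambda>k. a s k - a t k)) \<longlongrightarrow> 0) (at t)"
      and sol: "\<And>T. (\<And>t. 0 \<le> t \<Longrightarrow> t \<le> T \<Longrightarrow> l2norm (a t) \<le> l2norm p + r) \<Longrightarrow> ks_solution_on \<mu> {0..T} a"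
      using forward_curve[OF \<mu> b R] by auto
    note sa = ell2_sqs[OF ell]
    have "ks_solution_on \<mu> {0..} a"
    proof (rule attracted_near_fixed_point(1)[OF p sa])
      show "l2norm (\<lambda>k. a 0 k - p k) < r / 3" using bp by (simp add: a0)
      show "ks_solution_on \<mu> {0..T} a"
        if "\<And>t. 0 \<le> t \<Longrightarrow> t \<le> T \<Longrightarrow> l2norm (\<lambda>k. a t k - p k) \<le> r" for T
      proof (rule sol)
        show "l2norm (a t) \<le> l2norm p + r" if "0 \<le> t" "t \<le> T" for t
          using l2norm_le_add_diff[OF sa sp, of t] \<open>\<And>t. 0 \<le> t \<Longrightarrow> t \<le> T \<Longrightarrow> l2norm (\<lambda>k. a t k - p k) \<le> r\<close>[OF that]
          by linarith
      qed
      show "continuous_on {0..} (\<lambda>t. l2norm (\<lambda>k. a t k - p k))"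
      proof (rule continuous_at_imp_continuous_on, rule ballI)
        fix t
        show "isCont (\<lambda>t. l2norm (\<lambda>k. a t k - p k)) t"
          unfolding isCont_def
        proof (rule l2norm_tendsto)
          show "\<forall>\<^sub>F s in at t. sqs (\<lambda>k. a s k - p k)" by (intro always_eventually allI sqs_diff sa sp)
          show "sqs (\<lambda>k. a t k - p k)" by (intro sqs_diff sa sp)
          show "((\<lambda>s. l2norm (\<lambda>k. a s k - p k - (a t k - p k))) \<longlongrightarrow> 0) (at t)" using ac[of t] by simp
        qed
      qed
    qed
    then show "\<exists>a. ks_solution_on \<mu> {0..} a \<and> a 0 = b" using a0 by blast
    show "\<forall>a. ks_solution_on \<mu> {0..} a \<and> a 0 = b \<longrightarrow> ((\<lambda>t. l2norm (\<lambda>k. a t k - p k)) \<longlongrightarrow> 0) at_top"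
    proof (intro allI impI)
      fix a :: "real \<Rightarrow> nat \<Rightarrow> real" assume a: "ks_solution_on \<mu> {0..} a \<and> a 0 = b"
      show "((\<lambda>t. l2norm (\<lambda>k. a t k - p k)) \<longlongrightarrow> 0) at_top"
      proof (rule Lim_null_comparison)
        show "((\<lambda>t. (3 * l2norm (\<lambda>k. b k - p k)) * exp (- (c / 4) * t)) \<longlongrightarrow> 0) at_top"
          using c by (intro exp_rate_tendsto_0) simp
        show "\<forall>\<^sub>F t in at_top. norm (l2norm (\<lambda>k. a t k - p k)) \<le> (3 * l2norm (\<lambda>k. b k - p k)) * exp (- (c / 4) * t)"
          unfolding eventually_at_top_linorder
        proof (intro exI[of _ 0] allI impI)
          fix t :: real assume t: "0 \<le> t"
          have "0 \<le> l2norm (\<lambda>k. a t k - p k)"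
            using ks_solutionD(1)[of \<mu> "{0..}" a t] a t by (intro l2norm_nonneg sqs_diff sp) auto
          then show "norm (l2norm (\<lambda>k. a t k - p k)) \<le> (3 * l2norm (\<lambda>k. b k - p k)) * exp (- (c / 4) * t)"
            using near[of a t] a bp t by (simp add: mult_ac)
        qed
      qed
    qed
  qed
  ultimately show ?thesis using p(1) unfolding ks_attracting_fixed_point_def by blast
qed

text \<open>Contraction between the orbit and its shift by h bounds their distance at time s by 6 R
  exp (- c s / 4), uniformly in h, so the orbit is Cauchy. At the limit each component of the field
  vanishes, because a mode and its derivative both converge.\<close>

lemma fixed_point_limit:
  assumes a: "ks_solution_on \<mu> {0..} a" and box: "\<And>t. 0 \<le> t \<Longrightarrow> in_box m1 v1 m2 v2 \<beta> (a t)"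
    and bd: "\<And>t. 0 \<le> t \<Longrightarrow> l2norm (a t) \<le> R"
  obtains p where "ks_fixed_point \<mu> p" "in_box m1 v1 m2 v2 \<beta> p"
    "((\<lambda>t. l2norm (\<lambda>k. a t k - p k)) \<longlongrightarrow> 0) at_top"
proof -
  have sa: "sqs (a t)" if "0 \<le> t" for t using ks_solutionD(1)[OF a, of t] that by simp
  have a0: "a t 0 = 0" if "0 \<le> t" for t using ks_solutionD(2)[OF a, of t] that by simp
  define B where "B t = (6 * R) * exp (- (c / 4) * t)" for t
  have B: "(B \<longlongrightarrow> 0) at_top" unfolding B_def[abs_def] using c by (intro exp_rate_tendsto_0) simp
  have cauchy: "l2norm (\<lambda>k. a s k - a t k) \<le> B s" if st: "0 \<le> s" "s \<le> t" for s t
  proof -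
    define h where "h = t - s"
    have h: "0 \<le> h" "t = s + h" using st by (simp_all add: h_def)
    have "l2norm (\<lambda>k. a s k - a (s + h) k) \<le> 3 * exp (- c / 4 * s) * l2norm (\<lambda>k. a 0 k - a (0 + h) k)"
    proof (rule contraction_in_box[OF _ _ st(1)])
      show "ks_solution_on \<mu> {0..s} a" by (rule ks_solution_on_subset[OF a]) auto
      show "ks_solution_on \<mu> {0..s} (\<lambda>t. a (t + h))" by (rule ks_solution_on_shift[OF a]) (use h in auto)
      fix t :: real assume "0 \<le> t"
      then have t: "0 \<le> t" "0 \<le> t + h" using h by auto
      show "in_box l1 u1 l2 u2 \<alpha> (\<lambda>k. a t k + a (t + h) k)"
        \<comment> \<open>Each state is its own reference point, at distance 0.\<close>
        by (rule box_sum_near[OF sa sa sa box box]) (use t r in \<open>auto simp: l2norm_def\<close>)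
    qed
    also have "\<dots> \<le> 3 * exp (- c / 4 * s) * (R + R)"
      using l2norm_diff_triangle[OF sa sa, of 0 h] bd[of 0] bd[of h] h by (intro mult_left_mono) auto
    finally show ?thesis by (simp add: B_def h mult_ac)
  qed
  obtain p where sp: "sqs p" and near: "\<And>t. 0 \<le> t \<Longrightarrow> l2norm (\<lambda>k. a t k - p k) \<le> B t"
    and comp: "\<And>k. ((\<lambda>t. a t k) \<longlongrightarrow> p k) at_top"
    using l2_limit_exists[of a B, OF sa B cauchy] by metis
  have ev: "\<forall>\<^sub>F t in at_top. 0 \<le> (t::real)" by (rule eventually_ge_at_top)
  have lim: "((\<lambda>t. l2norm (\<lambda>k. a t k - p k)) \<longlongrightarrow> 0) at_top"
  proof (rule Lim_null_comparison[OF _ B])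
    show "\<forall>\<^sub>F t in at_top. norm (l2norm (\<lambda>k. a t k - p k)) \<le> B t"
      using ev
    proof eventually_elim
      case (elim t)
      then show ?case using near[OF elim] l2norm_nonneg[OF sqs_diff[OF sa[OF elim] sp]] by simp
    qed
  qed
  have evs: "\<forall>\<^sub>F t in at_top. sqs (a t)" using ev by eventually_elim (rule sa)
  have "((\<lambda>t. a t 0) \<longlongrightarrow> 0) at_top"
    by (rule tendsto_eventually) (use ev in eventually_elim, simp add: a0)
  then have p0: "p 0 = 0" using tendsto_unique[OF trivial_limit_at_top_linorder comp] by blast
  have "in_box m1 v1 m2 v2 \<beta> p"
  proof -
    have evb: "\<forall>\<^sub>F t in at_top. in_box m1 v1 m2 v2 \<beta> (a t)" using ev by eventually_elim (rule box)
    have tl: "((\<lambda>t. l2norm (tail 3 (a t))) \<longlongrightarrow> l2norm (tail 3 p)) at_top"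
    proof (rule l2norm_tendsto)
      show "\<forall>\<^sub>F t in at_top. sqs (tail 3 (a t))" using evs by eventually_elim (rule sqs_tail)
      show "((\<lambda>t. l2norm (\<lambda>k. tail 3 (a t) k - tail 3 p k)) \<longlongrightarrow> 0) at_top"
      proof (rule Lim_null_comparison[OF _ lim])
        show "\<forall>\<^sub>F t in at_top. norm (l2norm (\<lambda>k. tail 3 (a t) k - tail 3 p k)) \<le> l2norm (\<lambda>k. a t k - p k)"
          using evs
        proof eventually_elim
          case (elim t)
          then show ?case
            using l2norm_tail_le[OF sqs_diff[OF elim sp], of 3] l2norm_nonneg[OF sqs_tail[OF sqs_diff[OF elim sp]], of 3]
            unfolding tail_diff by simp
        qed
      qed
    qed (rule sqs_tail[OF sp])
    have nt: "at_top \<noteq> (bot :: real filter)" by simp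
    show ?thesis
      unfolding in_box_def
    proof (intro conjI)
      show "m1 \<le> p 1" by (rule tendsto_lowerbound[OF comp[of 1] _ nt]) (use evb in eventually_elim, simp add: in_box_def)
      show "p 1 \<le> v1" by (rule tendsto_upperbound[OF comp[of 1] _ nt]) (use evb in eventually_elim, simp add: in_box_def)
      show "m2 \<le> p 2" by (rule tendsto_lowerbound[OF comp[of 2] _ nt]) (use evb in eventually_elim, simp add: in_box_def)
      show "p 2 \<le> v2" by (rule tendsto_upperbound[OF comp[of 2] _ nt]) (use evb in eventually_elim, simp add: in_box_def)
      show "l2norm (tail 3 p) \<le> \<beta>" by (rule tendsto_upperbound[OF tl _ nt]) (use evb in eventually_elim, simp add: in_box_def)
    qed
  qed
  moreover have "ks_fixed_point \<mu> p"
    unfolding ks_fixed_point_def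
  proof (intro conjI allI impI)
    show "p \<in> ell2" using sp p0 by (simp add: ell2_def sqs_def)
    fix k :: nat assume k: "1 \<le> k"
    have "ks_eig \<mu> k * p k + ks_bil p p k = 0"
    proof (rule convergent_imp_deriv_limit_0[OF _ comp[of k]])
      show "((\<lambda>t. a t k) has_real_derivative ks_eig \<mu> k * a t k + ks_bil (a t) (a t) k) (at t)" if "0 < t" for t
        by (rule ks_solution_deriv_interior[OF a _ k]) (use that in \<open>auto intro!: interiorI[of "{0<..}"]\<close>)
      show "((\<lambda>t. ks_eig \<mu> k * a t k + ks_bil (a t) (a t) k) \<longlongrightarrow> ks_eig \<mu> k * p k + ks_bil p p k) at_top"
        by (intro tendsto_intros comp ks_bil_tendsto[OF evs sp lim])
    qed
    then show "ks_field \<mu> p k = 0" by (simp add: ks_field_eq[OF sp])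
  qed
  ultimately show thesis using that lim by blast
qed

end

end

text \<open>Below \<xi> the bound a_2 \<ge> - w a_1^2 leaves a_1 growing at rate \<rho> at least, so
  a_1 finally stays above \<xi>; with a_1 \<le> X the slaving bounds then confine a_2 and the
  tail.\<close>

lemma eventually_in_box:
  assumes \<mu>: "3/4 \<le> \<mu>" "\<mu> < 1" and a: "ks_solution_on \<mu> UNIV a"
    and cone: "\<And>t. 0 < a t 1 \<and> a t 1 \<le> X \<and> (l2norm (tail 2 (a t)))\<^sup>2 \<le> (a t 1)\<^sup>2 / 10"
    and X: "X \<le> 4/5"
    and g: "(1 - \<mu>) + 28/1000 * X ^ 4 \<le> g"
      "0 \<le> q" "q \<le> (2 - 187/1000 * X\<^sup>2) / (4 * (4 * \<mu> - 1) + 2 * g)"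
    and h: "2 * (312/1000) * X\<^sup>2 + 28/1000 * X ^ 4 - (1 - \<mu>) \<le> h" "0 \<le> h" "0 < 4 * (4 * \<mu> - 1) - 2 * h"
      "(2 + 187/1000 * X\<^sup>2) / (4 * (4 * \<mu> - 1) - 2 * h) \<le> w"
    and drift: "2 * w * \<xi>\<^sup>2 + 28/1000 * \<xi> ^ 4 - (1 - \<mu>) \<le> - \<rho>" "0 < \<rho>" "0 \<le> \<xi>"
  obtains t0 where "\<And>t. t0 \<le> t \<Longrightarrow> in_box \<xi> X (- w * X\<^sup>2) (- q * \<xi>\<^sup>2) (47/1000 * X ^ 3) (a t)"
proof -
  have solT: "ks_solution_on \<mu> {..T} a" for T by (rule ks_solution_on_subset[OF a]) simp
  have hyp: "0 < a t 1 \<and> a t 1 \<le> 4/5 \<and> (l2norm (tail 2 (a t)))\<^sup>2 \<le> (a t 1)\<^sup>2 / 10" if "t \<le> T" for t T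
    using cone[of t] X by auto
  have aX: "a t 1 \<le> X" if "t \<le> T" for t T using cone by blast
  have up: "a t 2 \<le> - q * (a t 1)\<^sup>2" for t
  proof -
    have "a t 2 \<le> - (2 - 187/1000 * X\<^sup>2) / (4 * (4 * \<mu> - 1) + 2 * g) * (a t 1)\<^sup>2"
      by (rule y_upper[OF \<mu> solT[of t] hyp aX X g(1) order_refl]) auto
    also have "\<dots> \<le> - q * (a t 1)\<^sup>2"
      unfolding minus_divide_left[symmetric] using g(3) by (intro mult_right_mono le_imp_neg_le) auto
    finally show ?thesis .
  qed
  have lo: "\<bar>a t 2\<bar> \<le> w * (a t 1)\<^sup>2" for t
  proof -
    have "\<bar>a t 2\<bar> \<le> (2 + 187/1000 * X\<^sup>2) / (4 * (4 * \<mu> - 1) - 2 * h) * (a t 1)\<^sup>2"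
      by (rule y_lower[OF \<mu> solT[of t] hyp aX h(1-3) order_refl]) auto
    also have "\<dots> \<le> w * (a t 1)\<^sup>2" using h(4) by (intro mult_right_mono) auto
    finally show ?thesis .
  qed
  have "0 \<le> (2 + 187/1000 * X\<^sup>2) / (4 * (4 * \<mu> - 1) - 2 * h)"
    using h(3) by (intro divide_nonneg_pos) auto
  then have w: "0 \<le> w" using h(4) by linarith
  have deriv: "((\<lambda>s. a s 1) has_real_derivative (1 - \<mu>) * a t 1 + ks_bil (a t) (a t) 1) (at t)" for t
    using ks_solutionD(4)[OF a UNIV_I, of 1 t] by (simp add: ks_eig_def)
  have dr: "\<rho> * a t 1 \<le> (1 - \<mu>) * a t 1 + ks_bil (a t) (a t) 1" if "a t 1 < \<xi>" for t
  proof -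
    have "- (- \<rho>) * a t 1 \<le> (1 - \<mu>) * a t 1 + ks_bil (a t) (a t) 1"
      by (rule growth_lower[OF \<mu> solT[of t] hyp order_refl lo quadratic_term_bounds(2)[OF \<mu> solT[of t] hyp order_refl] w _ less_imp_le[OF that] drift(1)])
        auto
    then show ?thesis by simp
  qed
  obtain t0 where t0: "\<And>t. t0 \<le> t \<Longrightarrow> \<xi> \<le> a t 1"
    by (rule eventually_above[OF deriv _ dr drift(2)]) (use cone in blast)+
  show thesis
  proof (rule that[of t0])
    fix t assume t: "t0 \<le> t"
    have "\<xi>\<^sup>2 \<le> (a t 1)\<^sup>2" using t0[OF t] drift(3) by (intro power_mono)
    then have "q * \<xi>\<^sup>2 \<le> q * (a t 1)\<^sup>2" using g(2) by (rule mult_left_mono)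
    moreover have "(a t 1)\<^sup>2 \<le> X\<^sup>2" using cone[of t] by (intro power_mono) auto
    then have "w * (a t 1)\<^sup>2 \<le> w * X\<^sup>2" using w by (rule mult_left_mono)
    moreover have "l2norm (tail 3 (a t)) \<le> 47/1000 * a t 1 ^ 3"
      by (rule refined_tail_bounds(2)[OF \<mu> solT[of t] hyp order_refl])
    moreover have "a t 1 ^ 3 \<le> X ^ 3" using cone[of t] by (intro power_mono) auto
    ultimately show "in_box \<xi> X (- w * X\<^sup>2) (- q * \<xi>\<^sup>2) (47/1000 * X ^ 3) (a t)"
      using t0[OF t] cone[of t] up[of t] lo[of t] unfolding in_box_def abs_le_iff by linarith
  qed
qed

text \<open>The orbit leaving 0 refutes stability: suitable time shifts of it start arbitrarily
  close to 0 and still pass through the fixed nonzero state at time T.\<close>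

lemma zero_unstable:
  assumes a: "ks_solution_on \<mu> UNIV a" "((\<lambda>t. l2norm (a t)) \<longlongrightarrow> 0) at_bot" "a T k \<noteq> 0"
  shows "ks_unstable_fixed_point \<mu> (\<lambda>k. 0)"
proof -
  have "ks_field \<mu> (\<lambda>k. 0) k = 0" for k by (simp add: ks_field_def)
  then have "ks_fixed_point \<mu> (\<lambda>k. 0)" by (simp add: ks_fixed_point_def ell2_def)
  moreover have "\<not> ks_stable \<mu> (\<lambda>k. 0)"
  proof
    assume "ks_stable \<mu> (\<lambda>k. 0)"
    then have "\<exists>\<delta>>0. \<forall>b. ks_solution_on \<mu> {0..} b \<and> l2norm (b 0) < \<delta> \<longrightarrow> (\<forall>t\<ge>0. l2norm (b t) < \<bar>a T k\<bar>)"
      using a(3) unfolding ks_stable_def ell2_dist_l2norm by simp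
    then obtain \<delta> where \<delta>: "0 < \<delta>"
      "\<And>b t. ks_solution_on \<mu> {0..} b \<Longrightarrow> l2norm (b 0) < \<delta> \<Longrightarrow> 0 \<le> t \<Longrightarrow> l2norm (b t) < \<bar>a T k\<bar>"
      by blast
    have "\<forall>\<^sub>F t in at_bot. l2norm (a t) < \<delta>" using a(2) \<delta>(1) by (intro order_tendstoD(2))
    then obtain s where s: "\<And>t. t \<le> s \<Longrightarrow> l2norm (a t) < \<delta>" unfolding eventually_at_bot_linorder by blast
    define m where "m = min s T"
    have "ks_solution_on \<mu> {0..} (\<lambda>t. a (t + m))" by (rule ks_solution_on_shift[OF a(1)]) simp
    from \<delta>(2)[OF this, of "T - m"] have "l2norm (a T) < \<bar>a T k\<bar>" using s[of m] by (simp add: m_def)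
    then show False using abs_le_l2norm[OF ks_solutionD(1)[OF a(1) UNIV_I], of T k] by simp
  qed
  ultimately show ?thesis unfolding ks_unstable_fixed_point_def by blast
qed

text \<open>
  On the whole orbit \<open>a\<^sub>1 \<le> X\<close>, eventually \<open>a\<^sub>1 \<ge> \<xi>\<close>, and \<open>- w a\<^sub>1\<^sup>2 \<le> a\<^sub>2 \<le> - q a\<^sub>1\<^sup>2\<close>; \<open>g\<close> and \<open>h\<close>
  bound the growth and decay rates of \<open>a\<^sub>1\<close>, and \<open>\<rho>\<close> is its growth rate below \<open>\<xi>\<close>. The box with
  bounds \<open>l1, u1, l2, u2, \<alpha>\<close> contains the sum of any two states that are \<open>r\<close>-close to the region
  so described.
\<close>

lemma heteroclinic_connection:
  assumes \<mu>: "3/4 \<le> \<mu>" "\<mu> < 1" and X: "0 < X" "X \<le> 4/5"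
    and g: "(1 - \<mu>) + 28/1000 * X ^ 4 \<le> g" "0 \<le> q" "q \<le> (2 - 187/1000 * X\<^sup>2) / (4 * (4 * \<mu> - 1) + 2 * g)"
      "(1 - \<mu>) - 2 * (2 - 187/1000 * X\<^sup>2) / (4 * (4 * \<mu> - 1) + 2 * g) * X\<^sup>2 + 28/1000 * X ^ 4 < 0"
    and h: "2 * (312/1000) * X\<^sup>2 + 28/1000 * X ^ 4 - (1 - \<mu>) \<le> h" "0 \<le> h" "0 < 4 * (4 * \<mu> - 1) - 2 * h"
      "(2 + 187/1000 * X\<^sup>2) / (4 * (4 * \<mu> - 1) - 2 * h) \<le> w"
    and drift: "2 * w * \<xi>\<^sup>2 + 28/1000 * \<xi> ^ 4 - (1 - \<mu>) \<le> - \<rho>" "0 < \<rho>" "0 \<le> \<xi>"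
    and \<eta>: "0 \<le> \<eta>" "\<eta> \<le> 1/2" and c: "0 < c" and l1: "0 \<le> l1"
    and form: "\<And>M H d1 d2. in_box l1 u1 l2 u2 \<alpha> M \<Longrightarrow> 0 \<le> l2norm (tail 3 M) \<Longrightarrow> 0 \<le> H \<Longrightarrow>
      ks_form \<mu> \<eta> (M 1) (M 2) (l2norm (tail 3 M)) d1 d2 H \<le> - c * (d1\<^sup>2 + d2\<^sup>2 + H\<^sup>2)"
    and r: "0 < r"
    and slack: "l1 \<le> 2 * \<xi> - r" "2 * X + r \<le> u1" "l2 \<le> 2 * (- w * X\<^sup>2) - r" "2 * (- q * \<xi>\<^sup>2) + r \<le> u2"
      "2 * (47/1000 * X ^ 3) + r \<le> \<alpha>"
  shows "ks_unstable_fixed_point \<mu> (\<lambda>k. 0) \<and>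
    (\<exists>(u :: real \<Rightarrow> real \<Rightarrow> real) (v :: real \<Rightarrow> real)
       (a :: real \<Rightarrow> nat \<Rightarrow> real) (p :: nat \<Rightarrow> real).
       ks_classical_solution \<mu> u \<and> (\<forall>t. sine_series (a t) (u t)) \<and>
       ks_classical_solution \<mu> (\<lambda>t. v) \<and> sine_series p v \<and>
       ks_attracting_fixed_point \<mu> p \<and>
       ks_heteroclinic \<mu> (\<lambda>k. 0) p a)"
proof -
  obtain a where a: "ks_solution_on \<mu> UNIV a" and bot: "((\<lambda>t. l2norm (a t)) \<longlongrightarrow> 0) at_bot"
    and cone: "\<And>t. 0 < a t 1 \<and> a t 1 \<le> X \<and> (l2norm (tail 2 (a t)))\<^sup>2 \<le> (a t 1)\<^sup>2 / 10"
    using global_unstable_orbit[OF \<mu> X g(1,4)] by blast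
  note sa = ks_solutionD(1,2)[OF a UNIV_I]
  have bd: "l2norm (a t) \<le> 1" for t
  proof -
    have "l2norm (a t) \<le> 105/100 * a t 1" by (rule cone_l2norm_le[OF sa]) (use cone[of t] in auto)
    then show ?thesis using cone[of t] X(2) by linarith
  qed
  obtain t0 where box: "\<And>t. t0 \<le> t \<Longrightarrow> in_box \<xi> X (- w * X\<^sup>2) (- q * \<xi>\<^sup>2) (47/1000 * X ^ 3) (a t)"
    using eventually_in_box[OF \<mu> a cone X(2) g(1-3) h drift] by blast
  have sol0: "ks_solution_on \<mu> {0..} (\<lambda>t. a (t + t0))" by (rule ks_solution_on_shift[OF a]) simp
  have box0: "in_box \<xi> X (- w * X\<^sup>2) (- q * \<xi>\<^sup>2) (47/1000 * X ^ 3) (a (t + t0))" if "0 \<le> t" for t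
    using box that by simp
  obtain p where p: "ks_fixed_point \<mu> p" "in_box \<xi> X (- w * X\<^sup>2) (- q * \<xi>\<^sup>2) (47/1000 * X ^ 3) p"
    and top: "((\<lambda>t. l2norm (\<lambda>k. a (t + t0) k - p k)) \<longlongrightarrow> 0) at_top"
    using fixed_point_limit[OF \<mu>(1) \<eta> c l1 form r slack sol0 box0 bd] by blast
  have attr: "ks_attracting_fixed_point \<mu> p"
    by (rule attracting_in_box[OF \<mu>(1) \<eta> c l1 form r slack p])
  have "filterlim (\<lambda>t. t - t0) at_top at_top" by real_asymp
  from filterlim_compose[OF top this] have "((\<lambda>t. l2norm (\<lambda>k. a t k - p k)) \<longlongrightarrow> 0) at_top" by simp
  moreover have unst: "ks_unstable_fixed_point \<mu> (\<lambda>k. 0)"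
    by (rule zero_unstable[OF a bot, of 0 1]) (use cone[of 0] in simp)
  ultimately have het: "ks_heteroclinic \<mu> (\<lambda>k. 0) p a"
    using a bot p(1) unfolding ks_heteroclinic_def ks_unstable_fixed_point_def ell2_dist_l2norm by simp
  \<comment> \<open>A fixed point is a constant full orbit, so the same regularity lemma makes it
    classical.\<close>
  note u = classical_solution[OF \<mu>(1) a bd]
    and v = classical_solution[OF \<mu>(1) ks_solution_on_const[OF p(1)] order_refl]
  show ?thesis using unst u v attr het by blast
qed

theorem theorem6p2:
  fixes \<mu> :: real
  assumes "\<mu> \<in> {99 / 100, 3 / 4}"
  shows "ks_unstable_fixed_point \<mu> (\<lambda>k. 0) \<and>
    (\<exists>(u :: real \<Rightarrow> real \<Rightarrow> real) (v :: real \<Rightarrow> real)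
       (a :: real \<Rightarrow> nat \<Rightarrow> real) (p :: nat \<Rightarrow> real).
       ks_classical_solution \<mu> u \<and> (\<forall>t. sine_series (a t) (u t)) \<and>
       ks_classical_solution \<mu> (\<lambda>t. v) \<and> sine_series p v \<and>
       ks_attracting_fixed_point \<mu> p \<and>
       ks_heteroclinic \<mu> (\<lambda>k. 0) p a)"
proof -
  consider "\<mu> = 99/100" | "\<mu> = 3/4" using assms by auto
  then show ?thesis
  proof cases
    case 1
    \<comment> \<open>\<xi> = 0.17 and X = 0.19 bracket the reduced equilibrium 0.172. The rates g,
      h and the factors q, w are the values that X produces, rounded outward; \<rho> and r are what
      the narrow margins leave.\<close>
    show ?thesis
      unfolding 1
      by (rule heteroclinic_connection[where X = "19/100" and g = "10037/1000000" and h = "126/10000"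
            and q = "168/1000" and w = "17/100" and \<xi> = "17/100" and \<rho> = "1/10000" and r = "1/10000",
            OF _ _ _ _ _ _ _ _ _ _ _ _ _ _ _ _ _ _ _ ks_form_99])
        ((simp_all add: power2_eq_square power3_eq_cube power4_eq_xxxx)?, linarith+)
  next
    case 2
    \<comment> \<open>\<xi> = 0.66 and X = 0.8 bracket the reduced equilibrium 0.707; 4/5 is the
      largest X that the cone estimates admit. The other constants arise as for the first value of
      \<mu>.\<close>
    show ?thesis
      unfolding 2
      by (rule heteroclinic_connection[where X = "4/5" and g = "262/1000" and h = "161/1000"
            and q = "22/100" and w = "277/1000" and \<xi> = "66/100" and \<rho> = "3/1000" and r = "1/1000",
            OF _ _ _ _ _ _ _ _ _ _ _ _ _ _ _ _ _ _ _ ks_form_75])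
        ((simp_all add: power2_eq_square power3_eq_cube power4_eq_xxxx)?, linarith+)
  qed
qed

end
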